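(* Let $q\ge r\ge 1$ be integers, $v_x,v_y>0$ known, $v_0\ge v_x$, and $v_w=(1/v_x+1/v_y)^{-1}$. Assume that $q-r-1>0$. Let $\hat p_{GB}(Y\mid X)$ be the generalized Bayesian predictive density with respect to the hierarchical prior with parameters $(a,b)$ defined in the context. Then $\hat p_{GB}(Y\mid X)$ is minimax relative to the Kullback-Leibler loss if $$a>-q+2,\qquad b>2,\qquad a+b\le \frac{q-r-1}{2-v_w/v_0}-2r+2.$$ Moreover, there exist constants $a$ and $b$ satisfying these three conditions if $q-r-1+(2-v_w/v_0)(q-2r-2)>0$.
   Context: Prediction problem: $X\mid\Theta\sim\mathcal N_{r\times q}(\Theta,v_xI_r\otimes I_q)$ and $Y\mid\Theta\sim\mathcal N_{r\times q}(\Theta,v_yI_r\otimes I_q)$ are independent given $\Theta$, i.e. $p(X\mid\Theta)=(2\pi v_x)^{-qr/2}\exp(-\|X-\Theta\|^2/(2v_x))$ and similarly $p(Y\mid\Theta)$ with $v_y$, where $\|A\|^2=\mathrm{tr}(AA^\top)$. The matrix $\Theta\in\mathbb R^{r\times q}$ is unknown. A predictive density $\hat p=\hat p(Y\mid X)$ is an estimate of the density $p(Y\mid\Theta)$ based on $X$. The Kullback-Leibler (KL) loss is $L_{KL}(\Theta,\hat p)=\int_{\mathbb R^{r\times q}}p(Y\mid\Theta)\log\frac{p(Y\mid\Theta)}{\hat p(Y\mid X)}\,dY$ and the risk is $R_{KL}(\Theta,\hat p)=\int_{\mathbb R^{r\times q}} p(X\mid\Theta)L_{KL}(\Theta,\hat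 p)\,dX$. $\hat p$ is minimax if $\sup_\Theta R_{KL}(\Theta,\hat p)=\inf_{\tilde p}\sup_\Theta R_{KL}(\Theta,\tilde p)$ over all predictive densities $\tilde p$. For a (proper or improper) prior density $\pi(\Theta)$ with $\int p(X\mid\Theta)\pi(\Theta)\,d\Theta<\infty$ for all $X$, the (generalized) Bayesian predictive density is $\hat p_\pi(Y\mid X)=\dfrac{\int p(X\mid\Theta)p(Y\mid\Theta)\pi(\Theta)\,d\Theta}{\int p(X\mid\Theta)\pi(\Theta)\,d\Theta}$. Hierarchical prior: let $\mathcal R_r$ be the set of real symmetric $r\times r$ matrices $\Omega$ such that $\Omega$ and $I_r-\Omega$ are both positive definite. Given $\Omega\in\mathcal R_r$, $\Theta\sim\mathcal N_{r\times q}(0,v_0\Omega^{-1}(I_r-\Omega)\otimes I_q)$, with density $$\pi_1(\Theta\mid\Omega)=(2\pi v_0)^{-qr/2}|\Omega(I_r-\Omega)^{-1}|^{q/2}\exp\Big[-\frac1{2v_0}\mathrm{tr}\{\Omega(I_r-\Omega)^{-1}\Theta\Theta^\top\}\Big],$$ and the (possibly improper) second-stage density on $\mathcal R_r$ is $\pi_{GB}(\Omega)=K_{a,b}|\Omega|^{a/2-1}|I_r-\Omega|^{b/2-1}$, where $a,b$ are real constants and $K_{a,b}>0$ is a constant (the normalizing constant when $\pi_{GB}$ is proper). The prior is $\pi(\Theta)=\int_{\mathcal R_r}\pi_1(\Theta\mid\Omega)\pi_{GB}(\Omega)\,d\Omega$, and $\hat p_{GB}$ is the corresponding Bayesian predictive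 density. *)

theory Defs
  imports "HOL-Analysis.Analysis"
begin

(* An r x q real matrix is an element of real^'q^'r, with r = CARD('r) and q = CARD('q);
   lborel on this type is Lebesgue measure in the r * q entries, and norm is the
   Frobenius norm: *)

lemma norm_matrix_eq_trace:
  fixes A :: "real^'q^'r"
  shows "(norm A)\<^sup>2 = trace (A ** transpose A)"
proof -
  have "(norm A)\<^sup>2 = (\<Sum>i\<in>UNIV. \<Sum>j\<in>UNIV. A $ i $ j * A $ i $ j)"
    by (simp add: power2_norm_eq_inner inner_vec_def)
  then show ?thesis
    by (simp add: trace_def matrix_matrix_mult_def transpose_def)
qed

definition matrix_normal_density :: "real \<Rightarrow> real^'q^'r \<Rightarrow> real^'q^'r \<Rightarrow> real" where
  "matrix_normal_density v \<Theta> X =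
     (2 * pi * v) powr (- (real CARD('q) * real CARD('r)) / 2)
     * exp (- (norm (X - \<Theta>))\<^sup>2 / (2 * v))"

(* A predictive density takes its arguments in the order X, Y. *)
definition predictive_density :: "(real^'q^'r \<Rightarrow> real^'q^'r \<Rightarrow> real) \<Rightarrow> bool" where
  "predictive_density p \<longleftrightarrow>
     (\<lambda>(X, Y). p X Y) \<in> borel_measurable (borel \<Otimes>\<^sub>M borel)
     \<and> (\<forall>X Y. 0 \<le> p X Y)
     \<and> (\<forall>X. (\<integral>\<^sup>+Y. ennreal (p X Y) \<partial>lborel) = 1)"

(* Lebesgue integral with values in the extended reals, which (unlike the Bochner integral)
   distinguishes an infinite integral from 0.  For the loss below the second term is finite
   whenever p is a predictive density, since u * ln (u / w) \<ge> u - w for u, w > 0. *)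
definition ext_integral :: "'a measure \<Rightarrow> ('a \<Rightarrow> ereal) \<Rightarrow> ereal" where
  "ext_integral M f =
     enn2ereal (\<integral>\<^sup>+x. e2ennreal (f x) \<partial>M) - enn2ereal (\<integral>\<^sup>+x. e2ennreal (- f x) \<partial>M)"

(* u * ln (u / w), with value \<infinity> at w = 0; only used for u > 0 and w \<ge> 0 *)
definition kl_integrand :: "real \<Rightarrow> real \<Rightarrow> ereal" where
  "kl_integrand u w = (if w = 0 then \<infinity> else ereal (u * ln (u / w)))"

definition kl_loss ::
  "real \<Rightarrow> real^'q^'r \<Rightarrow> (real^'q^'r \<Rightarrow> real^'q^'r \<Rightarrow> real) \<Rightarrow> real^'q^'r \<Rightarrow> ereal" where
  "kl_loss v\<^sub>y \<Theta> p X =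
     ext_integral lborel (\<lambda>Y. kl_integrand (matrix_normal_density v\<^sub>y \<Theta> Y) (p X Y))"

definition kl_risk ::
  "real \<Rightarrow> real \<Rightarrow> real^'q^'r \<Rightarrow> (real^'q^'r \<Rightarrow> real^'q^'r \<Rightarrow> real) \<Rightarrow> ereal" where
  "kl_risk v\<^sub>x v\<^sub>y \<Theta> p =
     ext_integral lborel (\<lambda>X. ereal (matrix_normal_density v\<^sub>x \<Theta> X) * kl_loss v\<^sub>y \<Theta> p X)"

definition kl_minimax ::
  "real \<Rightarrow> real \<Rightarrow> (real^'q^'r \<Rightarrow> real^'q^'r \<Rightarrow> real) \<Rightarrow> bool" where
  "kl_minimax v\<^sub>x v\<^sub>y (p :: real^'q^'r \<Rightarrow> real^'q^'r \<Rightarrow> real) \<longleftrightarrow>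
     predictive_density p
     \<and> (SUP \<Theta>. kl_risk v\<^sub>x v\<^sub>y \<Theta> p)
       = (INF p'\<in>{p' :: real^'q^'r \<Rightarrow> real^'q^'r \<Rightarrow> real. predictive_density p'}.
            SUP \<Theta>. kl_risk v\<^sub>x v\<^sub>y \<Theta> p')"

(* The prior may be improper and may take the value \<infinity>.  If the integral in the denominator is
   infinite for some X, the value of the quotient at X is 0, so that bayes_predictive is not a
   predictive_density and hence not kl_minimax. *)
definition bayes_predictive ::
  "real \<Rightarrow> real \<Rightarrow> (real^'q^'r \<Rightarrow> ennreal) \<Rightarrow> real^'q^'r \<Rightarrow> real^'q^'r \<Rightarrow> real" where
  "bayes_predictive v\<^sub>x v\<^sub>y prior X Y =
     enn2real (\<integral>\<^sup>+\<Theta>. ennreal (matrix_normal_density v\<^sub>x \<Theta> X)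
                      * ennreal (matrix_normal_density v\<^sub>y \<Theta> Y) * prior \<Theta> \<partial>lborel)
     / enn2real (\<integral>\<^sup>+\<Theta>. ennreal (matrix_normal_density v\<^sub>x \<Theta> X) * prior \<Theta> \<partial>lborel)"

definition pos_def_matrix :: "real^'r^'r \<Rightarrow> bool" where
  "pos_def_matrix A \<longleftrightarrow> transpose A = A \<and> (\<forall>x. x \<noteq> 0 \<longrightarrow> 0 < x \<bullet> (A *v x))"

definition R_set :: "(real^'r^'r) set" where
  "R_set = {\<Omega>. pos_def_matrix \<Omega> \<and> pos_def_matrix (mat 1 - \<Omega>)}"

(* Lebesgue measure in the r (r + 1) / 2 free entries of a symmetric matrix.  Since the index type
   need not be ordered, the entry in positions (i, j) and (j, i) is indexed by the set {i, j}. *)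
definition sym_lborel :: "(real^'r^'r) measure" where
  "sym_lborel =
     distr (Pi\<^sub>M {{i, j} | i j :: 'r. True} (\<lambda>_. lborel)) borel (\<lambda>f. \<chi> i j. f {i, j})"

definition pi_1 :: "real \<Rightarrow> real^'r^'r \<Rightarrow> real^'q^'r \<Rightarrow> real" where
  "pi_1 v\<^sub>0 \<Omega> \<Theta> =
     (2 * pi * v\<^sub>0) powr (- (real CARD('q) * real CARD('r)) / 2)
     * det (\<Omega> ** matrix_inv (mat 1 - \<Omega>)) powr (real CARD('q) / 2)
     * exp (- (1 / (2 * v\<^sub>0))
            * trace (\<Omega> ** matrix_inv (mat 1 - \<Omega>) ** (\<Theta> ** transpose \<Theta>)))"

definition pi_GB :: "real \<Rightarrow> real \<Rightarrow> real \<Rightarrow> real^'r^'r \<Rightarrow> real" where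
  "pi_GB K a b \<Omega> = K * det \<Omega> powr (a / 2 - 1) * det (mat 1 - \<Omega>) powr (b / 2 - 1)"

definition GB_prior :: "real \<Rightarrow> real \<Rightarrow> real \<Rightarrow> real \<Rightarrow> real^'q^'r \<Rightarrow> ennreal" where
  "GB_prior v\<^sub>0 K a b \<Theta> =
     (\<integral>\<^sup>+\<Omega>\<in>R_set. ennreal (pi_1 v\<^sub>0 \<Omega> \<Theta> * pi_GB K a b \<Omega>) \<partial>sym_lborel)"

definition p_GB ::
  "real \<Rightarrow> real \<Rightarrow> real \<Rightarrow> real \<Rightarrow> real \<Rightarrow> real \<Rightarrow> real^'q^'r \<Rightarrow> real^'q^'r \<Rightarrow> real" where
  "p_GB v\<^sub>x v\<^sub>y v\<^sub>0 K a b = bayes_predictive v\<^sub>x v\<^sub>y (GB_prior v\<^sub>0 K a b)"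

end

theory Submission
  imports Defs "HOL-Probability.Probability"
begin

text \<open>Let \<open>m(z; v)\<close> be the marginal density of \<open>z\<close> when \<open>z\<close> is normal with mean \<open>\<Theta>\<close> and variance \<open>v\<close> and
  \<open>\<Theta>\<close> has the given prior. The risk of the Bayesian predictive density at \<open>\<Theta>\<close> is the constant
  \<open>(q r / 2) ln ((v\<^sub>x + v\<^sub>y) / v\<^sub>y)\<close> plus \<open>E ln m(Z; v)\<close> at \<open>v = v\<^sub>x\<close> minus its value at \<open>v = v\<^sub>w\<close>, where \<open>Z\<close> is
  normal with mean \<open>\<Theta>\<close> and variance \<open>v\<close>. The constant is a lower bound for the maximal risk of every
  predictive density: it is the limit of the Bayes risks for normal priors of growing variance. As \<open>m\<close>
  solves the heat equation, \<open>E ln m(Z; v)\<close> decreases in \<open>v\<close> as soon as \<open>2 m \<Delta>m \<le> |\<nabla>m|\<^sup>2\<close>, that is,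
  if \<open>sqrt m\<close> is superharmonic.

  Integrating out \<open>\<Theta>\<close> shows that \<open>m\<close> is a mixture over \<open>\<Omega>\<close> of \<open>exp (- tr (B z z\<^sup>T) / 2)\<close>, where
  \<open>B = \<Omega> (I - \<kappa>\<Omega>)\<^sup>-\<^sup>1 / v\<^sub>0\<close> and \<open>\<kappa> = 1 - v / v\<^sub>0\<close>. With \<open>M\<close> the posterior mean of \<open>B\<close>, the superharmonicity
  compares second moments of \<open>B\<close> with \<open>M\<close>. It follows by integrating over \<open>R_set\<close> the divergence of the
  posterior density times the field that is \<open>2 B\<^sup>2 - (B M + M B) / 2\<close> in the coordinate \<open>B\<close>; the
  terms left over have a sign because \<open>tr ((f(B) - f(M)) (B - M)) \<ge> 0\<close> for increasing matrix functions
  \<open>f\<close>. The factor \<open>exp (- \<epsilon> (tr \<Omega>\<^sup>-\<^sup>1 + tr (I - \<Omega>)\<^sup>-\<^sup>1))\<close> removes the boundary terms, and \<open>\<epsilon>\<close> tends to \<open>0\<close>.\<close>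

section \<open>Gaussian integrals\<close>

lemma has_field_derivative_integral:
  fixes f f' :: "real \<Rightarrow> 'o \<Rightarrow> real"
  assumes S: "convex S" and t0: "t0 \<in> S" and nontriv: "at t0 within S \<noteq> bot"
    and int: "\<And>t. t \<in> S \<Longrightarrow> integrable M (f t)"
    and der: "\<And>t x. t \<in> S \<Longrightarrow> x \<in> space M \<Longrightarrow> ((\<lambda>t. f t x) has_field_derivative f' t x) (at t within S)"
    and bnd: "\<And>t x. t \<in> S \<Longrightarrow> x \<in> space M \<Longrightarrow> \<bar>f' t x\<bar> \<le> g x"
    and g: "integrable M g"
  shows "((\<lambda>t. \<integral>x. f t x \<partial>M) has_field_derivative (\<integral>x. f' t0 x \<partial>M)) (at t0 within S)"
    and "f' t0 \<in> borel_measurable M" and "integrable M (f' t0)"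
proof -
  define q where "q t x = (f t x - f t0 x) / (t - t0)" for t x
  have q_lim: "((\<lambda>t. q t x) \<longlongrightarrow> f' t0 x) (at t0 within S)" if "x \<in> space M" for x
    using der[OF t0 that] unfolding has_field_derivative_iff q_def by simp
  have q_meas [measurable]: "q t \<in> borel_measurable M" if "t \<in> S" for t
  proof -
    have [measurable]: "f t \<in> borel_measurable M" "f t0 \<in> borel_measurable M"
      using int[OF that] int[OF t0] by auto
    show ?thesis unfolding q_def by measurable
  qed
  have q_bnd: "\<bar>q t x\<bar> \<le> g x" if "t \<in> S" "x \<in> space M" for t x
  proof (cases "t = t0")
    case True
    then show ?thesis using bnd[OF that] by (simp add: q_def)
  next
    case False
    have "norm (f t x - f t0 x) \<le> g x * norm (t - t0)"
      by (rule field_differentiable_bound[OF S, of "\<lambda>t. f t x" "\<lambda>t. f' t x"])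
        (use der bnd that t0 in auto)
    then show ?thesis using False by (simp add: q_def field_simps)
  qed
  obtain T where T: "\<And>n. T n \<in> S" "\<And>n. T n \<noteq> t0" "T \<longlonglongrightarrow> t0"
    using nontriv unfolding trivial_limit_within islimpt_sequential by auto
  have qT: "(\<lambda>n. q (T n) x) \<longlonglongrightarrow> f' t0 x" if "x \<in> space M" for x
    using q_lim[OF that] T unfolding tendsto_at_iff_sequentially by (auto simp: o_def)
  show meas: "f' t0 \<in> borel_measurable M"
    by (rule borel_measurable_LIMSEQ_real[where u="\<lambda>n. q (T n)"]) (use qT T in auto)
  show "integrable M (f' t0)"
    by (rule Bochner_Integration.integrable_bound[OF g meas]) (use bnd[OF t0] in fastforce)
  show "((\<lambda>t. \<integral>x. f t x \<partial>M) has_field_derivative (\<integral>x. f' t0 x \<partial>M)) (at t0 within S)"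
    unfolding has_field_derivative_iff tendsto_at_iff_sequentially
  proof (intro allI impI)
    fix X assume X: "\<forall>i. X i \<in> S - {t0}" "X \<longlonglongrightarrow> t0"
    have "(\<lambda>n. \<integral>x. q (X n) x \<partial>M) \<longlonglongrightarrow> (\<integral>x. f' t0 x \<partial>M)"
    proof (rule integral_dominated_convergence[OF meas _ g])
      show "AE x in M. (\<lambda>n. q (X n) x) \<longlonglongrightarrow> f' t0 x"
        using q_lim X unfolding tendsto_at_iff_sequentially by (auto simp: o_def)
      show "AE x in M. norm (q (X n) x) \<le> g x" for n
        using q_bnd X by auto
    qed (use X q_meas in auto)
    also have "(\<lambda>n. \<integral>x. q (X n) x \<partial>M) = ((\<lambda>y. ((\<integral>x. f y x \<partial>M) - (\<integral>x. f t0 x \<partial>M)) / (y - t0)) \<circ> X)"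
      using X int t0 by (auto simp: q_def fun_eq_iff)
    finally show "((\<lambda>y. ((\<integral>x. f y x \<partial>M) - (\<integral>x. f t0 x \<partial>M)) / (y - t0)) \<circ> X) \<longlonglongrightarrow> (\<integral>x. f' t0 x \<partial>M)" .
  qed
qed

lemma integral_derivative_translation_invariant:
  fixes M :: "'a::real_normed_vector measure" and g g' :: "'a \<Rightarrow> real"
  assumes sets: "sets M = sets borel"
    and inv: "\<And>t::real. distr M borel (\<lambda>x. x + t *\<^sub>R h) = M"
    and int: "integrable M g"
    and der: "\<And>x. ((\<lambda>t. g (x + t *\<^sub>R h)) has_field_derivative g' x) (at 0)"
    and bnd: "\<And>x t. \<bar>t\<bar> \<le> 1 \<Longrightarrow> \<bar>g' (x + t *\<^sub>R h)\<bar> \<le> D x"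
    and D: "integrable M D"
  shows "(\<integral>x. g' x \<partial>M) = 0" and "integrable M g'"
proof -
  have [measurable]: "(\<lambda>x. x + t *\<^sub>R h) \<in> measurable M borel" for t
    by (subst measurable_cong_sets[OF sets refl]) (intro borel_measurable_continuous_onI continuous_intros)
  have [measurable]: "g \<in> borel_measurable borel"
    using int sets by (simp add: integrable_iff_bounded cong: measurable_cong_sets)
  have const: "(\<integral>x. g (x + t *\<^sub>R h) \<partial>M) = (\<integral>x. g x \<partial>M)" for t
    by (subst (2) inv[of t, symmetric], subst integral_distr) auto
  have int': "integrable M (\<lambda>x. g (x + t *\<^sub>R h))" for t
    using int by (subst (asm) inv[of t, symmetric], subst (asm) integrable_distr_eq) auto
  have der': "((\<lambda>t. g (x + t *\<^sub>R h)) has_field_derivative g' (x + t *\<^sub>R h)) (at t within {-1..1})" for x t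
  proof -
    have "((\<lambda>s. g ((x + t *\<^sub>R h) + s *\<^sub>R h)) has_field_derivative g' (x + t *\<^sub>R h)) (at 0)"
      by (rule der)
    then have "((\<lambda>s. g (x + s *\<^sub>R h)) has_field_derivative g' (x + t *\<^sub>R h)) (at (0 + t))"
      unfolding DERIV_shift by (simp only: scaleR_add_left ab_semigroup_add_class.add_ac)
    then show ?thesis by (simp add: has_field_derivative_at_within)
  qed
  have nb: "at 0 within {-1..1::real} \<noteq> bot"
    by (simp add: at_within_Icc_at)
  have *: "((\<lambda>t. \<integral>x. g (x + t *\<^sub>R h) \<partial>M) has_field_derivative (\<integral>x. g' (x + 0 *\<^sub>R h) \<partial>M)) (at 0 within {-1..1})"
    and **: "integrable M (\<lambda>x. g' (x + 0 *\<^sub>R h))"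
    by (rule has_field_derivative_integral[OF _ _ nb int' der' _ D]; use bnd in force)+
  have "((\<lambda>t::real. \<integral>x. g x \<partial>M) has_field_derivative (\<integral>x. g' x \<partial>M)) (at 0)"
    using * by (simp add: const at_within_Icc_at)
  then show "(\<integral>x. g' x \<partial>M) = 0"
    using DERIV_unique DERIV_const by blast
  show "integrable M g'" using ** by simp
qed

definition gauss :: "real \<Rightarrow> 'a::euclidean_space \<Rightarrow> real" where
  "gauss v x = (2 * pi * v) powr (- real DIM('a) / 2) * exp (- (norm x)\<^sup>2 / (2 * v))"

lemma gauss_pos [simp]: "0 < v \<Longrightarrow> 0 < gauss v x"
  by (simp add: gauss_def)

lemma gauss_nonneg [simp]: "0 \<le> gauss v x"
  by (simp add: gauss_def)

lemma gauss_minus [simp]: "gauss v (- x) = gauss v x"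
  by (simp add: gauss_def)

lemma gauss_commute: "gauss v (x - y) = gauss v (y - x)"
  by (simp add: gauss_def norm_minus_commute)

lemma borel_measurable_gauss [measurable]: "gauss v \<in> borel_measurable borel"
  unfolding gauss_def by measurable

lemma gauss_le: "0 < v \<Longrightarrow> gauss v (x::'a::euclidean_space) \<le> (2 * pi * v) powr (- real DIM('a) / 2)"
  unfolding gauss_def by (rule mult_left_le) auto

lemma norm2_eq_sum_Basis: "(norm x)\<^sup>2 = (\<Sum>b\<in>Basis. (x \<bullet> b)\<^sup>2)"
  unfolding power2_norm_eq_inner by (subst euclidean_inner) (simp only: power2_eq_square)

lemma powr_sqrt_power:
  assumes "0 < c"
  shows "c powr (real n / 2) = sqrt c ^ n"
proof -
  have "sqrt c ^ n = (c powr (1/2)) powr real n"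
    using assms by (simp add: powr_half_sqrt powr_realpow)
  then show ?thesis by (simp add: powr_powr)
qed

lemma gauss_eq_prod:
  fixes x :: "'a::euclidean_space"
  assumes v: "0 < v"
  shows "gauss v x = (\<Prod>b\<in>Basis. normal_density 0 (sqrt v) (x \<bullet> b))"
proof -
  have "(2 * pi * v) powr (- real DIM('a) / 2) = (1 / sqrt (2 * pi * v)) ^ DIM('a)"
    using v by (subst minus_divide_left[symmetric], subst powr_minus_divide, subst powr_sqrt_power) (simp_all add: power_divide)
  then show ?thesis
    using v unfolding gauss_def normal_density_def
    by (simp add: norm2_eq_sum_Basis[of x] prod_dividef power_divide exp_sum[symmetric] sum_negf sum_divide_distrib)
qed

lemma lborel_prod_product:
  fixes f :: "'a::euclidean_space \<Rightarrow> real \<Rightarrow> real"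
  assumes f: "\<And>b. b \<in> Basis \<Longrightarrow> integrable lborel (f b)"
  shows "integrable lborel (\<lambda>x. \<Prod>b\<in>Basis. f b (x \<bullet> b))"
    and "(\<integral>x. (\<Prod>b\<in>Basis. f b (x \<bullet> b)) \<partial>lborel) = (\<Prod>b\<in>Basis. \<integral>t. f b t \<partial>lborel)"
proof -
  interpret product_sigma_finite "\<lambda>_::'a. lborel :: real measure" ..
  have [measurable]: "f b \<in> borel_measurable borel" if "b \<in> Basis" for b
    using f[OF that] by auto
  have m: "(\<lambda>x. \<Prod>b\<in>Basis. f b (x \<bullet> b)) \<in> borel_measurable (borel :: 'a measure)"
    by measurable
  have m2: "(\<lambda>f. \<Sum>b\<in>Basis. f b *\<^sub>R b) \<in> measurable (\<Pi>\<^sub>M b\<in>(Basis::'a set). lborel) borel"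
    by measurable
  have e: "(\<Prod>b\<in>Basis. f b ((\<Sum>c\<in>Basis. y c *\<^sub>R c) \<bullet> b)) = (\<Prod>b\<in>Basis. f b (y b))" for y :: "'a \<Rightarrow> real"
    by (rule prod.cong) auto
  show "integrable lborel (\<lambda>x. \<Prod>b\<in>Basis. f b (x \<bullet> b))"
    by (subst lborel_eq, subst integrable_distr_eq[OF m2 m], unfold e)
      (rule product_integrable_prod; use f in auto)
  show "(\<integral>x. (\<Prod>b\<in>Basis. f b (x \<bullet> b)) \<partial>lborel) = (\<Prod>b\<in>Basis. \<integral>t. f b t \<partial>lborel)"
    by (subst lborel_eq, subst integral_distr[OF m2 m], unfold e)
      (rule product_integral_prod; use f in auto)
qed

lemma gauss_integral:
  assumes v: "0 < v"
  shows integrable_gauss: "integrable lborel (gauss v :: 'a::euclidean_space \<Rightarrow> real)"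
    and integral_gauss: "(\<integral>x. gauss v (x::'a) \<partial>lborel) = 1"
proof -
  have i: "integrable lborel (normal_density 0 (sqrt v))" using v by auto
  have j: "(\<integral>t. normal_density 0 (sqrt v) t \<partial>lborel) = 1" using v by auto
  show "integrable lborel (gauss v :: 'a::euclidean_space \<Rightarrow> real)"
    using lborel_prod_product(1)[of "\<lambda>_::'a. normal_density 0 (sqrt v)"] i
    unfolding gauss_eq_prod[OF v, abs_def] by blast
  show "(\<integral>x. gauss v (x::'a) \<partial>lborel) = 1"
    using lborel_prod_product(2)[of "\<lambda>_::'a. normal_density 0 (sqrt v)"] i j
    unfolding gauss_eq_prod[OF v] by simp
qed

lemma gauss_second_moment:
  assumes v: "0 < v"
  shows integrable_gauss_norm2: "integrable lborel (\<lambda>x::'a::euclidean_space. gauss v x * (norm x)\<^sup>2)"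
    and integral_gauss_norm2: "(\<integral>x. gauss v (x::'a) * (norm x)\<^sup>2 \<partial>lborel) = real DIM('a) * v"
proof -
  let ?f = "\<lambda>b c t. if c = (b::'a) then normal_density 0 (sqrt v) t * t^2 else normal_density 0 (sqrt v) t"
  have m2: "has_bochner_integral lborel (\<lambda>t. normal_density 0 (sqrt v) t * t^2) v"
    using normal_moment_even[of "sqrt v" 0 1] v by simp
  have i: "integrable lborel (?f b c)" for b c
    using m2 v by (cases "c = b") (auto simp: has_bochner_integral_iff)
  have e: "gauss v x * (x \<bullet> b)^2 = (\<Prod>c\<in>Basis. ?f b c (x \<bullet> c))" if b: "b \<in> Basis" for x b :: 'a
    by (simp add: gauss_eq_prod[OF v] prod.remove[OF finite_Basis b])
  have bi: "integrable lborel (\<lambda>x. gauss v x * (x \<bullet> b)^2)"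
    and bv: "(\<integral>x. gauss v x * (x \<bullet> b)^2 \<partial>lborel) = v" if b: "b \<in> Basis" for b :: 'a
  proof -
    show "integrable lborel (\<lambda>x. gauss v x * (x \<bullet> b)^2)"
      unfolding e[OF b] by (rule lborel_prod_product(1)) (rule i)
    have "(\<integral>x. gauss v x * (x \<bullet> b)^2 \<partial>lborel) = (\<Prod>c\<in>Basis. \<integral>t. ?f b c t \<partial>lborel)"
      unfolding e[OF b] by (rule lborel_prod_product(2)) (rule i)
    also have "\<dots> = (\<Prod>c\<in>Basis. if c = b then v else 1)"
      using m2 v by (intro prod.cong) (auto simp: has_bochner_integral_iff)
    finally show "(\<integral>x. gauss v x * (x \<bullet> b)^2 \<partial>lborel) = v" using b by simp
  qed
  have n: "gauss v x * (norm x)\<^sup>2 = (\<Sum>b\<in>Basis. gauss v x * (x \<bullet> b)^2)" for x :: 'a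
    by (simp only: norm2_eq_sum_Basis sum_distrib_left)
  show "integrable lborel (\<lambda>x::'a. gauss v x * (norm x)\<^sup>2)"
    unfolding n using bi by auto
  show "(\<integral>x. gauss v (x::'a) * (norm x)\<^sup>2 \<partial>lborel) = real DIM('a) * v"
    unfolding n by (subst Bochner_Integration.integral_sum) (use bi bv in auto)
qed

lemma integrable_exp_norm2:
  assumes "0 < c"
  shows "integrable lborel (\<lambda>x::'a::euclidean_space. exp (- c * (norm x)\<^sup>2))"
proof -
  have "integrable lborel (\<lambda>x::'a. gauss (1 / (2 * c)) x * (2 * pi * (1 / (2 * c))) powr (real DIM('a) / 2))"
    using integrable_gauss[of "1 / (2 * c)"] assms by (intro integrable_mult_left) auto
  also have "(\<lambda>x::'a. gauss (1 / (2 * c)) x * (2 * pi * (1 / (2 * c))) powr (real DIM('a) / 2)) = (\<lambda>x. exp (- c * (norm x)\<^sup>2))"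
    using assms by (auto simp: gauss_def powr_minus field_simps fun_eq_iff)
  finally show ?thesis .
qed

lemma cubic_exp_bound:
  fixes t v :: real
  assumes v: "0 < v" and t: "0 \<le> t"
  shows "(1 + t) ^ 3 * exp (- t\<^sup>2 / (2 * v)) \<le> 27 * exp v * exp (- t\<^sup>2 / (4 * v))"
proof -
  have "(1 + t) ^ 3 \<le> (3 * exp (t / 3)) ^ 3"
    using exp_ge_add_one_self[of "t / 3"] t by (intro power_mono) linarith+
  also have "\<dots> = 27 * exp t" by (simp add: power_mult_distrib exp_of_nat_mult[symmetric])
  finally have "(1 + t) ^ 3 * exp (- t\<^sup>2 / (2 * v)) \<le> 27 * exp t * exp (- t\<^sup>2 / (2 * v))"
    by (intro mult_right_mono) auto
  also have "\<dots> = 27 * exp (t - t\<^sup>2 / (2 * v))" by (simp add: mult_exp_exp)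
  also have "\<dots> \<le> 27 * exp (v + - t\<^sup>2 / (4 * v))"
  proof -
    have "0 \<le> (t - 2 * v)\<^sup>2 / (4 * v)" using v by simp
    also have "(t - 2 * v)\<^sup>2 / (4 * v) = v + - t\<^sup>2 / (4 * v) - (t - t\<^sup>2 / (2 * v))"
      using v by (simp add: field_simps power2_eq_square)
    finally show ?thesis by simp
  qed
  finally show ?thesis by (simp only: exp_add mult.assoc)
qed

lemma shifted_gauss_bound:
  fixes x h :: "'a::real_inner"
  assumes c: "0 < c"
  shows "exp (- c * (norm (x + h))\<^sup>2) \<le> exp (c * (norm h)\<^sup>2) * exp (- (c / 2) * (norm x)\<^sup>2)"
proof -
  have "norm x \<le> norm (x + h) + norm h"
    using norm_triangle_ineq4[of "x + h" h] by simp
  then have "(norm x)\<^sup>2 \<le> (norm (x + h) + norm h)\<^sup>2" by (intro power_mono) auto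
  also have "\<dots> \<le> 2 * (norm (x + h))\<^sup>2 + 2 * (norm h)\<^sup>2"
    using sum_squares_bound[of "norm (x + h)" "norm h"] by (simp add: power2_sum)
  finally have "c * (norm x)\<^sup>2 \<le> c * (2 * (norm (x + h))\<^sup>2 + 2 * (norm h)\<^sup>2)"
    using c by (intro mult_left_mono) auto
  then show ?thesis unfolding exp_add[symmetric] by (simp add: algebra_simps)
qed

lemma integrable_gauss_poly:
  fixes f :: "'a::euclidean_space \<Rightarrow> real"
  assumes v: "0 < v" and [measurable]: "f \<in> borel_measurable borel"
    and f: "\<And>x. \<bar>f x\<bar> \<le> C * (1 + norm x) ^ 3"
  shows "integrable lborel (\<lambda>x. gauss v x * f x)"
proof (rule Bochner_Integration.integrable_bound)
  let ?K = "(2 * pi * v) powr (- real DIM('a) / 2)"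
  show "integrable lborel (\<lambda>x::'a. (?K * \<bar>C\<bar> * 27 * exp v) * exp (- (1 / (4 * v)) * (norm x)\<^sup>2))"
    by (intro integrable_mult_right integrable_exp_norm2) (use v in auto)
  have "norm (gauss v x * f x) \<le> norm ((?K * \<bar>C\<bar> * 27 * exp v) * exp (- (1 / (4 * v)) * (norm x)\<^sup>2))" for x :: 'a
  proof -
    have "norm (gauss v x * f x) \<le> gauss v x * (C * (1 + norm x) ^ 3)"
      using f[of x] by (simp add: abs_mult mult_left_mono)
    also have "\<dots> \<le> gauss v x * (\<bar>C\<bar> * (1 + norm x) ^ 3)"
      by (intro mult_left_mono mult_right_mono) auto
    also have "\<dots> = (?K * \<bar>C\<bar>) * ((1 + norm x) ^ 3 * exp (- (norm x)\<^sup>2 / (2 * v)))"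
      by (simp add: gauss_def)
    also have "\<dots> \<le> (?K * \<bar>C\<bar>) * (27 * exp v * exp (- (norm x)\<^sup>2 / (4 * v)))"
      by (intro mult_left_mono cubic_exp_bound v) auto
    finally show ?thesis by (simp add: abs_mult)
  qed
  then show "AE x in lborel. norm (gauss v x * f x) \<le> norm ((?K * \<bar>C\<bar> * 27 * exp v) * exp (- (1 / (4 * v)) * (norm x)\<^sup>2))"
    by simp
qed measurable

lemma distr_lborel_plus_right:
  fixes h :: "'a::euclidean_space"
  shows "distr lborel borel (\<lambda>x. x + h) = lborel"
proof -
  have "(\<lambda>x. x + h) = (+) h" by (auto simp: add.commute)
  then show ?thesis by (simp only: lborel_distr_plus)
qed

lemma integral_lborel_translate:
  fixes h :: "'a::euclidean_space" and f :: "'a \<Rightarrow> real"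
  assumes [measurable]: "f \<in> borel_measurable borel"
  shows "(\<integral>x. f (x + h) \<partial>lborel) = (\<integral>x. f x \<partial>lborel)"
    and "integrable lborel (\<lambda>x. f (x + h)) \<longleftrightarrow> integrable lborel f"
  by (subst (2) distr_lborel_plus_right[of h, symmetric], subst integral_distr integrable_distr_eq; simp)+

lemma nn_integral_lborel_translate:
  fixes h :: "'a::euclidean_space" and f :: "'a \<Rightarrow> ennreal"
  assumes [measurable]: "f \<in> borel_measurable borel"
  shows "(\<integral>\<^sup>+x. f (x + h) \<partial>lborel) = (\<integral>\<^sup>+x. f x \<partial>lborel)"
  by (subst (2) distr_lborel_plus_right[of h, symmetric], subst nn_integral_distr; simp)

lemma integral_gauss_scale:
  fixes f :: "'a::euclidean_space \<Rightarrow> real"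
  assumes v: "0 < v" and [measurable]: "f \<in> borel_measurable borel"
  shows "(\<integral>x. gauss v (x - \<theta>) * f x \<partial>lborel) = (\<integral>\<xi>. gauss 1 \<xi> * f (\<theta> + sqrt v *\<^sub>R \<xi>) \<partial>lborel)"
proof -
  have c: "sqrt v \<noteq> 0" using v by simp
  have p: "(2 * pi * v) powr (- real DIM('a) / 2) * \<bar>sqrt v\<bar> ^ DIM('a) = (2 * pi) powr (- real DIM('a) / 2)"
  proof -
    have "(2 * pi * v) powr (real DIM('a) / 2) = sqrt (2 * pi) ^ DIM('a) * sqrt v ^ DIM('a)"
      using v by (subst powr_sqrt_power) (simp_all only: real_sqrt_mult power_mult_distrib mult_pos_pos pi_gt_zero zero_less_numeral)
    moreover have "(2 * pi) powr (real DIM('a) / 2) = sqrt (2 * pi) ^ DIM('a)"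
      by (rule powr_sqrt_power) simp
    ultimately show ?thesis
      using v unfolding minus_divide_left[symmetric] powr_minus by (simp add: field_simps)
  qed
  have g: "\<bar>sqrt v\<bar> ^ DIM('a) * gauss v (sqrt v *\<^sub>R \<xi>) = gauss 1 \<xi>" for \<xi> :: 'a
    using v p by (simp add: gauss_def power_mult_distrib mult.assoc[symmetric] mult.commute)
  have "(\<integral>x. gauss v (x - \<theta>) * f x \<partial>lborel) = (\<integral>x. gauss v (x - \<theta>) * f x \<partial>density (distr lborel borel (\<lambda>x. \<theta> + sqrt v *\<^sub>R x)) (\<lambda>_. ennreal (\<bar>sqrt v\<bar> ^ DIM('a))))"
    using lborel_affine[OF c, of \<theta>] v by (simp add: ennreal_power)
  also have "\<dots> = (\<integral>\<xi>. \<bar>sqrt v\<bar> ^ DIM('a) * (gauss v (sqrt v *\<^sub>R \<xi>) * f (\<theta> + sqrt v *\<^sub>R \<xi>)) \<partial>lborel)"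
    by (subst integral_density) (auto simp: integral_distr)
  also have "\<dots> = (\<integral>\<xi>. gauss 1 \<xi> * f (\<theta> + sqrt v *\<^sub>R \<xi>) \<partial>lborel)"
    by (intro Bochner_Integration.integral_cong) (auto simp: mult.assoc[symmetric] g)
  finally show ?thesis .
qed

lemma gauss_integration_by_parts:
  fixes f f' :: "'a::euclidean_space \<Rightarrow> real"
  assumes b: "norm b \<le> 1" and [measurable]: "f \<in> borel_measurable borel"
    and der: "\<And>x. ((\<lambda>t. f (x + t *\<^sub>R b)) has_field_derivative f' x) (at 0)"
    and f: "\<And>x. \<bar>f x\<bar> \<le> C * (1 + norm x)\<^sup>2" and f': "\<And>x. \<bar>f' x\<bar> \<le> C * (1 + norm x)\<^sup>2"
  shows "(\<integral>x. gauss 1 x * ((x \<bullet> b) * f x) \<partial>lborel) = (\<integral>x. gauss 1 x * f' x \<partial>lborel)"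
    and "integrable lborel (\<lambda>x. gauss 1 x * f' x)"
    and "integrable lborel (\<lambda>x. gauss 1 x * ((x \<bullet> b) * f x))"
proof -
  have C: "0 \<le> C" using f[of 0] by simp
  have n32: "(1 + norm x)\<^sup>2 \<le> (1 + norm x) ^ 3" for x :: 'a
    by (intro power_increasing) auto
  have xb: "\<bar>(x \<bullet> b) * f x\<bar> \<le> C * (1 + norm x) ^ 3" for x
  proof -
    have "\<bar>x \<bullet> b\<bar> \<le> norm x * norm b" by (rule Cauchy_Schwarz_ineq2)
    also have "\<dots> \<le> 1 + norm x" using b mult_left_le[of "norm b" "norm x"] by simp
    finally have "\<bar>x \<bullet> b\<bar> * \<bar>f x\<bar> \<le> (1 + norm x) * (C * (1 + norm x)\<^sup>2)"
      by (intro mult_mono f) auto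
    then show ?thesis by (simp add: abs_mult power3_eq_cube power2_eq_square algebra_simps)
  qed
  define g' where "g' x = gauss 1 x * (f' x - (x \<bullet> b) * f x)" for x
  have gd: "((\<lambda>t. gauss 1 (x + t *\<^sub>R b) * f (x + t *\<^sub>R b)) has_field_derivative g' x) (at 0)" for x
  proof -
    have "((\<lambda>t. gauss 1 (x + t *\<^sub>R b)) has_field_derivative - (x \<bullet> b) * gauss 1 x) (at 0)"
      unfolding gauss_def power2_norm_eq_inner
      by (auto intro!: derivative_eq_intros simp: inner_simps inner_commute algebra_simps)
    from DERIV_mult[OF this der[of x]] show ?thesis
      by (simp add: g'_def algebra_simps)
  qed
  let ?K = "(2 * pi) powr (- real DIM('a) / 2)"
  have g'b: "\<bar>g' x\<bar> \<le> ?K * (2 * C) * (27 * exp 1) * exp (- (1 / 4) * (norm x)\<^sup>2)" for x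
  proof -
    have "\<bar>f' x - (x \<bullet> b) * f x\<bar> \<le> 2 * C * (1 + norm x) ^ 3"
      using f'[of x] xb[of x] mult_left_mono[OF n32[of x] C] by linarith
    then have "\<bar>g' x\<bar> \<le> gauss 1 x * (2 * C * (1 + norm x) ^ 3)"
      by (simp add: g'_def abs_mult mult_left_mono)
    also have "\<dots> = (?K * (2 * C)) * ((1 + norm x) ^ 3 * exp (- (norm x)\<^sup>2 / (2 * 1)))"
      by (simp add: gauss_def)
    also have "\<dots> \<le> (?K * (2 * C)) * (27 * exp 1 * exp (- (norm x)\<^sup>2 / (4 * 1)))"
      by (intro mult_left_mono cubic_exp_bound) (use C in auto)
    finally show ?thesis by simp
  qed
  have bnd: "\<bar>g' (x + t *\<^sub>R b)\<bar> \<le> ?K * (2 * C) * (27 * exp 1) * (exp 1 * exp (- (1 / 8) * (norm x)\<^sup>2))"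
    if "\<bar>t\<bar> \<le> 1" for x t
  proof -
    have tb: "norm (t *\<^sub>R b) \<le> 1" using that b by (simp add: mult_le_one)
    have "exp (- (1 / 4) * (norm (x + t *\<^sub>R b))\<^sup>2) \<le> exp (1 / 4 * (norm (t *\<^sub>R b))\<^sup>2) * exp (- (1 / 4 / 2) * (norm x)\<^sup>2)"
      by (rule shifted_gauss_bound) simp
    also have "\<dots> \<le> exp 1 * exp (- (1 / 8) * (norm x)\<^sup>2)"
      using power_le_one[OF norm_ge_zero tb, of 2] by (intro mult_mono) auto
    finally show ?thesis
      using g'b[of "x + t *\<^sub>R b"] C by (smt (verit) mult_left_mono mult_nonneg_nonneg powr_ge_zero exp_ge_zero)
  qed
  have i1: "integrable lborel (\<lambda>x. gauss 1 x * f x)"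
    by (rule integrable_gauss_poly[of _ _ C]) (auto intro: order_trans[OF f mult_left_mono[OF n32 C]])
  have i2: "integrable lborel (\<lambda>x::'a. ?K * (2 * C) * (27 * exp 1) * (exp 1 * exp (- (1 / 8) * (norm x)\<^sup>2)))"
    by (intro integrable_mult_right integrable_exp_norm2) auto
  have z: "(\<integral>x. g' x \<partial>lborel) = 0" and zi: "integrable lborel g'"
    by (rule integral_derivative_translation_invariant[OF sets_lborel distr_lborel_plus_right i1 gd bnd i2]; assumption)+
  show i3: "integrable lborel (\<lambda>x. gauss 1 x * ((x \<bullet> b) * f x))"
    by (rule integrable_gauss_poly[of _ _ C]) (use xb in auto)
  have "integrable lborel (\<lambda>x. g' x + gauss 1 x * ((x \<bullet> b) * f x))"
    using zi i3 by auto
  then show i4: "integrable lborel (\<lambda>x. gauss 1 x * f' x)"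
    by (simp add: g'_def algebra_simps)
  have "(\<integral>x. g' x \<partial>lborel) = (\<integral>x. gauss 1 x * f' x - gauss 1 x * ((x \<bullet> b) * f x) \<partial>lborel)"
    by (simp add: g'_def algebra_simps)
  also have "\<dots> = (\<integral>x. gauss 1 x * f' x \<partial>lborel) - (\<integral>x. gauss 1 x * ((x \<bullet> b) * f x) \<partial>lborel)"
    using i3 i4 by simp
  finally show "(\<integral>x. gauss 1 x * ((x \<bullet> b) * f x) \<partial>lborel) = (\<integral>x. gauss 1 x * f' x \<partial>lborel)"
    using z by simp
qed

section \<open>Heat flow of a Gaussian mixture\<close>

locale gauss_mixture = finite_measure \<mu> for \<mu> :: "'o measure" +
  fixes w :: "real \<Rightarrow> 'o \<Rightarrow> real" and B :: "real \<Rightarrow> 'o \<Rightarrow> 'a::euclidean_space \<Rightarrow> 'a"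
    and lo hi C :: real
  assumes lo_pos: "0 < lo" and lo_hi: "lo < hi"
    and mu_pos: "emeasure \<mu> (space \<mu>) \<noteq> 0"
    and w_meas: "v \<in> {lo..hi} \<Longrightarrow> w v \<in> borel_measurable \<mu>"
    and w_pos: "v \<in> {lo..hi} \<Longrightarrow> \<omega> \<in> space \<mu> \<Longrightarrow> 0 < w v \<omega>"
    and w_le: "v \<in> {lo..hi} \<Longrightarrow> \<omega> \<in> space \<mu> \<Longrightarrow> w v \<omega> \<le> C"
    and B_lin: "linear (B v \<omega>)"
    and B_sym: "v \<in> {lo..hi} \<Longrightarrow> \<omega> \<in> space \<mu> \<Longrightarrow> x \<bullet> B v \<omega> y = B v \<omega> x \<bullet> y"
    and B_psd: "v \<in> {lo..hi} \<Longrightarrow> \<omega> \<in> space \<mu> \<Longrightarrow> 0 \<le> x \<bullet> B v \<omega> x"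
    and B_le: "v \<in> {lo..hi} \<Longrightarrow> \<omega> \<in> space \<mu> \<Longrightarrow> norm (B v \<omega> x) \<le> C * norm x"
    and B_meas: "v \<in> {lo..hi} \<Longrightarrow> (\<lambda>\<omega>. B v \<omega> x) \<in> borel_measurable \<mu>"
    and w_der: "v \<in> {lo..hi} \<Longrightarrow> \<omega> \<in> space \<mu> \<Longrightarrow>
      ((\<lambda>v. w v \<omega>) has_field_derivative - (\<Sum>b\<in>Basis. b \<bullet> B v \<omega> b) / 2 * w v \<omega>) (at v within {lo..hi})"
    and B_der: "v \<in> {lo..hi} \<Longrightarrow> \<omega> \<in> space \<mu> \<Longrightarrow>
      ((\<lambda>v. B v \<omega> x) has_vector_derivative - B v \<omega> (B v \<omega> x)) (at v within {lo..hi})"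
begin

definition "kern v z \<omega> = w v \<omega> * exp (- (z \<bullet> B v \<omega> z) / 2)"
definition "mix v z = (\<integral>\<omega>. kern v z \<omega> \<partial>\<mu>)"
definition "grad b v z = (\<integral>\<omega>. - (b \<bullet> B v \<omega> z) * kern v z \<omega> \<partial>\<mu>)"
definition "hess b v z = (\<integral>\<omega>. ((b \<bullet> B v \<omega> z)\<^sup>2 - b \<bullet> B v \<omega> b) * kern v z \<omega> \<partial>\<mu>)"

lemma C_pos: "0 < C"
proof -
  obtain \<omega> where "\<omega> \<in> space \<mu>" using mu_pos by (metis emeasure_empty equals0I)
  then show ?thesis using w_pos[of lo \<omega>] w_le[of lo \<omega>] lo_hi by auto
qed

lemma B_repr: "B v \<omega> z = (\<Sum>b\<in>Basis. (z \<bullet> b) *\<^sub>R B v \<omega> b)"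
  by (subst euclidean_representation[of z, symmetric])
    (simp only: linear_sum[OF B_lin] linear_cmul[OF B_lin])

context fixes v assumes v: "v \<in> {lo..hi}"
begin

lemma [measurable]: "w v \<in> borel_measurable \<mu>" and [measurable]: "(\<lambda>\<omega>. B v \<omega> z) \<in> borel_measurable \<mu>"
  using w_meas[OF v] B_meas[OF v] by auto

lemma B_meas2 [measurable]: "(\<lambda>(z, \<omega>). B v \<omega> z) \<in> borel_measurable (borel \<Otimes>\<^sub>M \<mu>)"
  by (subst B_repr) measurable

lemma kern_meas2 [measurable]: "(\<lambda>(z, \<omega>). kern v z \<omega>) \<in> borel_measurable (borel \<Otimes>\<^sub>M \<mu>)"
  unfolding kern_def by measurable

lemma kern_pos: "\<omega> \<in> space \<mu> \<Longrightarrow> 0 < kern v z \<omega>"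
  using w_pos[OF v] by (simp add: kern_def)

lemma kern_le: "\<omega> \<in> space \<mu> \<Longrightarrow> kern v z \<omega> \<le> C"
  using mult_mono[OF w_le[OF v], of \<omega> "exp (- (z \<bullet> B v \<omega> z) / 2)" 1] B_psd[OF v, of \<omega> z] C_pos
  by (simp add: kern_def)

lemma inner_B_le: "\<omega> \<in> space \<mu> \<Longrightarrow> \<bar>x \<bullet> B v \<omega> y\<bar> \<le> C * norm x * norm y"
  using Cauchy_Schwarz_ineq2[of x "B v \<omega> y"] mult_left_mono[OF B_le[OF v, of \<omega> y] norm_ge_zero[of x]]
  by (simp add: mult_ac)

lemma coeff_le:
  assumes "b \<in> Basis" "\<omega> \<in> space \<mu>"
  shows "\<bar>b \<bullet> B v \<omega> z\<bar> \<le> C * norm z" "\<bar>(b \<bullet> B v \<omega> z)\<^sup>2 - b \<bullet> B v \<omega> b\<bar> \<le> C\<^sup>2 * (norm z)\<^sup>2 + C"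
proof -
  show 1: "\<bar>b \<bullet> B v \<omega> z\<bar> \<le> C * norm z" using inner_B_le[OF assms(2), of b z] assms by simp
  have "\<bar>b \<bullet> B v \<omega> b\<bar> \<le> C" using inner_B_le[OF assms(2), of b b] assms by simp
  moreover have "(b \<bullet> B v \<omega> z)\<^sup>2 \<le> C\<^sup>2 * (norm z)\<^sup>2"
    using power_mono[OF 1, of 2] by (simp add: power_mult_distrib)
  ultimately show "\<bar>(b \<bullet> B v \<omega> z)\<^sup>2 - b \<bullet> B v \<omega> b\<bar> \<le> C\<^sup>2 * (norm z)\<^sup>2 + C"
    using zero_le_power2[of "b \<bullet> B v \<omega> z"] by linarith
qed

lemma integrable_mult_kern:
  assumes [measurable]: "f \<in> borel_measurable \<mu>" and "\<And>\<omega>. \<omega> \<in> space \<mu> \<Longrightarrow> \<bar>f \<omega>\<bar> \<le> K"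
  shows "integrable \<mu> (\<lambda>\<omega>. f \<omega> * kern v z \<omega>)"
proof (rule integrable_const_bound[of _ "\<bar>K\<bar> * C"])
  have "\<bar>f \<omega>\<bar> * \<bar>kern v z \<omega>\<bar> \<le> \<bar>K\<bar> * C" if "\<omega> \<in> space \<mu>" for \<omega>
    using assms(2)[OF that] kern_le[OF that, of z] kern_pos[OF that, of z] by (intro mult_mono) auto
  then show "AE \<omega> in \<mu>. norm (f \<omega> * kern v z \<omega>) \<le> \<bar>K\<bar> * C"
    by (simp add: abs_mult)
qed measurable

lemma integral_mult_kern_le:
  assumes [measurable]: "f \<in> borel_measurable \<mu>" and K: "\<And>\<omega>. \<omega> \<in> space \<mu> \<Longrightarrow> \<bar>f \<omega>\<bar> \<le> K"
  shows "\<bar>\<integral>\<omega>. f \<omega> * kern v z \<omega> \<partial>\<mu>\<bar> \<le> K * mix v z"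
proof -
  have "\<bar>\<integral>\<omega>. f \<omega> * kern v z \<omega> \<partial>\<mu>\<bar> \<le> (\<integral>\<omega>. \<bar>f \<omega> * kern v z \<omega>\<bar> \<partial>\<mu>)"
    by (rule integral_abs_bound)
  also have "\<dots> \<le> (\<integral>\<omega>. K * kern v z \<omega> \<partial>\<mu>)"
    using kern_pos K
    by (intro integral_mono integrable_abs integrable_mult_kern[OF assms] integrable_mult_kern[of "\<lambda>_. K" "\<bar>K\<bar>"])
      (auto simp: abs_mult less_imp_le intro!: mult_right_mono)
  finally show ?thesis by (simp add: mix_def)
qed

lemma kern_integrable: "integrable \<mu> (kern v z)"
  using integrable_mult_kern[of "\<lambda>_. 1" 1 z] by simp

lemma mix_pos: "0 < mix v z"
proof -
  have "0 \<le> mix v z" unfolding mix_def using kern_pos by (intro integral_nonneg_AE AE_I2) (auto simp: less_imp_le)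
  moreover have "mix v z \<noteq> 0"
  proof
    assume "mix v z = 0"
    then have "AE \<omega> in \<mu>. kern v z \<omega> = 0"
      unfolding mix_def using kern_pos
      by (subst (asm) integral_nonneg_eq_0_iff_AE[OF kern_integrable]) (auto simp: less_imp_le)
    then have "AE \<omega> in \<mu>. False"
      by (rule AE_mp) (use kern_pos in \<open>auto simp: less_le\<close>)
    then show False using mu_pos by (simp add: AE_iff_null null_sets_def)
  qed
  ultimately show ?thesis by simp
qed

lemma mix_le: "mix v z \<le> C * measure \<mu> (space \<mu>)"
proof -
  have "mix v z \<le> (\<integral>\<omega>. C \<partial>\<mu>)" unfolding mix_def
    by (rule integral_mono[OF kern_integrable]) (auto intro: kern_le)
  then show ?thesis by (simp add: mult.commute)
qed

lemma mix_ge: "mix v 0 * exp (- C * (norm z)\<^sup>2 / 2) \<le> mix v z"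
proof -
  have "kern v 0 \<omega> * exp (- C * (norm z)\<^sup>2 / 2) \<le> kern v z \<omega>" if "\<omega> \<in> space \<mu>" for \<omega>
    using inner_B_le[OF that, of z z] w_pos[OF v that]
    by (auto simp: kern_def power2_eq_square intro!: mult_left_mono)
  then have "(\<integral>\<omega>. kern v 0 \<omega> * exp (- C * (norm z)\<^sup>2 / 2) \<partial>\<mu>) \<le> mix v z"
    unfolding mix_def by (intro integral_mono) (auto intro!: kern_integrable)
  then show ?thesis by (simp add: mix_def)
qed

lemma ln_mix_bound: "\<exists>K. \<forall>z. \<bar>ln (mix v z)\<bar> \<le> K * (1 + (norm z)\<^sup>2)"
proof -
  let ?a = "C * measure \<mu> (space \<mu>)" and ?b = "mix v 0"
  have "\<bar>ln (mix v z)\<bar> \<le> (\<bar>ln ?a\<bar> + \<bar>ln ?b\<bar> + C) * (1 + (norm z)\<^sup>2)" for z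
  proof -
    have "ln (mix v z) \<le> ln ?a" using mix_pos[of z] mix_le[of z] by (subst ln_le_cancel_iff) auto
    moreover have "ln (?b * exp (- C * (norm z)\<^sup>2 / 2)) \<le> ln (mix v z)"
      using mix_pos[of z] mix_pos[of 0] mix_ge[of z] by (subst ln_le_cancel_iff) auto
    then have "ln ?b - C * (norm z)\<^sup>2 / 2 \<le> ln (mix v z)"
      using mix_pos[of 0] by (simp add: ln_mult)
    moreover have "0 \<le> C * (norm z)\<^sup>2" "0 \<le> (\<bar>ln ?a\<bar> + \<bar>ln ?b\<bar>) * (norm z)\<^sup>2" using C_pos by auto
    ultimately have "\<bar>ln (mix v z)\<bar> \<le> \<bar>ln ?a\<bar> + \<bar>ln ?b\<bar> + C + (\<bar>ln ?a\<bar> + \<bar>ln ?b\<bar>) * (norm z)\<^sup>2 + C * (norm z)\<^sup>2"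
      using C_pos by linarith
    then show ?thesis by (simp only: ring_distribs mult_1_right)
  qed
  then show ?thesis by blast
qed

lemma mix_meas [measurable]: "mix v \<in> borel_measurable borel"
  unfolding mix_def by measurable

lemma grad_meas [measurable]: "grad b v \<in> borel_measurable borel"
  unfolding grad_def by measurable

lemma hess_meas [measurable]: "hess b v \<in> borel_measurable borel"
  unfolding hess_def by measurable

lemma grad_le: "b \<in> Basis \<Longrightarrow> \<bar>grad b v z\<bar> \<le> C * norm z * mix v z"
  unfolding grad_def by (rule integral_mult_kern_le) (use coeff_le(1) in auto)

lemma hess_le: "b \<in> Basis \<Longrightarrow> \<bar>hess b v z\<bar> \<le> (C\<^sup>2 * (norm z)\<^sup>2 + C) * mix v z"
  unfolding hess_def by (rule integral_mult_kern_le) (use coeff_le(2) in auto)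

lemma kern_line_deriv:
  assumes "\<omega> \<in> space \<mu>"
  shows "((\<lambda>t. kern v (z + t *\<^sub>R b) \<omega>) has_field_derivative
    - (b \<bullet> B v \<omega> (z + t *\<^sub>R b)) * kern v (z + t *\<^sub>R b) \<omega>) (at t within S)"
proof -
  interpret B: linear "B v \<omega>" by (rule B_lin)
  have s: "z \<bullet> B v \<omega> b = b \<bullet> B v \<omega> z" using B_sym[OF v assms, of z b] by (simp add: inner_commute)
  have e: "(z + t *\<^sub>R b) \<bullet> B v \<omega> (z + t *\<^sub>R b) = z \<bullet> B v \<omega> z + 2 * t * (b \<bullet> B v \<omega> z) + t\<^sup>2 * (b \<bullet> B v \<omega> b)" for t
    by (simp add: B.add B.scaleR inner_simps s power2_eq_square algebra_simps)
  have e2: "b \<bullet> B v \<omega> (z + t *\<^sub>R b) = b \<bullet> B v \<omega> z + t * (b \<bullet> B v \<omega> b)" for t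
    by (simp add: B.add B.scaleR inner_simps)
  show ?thesis
    unfolding kern_def e e2
    by (auto intro!: derivative_eq_intros simp: field_simps)
qed

lemma line_deriv_integral:
  assumes f: "\<And>t. f t \<in> borel_measurable \<mu>" and K: "\<And>t \<omega>. \<bar>t\<bar> \<le> 1 \<Longrightarrow> \<omega> \<in> space \<mu> \<Longrightarrow> \<bar>f t \<omega>\<bar> \<le> K"
    and der: "\<And>t \<omega>. \<omega> \<in> space \<mu> \<Longrightarrow> ((\<lambda>t. f t \<omega> * kern v (z + t *\<^sub>R b) \<omega>) has_field_derivative
      f' t \<omega> * kern v (z + t *\<^sub>R b) \<omega>) (at t)"
    and K': "\<And>t \<omega>. \<bar>t\<bar> \<le> 1 \<Longrightarrow> \<omega> \<in> space \<mu> \<Longrightarrow> \<bar>f' t \<omega>\<bar> \<le> K'"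
  shows "((\<lambda>t. \<integral>\<omega>. f t \<omega> * kern v (z + t *\<^sub>R b) \<omega> \<partial>\<mu>) has_field_derivative
    (\<integral>\<omega>. f' 0 \<omega> * kern v z \<omega> \<partial>\<mu>)) (at 0)"
proof -
  have nb: "at 0 within {-1..1::real} \<noteq> bot" by (simp add: at_within_Icc_at)
  have "((\<lambda>t. \<integral>\<omega>. f t \<omega> * kern v (z + t *\<^sub>R b) \<omega> \<partial>\<mu>) has_field_derivative
    (\<integral>\<omega>. f' 0 \<omega> * kern v (z + 0 *\<^sub>R b) \<omega> \<partial>\<mu>)) (at 0 within {-1..1})"
  proof (rule has_field_derivative_integral(1)[OF _ _ nb, where g="\<lambda>_. \<bar>K'\<bar> * C"])
    fix t :: real and \<omega> assume t: "t \<in> {-1..1}" and \<omega>: "\<omega> \<in> space \<mu>"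
    show "((\<lambda>t. f t \<omega> * kern v (z + t *\<^sub>R b) \<omega>) has_field_derivative
      f' t \<omega> * kern v (z + t *\<^sub>R b) \<omega>) (at t within {-1..1})"
      by (rule has_field_derivative_at_within[OF der[OF \<omega>]])
    show "\<bar>f' t \<omega> * kern v (z + t *\<^sub>R b) \<omega>\<bar> \<le> \<bar>K'\<bar> * C"
      unfolding abs_mult using K'[of t \<omega>] t \<omega> kern_le[OF \<omega>] kern_pos[OF \<omega>] C_pos
      by (intro mult_mono) (auto simp: abs_le_iff less_imp_le intro: order_trans)
  next
    fix t :: real assume "t \<in> {-1..1}"
    then show "integrable \<mu> (\<lambda>\<omega>. f t \<omega> * kern v (z + t *\<^sub>R b) \<omega>)"
      using K by (intro integrable_mult_kern[where K=K] f) auto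
  qed auto
  then show ?thesis by (simp add: at_within_Icc_at)
qed

lemma mix_deriv:
  assumes b: "b \<in> Basis"
  shows "((\<lambda>t. mix v (z + t *\<^sub>R b)) has_field_derivative grad b v z) (at 0)"
proof -
  have n: "norm (z + t *\<^sub>R b) \<le> norm z + 1" if "\<bar>t\<bar> \<le> 1" for t
    using norm_triangle_ineq[of z "t *\<^sub>R b"] b that by simp
  have "((\<lambda>t. \<integral>\<omega>. 1 * kern v (z + t *\<^sub>R b) \<omega> \<partial>\<mu>) has_field_derivative
    (\<integral>\<omega>. - (b \<bullet> B v \<omega> (z + 0 *\<^sub>R b)) * kern v z \<omega> \<partial>\<mu>)) (at 0)"
  proof (rule line_deriv_integral[where K=1 and K'="C * (norm z + 1)"])
    fix t \<omega> assume t: "\<bar>t\<bar> \<le> (1::real)" and \<omega>: "\<omega> \<in> space \<mu>"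
    have "C * norm (z + t *\<^sub>R b) \<le> C * (norm z + 1)"
      using n[OF t] C_pos by (intro mult_left_mono) auto
    then show "\<bar>- (b \<bullet> B v \<omega> (z + t *\<^sub>R b))\<bar> \<le> C * (norm z + 1)"
      using coeff_le(1)[OF b \<omega>, of "z + t *\<^sub>R b"] by simp
  next
    fix t \<omega> assume "\<omega> \<in> space \<mu>"
    then show "((\<lambda>t. 1 * kern v (z + t *\<^sub>R b) \<omega>) has_field_derivative
      - (b \<bullet> B v \<omega> (z + t *\<^sub>R b)) * kern v (z + t *\<^sub>R b) \<omega>) (at t)"
      using kern_line_deriv by simp
  qed auto
  then show ?thesis by (simp add: mix_def grad_def)
qed

lemma grad_deriv:
  assumes b: "b \<in> Basis"
  shows "((\<lambda>t. grad b v (z + t *\<^sub>R b)) has_field_derivative hess b v z) (at 0)"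
proof -
  have n: "norm (z + t *\<^sub>R b) \<le> norm z + 1" if "\<bar>t\<bar> \<le> 1" for t
    using norm_triangle_ineq[of z "t *\<^sub>R b"] b that by simp
  have "((\<lambda>t. \<integral>\<omega>. - (b \<bullet> B v \<omega> (z + t *\<^sub>R b)) * kern v (z + t *\<^sub>R b) \<omega> \<partial>\<mu>) has_field_derivative
    (\<integral>\<omega>. ((b \<bullet> B v \<omega> (z + 0 *\<^sub>R b))\<^sup>2 - b \<bullet> B v \<omega> b) * kern v z \<omega> \<partial>\<mu>)) (at 0)"
  proof (rule line_deriv_integral[where K="C * (norm z + 1)" and K'="C\<^sup>2 * (norm z + 1)\<^sup>2 + C"])
    fix t \<omega> assume t: "\<bar>t\<bar> \<le> (1::real)" and \<omega>: "\<omega> \<in> space \<mu>"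
    have "C * norm (z + t *\<^sub>R b) \<le> C * (norm z + 1)"
      using n[OF t] C_pos by (intro mult_left_mono) auto
    then show "\<bar>- (b \<bullet> B v \<omega> (z + t *\<^sub>R b))\<bar> \<le> C * (norm z + 1)"
      using coeff_le(1)[OF b \<omega>, of "z + t *\<^sub>R b"] by simp
    have "C\<^sup>2 * (norm (z + t *\<^sub>R b))\<^sup>2 \<le> C\<^sup>2 * (norm z + 1)\<^sup>2"
      using n[OF t] by (intro mult_left_mono power_mono) auto
    then show "\<bar>(b \<bullet> B v \<omega> (z + t *\<^sub>R b))\<^sup>2 - b \<bullet> B v \<omega> b\<bar> \<le> C\<^sup>2 * (norm z + 1)\<^sup>2 + C"
      using coeff_le(2)[OF b \<omega>, of "z + t *\<^sub>R b"] by simp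
  next
    fix t \<omega> assume \<omega>: "\<omega> \<in> space \<mu>"
    interpret B: linear "B v \<omega>" by (rule B_lin)
    have e2: "b \<bullet> B v \<omega> (z + t *\<^sub>R b) = b \<bullet> B v \<omega> z + t * (b \<bullet> B v \<omega> b)" for t
      by (simp add: B.add B.scaleR inner_simps)
    have "((\<lambda>t. - (b \<bullet> B v \<omega> (z + t *\<^sub>R b))) has_field_derivative - (b \<bullet> B v \<omega> b)) (at t)"
      unfolding e2 by (rule derivative_eq_intros refl | simp)+
    from DERIV_mult[OF this kern_line_deriv[OF \<omega>]]
    show "((\<lambda>t. - (b \<bullet> B v \<omega> (z + t *\<^sub>R b)) * kern v (z + t *\<^sub>R b) \<omega>) has_field_derivative
      ((b \<bullet> B v \<omega> (z + t *\<^sub>R b))\<^sup>2 - b \<bullet> B v \<omega> b) * kern v (z + t *\<^sub>R b) \<omega>) (at t)"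
      by (simp add: power2_eq_square algebra_simps)
  qed measurable
  then show ?thesis by (simp add: grad_def hess_def)
qed

end

lemma kern_path_deriv:
  fixes \<theta> \<xi> :: 'a
  assumes v: "v \<in> {lo..hi}" and \<omega>: "\<omega> \<in> space \<mu>"
  defines "z \<equiv> \<lambda>v. \<theta> + sqrt v *\<^sub>R \<xi>"
  shows "((\<lambda>v. kern v (z v) \<omega>) has_field_derivative
    (\<Sum>b\<in>Basis. ((b \<bullet> B v \<omega> (z v))\<^sup>2 - b \<bullet> B v \<omega> b) / 2 - (\<xi> \<bullet> b) / (2 * sqrt v) * (b \<bullet> B v \<omega> (z v)))
      * kern v (z v) \<omega>) (at v within {lo..hi})"
proof -
  have v0: "0 < v" using v lo_pos by simp
  have lin: "linear (B v \<omega>)" for v by (rule B_lin)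
  have e: "z u \<bullet> B u \<omega> (z u) = \<theta> \<bullet> B u \<omega> \<theta> + 2 * sqrt u * (\<xi> \<bullet> B u \<omega> \<theta>) + u * (\<xi> \<bullet> B u \<omega> \<xi>)"
    if "u \<in> {lo..hi}" for u
    using B_sym[OF that \<omega>, of \<theta> \<xi>] that lo_pos
    by (simp add: z_def linear_add[OF lin] linear_cmul[OF lin] inner_simps inner_commute algebra_simps)
  have bd: "((\<lambda>v. x \<bullet> B v \<omega> y) has_field_derivative - (B v \<omega> x \<bullet> B v \<omega> y)) (at v within {lo..hi})" for x y
    using bounded_linear.has_vector_derivative[OF bounded_linear_inner_right[of x] B_der[OF v \<omega>, of y]] B_sym[OF v \<omega>, of x "B v \<omega> y"]
    by (simp add: has_real_derivative_iff_has_vector_derivative)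
  define E where "E = - (B v \<omega> \<theta> \<bullet> B v \<omega> \<theta>) + (\<xi> \<bullet> B v \<omega> \<theta>) / sqrt v - 2 * sqrt v * (B v \<omega> \<xi> \<bullet> B v \<omega> \<theta>)
      + (\<xi> \<bullet> B v \<omega> \<xi>) - v * (B v \<omega> \<xi> \<bullet> B v \<omega> \<xi>)"
  have "((\<lambda>u. \<theta> \<bullet> B u \<omega> \<theta> + 2 * sqrt u * (\<xi> \<bullet> B u \<omega> \<theta>) + u * (\<xi> \<bullet> B u \<omega> \<xi>)) has_field_derivative E) (at v within {lo..hi})"
    unfolding E_def using v0
    by (auto intro!: derivative_eq_intros bd simp: field_simps)
  then have qd: "((\<lambda>u. z u \<bullet> B u \<omega> (z u)) has_field_derivative E) (at v within {lo..hi})"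
    by (rule has_field_derivative_transform_within[OF _ zero_less_one v]) (simp add: e)
  have E: "E = (\<xi> \<bullet> B v \<omega> (z v)) / sqrt v - B v \<omega> (z v) \<bullet> B v \<omega> (z v)"
    using v0 by (simp add: E_def z_def linear_add[OF lin] linear_cmul[OF lin] inner_simps inner_commute field_simps)
  have s: "(\<Sum>b\<in>Basis. ((b \<bullet> B v \<omega> (z v))\<^sup>2 - b \<bullet> B v \<omega> b) / 2 - (\<xi> \<bullet> b) / (2 * sqrt v) * (b \<bullet> B v \<omega> (z v)))
     = - (\<Sum>b\<in>Basis. b \<bullet> B v \<omega> b) / 2 - E / 2"
  proof -
    have "\<xi> \<bullet> B v \<omega> (z v) = (\<Sum>b\<in>Basis. (\<xi> \<bullet> b) * (b \<bullet> B v \<omega> (z v)))"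
      by (subst euclidean_inner) (simp add: inner_commute)
    moreover have "B v \<omega> (z v) \<bullet> B v \<omega> (z v) = (\<Sum>b\<in>Basis. (b \<bullet> B v \<omega> (z v))\<^sup>2)"
      by (subst euclidean_inner) (simp add: inner_commute power2_eq_square)
    ultimately show ?thesis
      unfolding E by (simp add: sum_subtractf sum_divide_distrib[symmetric] diff_divide_distrib mult.commute[of "sqrt v"] flip: divide_divide_eq_left)
  qed
  have "((\<lambda>v. w v \<omega> * exp (- (z v \<bullet> B v \<omega> (z v)) / 2)) has_field_derivative
     (- (\<Sum>b\<in>Basis. b \<bullet> B v \<omega> b) / 2 * w v \<omega>) * exp (- (z v \<bullet> B v \<omega> (z v)) / 2)
     + (exp (- (z v \<bullet> B v \<omega> (z v)) / 2) * (- E / 2)) * w v \<omega>) (at v within {lo..hi})"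
    by (intro DERIV_mult w_der[OF v \<omega>] DERIV_chain2[OF DERIV_exp] DERIV_cdivide DERIV_minus qd)
  moreover have "- T / 2 * u * x + x * (- E / 2) * u = (- T / 2 - E / 2) * (u * x)" for T u x :: real
    by (simp add: algebra_simps)
  ultimately show ?thesis unfolding s kern_def by simp
qed

lemma mix_path_deriv:
  fixes \<theta> \<xi> :: 'a
  assumes v: "v \<in> {lo..hi}"
  defines "z \<equiv> \<lambda>v. \<theta> + sqrt v *\<^sub>R \<xi>"
  shows "((\<lambda>v. mix v (z v)) has_field_derivative
    (\<Sum>b\<in>Basis. hess b v (z v) / 2 + (\<xi> \<bullet> b) / (2 * sqrt v) * grad b v (z v))) (at v within {lo..hi})"
proof -
  define f where "f v \<omega> = (\<Sum>b\<in>Basis. ((b \<bullet> B v \<omega> (z v))\<^sup>2 - b \<bullet> B v \<omega> b) / 2 - (\<xi> \<bullet> b) / (2 * sqrt v) * (b \<bullet> B v \<omega> (z v)))" for v \<omega>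
  define Z where "Z = norm \<theta> + sqrt hi * norm \<xi>"
  have zZ: "norm (z u) \<le> Z" if "u \<in> {lo..hi}" for u
    using norm_triangle_ineq[of \<theta> "sqrt u *\<^sub>R \<xi>"] that lo_pos mult_right_mono[of "sqrt u" "sqrt hi" "norm \<xi>"]
    by (auto simp: z_def Z_def)
  define K where "K = (\<Sum>b\<in>(Basis::'a set). (C\<^sup>2 * Z\<^sup>2 + C) / 2 + norm \<xi> / (2 * sqrt lo) * (C * Z))"
  have fK: "\<bar>f u \<omega>\<bar> \<le> K" if u: "u \<in> {lo..hi}" and \<omega>: "\<omega> \<in> space \<mu>" for u \<omega>
  proof -
    have "\<bar>((b \<bullet> B u \<omega> (z u))\<^sup>2 - b \<bullet> B u \<omega> b) / 2 - (\<xi> \<bullet> b) / (2 * sqrt u) * (b \<bullet> B u \<omega> (z u))\<bar>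
      \<le> (C\<^sup>2 * Z\<^sup>2 + C) / 2 + norm \<xi> / (2 * sqrt lo) * (C * Z)" if b: "b \<in> Basis" for b
    proof -
      have "C\<^sup>2 * (norm (z u))\<^sup>2 \<le> C\<^sup>2 * Z\<^sup>2" using zZ[OF u] by (intro mult_left_mono power_mono) auto
      then have 1: "\<bar>(b \<bullet> B u \<omega> (z u))\<^sup>2 - b \<bullet> B u \<omega> b\<bar> \<le> C\<^sup>2 * Z\<^sup>2 + C"
        using coeff_le(2)[OF u b \<omega>, of "z u"] by simp
      have 2: "\<bar>b \<bullet> B u \<omega> (z u)\<bar> \<le> C * Z"
        using order_trans[OF coeff_le(1)[OF u b \<omega>] mult_left_mono[OF zZ[OF u]]] C_pos by simp
      have "\<bar>(\<xi> \<bullet> b) / (2 * sqrt u)\<bar> \<le> norm \<xi> / (2 * sqrt lo)"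
        using u lo_pos Cauchy_Schwarz_ineq2[of \<xi> b] b by (auto simp: abs_mult intro!: frac_le)
      then have "\<bar>(\<xi> \<bullet> b) / (2 * sqrt u) * (b \<bullet> B u \<omega> (z u))\<bar> \<le> norm \<xi> / (2 * sqrt lo) * (C * Z)"
        unfolding abs_mult using 2 lo_pos by (intro mult_mono) auto
      moreover have "\<bar>x / 2 - y\<bar> \<le> X / 2 + Y" if "\<bar>x\<bar> \<le> X" "\<bar>y\<bar> \<le> Y" for x y X Y :: real
        using that by linarith
      ultimately show ?thesis using 1 by blast
    qed
    then show ?thesis unfolding f_def K_def by (intro order_trans[OF sum_abs] sum_mono) auto
  qed
  have nb: "at v within {lo..hi} \<noteq> bot"
    using v lo_hi by (simp add: trivial_limit_within)
  have "((\<lambda>v. \<integral>\<omega>. kern v (z v) \<omega> \<partial>\<mu>) has_field_derivative (\<integral>\<omega>. f v \<omega> * kern v (z v) \<omega> \<partial>\<mu>)) (at v within {lo..hi})"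
  proof (rule has_field_derivative_integral(1)[OF _ v nb, where g="\<lambda>_. K * C"])
    fix u \<omega> assume u: "u \<in> {lo..hi}" and \<omega>: "\<omega> \<in> space \<mu>"
    show "((\<lambda>v. kern v (z v) \<omega>) has_field_derivative f u \<omega> * kern u (z u) \<omega>) (at u within {lo..hi})"
      unfolding f_def z_def by (rule kern_path_deriv[OF u \<omega>])
    show "\<bar>f u \<omega> * kern u (z u) \<omega>\<bar> \<le> K * C"
      unfolding abs_mult using fK[OF u \<omega>] kern_le[OF u \<omega>] kern_pos[OF u \<omega>] C_pos
      by (intro mult_mono) (auto simp: less_imp_le)
  qed (auto intro: kern_integrable)
  moreover have "(\<integral>\<omega>. f v \<omega> * kern v (z v) \<omega> \<partial>\<mu>) = (\<Sum>b\<in>Basis. hess b v (z v) / 2 + (\<xi> \<bullet> b) / (2 * sqrt v) * grad b v (z v))"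
  proof -
    note [measurable] = B_meas[OF v]
    have i1: "integrable \<mu> (\<lambda>\<omega>. ((b \<bullet> B v \<omega> (z v))\<^sup>2 - b \<bullet> B v \<omega> b) * kern v (z v) \<omega>)" if "b \<in> Basis" for b
      by (rule integrable_mult_kern[OF v]) (use coeff_le(2)[OF v that] in auto)
    have i2: "integrable \<mu> (\<lambda>\<omega>. - (b \<bullet> B v \<omega> (z v)) * kern v (z v) \<omega>)" if "b \<in> Basis" for b
      by (rule integrable_mult_kern[OF v]) (use coeff_le(1)[OF v that] in auto)
    have "f v \<omega> * kern v (z v) \<omega> = (\<Sum>b\<in>Basis. (((b \<bullet> B v \<omega> (z v))\<^sup>2 - b \<bullet> B v \<omega> b) * kern v (z v) \<omega>) / 2
       + (\<xi> \<bullet> b) / (2 * sqrt v) * (- (b \<bullet> B v \<omega> (z v)) * kern v (z v) \<omega>))" for \<omega>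
      unfolding f_def sum_distrib_right by (intro sum.cong refl) (simp add: algebra_simps)
    then show ?thesis
      unfolding hess_def grad_def using i1 i2 by (simp add: Bochner_Integration.integral_sum)
  qed
  ultimately show ?thesis by (simp add: mix_def)
qed

lemma integrable_ln_mix:
  assumes v: "v \<in> {lo..hi}"
  shows "integrable lborel (\<lambda>\<xi>. gauss 1 \<xi> * ln (mix v (\<theta> + sqrt v *\<^sub>R \<xi>)))"
proof -
  note [measurable] = mix_meas[OF v]
  obtain K where K: "\<And>z. \<bar>ln (mix v z)\<bar> \<le> K * (1 + (norm z)\<^sup>2)" using ln_mix_bound[OF v] by blast
  have K0: "0 \<le> K" using K[of 0] by simp
  let ?k = "norm \<theta> + sqrt v"
  have v0: "0 < v" using v lo_pos by simp
  show ?thesis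
  proof (rule integrable_gauss_poly)
    fix \<xi> :: 'a
    have "norm (\<theta> + sqrt v *\<^sub>R \<xi>) \<le> norm \<theta> + sqrt v * norm \<xi>"
      using norm_triangle_ineq[of \<theta> "sqrt v *\<^sub>R \<xi>"] v0 by simp
    also have "\<dots> \<le> ?k * (1 + norm \<xi>)" using v0 by (simp add: algebra_simps)
    finally have "(norm (\<theta> + sqrt v *\<^sub>R \<xi>))\<^sup>2 \<le> ?k\<^sup>2 * (1 + norm \<xi>)\<^sup>2"
      by (simp add: power_mono flip: power_mult_distrib)
    then have "1 + (norm (\<theta> + sqrt v *\<^sub>R \<xi>))\<^sup>2 \<le> (1 + ?k\<^sup>2) * (1 + norm \<xi>)\<^sup>2"
      using one_le_power[of "1 + norm \<xi>" 2] unfolding distrib_right by (intro add_mono) auto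
    also have "\<dots> \<le> (1 + ?k\<^sup>2) * (1 + norm \<xi>) ^ 3"
      by (intro mult_left_mono power_increasing) auto
    finally show "\<bar>ln (mix v (\<theta> + sqrt v *\<^sub>R \<xi>))\<bar> \<le> (K * (1 + ?k\<^sup>2)) * (1 + norm \<xi>) ^ 3"
      using order_trans[OF K mult_left_mono[OF _ K0]] by (simp add: mult.assoc)
  qed auto
qed

theorem expectation_ln_mix_le:
  assumes H: "\<And>v z. v \<in> {lo..hi} \<Longrightarrow> 2 * mix v z * (\<Sum>b\<in>Basis. hess b v z) \<le> (\<Sum>b\<in>Basis. (grad b v z)\<^sup>2)"
  shows "(\<integral>x. gauss hi (x - \<theta>) * ln (mix hi x) \<partial>lborel) \<le> (\<integral>x. gauss lo (x - \<theta>) * ln (mix lo x) \<partial>lborel)"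
proof -
  define z where "z v \<xi> = \<theta> + sqrt v *\<^sub>R \<xi>" for v \<xi>
  define \<phi> where "\<phi> v = (\<integral>\<xi>. gauss 1 \<xi> * ln (mix v (z v \<xi>)) \<partial>lborel)" for v
  define d where "d v \<xi> = gauss 1 \<xi> * ((\<Sum>b\<in>Basis. hess b v (z v \<xi>) / 2 + (\<xi> \<bullet> b) / (2 * sqrt v) * grad b v (z v \<xi>)) / mix v (z v \<xi>))" for v \<xi>
  define k where "k = norm \<theta> + sqrt hi"
  have k0: "0 \<le> k" using lo_pos lo_hi by (simp add: k_def)
  have zk: "norm (z v \<xi>) \<le> k * (1 + norm \<xi>)" if v: "v \<in> {lo..hi}" for v \<xi>
  proof -
    have "norm (z v \<xi>) \<le> norm \<theta> + sqrt v * norm \<xi>"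
      using norm_triangle_ineq[of \<theta> "sqrt v *\<^sub>R \<xi>"] v lo_pos by (simp add: z_def)
    also have "\<dots> \<le> norm \<theta> + sqrt hi * norm \<xi>" using v by (auto intro: mult_right_mono)
    also have "\<dots> \<le> k * (1 + norm \<xi>)" using lo_pos lo_hi by (simp add: k_def algebra_simps)
    finally show ?thesis .
  qed
  define K where "K = C\<^sup>2 * k\<^sup>2 + C + C * k + C * k / (2 * sqrt lo) + sqrt hi * (2 * C\<^sup>2 * k\<^sup>2 + C)"
  have gb: "\<bar>grad b v (z v \<xi>) / mix v (z v \<xi>)\<bar> \<le> C * k * (1 + norm \<xi>)"
    and hb: "\<bar>hess b v (z v \<xi>) / mix v (z v \<xi>)\<bar> \<le> (C\<^sup>2 * k\<^sup>2 + C) * (1 + norm \<xi>)\<^sup>2"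
    if v: "v \<in> {lo..hi}" and b: "b \<in> Basis" for v \<xi> b
  proof -
    have "\<bar>grad b v (z v \<xi>) / mix v (z v \<xi>)\<bar> \<le> C * norm (z v \<xi>)"
      using grad_le[OF v b, of "z v \<xi>"] mix_pos[OF v, of "z v \<xi>"] by (simp add: field_simps)
    also have "\<dots> \<le> C * (k * (1 + norm \<xi>))" using zk[OF v] C_pos by (intro mult_left_mono) auto
    finally show "\<bar>grad b v (z v \<xi>) / mix v (z v \<xi>)\<bar> \<le> C * k * (1 + norm \<xi>)" by (simp add: mult.assoc)
    have "\<bar>hess b v (z v \<xi>) / mix v (z v \<xi>)\<bar> \<le> C\<^sup>2 * (norm (z v \<xi>))\<^sup>2 + C"
      using hess_le[OF v b, of "z v \<xi>"] mix_pos[OF v, of "z v \<xi>"] by (simp add: pos_divide_le_eq)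
    also have "\<dots> \<le> C\<^sup>2 * (k * (1 + norm \<xi>))\<^sup>2 + C * (1 + norm \<xi>)\<^sup>2"
      using zk[OF v] C_pos one_le_power[of "1 + norm \<xi>" 2] by (intro add_mono mult_left_mono power_mono) auto
    finally show "\<bar>hess b v (z v \<xi>) / mix v (z v \<xi>)\<bar> \<le> (C\<^sup>2 * k\<^sup>2 + C) * (1 + norm \<xi>)\<^sup>2"
      by (simp only: power_mult_distrib distrib_right mult.assoc)
  qed
  have nb: "at v within {lo..hi} \<noteq> bot" if "v \<in> {lo..hi}" for v
    using that lo_hi by (simp add: trivial_limit_within)
  define D where "D = real DIM('a) * ((C\<^sup>2 * k\<^sup>2 + C) / 2 + C * k / (2 * sqrt lo))"
  have db: "\<bar>d v \<xi>\<bar> \<le> gauss 1 \<xi> * (D * (1 + norm \<xi>) ^ 3)" if v: "v \<in> {lo..hi}" for v \<xi>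
  proof -
    have "\<bar>(hess b v (z v \<xi>) / 2 + (\<xi> \<bullet> b) / (2 * sqrt v) * grad b v (z v \<xi>)) / mix v (z v \<xi>)\<bar>
      \<le> ((C\<^sup>2 * k\<^sup>2 + C) / 2 + C * k / (2 * sqrt lo)) * (1 + norm \<xi>)\<^sup>2" if b: "b \<in> Basis" for b
    proof -
      have "\<bar>(\<xi> \<bullet> b) / (2 * sqrt v)\<bar> \<le> (1 + norm \<xi>) / (2 * sqrt lo)"
        using v lo_pos Cauchy_Schwarz_ineq2[of \<xi> b] b by (auto simp: abs_mult intro!: frac_le)
      then have "\<bar>(\<xi> \<bullet> b) / (2 * sqrt v) * (grad b v (z v \<xi>) / mix v (z v \<xi>))\<bar> \<le> (1 + norm \<xi>) / (2 * sqrt lo) * (C * k * (1 + norm \<xi>))"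
        unfolding abs_mult[of "(\<xi> \<bullet> b) / (2 * sqrt v)"] using gb[OF v b, of \<xi>] lo_pos by (intro mult_mono) auto
      also have "\<dots> = C * k / (2 * sqrt lo) * (1 + norm \<xi>)\<^sup>2" by (simp add: power2_eq_square)
      finally have 1: "\<bar>(\<xi> \<bullet> b) / (2 * sqrt v) * (grad b v (z v \<xi>) / mix v (z v \<xi>))\<bar> \<le> C * k / (2 * sqrt lo) * (1 + norm \<xi>)\<^sup>2" .
      have e: "(hess b v (z v \<xi>) / 2 + (\<xi> \<bullet> b) / (2 * sqrt v) * grad b v (z v \<xi>)) / mix v (z v \<xi>)
        = hess b v (z v \<xi>) / mix v (z v \<xi>) / 2 + (\<xi> \<bullet> b) / (2 * sqrt v) * (grad b v (z v \<xi>) / mix v (z v \<xi>))"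
        by (simp add: add_divide_distrib)
      have "\<bar>x / 2 + y\<bar> \<le> X / 2 + Y" if "\<bar>x\<bar> \<le> X" "\<bar>y\<bar> \<le> Y" for x y X Y :: real
        using that by linarith
      from this[OF hb[OF v b, of \<xi>] 1] show ?thesis unfolding e by (simp only: distrib_right times_divide_eq_left)
    qed
    then have "\<bar>\<Sum>b\<in>Basis. (hess b v (z v \<xi>) / 2 + (\<xi> \<bullet> b) / (2 * sqrt v) * grad b v (z v \<xi>)) / mix v (z v \<xi>)\<bar>
      \<le> (\<Sum>b\<in>(Basis::'a set). ((C\<^sup>2 * k\<^sup>2 + C) / 2 + C * k / (2 * sqrt lo)) * (1 + norm \<xi>)\<^sup>2)"
      by (intro order_trans[OF sum_abs] sum_mono)
    also have "\<dots> = D * (1 + norm \<xi>)\<^sup>2" by (simp add: D_def)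
    also have "\<dots> \<le> D * (1 + norm \<xi>) ^ 3"
      using C_pos k0 lo_pos by (intro mult_left_mono power_increasing) (auto simp: D_def)
    finally show ?thesis unfolding d_def abs_mult[of "gauss 1 \<xi>"]
      by (simp add: mult_left_mono sum_divide_distrib)
  qed
  have \<phi>_der: "(\<phi> has_field_derivative (\<integral>\<xi>. d v \<xi> \<partial>lborel)) (at v within {lo..hi})" if v: "v \<in> {lo..hi}" for v
    unfolding \<phi>_def
  proof (rule has_field_derivative_integral(1)[OF _ v nb[OF v] _ _ db])
    show "integrable lborel (\<lambda>\<xi>::'a. gauss 1 \<xi> * (D * (1 + norm \<xi>) ^ 3))"
      by (rule integrable_gauss_poly[of _ _ "\<bar>D\<bar>"]) (auto simp: abs_mult)
    show "integrable lborel (\<lambda>\<xi>. gauss 1 \<xi> * ln (mix v (z v \<xi>)))" if "v \<in> {lo..hi}" for v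
      unfolding z_def by (rule integrable_ln_mix[OF that])
    fix u \<xi> assume u: "u \<in> {lo..hi}"
    show "((\<lambda>v. gauss 1 \<xi> * ln (mix v (z v \<xi>))) has_field_derivative d u \<xi>) (at u within {lo..hi})"
      using DERIV_cmult[OF DERIV_chain2[OF DERIV_ln_divide[OF mix_pos[OF u]] mix_path_deriv[OF u, of \<theta> \<xi>]], of "gauss 1 \<xi>"]
      by (simp add: d_def z_def)
  qed auto
  have neg: "(\<integral>\<xi>. d v \<xi> \<partial>lborel) \<le> 0" if v: "v \<in> {lo..hi}" for v
  proof -
    note [measurable] = mix_meas[OF v] grad_meas[OF v] hess_meas[OF v]
    have v0: "0 < v" using v lo_pos by simp
    have [measurable]: "z v \<in> borel_measurable borel" unfolding z_def by measurable
    have sv: "sqrt v \<le> sqrt hi" using v by simp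
    define f where "f b \<xi> = grad b v (z v \<xi>) / mix v (z v \<xi>)" for b \<xi>
    define f' where "f' b \<xi> = sqrt v * (hess b v (z v \<xi>) / mix v (z v \<xi>) - (f b \<xi>)\<^sup>2)" for b \<xi>
    have K: "C * k \<le> K" "C\<^sup>2 * k\<^sup>2 + C \<le> K" "sqrt hi * (2 * C\<^sup>2 * k\<^sup>2 + C) \<le> K"
      using C_pos k0 lo_pos lo_hi by (auto simp: K_def)
    have fb: "\<bar>f b \<xi>\<bar> \<le> K * (1 + norm \<xi>)\<^sup>2" if b: "b \<in> Basis" for b \<xi>
    proof -
      have "C * k * (1 + norm \<xi>) \<le> K * (1 + norm \<xi>)\<^sup>2"
        using K(1) order_trans[OF mult_nonneg_nonneg[OF less_imp_le[OF C_pos] k0] K(1)] self_le_power[of "1 + norm \<xi>" 2]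
        by (intro mult_mono) auto
      then show ?thesis using gb[OF v b, of \<xi>] by (simp add: f_def)
    qed
    have f'b: "\<bar>f' b \<xi>\<bar> \<le> K * (1 + norm \<xi>)\<^sup>2" if b: "b \<in> Basis" for b \<xi>
    proof -
      have "(f b \<xi>)\<^sup>2 \<le> (C * k * (1 + norm \<xi>))\<^sup>2"
        using gb[OF v b, of \<xi>] unfolding f_def by (intro abs_le_square_iff[THEN iffD1]) auto
      then have "\<bar>hess b v (z v \<xi>) / mix v (z v \<xi>) - (f b \<xi>)\<^sup>2\<bar> \<le> (2 * C\<^sup>2 * k\<^sup>2 + C) * (1 + norm \<xi>)\<^sup>2"
      proof -
        have "\<bar>x - y\<bar> \<le> 2 * X + Y" if "\<bar>x\<bar> \<le> X + Y" "0 \<le> y" "y \<le> X" for x y X Y :: real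
          using that by linarith
        from this[OF hb[OF v b, of \<xi>, unfolded distrib_right] zero_le_power2[of "f b \<xi>"]] \<open>(f b \<xi>)\<^sup>2 \<le> _\<close>
        show ?thesis by (simp only: power_mult_distrib distrib_right mult.assoc)
      qed
      then have "\<bar>f' b \<xi>\<bar> \<le> sqrt hi * ((2 * C\<^sup>2 * k\<^sup>2 + C) * (1 + norm \<xi>)\<^sup>2)"
        unfolding f'_def abs_mult[of "sqrt v"] using sv v0 by (intro mult_mono) auto
      also have "\<dots> = sqrt hi * (2 * C\<^sup>2 * k\<^sup>2 + C) * (1 + norm \<xi>)\<^sup>2" by (simp add: mult.assoc)
      also have "\<dots> \<le> K * (1 + norm \<xi>)\<^sup>2" using K by (intro mult_right_mono) auto
      finally show ?thesis .
    qed
    have fd: "((\<lambda>t. f b (\<xi> + t *\<^sub>R b)) has_field_derivative f' b \<xi>) (at 0)" if b: "b \<in> Basis" for b \<xi>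
    proof -
      have ze: "z v (\<xi> + t *\<^sub>R b) = z v \<xi> + (sqrt v * t) *\<^sub>R b" for t by (simp add: z_def algebra_simps)
      have "((\<lambda>t. mix v (z v \<xi> + (sqrt v * t) *\<^sub>R b)) has_field_derivative grad b v (z v \<xi>) * sqrt v) (at 0)"
        using DERIV_chain2[of "\<lambda>t. mix v (z v \<xi> + t *\<^sub>R b)" _ "\<lambda>t. sqrt v * t" 0 "sqrt v" UNIV] mix_deriv[OF v b, of "z v \<xi>"]
        by (auto intro!: derivative_eq_intros)
      moreover have "((\<lambda>t. grad b v (z v \<xi> + (sqrt v * t) *\<^sub>R b)) has_field_derivative hess b v (z v \<xi>) * sqrt v) (at 0)"
        using DERIV_chain2[of "\<lambda>t. grad b v (z v \<xi> + t *\<^sub>R b)" _ "\<lambda>t. sqrt v * t" 0 "sqrt v" UNIV] grad_deriv[OF v b, of "z v \<xi>"]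
        by (auto intro!: derivative_eq_intros)
      ultimately show ?thesis
        unfolding f_def f'_def ze using mix_pos[OF v, of "z v \<xi>"]
        by (auto intro!: derivative_eq_intros simp: field_simps power2_eq_square)
    qed
    have fm: "f b \<in> borel_measurable borel" for b unfolding f_def by measurable
    note ibp = gauss_integration_by_parts[OF _ fm fd fb f'b]
    have i1: "integrable lborel (\<lambda>\<xi>. gauss 1 \<xi> * f' b \<xi>)" if "b \<in> Basis" for b
      using ibp(2)[of b] that by simp
    have i2: "integrable lborel (\<lambda>\<xi>. gauss 1 \<xi> * ((\<xi> \<bullet> b) * f b \<xi>))" if "b \<in> Basis" for b
      using ibp(3)[of b] that by simp
    have i3: "integrable lborel (\<lambda>\<xi>. gauss 1 \<xi> * (hess b v (z v \<xi>) / mix v (z v \<xi>)))" if b: "b \<in> Basis" for b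
    proof (rule integrable_gauss_poly)
      fix \<xi> :: 'a
      have "(C\<^sup>2 * k\<^sup>2 + C) * (1 + norm \<xi>)\<^sup>2 \<le> (C\<^sup>2 * k\<^sup>2 + C) * (1 + norm \<xi>) ^ 3"
        using C_pos by (intro mult_left_mono power_increasing) auto
      then show "\<bar>hess b v (z v \<xi>) / mix v (z v \<xi>)\<bar> \<le> (C\<^sup>2 * k\<^sup>2 + C) * (1 + norm \<xi>) ^ 3"
        using hb[OF v b, of \<xi>] by linarith
    qed auto
    define p where "p b \<xi> = gauss 1 \<xi> * (hess b v (z v \<xi>) / mix v (z v \<xi>))" for b \<xi>
    define g where "g b \<xi> = gauss 1 \<xi> * ((\<xi> \<bullet> b) * f b \<xi>)" for b \<xi>
    define g' where "g' b \<xi> = gauss 1 \<xi> * f' b \<xi>" for b \<xi>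
    note i1' = i1[folded g'_def] and i2' = i2[folded g_def] and i3' = i3[folded p_def]
    have "d v \<xi> = (\<Sum>b\<in>Basis. p b \<xi> / 2 + g b \<xi> / (2 * sqrt v))" for \<xi>
      unfolding d_def f_def p_def g_def sum_divide_distrib sum_distrib_left
      by (intro sum.cong refl) (simp add: algebra_simps add_divide_distrib)
    then have "(\<integral>\<xi>. d v \<xi> \<partial>lborel) = (\<Sum>b\<in>Basis. (\<integral>\<xi>. p b \<xi> \<partial>lborel) / 2 + (\<integral>\<xi>. g b \<xi> \<partial>lborel) / (2 * sqrt v))"
      using i2' i3' by (simp add: Bochner_Integration.integral_sum)
    also have "\<dots> = (\<Sum>b\<in>Basis. (\<integral>\<xi>. p b \<xi> \<partial>lborel) / 2 + (\<integral>\<xi>. g' b \<xi> \<partial>lborel) / (2 * sqrt v))"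
      unfolding g_def g'_def using ibp(1) by (intro sum.cong refl) simp
    also have "\<dots> = (\<integral>\<xi>. (\<Sum>b\<in>Basis. p b \<xi> / 2 + g' b \<xi> / (2 * sqrt v)) \<partial>lborel)"
      using i1' i3' by (simp add: Bochner_Integration.integral_sum)
    also have "\<dots> \<le> (\<integral>\<xi>. 0 \<partial>(lborel :: 'a measure))"
    proof (rule integral_mono)
      show "integrable lborel (\<lambda>\<xi>. \<Sum>b\<in>Basis. p b \<xi> / 2 + g' b \<xi> / (2 * sqrt v))"
        using i1' i3' by auto
      fix \<xi> :: 'a
      have m: "0 < mix v (z v \<xi>)" by (rule mix_pos[OF v])
      have "(\<Sum>b\<in>Basis. p b \<xi> / 2 + g' b \<xi> / (2 * sqrt v))
        = (\<Sum>b\<in>Basis. gauss 1 \<xi> / (2 * (mix v (z v \<xi>))\<^sup>2) * (2 * mix v (z v \<xi>) * hess b v (z v \<xi>) - (grad b v (z v \<xi>))\<^sup>2))"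
        using m v0 unfolding p_def g'_def f_def f'_def by (intro sum.cong refl) (simp add: field_simps power2_eq_square)
      also have "\<dots> = gauss 1 \<xi> / (2 * (mix v (z v \<xi>))\<^sup>2)
        * (2 * mix v (z v \<xi>) * (\<Sum>b\<in>Basis. hess b v (z v \<xi>)) - (\<Sum>b\<in>Basis. (grad b v (z v \<xi>))\<^sup>2))"
        by (simp only: sum_distrib_left[symmetric] sum_subtractf)
      also have "\<dots> \<le> 0"
        using H[OF v, of "z v \<xi>"] by (intro mult_nonneg_nonpos) auto
      finally show "(\<Sum>b\<in>Basis. p b \<xi> / 2 + g' b \<xi> / (2 * sqrt v)) \<le> 0" .
    qed auto
    finally show ?thesis by simp
  qed
  have "(\<phi> has_derivative (\<lambda>h. h * (\<integral>\<xi>. d v \<xi> \<partial>lborel))) (at v within {lo..hi})" if "lo \<le> v" "v \<le> hi" for v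
    using \<phi>_der[of v] that by (simp add: has_field_derivative_def mult_commute_abs)
  then obtain c where c: "c \<in> {lo<..<hi}" "\<phi> hi - \<phi> lo = (hi - lo) * (\<integral>\<xi>. d c \<xi> \<partial>lborel)"
    using mvt_simple[OF lo_hi, of \<phi> "\<lambda>v h. h * (\<integral>\<xi>. d v \<xi> \<partial>lborel)"] by blast
  then have "\<phi> hi \<le> \<phi> lo"
    using mult_nonneg_nonpos[of "hi - lo", OF _ neg[of c]] lo_hi by simp
  then show ?thesis
    using lo_pos lo_hi mix_meas[of lo] mix_meas[of hi]
    by (subst (1 2) integral_gauss_scale) (auto simp: \<phi>_def z_def)
qed

end

section \<open>Kullback-Leibler risk\<close>

lemma matrix_normal_density_eq: "matrix_normal_density v \<Theta> X = gauss v (X - \<Theta>)"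
  unfolding matrix_normal_density_def gauss_def by (simp add: mult.commute)

definition kl_term :: "real \<Rightarrow> real \<Rightarrow> ennreal" where
  "kl_term u w = (if w = 0 then \<infinity> else ennreal (u * ln (u / w) - u + w))"

lemma kl_term_nonneg:
  fixes u w :: real
  assumes "0 < u" "0 < w"
  shows "0 \<le> u * ln (u / w) - u + w"
proof -
  have "ln (w / u) \<le> w / u - 1" using assms by (simp add: ln_le_minus_one)
  then have "u * ln (w / u) \<le> u * (w / u - 1)" using assms by (intro mult_left_mono) auto
  then show ?thesis using assms by (simp add: ln_div algebra_simps)
qed

lemma borel_measurable_kl_term [measurable (raw)]:
  assumes [measurable]: "f \<in> borel_measurable M" "g \<in> borel_measurable M"
  shows "(\<lambda>x. kl_term (f x) (g x)) \<in> borel_measurable M"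
  unfolding kl_term_def by measurable

lemma predictive_densityD:
  assumes "predictive_density p"
  shows "(\<lambda>(x, y). p x y) \<in> borel_measurable (borel \<Otimes>\<^sub>M borel)" "0 \<le> p x y" "(\<integral>\<^sup>+y. ennreal (p x y) \<partial>lborel) = 1"
    "p x \<in> borel_measurable borel"
proof -
  show m: "(\<lambda>(x, y). p x y) \<in> borel_measurable (borel \<Otimes>\<^sub>M borel)"
    and "0 \<le> p x y" "(\<integral>\<^sup>+y. ennreal (p x y) \<partial>lborel) = 1"
    using assms by (auto simp: predictive_density_def)
  show "p x \<in> borel_measurable borel"
    using measurable_compose[OF measurable_Pair1'[of x borel borel] m] by simp
qed

lemma nn_integral_gauss:
  fixes \<theta> :: "'a::euclidean_space"
  assumes v: "0 < v"
  shows "(\<integral>\<^sup>+x. ennreal (gauss v (x - \<theta>)) \<partial>lborel) = 1"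
proof -
  have "(\<integral>\<^sup>+x. ennreal (gauss v (x - \<theta>)) \<partial>lborel) = (\<integral>\<^sup>+x. ennreal (gauss v (x :: 'a)) \<partial>lborel)"
    using nn_integral_lborel_translate[of "\<lambda>x. ennreal (gauss v x)" "- \<theta>"] by simp
  also have "\<dots> = ennreal (\<integral>x. gauss v (x :: 'a) \<partial>lborel)"
    by (rule nn_integral_eq_integral[OF integrable_gauss[OF v]]) simp
  finally show ?thesis by (simp add: integral_gauss[OF v])
qed

lemma kl_loss_eq:
  assumes p: "predictive_density p" and v: "0 < v"
  shows "kl_loss v \<theta> p x = enn2ereal (\<integral>\<^sup>+y. kl_term (gauss v (y - \<theta>)) (p x y) \<partial>lborel)"
proof -
  note [measurable] = predictive_densityD(4)[OF p]
  let ?u = "\<lambda>y. gauss v (y - \<theta>)"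
  let ?f = "\<lambda>y. kl_integrand (?u y) (p x y)"
  have [measurable]: "?f \<in> borel_measurable borel"
    unfolding kl_integrand_def by measurable
  have pt: "kl_term (?u y) (p x y) + ennreal (?u y) + e2ennreal (- ?f y) = e2ennreal (?f y) + ennreal (p x y)" for y
  proof (cases "p x y = 0")
    case True
    then show ?thesis by (simp add: kl_term_def kl_integrand_def e2ennreal_infty)
  next
    case False
    then have w: "0 < p x y" using predictive_densityD(2)[OF p, of x y] by simp
    have u: "0 < ?u y" using v by simp
    define a where "a = ?u y * ln (?u y / p x y)"
    have k: "0 \<le> a - ?u y + p x y" unfolding a_def by (rule kl_term_nonneg[OF u w])
    have 1: "kl_term (?u y) (p x y) = ennreal (a - ?u y + p x y)" "?f y = ereal a"
      using False by (auto simp: kl_term_def kl_integrand_def a_def)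
    have 2: "e2ennreal (ereal a) = ennreal (max 0 a)" "e2ennreal (- ereal a) = ennreal (max 0 (- a))"
      by (auto simp: e2ennreal_ereal max_def ennreal_neg)
    have "ennreal (a - ?u y + p x y) + ennreal (?u y) + ennreal (max 0 (- a)) = ennreal (max 0 a) + ennreal (p x y)"
      using k u w by (simp add: ennreal_plus[symmetric] max_def del: ennreal_plus)
    then show ?thesis unfolding 1 2 .
  qed
  let ?K = "\<integral>\<^sup>+y. kl_term (?u y) (p x y) \<partial>lborel" and ?P = "\<integral>\<^sup>+y. e2ennreal (?f y) \<partial>lborel"
    and ?N = "\<integral>\<^sup>+y. e2ennreal (- ?f y) \<partial>lborel"
  have "e2ennreal (- ?f y) \<le> ennreal (p x y)" for y
  proof (cases "p x y = 0")
    case False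
    then have w: "0 < p x y" using predictive_densityD(2)[OF p, of x y] by simp
    have u: "0 < ?u y" using v by simp
    then have "- (?u y * ln (?u y / p x y)) \<le> p x y" using kl_term_nonneg[OF u w] by simp
    then show ?thesis using False by (simp add: kl_integrand_def e2ennreal_ereal ennreal_leI)
  qed (simp add: kl_integrand_def e2ennreal_neg)
  then have "?N \<le> (\<integral>\<^sup>+y. ennreal (p x y) \<partial>lborel)" by (intro nn_integral_mono)
  also have "\<dots> = 1" by (rule predictive_densityD(3)[OF p])
  finally have N: "?N \<noteq> \<infinity>" by (auto simp: top_unique)
  have "(\<integral>\<^sup>+y. kl_term (?u y) (p x y) + ennreal (?u y) + e2ennreal (- ?f y) \<partial>lborel)
      = (\<integral>\<^sup>+y. e2ennreal (?f y) + ennreal (p x y) \<partial>lborel)"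
    using pt by simp
  then have "?K + 1 + ?N = ?P + 1"
    by (simp add: nn_integral_add nn_integral_gauss[OF v] predictive_densityD(3)[OF p])
  then have "1 + ?P = 1 + (?K + ?N)" by (simp add: ac_simps)
  then have P: "?P = ?K + ?N" by (subst (asm) ennreal_add_left_cancel) auto
  have "enn2ereal (?K + ?N) - enn2ereal ?N = enn2ereal ?K"
    using N by (simp add: plus_ennreal.rep_eq ereal_diff_add_eq_diff_diff_swap)
       (cases "enn2ereal ?K"; cases "enn2ereal ?N"; auto simp: enn2ereal_eq_top_iff)
  then show ?thesis
    unfolding kl_loss_def ext_integral_def matrix_normal_density_eq P by simp
qed

definition nn_risk :: "real \<Rightarrow> real \<Rightarrow> 'a::euclidean_space \<Rightarrow> ('a \<Rightarrow> 'a \<Rightarrow> real) \<Rightarrow> ennreal" where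
  "nn_risk v\<^sub>x v\<^sub>y \<theta> p = (\<integral>\<^sup>+x. ennreal (gauss v\<^sub>x (x - \<theta>)) * (\<integral>\<^sup>+y. kl_term (gauss v\<^sub>y (y - \<theta>)) (p x y) \<partial>lborel) \<partial>lborel)"

lemma kl_risk_eq:
  assumes p: "predictive_density p" and "0 < v\<^sub>x" "0 < v\<^sub>y"
  shows "kl_risk v\<^sub>x v\<^sub>y \<theta> p = enn2ereal (nn_risk v\<^sub>x v\<^sub>y \<theta> p)"
proof -
  have e: "ereal (gauss v\<^sub>x (x - \<theta>)) * enn2ereal k = enn2ereal (ennreal (gauss v\<^sub>x (x - \<theta>)) * k)" for x k
    by (simp add: times_ennreal.rep_eq enn2ereal_ennreal)
  have n: "e2ennreal (- enn2ereal k) = 0" for k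
    by (rule e2ennreal_neg) (simp add: enn2ereal_nonneg)
  show ?thesis
    unfolding kl_risk_def ext_integral_def matrix_normal_density_eq kl_loss_eq[OF p assms(3)] e n
    by (simp add: nn_risk_def e2ennreal_enn2ereal zero_ennreal.rep_eq)
qed

text \<open>Completing the square in \<open>\<theta>\<close>: given the two observations, the weighted mean
  \<open>w = x + v\<^sub>x / (v\<^sub>x + v\<^sub>y) (y - x)\<close> is sufficient for \<open>\<theta>\<close>, with variance \<open>v\<^sub>x v\<^sub>y / (v\<^sub>x + v\<^sub>y)\<close>.\<close>

lemma gauss_mult_gauss:
  fixes x y \<theta> :: "'a::euclidean_space"
  assumes vx: "0 < v\<^sub>x" and vy: "0 < v\<^sub>y"
  shows "gauss v\<^sub>x (x - \<theta>) * gauss v\<^sub>y (y - \<theta>)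
    = gauss (v\<^sub>x + v\<^sub>y) (y - x) * gauss (v\<^sub>x * v\<^sub>y / (v\<^sub>x + v\<^sub>y)) (x + (v\<^sub>x / (v\<^sub>x + v\<^sub>y)) *\<^sub>R (y - x) - \<theta>)"
proof -
  define a where "a = x - \<theta>"
  define s where "s = y - x"
  have y: "y - \<theta> = a + s" "x + (v\<^sub>x / (v\<^sub>x + v\<^sub>y)) *\<^sub>R (y - x) - \<theta> = a + (v\<^sub>x / (v\<^sub>x + v\<^sub>y)) *\<^sub>R s"
    by (simp_all add: a_def s_def)
  have c: "(2 * pi * v\<^sub>x) powr e * (2 * pi * v\<^sub>y) powr e
    = (2 * pi * (v\<^sub>x + v\<^sub>y)) powr e * (2 * pi * (v\<^sub>x * v\<^sub>y / (v\<^sub>x + v\<^sub>y))) powr e" for e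
  proof -
    have "(2 * pi * t) * (2 * pi * (v\<^sub>x * v\<^sub>y / t)) = (2 * pi * v\<^sub>x) * (2 * pi * v\<^sub>y)" if "t \<noteq> 0" for t :: real
      using that by simp
    from this[of "v\<^sub>x + v\<^sub>y"] show ?thesis
      using vx vy by (simp only: powr_mult[symmetric])
  qed
  have q: "(norm a)\<^sup>2 / (2 * v\<^sub>x) + (norm (a + s))\<^sup>2 / (2 * v\<^sub>y)
    = (norm s)\<^sup>2 / (2 * (v\<^sub>x + v\<^sub>y)) + (norm (a + (v\<^sub>x / (v\<^sub>x + v\<^sub>y)) *\<^sub>R s))\<^sup>2 / (2 * (v\<^sub>x * v\<^sub>y / (v\<^sub>x + v\<^sub>y)))"
  proof -
    define A B C where "A = a \<bullet> a" and "B = a \<bullet> s" and "C = s \<bullet> s"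
    define t k where "t = v\<^sub>x + v\<^sub>y" and "k = v\<^sub>x / (v\<^sub>x + v\<^sub>y)"
    have tk: "0 < t" "0 < k" "k < 1" using vx vy by (auto simp: t_def k_def)
    have v: "v\<^sub>x = k * t" "v\<^sub>y = (1 - k) * t" using vx vy by (auto simp: t_def k_def field_simps)
    have P: "k * t * ((1 - k) * t) / t = k * (1 - k) * t" using tk by simp
    have "A / (2 * (k * t)) + (A + 2 * B + C) / (2 * ((1 - k) * t))
      = C / (2 * t) + (A + 2 * k * B + k\<^sup>2 * C) / (2 * (k * t * ((1 - k) * t) / t))"
      unfolding P using tk by (simp add: divide_simps) (simp add: algebra_simps power2_eq_square)
    then have "A / (2 * v\<^sub>x) + (A + 2 * B + C) / (2 * v\<^sub>y)
      = C / (2 * (v\<^sub>x + v\<^sub>y)) + (A + 2 * (v\<^sub>x / (v\<^sub>x + v\<^sub>y)) * B + (v\<^sub>x / (v\<^sub>x + v\<^sub>y))\<^sup>2 * C) / (2 * (v\<^sub>x * v\<^sub>y / (v\<^sub>x + v\<^sub>y)))"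
      unfolding v[symmetric] unfolding k_def t_def .
    then show ?thesis
      unfolding power2_norm_eq_inner
      by (simp add: inner_simps inner_commute A_def B_def C_def power2_eq_square algebra_simps)
  qed
  have m: "(\<alpha> * exp (- p)) * (\<beta> * exp (- p')) = (\<alpha> * \<beta>) * exp (- (p + p'))" for \<alpha> \<beta> p p' :: real
    by (simp add: mult_exp_exp)
  show ?thesis
    unfolding gauss_def y unfolding a_def[symmetric] s_def[symmetric] minus_divide_left[symmetric] m q
    by (simp only: c[of "- (real DIM('a) / 2)"])
qed

lemma shear_lborel:
  fixes c :: real
  defines "T \<equiv> \<lambda>(x :: 'a::euclidean_space, y). (y - x, x + c *\<^sub>R (y - x))"
  shows "distr (lborel \<Otimes>\<^sub>M lborel) (borel \<Otimes>\<^sub>M borel) T = lborel \<Otimes>\<^sub>M lborel"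
proof (rule measure_eqI)
  have T[measurable]: "T \<in> measurable (borel \<Otimes>\<^sub>M borel) (borel \<Otimes>\<^sub>M borel)"
    unfolding T_def by measurable
  have T'[measurable]: "T \<in> measurable (lborel \<Otimes>\<^sub>M lborel) (borel \<Otimes>\<^sub>M borel)"
    unfolding T_def by measurable
  fix A assume "A \<in> sets (distr (lborel \<Otimes>\<^sub>M lborel) (borel \<Otimes>\<^sub>M borel) T)"
  then have A: "A \<in> sets (borel \<Otimes>\<^sub>M borel)" by simp
  have A'[measurable]: "A \<in> sets (lborel \<Otimes>\<^sub>M lborel)"
    using A by (subst sets_pair_measure_cong[OF sets_lborel sets_lborel]) 
  note [measurable] = A
  let ?f = "\<lambda>x y. indicator A (y - x, x + c *\<^sub>R (y - x)) :: ennreal"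
  have "emeasure (distr (lborel \<Otimes>\<^sub>M lborel) (borel \<Otimes>\<^sub>M borel) T) A = (\<integral>\<^sup>+z. indicator A z \<partial>distr (lborel \<Otimes>\<^sub>M lborel) (borel \<Otimes>\<^sub>M borel) T)"
    by simp
  also have "\<dots> = (\<integral>\<^sup>+z. indicator A (T z) \<partial>(lborel \<Otimes>\<^sub>M lborel))"
    by (rule nn_integral_distr) measurable
  also have "\<dots> = (\<integral>\<^sup>+x. \<integral>\<^sup>+y. indicator A (T (x, y)) \<partial>lborel \<partial>lborel)"
    by (rule lborel.nn_integral_fst[symmetric]) measurable
  also have "\<dots> = (\<integral>\<^sup>+x. \<integral>\<^sup>+s. indicator A (s, x + c *\<^sub>R s) \<partial>lborel \<partial>lborel)"
  proof (rule nn_integral_cong)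
    fix x :: 'a
    have "(\<lambda>y. ?f x y) \<in> borel_measurable borel" by measurable
    from nn_integral_lborel_translate[OF this, of x]
    show "(\<integral>\<^sup>+y. indicator A (T (x, y)) \<partial>lborel) = (\<integral>\<^sup>+s. indicator A (s, x + c *\<^sub>R s) \<partial>lborel)"
      by (simp add: T_def)
  qed
  also have "\<dots> = (\<integral>\<^sup>+s. \<integral>\<^sup>+x. indicator A (s, x + c *\<^sub>R s) \<partial>lborel \<partial>lborel)"
    by (rule lborel_pair.Fubini') measurable
  also have "\<dots> = (\<integral>\<^sup>+s. \<integral>\<^sup>+w. indicator A (s, w) \<partial>lborel \<partial>lborel)"
    by (intro nn_integral_cong nn_integral_lborel_translate) measurable
  also have "\<dots> = (\<integral>\<^sup>+z. indicator A z \<partial>(lborel \<Otimes>\<^sub>M lborel))"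
    by (rule lborel.nn_integral_fst) measurable
  finally show "emeasure (distr (lborel \<Otimes>\<^sub>M lborel) (borel \<Otimes>\<^sub>M borel) T) A = emeasure (lborel \<Otimes>\<^sub>M lborel) A"
    by simp
qed (simp add: sets_pair_measure_cong[OF sets_lborel sets_lborel])

lemma gauss_pair_change:
  fixes \<theta> :: "'a::euclidean_space" and f :: "'a \<times> 'a \<Rightarrow> real"
  assumes vx: "0 < v\<^sub>x" and vy: "0 < v\<^sub>y" and f: "f \<in> borel_measurable (borel \<Otimes>\<^sub>M borel)"
  defines "v\<^sub>w \<equiv> v\<^sub>x * v\<^sub>y / (v\<^sub>x + v\<^sub>y)" and "c \<equiv> v\<^sub>x / (v\<^sub>x + v\<^sub>y)"
  assumes i: "integrable (lborel \<Otimes>\<^sub>M lborel) (\<lambda>(s, w). gauss (v\<^sub>x + v\<^sub>y) s * gauss v\<^sub>w (w - \<theta>) * f (s, w))"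
  shows "integrable (lborel \<Otimes>\<^sub>M lborel) (\<lambda>(x, y). gauss v\<^sub>x (x - \<theta>) * gauss v\<^sub>y (y - \<theta>) * f (y - x, x + c *\<^sub>R (y - x)))"
    and "(\<integral>(x, y). gauss v\<^sub>x (x - \<theta>) * gauss v\<^sub>y (y - \<theta>) * f (y - x, x + c *\<^sub>R (y - x)) \<partial>(lborel \<Otimes>\<^sub>M lborel))
       = (\<integral>(s, w). gauss (v\<^sub>x + v\<^sub>y) s * gauss v\<^sub>w (w - \<theta>) * f (s, w) \<partial>(lborel \<Otimes>\<^sub>M lborel))"
proof -
  note [measurable] = f
  define T where "T = (\<lambda>(x :: 'a, y). (y - x, x + c *\<^sub>R (y - x)))"
  define g where "g = (\<lambda>(s, w). gauss (v\<^sub>x + v\<^sub>y) s * gauss v\<^sub>w (w - \<theta>) * f (s, w))"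
  have e: "(\<lambda>(x, y). gauss v\<^sub>x (x - \<theta>) * gauss v\<^sub>y (y - \<theta>) * f (y - x, x + c *\<^sub>R (y - x))) = (\<lambda>z. g (T z))"
    using gauss_mult_gauss[OF vx vy, of _ \<theta>] by (auto simp: g_def T_def v\<^sub>w_def c_def fun_eq_iff)
  have T[measurable]: "T \<in> measurable (lborel \<Otimes>\<^sub>M lborel) (borel \<Otimes>\<^sub>M borel)"
    unfolding T_def by measurable
  have g[measurable]: "g \<in> borel_measurable (borel \<Otimes>\<^sub>M borel)"
    unfolding g_def by measurable
  have D: "distr (lborel \<Otimes>\<^sub>M lborel) (borel \<Otimes>\<^sub>M borel) T = lborel \<Otimes>\<^sub>M lborel"
    unfolding T_def by (rule shear_lborel)
  show "integrable (lborel \<Otimes>\<^sub>M lborel) (\<lambda>(x, y). gauss v\<^sub>x (x - \<theta>) * gauss v\<^sub>y (y - \<theta>) * f (y - x, x + c *\<^sub>R (y - x)))"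
    unfolding e using i unfolding g_def[symmetric] by (subst (asm) D[symmetric], subst (asm) integrable_distr_eq) auto
  show "(\<integral>(x, y). gauss v\<^sub>x (x - \<theta>) * gauss v\<^sub>y (y - \<theta>) * f (y - x, x + c *\<^sub>R (y - x)) \<partial>(lborel \<Otimes>\<^sub>M lborel))
       = (\<integral>(s, w). gauss (v\<^sub>x + v\<^sub>y) s * gauss v\<^sub>w (w - \<theta>) * f (s, w) \<partial>(lborel \<Otimes>\<^sub>M lborel))"
    unfolding e g_def[symmetric] by (subst (2) D[symmetric], subst integral_distr) auto
qed

lemma ln_gauss: "0 < v \<Longrightarrow> ln (gauss v (x :: 'a::euclidean_space)) = - (real DIM('a) / 2) * ln (2 * pi * v) - (norm x)\<^sup>2 / (2 * v)"
  by (simp add: gauss_def ln_mult ln_powr)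

lemma integrable_gauss_shift:
  fixes f :: "'a::euclidean_space \<Rightarrow> real"
  assumes v: "0 < v" and [measurable]: "f \<in> borel_measurable borel" and f: "\<And>x. \<bar>f x\<bar> \<le> K * (1 + (norm x)\<^sup>2)"
  shows "integrable lborel (\<lambda>x. gauss v (x - \<theta>) * f x)"
proof -
  have K: "0 \<le> K" using f[of 0] by simp
  have "integrable lborel (\<lambda>x. gauss v x * f (x + \<theta>))"
  proof (rule integrable_gauss_poly[OF v])
    fix x :: 'a
    have "norm (x + \<theta>) \<le> (1 + norm \<theta>) * (1 + norm x)"
      using norm_triangle_ineq[of x \<theta>] mult_nonneg_nonneg[OF norm_ge_zero norm_ge_zero, of \<theta> x]
      unfolding distrib_left distrib_right by linarith
    from power_mono[OF this norm_ge_zero, of 2]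
    have "(norm (x + \<theta>))\<^sup>2 \<le> (1 + norm \<theta>)\<^sup>2 * (1 + norm x)\<^sup>2" unfolding power_mult_distrib .
    moreover have "1 \<le> (1 + norm x)\<^sup>2" by (rule one_le_power) simp
    ultimately have "1 + (norm (x + \<theta>))\<^sup>2 \<le> (1 + (1 + norm \<theta>)\<^sup>2) * (1 + norm x)\<^sup>2"
      unfolding distrib_right by linarith
    also have "\<dots> \<le> (1 + (1 + norm \<theta>)\<^sup>2) * (1 + norm x) ^ 3"
      by (intro mult_left_mono power_increasing) auto
    finally show "\<bar>f (x + \<theta>)\<bar> \<le> (K * (1 + (1 + norm \<theta>)\<^sup>2)) * (1 + norm x) ^ 3"
      using order_trans[OF f mult_left_mono[OF _ K]] by (simp add: mult.assoc)
  qed measurable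
  then have "integrable lborel (\<lambda>x. (\<lambda>x. gauss v (x - \<theta>) * f x) (x + \<theta>))" by simp
  then show ?thesis by (subst (asm) integral_lborel_translate(2)) auto
qed

lemma integral_gauss_shift_1: "0 < v \<Longrightarrow> (\<integral>x. gauss v (x - \<theta>) \<partial>lborel) = 1"
  "0 < v \<Longrightarrow> integrable lborel (\<lambda>x. gauss v (x - \<theta>))"
  using integral_lborel_translate[of "gauss v" "- \<theta>"] integrable_gauss[of v] integral_gauss[of v] by auto

lemma integral_gauss_entropy:
  assumes v: "0 < v"
  shows "(\<integral>x. gauss v (x - \<theta>) * ln (gauss v (x - \<theta> :: 'a::euclidean_space)) \<partial>lborel)
      = - (real DIM('a) / 2) * (ln (2 * pi * v) + 1)"
    and "integrable lborel (\<lambda>x. gauss v (x - \<theta>) * ln (gauss v (x - \<theta> :: 'a)))"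
proof -
  have e: "gauss v x * ln (gauss v x) = - (real DIM('a) / 2) * ln (2 * pi * v) * gauss v x - (1 / (2 * v)) * (gauss v x * (norm x)\<^sup>2)" for x :: 'a
    using v by (simp add: ln_gauss algebra_simps)
  have m: "(\<lambda>x::'a. gauss v x * ln (gauss v x)) \<in> borel_measurable borel" by measurable
  have "(\<integral>x. gauss v x * ln (gauss v (x::'a)) \<partial>lborel) = - (real DIM('a) / 2) * ln (2 * pi * v) * 1 - (1 / (2 * v)) * (real DIM('a) * v)"
    unfolding e using gauss_integral[OF v, where 'a='a] gauss_second_moment[OF v, where 'a='a] by simp
  then show "(\<integral>x. gauss v (x - \<theta>) * ln (gauss v (x - \<theta> :: 'a)) \<partial>lborel)
      = - (real DIM('a) / 2) * (ln (2 * pi * v) + 1)"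
    using integral_lborel_translate(1)[OF m, of "- \<theta>"] v by (simp add: field_simps)
  have "integrable lborel (\<lambda>x::'a. gauss v x * ln (gauss v x))"
    unfolding e using gauss_integral[OF v, where 'a='a] gauss_second_moment[OF v, where 'a='a] by simp
  then show "integrable lborel (\<lambda>x. gauss v (x - \<theta>) * ln (gauss v (x - \<theta> :: 'a)))"
    using integral_lborel_translate(2)[OF m, of "- \<theta>"] by simp
qed

lemma pair_integral_mult:
  fixes f g :: "'a::euclidean_space \<Rightarrow> real"
  assumes "integrable lborel f" "integrable lborel g"
  shows "integrable (lborel \<Otimes>\<^sub>M lborel) (\<lambda>(x, y). f x * g y)"
    and "(\<integral>(x, y). f x * g y \<partial>(lborel \<Otimes>\<^sub>M lborel)) = (\<integral>x. f x \<partial>lborel) * (\<integral>y. g y \<partial>lborel)"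
proof -
  have [measurable]: "f \<in> borel_measurable borel" "g \<in> borel_measurable borel" using assms by auto
  show i: "integrable (lborel \<Otimes>\<^sub>M lborel) (\<lambda>(x, y). f x * g y)"
    by (rule lborel_pair.Fubini_integrable) (use assms in \<open>auto simp: abs_mult integrable_mult_left\<close>)
  show "(\<integral>(x, y). f x * g y \<partial>(lborel \<Otimes>\<^sub>M lborel)) = (\<integral>x. f x \<partial>lborel) * (\<integral>y. g y \<partial>lborel)"
    using lborel_pair.integral_fst'[OF i] by simp
qed

context
  fixes v\<^sub>x v\<^sub>y v\<^sub>w c :: real
  assumes vx: "0 < v\<^sub>x" and vy: "0 < v\<^sub>y"
    and vw_eq: "v\<^sub>w = v\<^sub>x * v\<^sub>y / (v\<^sub>x + v\<^sub>y)" and c_eq: "c = v\<^sub>x / (v\<^sub>x + v\<^sub>y)"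
begin

lemma vw_pos: "0 < v\<^sub>w" using vx vy by (simp add: vw_eq)

lemma nn_risk_formula:
  fixes \<theta> :: "'a::euclidean_space" and p :: "'a \<Rightarrow> 'a \<Rightarrow> real" and mw mx :: "'a \<Rightarrow> real"
  assumes p: "\<And>x y. p x y = gauss (v\<^sub>x + v\<^sub>y) (y - x) * mw (x + c *\<^sub>R (y - x)) / mx x"
    and p1: "\<And>x. (\<integral>\<^sup>+y. ennreal (p x y) \<partial>lborel) = 1"
    and [measurable]: "mw \<in> borel_measurable borel" "mx \<in> borel_measurable borel"
    and mw: "\<And>z. 0 < mw z" and mx: "\<And>z. 0 < mx z"
    and lmw: "\<And>z. \<bar>ln (mw z)\<bar> \<le> K * (1 + (norm z)\<^sup>2)" and lmx: "\<And>z. \<bar>ln (mx z)\<bar> \<le> K * (1 + (norm z)\<^sup>2)"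
  defines "R \<equiv> real DIM('a) / 2 * ln ((v\<^sub>x + v\<^sub>y) / v\<^sub>y)
      - (\<integral>z. gauss v\<^sub>w (z - \<theta>) * ln (mw z) \<partial>lborel) + (\<integral>z. gauss v\<^sub>x (z - \<theta>) * ln (mx z) \<partial>lborel)"
  shows "nn_risk v\<^sub>x v\<^sub>y \<theta> p = ennreal R" and "0 \<le> R"
proof -
  let ?g = "\<lambda>x. gauss v\<^sub>x (x - \<theta>)" and ?u = "\<lambda>y. gauss v\<^sub>y (y - \<theta>)" and ?w = "\<lambda>x y. x + c *\<^sub>R (y - x)"
  let ?L = "lborel \<Otimes>\<^sub>M lborel :: ('a \<times> 'a) measure"
  have pp: "0 < p x y" for x y unfolding p using vx vy mw mx by simp
  have [measurable]: "(\<lambda>(x, y). p x y) \<in> borel_measurable (borel \<Otimes>\<^sub>M borel)"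
    unfolding p by measurable
  have i1: "integrable ?L (\<lambda>(x, y). ?g x * (?u y * ln (?u y)))"
    and e1: "(\<integral>(x, y). ?g x * (?u y * ln (?u y)) \<partial>?L) = - (real DIM('a) / 2) * (ln (2 * pi * v\<^sub>y) + 1)"
    using pair_integral_mult[OF integral_gauss_shift_1(2)[OF vx] integral_gauss_entropy(2)[OF vy, of \<theta>], of \<theta>]
    by (auto simp: integral_gauss_shift_1[OF vx] integral_gauss_entropy[OF vy])
  have vs: "0 < v\<^sub>x + v\<^sub>y" using vx vy by simp
  have mG: "(\<lambda>(s, w :: 'a). ln (gauss (v\<^sub>x + v\<^sub>y) (s :: 'a))) \<in> borel_measurable (borel \<Otimes>\<^sub>M borel)" by measurable
  have j2: "integrable ?L (\<lambda>(s, w). gauss (v\<^sub>x + v\<^sub>y) s * ln (gauss (v\<^sub>x + v\<^sub>y) s) * gauss v\<^sub>w (w - \<theta>))"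
    and f2: "(\<integral>(s, w). gauss (v\<^sub>x + v\<^sub>y) s * ln (gauss (v\<^sub>x + v\<^sub>y) s) * gauss v\<^sub>w (w - \<theta>) \<partial>?L) = - (real DIM('a) / 2) * (ln (2 * pi * (v\<^sub>x + v\<^sub>y)) + 1)"
    using pair_integral_mult[OF integral_gauss_entropy(2)[OF vs, of 0] integral_gauss_shift_1(2)[OF vw_pos, of \<theta>]]
      integral_gauss_entropy(1)[OF vs, of 0] integral_gauss_shift_1(1)[OF vw_pos, of \<theta>] by auto
  have i2: "integrable ?L (\<lambda>(x, y). ?g x * ?u y * ln (gauss (v\<^sub>x + v\<^sub>y) (y - x)))"
    and e2: "(\<integral>(x, y). ?g x * ?u y * ln (gauss (v\<^sub>x + v\<^sub>y) (y - x)) \<partial>?L) = - (real DIM('a) / 2) * (ln (2 * pi * (v\<^sub>x + v\<^sub>y)) + 1)"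
    using gauss_pair_change[OF vx vy mG, of \<theta>] j2 f2 by (simp_all add: vw_eq[symmetric] mult_ac)
  have mM: "(\<lambda>(s :: 'a, w). ln (mw w)) \<in> borel_measurable (borel \<Otimes>\<^sub>M borel)" by measurable
  have iw: "integrable lborel (\<lambda>z. gauss v\<^sub>w (z - \<theta>) * ln (mw z))"
    by (rule integrable_gauss_shift[OF vw_pos _ lmw]) measurable
  have ix: "integrable lborel (\<lambda>z. gauss v\<^sub>x (z - \<theta>) * ln (mx z))"
    by (rule integrable_gauss_shift[OF vx _ lmx]) measurable
  have j3: "integrable ?L (\<lambda>(s, w). gauss (v\<^sub>x + v\<^sub>y) s * (gauss v\<^sub>w (w - \<theta>) * ln (mw w)))"
    and f3: "(\<integral>(s, w). gauss (v\<^sub>x + v\<^sub>y) s * (gauss v\<^sub>w (w - \<theta>) * ln (mw w)) \<partial>?L) = (\<integral>z. gauss v\<^sub>w (z - \<theta>) * ln (mw z) \<partial>lborel)"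
    using pair_integral_mult[OF integrable_gauss[OF vs] iw] integral_gauss[OF vs, where 'a='a] by auto
  have i3: "integrable ?L (\<lambda>(x, y). ?g x * ?u y * ln (mw (?w x y)))"
    and e3: "(\<integral>(x, y). ?g x * ?u y * ln (mw (?w x y)) \<partial>?L) = (\<integral>z. gauss v\<^sub>w (z - \<theta>) * ln (mw z) \<partial>lborel)"
    using gauss_pair_change[OF vx vy mM, of \<theta>] j3 f3 by (simp_all add: vw_eq[symmetric] c_eq[symmetric] mult.assoc)
  have i4: "integrable ?L (\<lambda>(x, y). (?g x * ln (mx x)) * ?u y)"
    and e4: "(\<integral>(x, y). (?g x * ln (mx x)) * ?u y \<partial>?L) = (\<integral>z. gauss v\<^sub>x (z - \<theta>) * ln (mx z) \<partial>lborel)"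
    using pair_integral_mult[OF ix integral_gauss_shift_1(2)[OF vy, of \<theta>]] integral_gauss_shift_1(1)[OF vy, of \<theta>] by auto
  have i5: "integrable ?L (\<lambda>(x, y). ?g x * ?u y)" and e5: "(\<integral>(x, y). ?g x * ?u y \<partial>?L) = 1"
    using pair_integral_mult[OF integral_gauss_shift_1(2)[OF vx, of \<theta>] integral_gauss_shift_1(2)[OF vy, of \<theta>]]
      integral_gauss_shift_1(1)[OF vx, of \<theta>] integral_gauss_shift_1(1)[OF vy, of \<theta>] by auto
  have pn: "(\<integral>\<^sup>+z. ennreal (case z of (x, y) \<Rightarrow> ?g x * p x y) \<partial>?L) = 1"
  proof -
    have "(\<integral>\<^sup>+z. ennreal (case z of (x, y) \<Rightarrow> ?g x * p x y) \<partial>?L) = (\<integral>\<^sup>+x. \<integral>\<^sup>+y. ennreal (?g x * p x y) \<partial>lborel \<partial>lborel)"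
      by (subst lborel.nn_integral_fst[symmetric]) auto
    also have "\<dots> = (\<integral>\<^sup>+x. ennreal (?g x) * (\<integral>\<^sup>+y. ennreal (p x y) \<partial>lborel) \<partial>lborel)"
      using pp by (intro nn_integral_cong) (simp add: ennreal_mult less_imp_le nn_integral_cmult)
    also have "\<dots> = 1" by (simp add: p1 nn_integral_gauss[OF vx])
    finally show ?thesis .
  qed
  have i6: "integrable ?L (\<lambda>(x, y). ?g x * p x y)"
    by (rule integrableI_nonneg) (use pp pn in \<open>auto simp: less_imp_le\<close>)
  have e6: "(\<integral>(x, y). ?g x * p x y \<partial>?L) = 1"
    by (subst integral_eq_nn_integral) (use pp pn in \<open>auto simp: less_imp_le\<close>)
  define F where "F = (\<lambda>(x, y). ?g x * (?u y * ln (?u y / p x y) - ?u y + p x y))"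
  have F: "F z = (case z of (x, y) \<Rightarrow> ?g x * (?u y * ln (?u y))) - (case z of (x, y) \<Rightarrow> ?g x * ?u y * ln (gauss (v\<^sub>x + v\<^sub>y) (y - x)))
     - (case z of (x, y) \<Rightarrow> ?g x * ?u y * ln (mw (?w x y))) + (case z of (x, y) \<Rightarrow> (?g x * ln (mx x)) * ?u y)
     - (case z of (x, y) \<Rightarrow> ?g x * ?u y) + (case z of (x, y) \<Rightarrow> ?g x * p x y)" for z
  proof -
    obtain x y where z: "z = (x, y)" by (cases z)
    have L: "ln (?u y / p x y) = ln (?u y) - ln (gauss (v\<^sub>x + v\<^sub>y) (y - x)) - ln (mw (?w x y)) + ln (mx x)"
      using pp[of x y] gauss_pos[OF vy, of "y - \<theta>"] gauss_pos[OF vs, of "y - x"] mw[of "?w x y"] mx[of x] by (simp add: p ln_div ln_mult)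
    show ?thesis unfolding F_def z prod.case L by (simp only: algebra_simps)
  qed
  have iF: "integrable ?L F"
    unfolding F[abs_def] by (intro Bochner_Integration.integrable_add Bochner_Integration.integrable_diff i1 i2 i3 i4 i5 i6)
  have "(\<integral>z. F z \<partial>?L) = - (real DIM('a) / 2) * (ln (2 * pi * v\<^sub>y) + 1) - (- (real DIM('a) / 2) * (ln (2 * pi * (v\<^sub>x + v\<^sub>y)) + 1))
     - (\<integral>z. gauss v\<^sub>w (z - \<theta>) * ln (mw z) \<partial>lborel) + (\<integral>z. gauss v\<^sub>x (z - \<theta>) * ln (mx z) \<partial>lborel) - 1 + 1"
    unfolding F using i1 i2 i3 i4 i5 i6
    by (simp only: Bochner_Integration.integral_add Bochner_Integration.integral_diff
        Bochner_Integration.integrable_add Bochner_Integration.integrable_diff e1 e2 e3 e4 e5 e6)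
  also have "\<dots> = R"
  proof -
    have "ln (2 * pi * t) = ln (2 * pi) + ln t" if "0 < t" for t :: real
      using that by (simp add: ln_mult)
    note l = this[OF vy] this[OF vs]
    show ?thesis unfolding l R_def using vx vy by (simp add: ln_div field_simps)
  qed
  finally have FR: "(\<integral>z. F z \<partial>?L) = R" .
  have F0: "0 \<le> F z" for z
    using kl_term_nonneg pp vy by (auto simp: F_def intro!: mult_nonneg_nonneg split: prod.split)
  show "0 \<le> R" unfolding FR[symmetric] using F0 by (intro integral_nonneg_AE AE_I2)
  have "nn_risk v\<^sub>x v\<^sub>y \<theta> p = (\<integral>\<^sup>+x. \<integral>\<^sup>+y. ennreal (F (x, y)) \<partial>lborel \<partial>lborel)"
    unfolding nn_risk_def
  proof (rule nn_integral_cong)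
    fix x
    have "(\<integral>\<^sup>+y. ennreal (F (x, y)) \<partial>lborel) = (\<integral>\<^sup>+y. ennreal (?g x) * kl_term (?u y) (p x y) \<partial>lborel)"
      using kl_term_nonneg pp[of x] vy less_imp_neq[OF pp[of x], symmetric]
      by (intro nn_integral_cong) (simp add: F_def kl_term_def ennreal_mult)
    also have "\<dots> = ennreal (?g x) * (\<integral>\<^sup>+y. kl_term (?u y) (p x y) \<partial>lborel)"
      by (rule nn_integral_cmult) measurable
    finally show "ennreal (?g x) * (\<integral>\<^sup>+y. kl_term (?u y) (p x y) \<partial>lborel) = (\<integral>\<^sup>+y. ennreal (F (x, y)) \<partial>lborel)" ..
  qed
  also have "\<dots> = (\<integral>\<^sup>+z. ennreal (F z) \<partial>?L)"
    using iF by (intro lborel.nn_integral_fst) auto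
  also have "\<dots> = ennreal R"
    unfolding FR[symmetric] using F0 by (intro nn_integral_eq_integral iF) auto
  finally show "nn_risk v\<^sub>x v\<^sub>y \<theta> p = ennreal R" .
qed

end

lemma kl_term_bayes:
  fixes \<mu> u :: "'a::euclidean_space \<Rightarrow> real"
  assumes \<mu>: "integrable lborel \<mu>" "\<And>\<theta>. 0 < \<mu> \<theta>" and [measurable]: "u \<in> borel_measurable borel"
    and u: "\<And>\<theta>. 0 < u \<theta>" "\<And>\<theta>. u \<theta> \<le> U" and w: "0 \<le> w"
    and ub: "(\<integral>\<theta>. \<mu> \<theta> * u \<theta> \<partial>lborel) = (\<integral>\<theta>. \<mu> \<theta> \<partial>lborel) * um" "0 < um"
  shows "(\<integral>\<^sup>+\<theta>. ennreal (\<mu> \<theta>) * kl_term (u \<theta>) um \<partial>lborel) \<le> (\<integral>\<^sup>+\<theta>. ennreal (\<mu> \<theta>) * kl_term (u \<theta>) w \<partial>lborel)"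
proof (cases "w = 0")
  case True
  have [measurable]: "\<mu> \<in> borel_measurable borel" using \<mu> by auto
  have "(\<integral>\<^sup>+\<theta>. ennreal (\<mu> \<theta>) * kl_term (u \<theta>) w \<partial>lborel) = (\<integral>\<^sup>+\<theta>. \<infinity> \<partial>(lborel :: 'a measure))"
    using True \<mu>(2) by (intro nn_integral_cong) (auto simp: kl_term_def ennreal_mult_eq_top_iff ennreal_eq_0_iff not_le)
  then show ?thesis by (simp add: ennreal_top_mult)
next
  case False
  then have w: "0 < w" using w by simp
  have [measurable]: "\<mu> \<in> borel_measurable borel" using \<mu> by auto
  have U: "0 < U" using u[of 0] by simp
  have i1: "integrable lborel (\<lambda>\<theta>. \<mu> \<theta> * u \<theta>)"
    by (rule Bochner_Integration.integrable_bound[OF integrable_mult_left[OF \<mu>(1), of U]])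
      (use \<mu>(2) u U in \<open>auto simp: abs_mult less_imp_le intro!: AE_I2 mult_left_mono\<close>)
  have lb: "\<bar>u \<theta> * ln (u \<theta>)\<bar> \<le> 1 + U\<^sup>2" for \<theta>
  proof -
    have "u \<theta> * ln (u \<theta>) \<le> u \<theta> * u \<theta>"
      using ln_le_minus_one[OF u(1)[of \<theta>]] u(1)[of \<theta>] by (intro mult_left_mono) auto
    also have "\<dots> \<le> U\<^sup>2" unfolding power2_eq_square using u[of \<theta>] by (intro mult_mono) auto
    finally have 1: "u \<theta> * ln (u \<theta>) \<le> U\<^sup>2" .
    have "0 \<le> u \<theta> * ln (u \<theta> / 1) - u \<theta> + 1" using u(1) by (intro kl_term_nonneg) auto
    then have "- 1 \<le> u \<theta> * ln (u \<theta>)" using u(1)[of \<theta>] by simp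
    then show ?thesis using 1 zero_le_power2[of U] by (simp only: abs_le_iff) linarith
  qed
  have i2: "integrable lborel (\<lambda>\<theta>. \<mu> \<theta> * (u \<theta> * ln (u \<theta>)))"
    by (rule Bochner_Integration.integrable_bound[OF integrable_mult_left[OF \<mu>(1), of "1 + U\<^sup>2"]])
      (use \<mu>(2) lb U in \<open>auto simp: abs_mult[of "\<mu> _"] less_imp_le intro!: AE_I2 mult_left_mono\<close>)
  have k: "(\<integral>\<^sup>+\<theta>. ennreal (\<mu> \<theta>) * kl_term (u \<theta>) w \<partial>lborel)
      = ennreal ((\<integral>\<theta>. \<mu> \<theta> * (u \<theta> * ln (u \<theta>)) \<partial>lborel) + (\<integral>\<theta>. \<mu> \<theta> \<partial>lborel) * (- um * ln w - um + w))" if w: "0 < w" for w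
  proof -
    have e: "\<mu> \<theta> * (u \<theta> * ln (u \<theta> / w) - u \<theta> + w) = \<mu> \<theta> * (u \<theta> * ln (u \<theta>)) - (ln w + 1) * (\<mu> \<theta> * u \<theta>) + w * \<mu> \<theta>" for \<theta>
      using u(1)[of \<theta>] w by (simp add: ln_div algebra_simps)
    have i: "integrable lborel (\<lambda>\<theta>. \<mu> \<theta> * (u \<theta> * ln (u \<theta> / w) - u \<theta> + w))"
      unfolding e using i1 i2 \<mu>(1) by auto
    have "(\<integral>\<^sup>+\<theta>. ennreal (\<mu> \<theta>) * kl_term (u \<theta>) w \<partial>lborel) = (\<integral>\<^sup>+\<theta>. ennreal (\<mu> \<theta> * (u \<theta> * ln (u \<theta> / w) - u \<theta> + w)) \<partial>lborel)"
      using kl_term_nonneg[OF u(1) w] \<mu>(2) w by (intro nn_integral_cong) (simp add: kl_term_def ennreal_mult less_imp_le)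
    also have "\<dots> = ennreal (\<integral>\<theta>. \<mu> \<theta> * (u \<theta> * ln (u \<theta> / w) - u \<theta> + w) \<partial>lborel)"
      using kl_term_nonneg[OF u(1) w] \<mu>(2) by (intro nn_integral_eq_integral i) (simp add: less_imp_le)
    also have "(\<integral>\<theta>. \<mu> \<theta> * (u \<theta> * ln (u \<theta> / w) - u \<theta> + w) \<partial>lborel)
      = (\<integral>\<theta>. \<mu> \<theta> * (u \<theta> * ln (u \<theta>)) \<partial>lborel) - (ln w + 1) * ((\<integral>\<theta>. \<mu> \<theta> \<partial>lborel) * um) + w * (\<integral>\<theta>. \<mu> \<theta> \<partial>lborel)"
      unfolding e using i1 i2 \<mu>(1) by (simp add: ub(1))
    finally show ?thesis by (simp add: algebra_simps)
  qed
  have "0 \<le> um * ln (um / w) - um + w" by (rule kl_term_nonneg[OF ub(2) w])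
  then have "- um * ln um - um + um \<le> - um * ln w - um + w" using ub(2) w by (simp add: ln_div algebra_simps)
  moreover have "0 \<le> (\<integral>\<theta>. \<mu> \<theta> \<partial>lborel)" using \<mu>(2) by (intro integral_nonneg_AE AE_I2) (simp add: less_imp_le)
  ultimately show ?thesis
    unfolding k[OF w] k[OF ub(2)] by (intro ennreal_leI add_left_mono mult_left_mono)
qed


lemma gauss_convolution:
  fixes z :: "'a::euclidean_space"
  assumes v: "0 < v" and \<tau>: "0 < \<tau>"
  shows "integrable lborel (\<lambda>\<theta>. gauss v (z - \<theta>) * gauss \<tau> \<theta>)"
    and "(\<integral>\<theta>. gauss v (z - \<theta>) * gauss \<tau> \<theta> \<partial>lborel) = gauss (v + \<tau>) z"
proof -
  let ?v = "v * \<tau> / (v + \<tau>)" and ?a = "z + (v / (v + \<tau>)) *\<^sub>R (0 - z)"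
  have p: "0 < ?v" using v \<tau> by simp
  have e: "gauss v (z - \<theta>) * gauss \<tau> \<theta> = gauss (v + \<tau>) z * gauss ?v (\<theta> - ?a)" for \<theta>
    using gauss_mult_gauss[OF v \<tau>, of z \<theta> 0] unfolding gauss_commute[of ?v \<theta> ?a] by simp
  show "integrable lborel (\<lambda>\<theta>. gauss v (z - \<theta>) * gauss \<tau> \<theta>)"
    unfolding e using integral_gauss_shift_1(2)[OF p, of ?a] by simp
  show "(\<integral>\<theta>. gauss v (z - \<theta>) * gauss \<tau> \<theta> \<partial>lborel) = gauss (v + \<tau>) z"
    unfolding e using integral_gauss_shift_1(1)[OF p, of ?a] by simp
qed

lemma nn_gauss_convolution:
  fixes z :: "'a::euclidean_space"
  assumes v: "0 < v" and \<tau>: "0 < \<tau>"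
  shows "(\<integral>\<^sup>+\<theta>. ennreal (gauss v (z - \<theta>)) * ennreal (gauss \<tau> \<theta>) \<partial>lborel) = ennreal (gauss (v + \<tau>) z)"
  using nn_integral_eq_integral[OF gauss_convolution(1)[OF assms, of z]] gauss_convolution(2)[OF assms, of z]
  by (simp add: ennreal_mult)

lemma gauss_convolution_ln:
  fixes v \<tau> :: real
  assumes v: "0 < v" and \<tau>: "0 < \<tau>"
  defines "A \<equiv> \<lambda>\<theta> :: 'a::euclidean_space. \<integral>z. gauss v (z - \<theta>) * ln (gauss (v + \<tau>) z) \<partial>lborel"
  shows "integrable lborel (\<lambda>\<theta>. gauss \<tau> \<theta> * A \<theta>)"
    and "(\<integral>\<theta>. gauss \<tau> \<theta> * A \<theta> \<partial>lborel) = - (real DIM('a) / 2) * (ln (2 * pi * (v + \<tau>)) + 1)"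
proof -
  have s: "0 < v + \<tau>" using v \<tau> by simp
  let ?f = "\<lambda>\<theta> z :: 'a. gauss \<tau> \<theta> * (gauss v (z - \<theta>) * ln (gauss (v + \<tau>) z))"
  let ?h = "\<lambda>z :: 'a. gauss (v + \<tau>) z * ln (gauss (v + \<tau>) z)"
  have f: "?f \<theta> z = gauss v (z - \<theta>) * gauss \<tau> \<theta> * ln (gauss (v + \<tau>) z)" for \<theta> z by simp
  have hi: "integrable lborel ?h" using integral_gauss_entropy(2)[OF s, of 0] by simp
  have i: "integrable (lborel \<Otimes>\<^sub>M lborel) (\<lambda>(z, \<theta>). ?f \<theta> z)"
  proof (rule lborel_pair.Fubini_integrable)
    have "(\<lambda>z. \<integral>\<theta>. norm (case (z, \<theta>) of (z, \<theta>) \<Rightarrow> ?f \<theta> z) \<partial>lborel) = (\<lambda>z. \<bar>?h z\<bar>)"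
    proof
      fix z :: 'a
      have "norm (case (z, \<theta>) of (z, \<theta>) \<Rightarrow> ?f \<theta> z) = gauss v (z - \<theta>) * gauss \<tau> \<theta> * \<bar>ln (gauss (v + \<tau>) z)\<bar>" for \<theta>
        by (simp add: abs_mult)
      then have "(\<integral>\<theta>. norm (case (z, \<theta>) of (z, \<theta>) \<Rightarrow> ?f \<theta> z) \<partial>lborel)
        = (\<integral>\<theta>. gauss v (z - \<theta>) * gauss \<tau> \<theta> \<partial>lborel) * \<bar>ln (gauss (v + \<tau>) z)\<bar>"
        by (simp only: integral_mult_left_zero)
      then show "(\<integral>\<theta>. norm (case (z, \<theta>) of (z, \<theta>) \<Rightarrow> ?f \<theta> z) \<partial>lborel) = \<bar>?h z\<bar>"
        by (simp only: gauss_convolution(2)[OF v \<tau>] abs_mult abs_of_nonneg[OF gauss_nonneg])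
    qed
    then show "integrable lborel (\<lambda>z. \<integral>\<theta>. norm (case (z, \<theta>) of (z, \<theta>) \<Rightarrow> ?f \<theta> z) \<partial>lborel)"
      using hi by (simp add: integrable_abs)
    show "AE z in lborel. integrable lborel (\<lambda>\<theta>. case (z, \<theta>) of (z, \<theta>) \<Rightarrow> ?f \<theta> z)"
      unfolding prod.case f using gauss_convolution(1)[OF v \<tau>] by (intro AE_I2 integrable_mult_left) auto
  qed measurable
  have i': "integrable (lborel \<Otimes>\<^sub>M lborel) (\<lambda>(\<theta>, z). ?f \<theta> z)"
    using lborel_pair.integrable_product_swap[OF i] by (simp add: case_prod_beta)
  have A: "gauss \<tau> \<theta> * A \<theta> = (\<integral>z. ?f \<theta> z \<partial>lborel)" for \<theta> by (simp add: A_def)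
  show "integrable lborel (\<lambda>\<theta>. gauss \<tau> \<theta> * A \<theta>)"
    unfolding A using lborel_pair.integrable_fst'[OF i'] by simp
  have "(\<integral>\<theta>. gauss \<tau> \<theta> * A \<theta> \<partial>lborel) = (\<integral>z. \<integral>\<theta>. ?f \<theta> z \<partial>lborel \<partial>lborel)"
    unfolding A by (rule lborel_pair.Fubini_integral[symmetric]) (use i' in simp)
  also have "\<dots> = (\<integral>z. ?h z \<partial>lborel)"
    unfolding f by (simp only: integral_mult_left_zero gauss_convolution(2)[OF v \<tau>])
  also have "\<dots> = - (real DIM('a) / 2) * (ln (2 * pi * (v + \<tau>)) + 1)"
    using integral_gauss_entropy(1)[OF s, of 0] by simp
  finally show "(\<integral>\<theta>. gauss \<tau> \<theta> * A \<theta> \<partial>lborel) = - (real DIM('a) / 2) * (ln (2 * pi * (v + \<tau>)) + 1)" .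
qed

lemma abs_ln_gauss_le:
  "0 < v \<Longrightarrow> \<bar>ln (gauss v (z :: 'a::euclidean_space))\<bar> \<le> (real DIM('a) / 2 * \<bar>ln (2 * pi * v)\<bar> + 1 / (2 * v)) * (1 + (norm z)\<^sup>2)"
proof -
  assume v: "0 < v"
  define l where "l = real DIM('a) / 2 * ln (2 * pi * v)"
  have "\<bar>ln (gauss v z)\<bar> \<le> \<bar>l\<bar> + (1 / (2 * v)) * (norm z)\<^sup>2"
    using v abs_triangle_ineq4[of "- l" "(norm z)\<^sup>2 / (2 * v)"] by (simp add: ln_gauss l_def)
  also have "\<dots> \<le> (\<bar>l\<bar> + 1 / (2 * v)) * (1 + (norm z)\<^sup>2)"
    using v by (simp add: algebra_simps)
  finally show ?thesis by (simp add: l_def abs_mult)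
qed

definition prior_marginal :: "('a::euclidean_space \<Rightarrow> ennreal) \<Rightarrow> real \<Rightarrow> 'a \<Rightarrow> ennreal" where
  "prior_marginal \<pi> v z = (\<integral>\<^sup>+\<theta>. ennreal (gauss v (z - \<theta>)) * \<pi> \<theta> \<partial>lborel)"

lemma borel_measurable_prior_marginal [measurable]:
  assumes [measurable]: "\<pi> \<in> borel_measurable borel"
  shows "prior_marginal \<pi> v \<in> borel_measurable borel"
  unfolding prior_marginal_def by measurable

context
  fixes v\<^sub>x v\<^sub>y v\<^sub>w c :: real
  assumes vx: "0 < v\<^sub>x" and vy: "0 < v\<^sub>y"
    and vw_eq: "v\<^sub>w = v\<^sub>x * v\<^sub>y / (v\<^sub>x + v\<^sub>y)" and c_eq: "c = v\<^sub>x / (v\<^sub>x + v\<^sub>y)"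
begin

private lemma vw: "0 < v\<^sub>w" by (rule vw_pos[OF vx vy vw_eq c_eq])

lemma prior_joint:
  assumes [measurable]: "\<pi> \<in> borel_measurable borel"
  shows "(\<integral>\<^sup>+\<theta>. ennreal (gauss v\<^sub>x (x - \<theta>)) * ennreal (gauss v\<^sub>y (y - \<theta>)) * \<pi> \<theta> \<partial>lborel)
    = ennreal (gauss (v\<^sub>x + v\<^sub>y) (y - x)) * prior_marginal \<pi> v\<^sub>w (x + c *\<^sub>R (y - x))"
proof -
  have "ennreal (gauss v\<^sub>x (x - \<theta>)) * ennreal (gauss v\<^sub>y (y - \<theta>)) * \<pi> \<theta>
    = ennreal (gauss (v\<^sub>x + v\<^sub>y) (y - x)) * (ennreal (gauss v\<^sub>w (x + c *\<^sub>R (y - x) - \<theta>)) * \<pi> \<theta>)" for \<theta>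
    using arg_cong[OF gauss_mult_gauss[OF vx vy, of x \<theta> y], of ennreal]
    by (simp add: ennreal_mult vw_eq c_eq mult.assoc)
  then show ?thesis unfolding prior_marginal_def by (simp add: nn_integral_cmult)
qed

lemma prior_predictive_total:
  assumes [measurable]: "\<pi> \<in> borel_measurable borel"
  shows "(\<integral>\<^sup>+y. ennreal (gauss (v\<^sub>x + v\<^sub>y) (y - x)) * prior_marginal \<pi> v\<^sub>w (x + c *\<^sub>R (y - x)) \<partial>lborel) = prior_marginal \<pi> v\<^sub>x x"
proof -
  have "(\<integral>\<^sup>+y. ennreal (gauss (v\<^sub>x + v\<^sub>y) (y - x)) * prior_marginal \<pi> v\<^sub>w (x + c *\<^sub>R (y - x)) \<partial>lborel)
    = (\<integral>\<^sup>+y. \<integral>\<^sup>+\<theta>. ennreal (gauss v\<^sub>x (x - \<theta>)) * ennreal (gauss v\<^sub>y (y - \<theta>)) * \<pi> \<theta> \<partial>lborel \<partial>lborel)"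
    by (simp add: prior_joint)
  also have "\<dots> = (\<integral>\<^sup>+\<theta>. \<integral>\<^sup>+y. ennreal (gauss v\<^sub>x (x - \<theta>)) * ennreal (gauss v\<^sub>y (y - \<theta>)) * \<pi> \<theta> \<partial>lborel \<partial>lborel)"
    by (rule lborel_pair.Fubini') measurable
  also have "\<dots> = (\<integral>\<^sup>+\<theta>. ennreal (gauss v\<^sub>x (x - \<theta>)) * \<pi> \<theta> * (\<integral>\<^sup>+y. ennreal (gauss v\<^sub>y (y - \<theta>)) \<partial>lborel) \<partial>lborel)"
    by (intro nn_integral_cong, subst nn_integral_cmult[symmetric]) (auto simp: mult_ac)
  finally show ?thesis by (simp add: nn_integral_gauss[OF vy] prior_marginal_def)
qed

lemma bayes_predictive_mixture:
  fixes \<pi> :: "real^'q^'r \<Rightarrow> ennreal" and mw mx :: "real^'q^'r \<Rightarrow> real"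
  assumes [measurable]: "\<pi> \<in> borel_measurable borel" "mw \<in> borel_measurable borel" "mx \<in> borel_measurable borel"
    and mw: "\<And>z. prior_marginal \<pi> v\<^sub>w z = ennreal (mw z)" "\<And>z. 0 < mw z"
    and mx: "\<And>z. prior_marginal \<pi> v\<^sub>x z = ennreal (mx z)" "\<And>z. 0 < mx z"
  shows "bayes_predictive v\<^sub>x v\<^sub>y \<pi> x y = gauss (v\<^sub>x + v\<^sub>y) (y - x) * mw (x + c *\<^sub>R (y - x)) / mx x"
    and "predictive_density (bayes_predictive v\<^sub>x v\<^sub>y \<pi>)"
proof -
  show e: "bayes_predictive v\<^sub>x v\<^sub>y \<pi> x y = gauss (v\<^sub>x + v\<^sub>y) (y - x) * mw (x + c *\<^sub>R (y - x)) / mx x" for x y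
  proof -
    have "(\<integral>\<^sup>+\<theta>. ennreal (gauss v\<^sub>x (x - \<theta>)) * ennreal (gauss v\<^sub>y (y - \<theta>)) * \<pi> \<theta> \<partial>lborel)
      = ennreal (gauss (v\<^sub>x + v\<^sub>y) (y - x) * mw (x + c *\<^sub>R (y - x)))"
      unfolding prior_joint[OF assms(1)] mw(1) using mw(2) by (simp add: ennreal_mult less_imp_le)
    moreover have "(\<integral>\<^sup>+\<theta>. ennreal (gauss v\<^sub>x (x - \<theta>)) * \<pi> \<theta> \<partial>lborel) = ennreal (mx x)"
      using mx(1)[of x] by (simp add: prior_marginal_def)
    ultimately show ?thesis
      using mw(2) mx(2) unfolding bayes_predictive_def matrix_normal_density_eq by (simp add: less_imp_le)
  qed
  have "(\<integral>\<^sup>+y. ennreal (gauss (v\<^sub>x + v\<^sub>y) (y - x) * mw (x + c *\<^sub>R (y - x)) / mx x) \<partial>lborel) = 1" for x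
  proof -
    have "(\<integral>\<^sup>+y. ennreal (gauss (v\<^sub>x + v\<^sub>y) (y - x) * mw (x + c *\<^sub>R (y - x)) / mx x) \<partial>lborel)
      = (\<integral>\<^sup>+y. ennreal (1 / mx x) * (ennreal (gauss (v\<^sub>x + v\<^sub>y) (y - x)) * prior_marginal \<pi> v\<^sub>w (x + c *\<^sub>R (y - x))) \<partial>lborel)"
      using mx(2)[of x] less_imp_le[OF mw(2)]
      by (intro nn_integral_cong) (simp add: mw(1) ennreal_mult[symmetric] less_imp_le)
    also have "\<dots> = ennreal (1 / mx x) * ennreal (mx x)"
      by (subst nn_integral_cmult) (auto simp: prior_predictive_total mx(1))
    also have "\<dots> = 1" using mx(2)[of x] by (simp add: ennreal_mult[symmetric] less_imp_le)
    finally show ?thesis .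
  qed
  then show "predictive_density (bayes_predictive v\<^sub>x v\<^sub>y \<pi>)"
    unfolding predictive_density_def e using mw(2) mx(2) by (auto simp: less_imp_le)
qed

lemma bayes_risk_eq:
  assumes [measurable]: "(\<lambda>(x, y). p x y) \<in> borel_measurable (borel \<Otimes>\<^sub>M borel)"
  shows "(\<integral>\<^sup>+\<theta>. ennreal (gauss \<tau> \<theta>) * nn_risk v\<^sub>x v\<^sub>y \<theta> p \<partial>lborel)
    = (\<integral>\<^sup>+x. \<integral>\<^sup>+y. \<integral>\<^sup>+\<theta>. ennreal (gauss v\<^sub>x (x - \<theta>) * gauss \<tau> \<theta>) * kl_term (gauss v\<^sub>y (y - \<theta>)) (p x y) \<partial>lborel \<partial>lborel \<partial>(lborel :: 'a::euclidean_space measure))"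
proof -
  let ?f = "\<lambda>\<theta> x y. ennreal (gauss v\<^sub>x (x - \<theta>) * gauss \<tau> \<theta>) * kl_term (gauss v\<^sub>y (y - \<theta>)) (p x y)"
  have "ennreal (gauss \<tau> \<theta>) * nn_risk v\<^sub>x v\<^sub>y \<theta> p = (\<integral>\<^sup>+x. \<integral>\<^sup>+y. ?f \<theta> x y \<partial>lborel \<partial>lborel)" for \<theta>
  proof -
    have "ennreal (gauss \<tau> \<theta>) * (ennreal (gauss v\<^sub>x (x - \<theta>)) * (\<integral>\<^sup>+y. kl_term (gauss v\<^sub>y (y - \<theta>)) (p x y) \<partial>lborel))
        = (\<integral>\<^sup>+y. ?f \<theta> x y \<partial>lborel)" for x
      by (subst nn_integral_cmult) (auto simp: ennreal_mult mult_ac)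
    then show ?thesis unfolding nn_risk_def by (subst nn_integral_cmult[symmetric]) auto
  qed
  then have "(\<integral>\<^sup>+\<theta>. ennreal (gauss \<tau> \<theta>) * nn_risk v\<^sub>x v\<^sub>y \<theta> p \<partial>lborel) = (\<integral>\<^sup>+\<theta>. \<integral>\<^sup>+x. \<integral>\<^sup>+y. ?f \<theta> x y \<partial>lborel \<partial>lborel \<partial>lborel)"
    by simp
  also have "\<dots> = (\<integral>\<^sup>+x. \<integral>\<^sup>+\<theta>. \<integral>\<^sup>+y. ?f \<theta> x y \<partial>lborel \<partial>lborel \<partial>lborel)"
    by (rule lborel_pair.Fubini') measurable
  also have "\<dots> = (\<integral>\<^sup>+x. \<integral>\<^sup>+y. \<integral>\<^sup>+\<theta>. ?f \<theta> x y \<partial>lborel \<partial>lborel \<partial>lborel)"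
    by (intro nn_integral_cong lborel_pair.Fubini') measurable
  finally show ?thesis .
qed

lemma sup_risk_ge_bayes_risk:
  fixes p :: "real^'q^'r \<Rightarrow> real^'q^'r \<Rightarrow> real"
  assumes p: "predictive_density p" and \<tau>: "0 < \<tau>"
  shows "ennreal (real DIM(real^'q^'r) / 2 * (ln ((v\<^sub>x + v\<^sub>y) / v\<^sub>y) + ln ((v\<^sub>w + \<tau>) / (v\<^sub>x + \<tau>)))) \<le> (SUP \<theta>. nn_risk v\<^sub>x v\<^sub>y \<theta> p)"
proof -
  let ?d = "real DIM(real^'q^'r)"
  have [measurable]: "(\<lambda>(x, y). p x y) \<in> borel_measurable (borel \<Otimes>\<^sub>M borel)" by (rule predictive_densityD(1)[OF p])
  define mw mx :: "real^'q^'r \<Rightarrow> real" where "mw = gauss (v\<^sub>w + \<tau>)" and "mx = gauss (v\<^sub>x + \<tau>)"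
  have [measurable]: "mw \<in> borel_measurable borel" "mx \<in> borel_measurable borel" by (auto simp: mw_def mx_def)
  have s: "0 < v\<^sub>w + \<tau>" "0 < v\<^sub>x + \<tau>" using vw vx \<tau> by auto
  have mpos: "0 < mw z" "0 < mx z" for z using s by (auto simp: mw_def mx_def)
  define b where "b x y = gauss (v\<^sub>x + v\<^sub>y) (y - x) * mw (x + c *\<^sub>R (y - x)) / mx x" for x y
  have m1: "prior_marginal (\<lambda>\<theta>. ennreal (gauss \<tau> \<theta>)) v\<^sub>w z = ennreal (mw z)" for z
    unfolding prior_marginal_def mw_def by (rule nn_gauss_convolution[OF vw \<tau>])
  have m2: "prior_marginal (\<lambda>\<theta>. ennreal (gauss \<tau> \<theta>)) v\<^sub>x z = ennreal (mx z)" for z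
    unfolding prior_marginal_def mx_def by (rule nn_gauss_convolution[OF vx \<tau>])
  have gm: "(\<lambda>\<theta> :: real^'q^'r. ennreal (gauss \<tau> \<theta>)) \<in> borel_measurable borel" by measurable
  note bp = bayes_predictive_mixture[OF gm _ _ m1 mpos(1) m2 mpos(2)]
  have b: "b = bayes_predictive v\<^sub>x v\<^sub>y (\<lambda>\<theta>. ennreal (gauss \<tau> \<theta>))"
    by (intro ext) (simp add: b_def bp(1))
  have bpred: "predictive_density b" unfolding b by (rule bp(2)) auto
  define K where "K = max (?d / 2 * \<bar>ln (2 * pi * (v\<^sub>w + \<tau>))\<bar> + 1 / (2 * (v\<^sub>w + \<tau>))) (?d / 2 * \<bar>ln (2 * pi * (v\<^sub>x + \<tau>))\<bar> + 1 / (2 * (v\<^sub>x + \<tau>)))"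
  have K: "\<bar>ln (mw z)\<bar> \<le> K * (1 + (norm z)\<^sup>2)" "\<bar>ln (mx z)\<bar> \<le> K * (1 + (norm z)\<^sup>2)" for z
    unfolding mw_def mx_def
    by (rule order_trans[OF abs_ln_gauss_le[OF s(1)]] order_trans[OF abs_ln_gauss_le[OF s(2)]], intro mult_right_mono, simp_all add: K_def)+
  define Aw Ax where "Aw \<theta> = (\<integral>z. gauss v\<^sub>w (z - \<theta>) * ln (mw z) \<partial>lborel)" and "Ax \<theta> = (\<integral>z. gauss v\<^sub>x (z - \<theta>) * ln (mx z) \<partial>lborel)" for \<theta>
  define R where "R \<theta> = ?d / 2 * ln ((v\<^sub>x + v\<^sub>y) / v\<^sub>y) - Aw \<theta> + Ax \<theta>" for \<theta>
  have R: "nn_risk v\<^sub>x v\<^sub>y \<theta> b = ennreal (R \<theta>)" "0 \<le> R \<theta>" for \<theta>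
    unfolding R_def Aw_def Ax_def
    using nn_risk_formula[OF vx vy vw_eq c_eq b_def predictive_densityD(3)[OF bpred] _ _ mpos K, of \<theta>] by auto
  have iA: "integrable lborel (\<lambda>\<theta>. gauss \<tau> \<theta> * Aw \<theta>)" "integrable lborel (\<lambda>\<theta>. gauss \<tau> \<theta> * Ax \<theta>)"
    unfolding Aw_def Ax_def mw_def mx_def by (rule gauss_convolution_ln(1)[OF vw \<tau>] gauss_convolution_ln(1)[OF vx \<tau>])+
  have eA: "(\<integral>\<theta>. gauss \<tau> \<theta> * Aw \<theta> \<partial>lborel) = - (?d / 2) * (ln (2 * pi * (v\<^sub>w + \<tau>)) + 1)"
    "(\<integral>\<theta>. gauss \<tau> \<theta> * Ax \<theta> \<partial>lborel) = - (?d / 2) * (ln (2 * pi * (v\<^sub>x + \<tau>)) + 1)"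
    unfolding Aw_def Ax_def mw_def mx_def by (rule gauss_convolution_ln(2)[OF vw \<tau>] gauss_convolution_ln(2)[OF vx \<tau>])+
  have e: "gauss \<tau> \<theta> * R \<theta> = (?d / 2 * ln ((v\<^sub>x + v\<^sub>y) / v\<^sub>y)) * gauss \<tau> \<theta> - gauss \<tau> \<theta> * Aw \<theta> + gauss \<tau> \<theta> * Ax \<theta>" for \<theta>
    by (simp add: R_def algebra_simps)
  have iR: "integrable lborel (\<lambda>\<theta>. gauss \<tau> \<theta> * R \<theta>)"
    unfolding e using iA integrable_gauss[OF \<tau>, where 'a="real^'q^'r"] by auto
  have "(\<integral>\<theta>. gauss \<tau> \<theta> * R \<theta> \<partial>lborel) = ?d / 2 * ln ((v\<^sub>x + v\<^sub>y) / v\<^sub>y)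
    - (- (?d / 2) * (ln (2 * pi * (v\<^sub>w + \<tau>)) + 1)) + (- (?d / 2) * (ln (2 * pi * (v\<^sub>x + \<tau>)) + 1))"
    unfolding e using iA integrable_gauss[OF \<tau>, where 'a="real^'q^'r"] integral_gauss[OF \<tau>, where 'a="real^'q^'r"] eA by simp
  also have "\<dots> = ?d / 2 * (ln ((v\<^sub>x + v\<^sub>y) / v\<^sub>y) + ln ((v\<^sub>w + \<tau>) / (v\<^sub>x + \<tau>)))"
  proof -
    have "ln (2 * pi * t) = ln (2 * pi) + ln t" if "0 < t" for t :: real
      using that by (simp add: ln_mult)
    note l = this[OF s(1)] this[OF s(2)]
    show ?thesis unfolding l using s by (simp add: ln_div field_simps)
  qed
  finally have BR: "(\<integral>\<theta>. gauss \<tau> \<theta> * R \<theta> \<partial>lborel) = ?d / 2 * (ln ((v\<^sub>x + v\<^sub>y) / v\<^sub>y) + ln ((v\<^sub>w + \<tau>) / (v\<^sub>x + \<tau>)))" .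
  have "ennreal (?d / 2 * (ln ((v\<^sub>x + v\<^sub>y) / v\<^sub>y) + ln ((v\<^sub>w + \<tau>) / (v\<^sub>x + \<tau>)))) = (\<integral>\<^sup>+\<theta>. ennreal (gauss \<tau> \<theta> * R \<theta>) \<partial>lborel)"
    unfolding BR[symmetric] using R(2) by (intro nn_integral_eq_integral[symmetric] iR) auto
  also have "\<dots> = (\<integral>\<^sup>+\<theta>. ennreal (gauss \<tau> \<theta>) * nn_risk v\<^sub>x v\<^sub>y \<theta> b \<partial>lborel)"
    using R by (simp add: ennreal_mult)
  also have "\<dots> \<le> (\<integral>\<^sup>+\<theta>. ennreal (gauss \<tau> \<theta>) * nn_risk v\<^sub>x v\<^sub>y \<theta> p \<partial>lborel)"
    unfolding bayes_risk_eq[OF predictive_densityD(1)[OF p]] bayes_risk_eq[OF predictive_densityD(1)[OF bpred]]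
  proof (rule nn_integral_mono, rule nn_integral_mono, rule kl_term_bayes)
    fix x y :: "real^'q^'r"
    have vs: "0 < v\<^sub>x + v\<^sub>y" using vx vy by simp
    show "integrable lborel (\<lambda>\<theta>. gauss v\<^sub>x (x - \<theta>) * gauss \<tau> \<theta>)" by (rule gauss_convolution(1)[OF vx \<tau>])
    show "(\<integral>\<theta>. gauss v\<^sub>x (x - \<theta>) * gauss \<tau> \<theta> * gauss v\<^sub>y (y - \<theta>) \<partial>lborel) = (\<integral>\<theta>. gauss v\<^sub>x (x - \<theta>) * gauss \<tau> \<theta> \<partial>lborel) * b x y"
    proof -
      have "gauss v\<^sub>x (x - \<theta>) * gauss \<tau> \<theta> * gauss v\<^sub>y (y - \<theta>)
        = gauss (v\<^sub>x + v\<^sub>y) (y - x) * (gauss v\<^sub>w (x + c *\<^sub>R (y - x) - \<theta>) * gauss \<tau> \<theta>)" for \<theta>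
        using gauss_mult_gauss[OF vx vy, of x \<theta> y] by (simp add: vw_eq c_eq mult_ac)
      then have "(\<integral>\<theta>. gauss v\<^sub>x (x - \<theta>) * gauss \<tau> \<theta> * gauss v\<^sub>y (y - \<theta>) \<partial>lborel) = gauss (v\<^sub>x + v\<^sub>y) (y - x) * mw (x + c *\<^sub>R (y - x))"
        by (simp only: integral_mult_right_zero gauss_convolution(2)[OF vw \<tau>] mw_def)
      then show ?thesis
        using mpos(2)[of x] gauss_convolution(2)[OF vx \<tau>, of x] by (simp add: b_def mx_def)
    qed
    show "0 < b x y" using mpos vs by (simp add: b_def)
    show "0 \<le> p x y" by (rule predictive_densityD(2)[OF p])
    show "gauss v\<^sub>y (y - \<theta>) \<le> (2 * pi * v\<^sub>y) powr (- ?d / 2)" for \<theta>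
      using gauss_le[OF vy, of "y - \<theta>"] .
  qed (use vx vy \<tau> in auto)
  also have "\<dots> \<le> (\<integral>\<^sup>+\<theta>. ennreal (gauss \<tau> \<theta>) * (SUP \<theta>. nn_risk v\<^sub>x v\<^sub>y \<theta> p) \<partial>(lborel :: (real^'q^'r) measure))"
    by (intro nn_integral_mono mult_left_mono SUP_upper) auto
  also have "\<dots> = (SUP \<theta>. nn_risk v\<^sub>x v\<^sub>y \<theta> p)"
    using nn_integral_gauss[OF \<tau>, of "0 :: real^'q^'r"] by (simp add: nn_integral_multc)
  finally show ?thesis .
qed

text \<open>The bound below is the constant risk of the Bayesian predictive density under the uniform prior.\<close>

lemma sup_risk_ge:
  fixes p :: "real^'q^'r \<Rightarrow> real^'q^'r \<Rightarrow> real"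
  assumes p: "predictive_density p"
  shows "ennreal (real DIM(real^'q^'r) / 2 * ln ((v\<^sub>x + v\<^sub>y) / v\<^sub>y)) \<le> (SUP \<theta>. nn_risk v\<^sub>x v\<^sub>y \<theta> p)"
proof (rule LIMSEQ_le_const2)
  let ?d = "real DIM(real^'q^'r)"
  have top: "filterlim (\<lambda>n. v\<^sub>x + real (Suc n)) at_infinity sequentially"
    by (intro filterlim_at_top_imp_at_infinity filterlim_tendsto_add_at_top[OF tendsto_const]
        filterlim_compose[OF filterlim_real_sequentially filterlim_Suc])
  have "(\<lambda>n. 1 - (v\<^sub>x - v\<^sub>w) / (v\<^sub>x + real (Suc n))) \<longlonglongrightarrow> 1 - 0"
    by (intro tendsto_diff tendsto_const tendsto_divide_0[OF tendsto_const top])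
  moreover have "1 - (v\<^sub>x - v\<^sub>w) / (v\<^sub>x + real (Suc n)) = (v\<^sub>w + real (Suc n)) / (v\<^sub>x + real (Suc n))" for n
    using vx by (simp add: field_simps)
  ultimately have l: "(\<lambda>n. (v\<^sub>w + real (Suc n)) / (v\<^sub>x + real (Suc n))) \<longlonglongrightarrow> 1" by simp
  have "(\<lambda>n. ?d / 2 * (ln ((v\<^sub>x + v\<^sub>y) / v\<^sub>y) + ln ((v\<^sub>w + real (Suc n)) / (v\<^sub>x + real (Suc n)))))
    \<longlonglongrightarrow> ?d / 2 * (ln ((v\<^sub>x + v\<^sub>y) / v\<^sub>y) + ln 1)"
    by (intro tendsto_intros l) auto
  then show "(\<lambda>n. ennreal (?d / 2 * (ln ((v\<^sub>x + v\<^sub>y) / v\<^sub>y) + ln ((v\<^sub>w + real (Suc n)) / (v\<^sub>x + real (Suc n))))))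
    \<longlonglongrightarrow> ennreal (?d / 2 * ln ((v\<^sub>x + v\<^sub>y) / v\<^sub>y))"
    by (intro tendsto_ennrealI) simp
qed (use sup_risk_ge_bayes_risk[OF p] in auto)

lemma kl_minimaxI:
  fixes p :: "real^'q^'r \<Rightarrow> real^'q^'r \<Rightarrow> real"
  assumes p: "predictive_density p"
    and le: "\<And>\<theta>. nn_risk v\<^sub>x v\<^sub>y \<theta> p \<le> ennreal (real DIM(real^'q^'r) / 2 * ln ((v\<^sub>x + v\<^sub>y) / v\<^sub>y))"
  shows "kl_minimax v\<^sub>x v\<^sub>y p"
proof -
  let ?R = "ennreal (real DIM(real^'q^'r) / 2 * ln ((v\<^sub>x + v\<^sub>y) / v\<^sub>y))"
  have sup: "enn2ereal ?R \<le> (SUP \<theta>. kl_risk v\<^sub>x v\<^sub>y \<theta> p')" if p': "predictive_density p'" for p' :: "real^'q^'r \<Rightarrow> real^'q^'r \<Rightarrow> real"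
  proof -
    have "(SUP \<theta>. nn_risk v\<^sub>x v\<^sub>y \<theta> p') \<le> e2ennreal (SUP \<theta>. kl_risk v\<^sub>x v\<^sub>y \<theta> p')"
    proof (rule SUP_least)
      fix \<theta>
      have "enn2ereal (nn_risk v\<^sub>x v\<^sub>y \<theta> p') \<le> (SUP \<theta>. kl_risk v\<^sub>x v\<^sub>y \<theta> p')"
        unfolding kl_risk_eq[OF p' vx vy, symmetric] by (rule SUP_upper) simp
      from e2ennreal_mono[OF this] show "nn_risk v\<^sub>x v\<^sub>y \<theta> p' \<le> e2ennreal (SUP \<theta>. kl_risk v\<^sub>x v\<^sub>y \<theta> p')"
        by (simp add: e2ennreal_enn2ereal)
    qed
    with sup_risk_ge[OF p'] have "?R \<le> e2ennreal (SUP \<theta>. kl_risk v\<^sub>x v\<^sub>y \<theta> p')" by (rule order_trans)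
    then have "enn2ereal ?R \<le> enn2ereal (e2ennreal (SUP \<theta>. kl_risk v\<^sub>x v\<^sub>y \<theta> p'))"
      by (simp add: less_eq_ennreal.rep_eq)
    moreover have "0 \<le> (SUP \<theta>. kl_risk v\<^sub>x v\<^sub>y \<theta> p')"
      by (rule SUP_upper2[of 0]) (auto simp: kl_risk_eq[OF p' vx vy])
    ultimately show ?thesis by (simp add: enn2ereal_e2ennreal)
  qed
  have "(SUP \<theta>. kl_risk v\<^sub>x v\<^sub>y \<theta> p) \<le> enn2ereal ?R"
    by (rule SUP_least) (use le in \<open>simp add: kl_risk_eq[OF p vx vy] less_eq_ennreal.rep_eq[symmetric]\<close>)
  also have "\<dots> \<le> (INF p'\<in>{p' :: real^'q^'r \<Rightarrow> real^'q^'r \<Rightarrow> real. predictive_density p'}. SUP \<theta>. kl_risk v\<^sub>x v\<^sub>y \<theta> p')"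
    by (rule INF_greatest) (use sup in auto)
  finally have "(SUP \<theta>. kl_risk v\<^sub>x v\<^sub>y \<theta> p) \<le> (INF p'\<in>{p' :: real^'q^'r \<Rightarrow> real^'q^'r \<Rightarrow> real. predictive_density p'}. SUP \<theta>. kl_risk v\<^sub>x v\<^sub>y \<theta> p')" .
  moreover have "(INF p'\<in>{p' :: real^'q^'r \<Rightarrow> real^'q^'r \<Rightarrow> real. predictive_density p'}. SUP \<theta>. kl_risk v\<^sub>x v\<^sub>y \<theta> p') \<le> (SUP \<theta>. kl_risk v\<^sub>x v\<^sub>y \<theta> p)"
    by (rule INF_lower) (use p in simp)
  ultimately show ?thesis using p unfolding kl_minimax_def by (auto intro: antisym)
qed

end

section \<open>Positive semidefinite matrices\<close>

lemma matrix_algebra_simps: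
  fixes A B :: "real^'n^'m" and C D :: "real^'p^'n"
  shows matrix_mult_add_right: "A ** (C + D) = A ** C + A ** D"
    and matrix_mult_add_left: "(A + B) ** C = A ** C + B ** C"
    and matrix_mult_diff_right: "A ** (C - D) = A ** C - A ** D"
    and matrix_mult_diff_left: "(A - B) ** C = A ** C - B ** C"
    and matrix_mult_minus_right: "A ** (- C) = - (A ** C)"
    and matrix_mult_minus_left: "(- A) ** C = - (A ** C)"
    and matrix_mult_scaleR_right: "A ** (c *\<^sub>R C) = c *\<^sub>R (A ** C)"
    and matrix_mult_scaleR_left: "(c *\<^sub>R A) ** C = c *\<^sub>R (A ** C)"
    and matrix_mult_zero_right: "A ** (0 :: real^'p^'n) = 0"
    and matrix_mult_zero_left: "(0 :: real^'n^'m) ** C = 0"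
  by (simp_all add: vec_eq_iff matrix_matrix_mult_def algebra_simps sum.distrib sum_subtractf
      sum_distrib_left sum_negf)

lemma transpose_algebra_simps:
  fixes A B :: "real^'n^'m"
  shows "transpose (A + B) = transpose A + transpose B"
    and "transpose (A - B) = transpose A - transpose B"
    and "transpose (- A) = - transpose A"
    and "transpose (c *\<^sub>R A) = c *\<^sub>R transpose A"
    and "transpose (0 :: real^'n^'m) = 0"
  by (simp_all add: vec_eq_iff transpose_def)

lemma trace_algebra_simps:
  fixes A B :: "real^'n^'n"
  shows "trace (A + B) = trace A + trace B"
    and "trace (A - B) = trace A - trace B"
    and "trace (- A) = - trace A"
    and "trace (c *\<^sub>R A) = c * trace A"
    and "trace (0 :: real^'n^'n) = 0"
    and "trace (mat 1 :: real^'n^'n) = real CARD('n)"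
  by (simp_all add: trace_def sum.distrib sum_subtractf sum_distrib_left sum_negf mat_def)

lemma inner_matrix_eq_trace:
  fixes A B :: "real^'n^'m"
  shows "A \<bullet> B = trace (transpose A ** B)"
  unfolding trace_def matrix_matrix_mult_def transpose_def inner_vec_def
  by (simp, subst sum.swap) simp

lemma inner_matrix_mult_left:
  fixes A :: "real^'n^'m" and C :: "real^'p^'n" and D :: "real^'p^'m"
  shows "D \<bullet> (A ** C) = (transpose A ** D) \<bullet> C"
  by (simp add: inner_matrix_eq_trace matrix_transpose_mul matrix_mul_assoc)

definition psd :: "real^'n^'n \<Rightarrow> bool" where
  "psd A \<longleftrightarrow> transpose A = A \<and> (\<forall>x. 0 \<le> x \<bullet> (A *v x))"

lemma psdD: "psd A \<Longrightarrow> transpose A = A" "psd A \<Longrightarrow> 0 \<le> x \<bullet> (A *v x)"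
  by (auto simp: psd_def)

lemma psd_add: "psd A \<Longrightarrow> psd B \<Longrightarrow> psd (A + B)"
  by (auto simp: psd_def transpose_algebra_simps matrix_vector_mult_add_rdistrib inner_add_right)

lemma psd_scaleR: "psd A \<Longrightarrow> 0 \<le> c \<Longrightarrow> psd (c *\<^sub>R A)"
  by (auto simp: psd_def transpose_algebra_simps scaleR_matrix_vector_assoc[symmetric])

lemma psd_mat_1: "psd (mat 1)"
  by (auto simp: psd_def)

lemma psd_0: "psd 0"
  by (auto simp: psd_def transpose_algebra_simps)

lemma pos_def_imp_psd: "pos_def_matrix A \<Longrightarrow> psd A"
  unfolding pos_def_matrix_def psd_def
  by (metis inner_zero_left less_eq_real_def)

lemma inner_axis_matrix: "axis i 1 \<bullet> ((A :: real^'n^'m) *v axis j 1) = A $ i $ j"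
  by (simp add: inner_axis' matrix_vector_mul_component inner_axis)

lemma psd_diag_nonneg: "psd A \<Longrightarrow> 0 \<le> A $ i $ i"
  using psdD(2)[of A "axis i 1"] by (simp add: inner_axis_matrix)

lemma psd_trace_nonneg: "psd A \<Longrightarrow> 0 \<le> trace A"
  unfolding trace_def by (intro sum_nonneg psd_diag_nonneg)

lemma inner_matrix_vector_transpose:
  fixes A :: "real^'n^'m"
  shows "x \<bullet> (A *v y) = (transpose A *v x) \<bullet> y"
  by (simp add: dot_lmul_matrix)

lemma psd_congruence:
  fixes D :: "real^'n^'m"
  assumes "psd A"
  shows "psd (D ** A ** transpose D)"
proof -
  have "x \<bullet> ((D ** A ** transpose D) *v x) = (transpose D *v x) \<bullet> (A *v (transpose D *v x))" for x
    unfolding matrix_vector_mul_assoc[symmetric] by (rule inner_matrix_vector_transpose)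
  then show ?thesis
    using assms by (simp add: psd_def matrix_transpose_mul matrix_mul_assoc del: transpose_matrix_vector)
qed

text \<open>One step of Gaussian elimination: subtracting the rank one matrix built from column \<open>i\<close>
  clears that row and column and keeps the matrix positive semidefinite.\<close>

lemma psd_eliminate:
  fixes A :: "real^'n^'n"
  assumes A: "psd A" and pos: "0 < A $ i $ i"
  defines "A' \<equiv> \<chi> j k. A $ j $ k - A $ j $ i * A $ k $ i / A $ i $ i"
  shows "psd A'" "A' $ i $ i = 0" "\<And>j. A $ j $ j = 0 \<Longrightarrow> A' $ j $ j = 0"
proof -
  have sym: "A $ j $ k = A $ k $ j" for j k
    using psdD(1)[OF A] by (metis transpose_def vec_lambda_beta)
  have quad: "x \<bullet> (A' *v x) = x \<bullet> (A *v x) - (\<Sum>j\<in>UNIV. x $ j * A $ j $ i)\<^sup>2 / A $ i $ i" for x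
    by (simp add: A'_def inner_vec_def matrix_vector_mult_def power2_eq_square algebra_simps
        sum_subtractf sum_product sum_distrib_left sum_divide_distrib)
  have "0 \<le> x \<bullet> (A' *v x)" for x
  proof -
    define s where "s = (\<Sum>j\<in>UNIV. x $ j * A $ j $ i)"
    define y where "y = x - (s / A $ i $ i) *\<^sub>R axis i 1"
    have a1: "x \<bullet> (A *v axis i 1) = s"
      by (simp add: s_def inner_vec_def matrix_vector_mult_basis column_def)
    have "axis i 1 \<bullet> (A *v x) = (A *v x) $ i" by (simp add: inner_axis')
    also have "\<dots> = s" by (simp add: s_def matrix_vector_mult_def sym[of i] mult.commute)
    finally have a: "x \<bullet> (A *v axis i 1) = s" "axis i 1 \<bullet> (A *v x) = s" using a1 by auto
    have "0 \<le> y \<bullet> (A *v y)" by (rule psdD(2)[OF A])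
    also have "y \<bullet> (A *v y) = x \<bullet> (A *v x) - s\<^sup>2 / A $ i $ i"
      using pos by (simp add: y_def matrix_vector_mult_diff_distrib matrix_vector_mult_scaleR inner_diff_left
          inner_diff_right a inner_axis_matrix field_simps power2_eq_square)
    finally show ?thesis by (simp add: quad s_def)
  qed
  moreover have "transpose A' = A'"
    by (simp add: A'_def transpose_def vec_eq_iff sym mult.commute)
  ultimately show p: "psd A'" by (simp add: psd_def)
  show "A' $ i $ i = 0" using pos by (simp add: A'_def)
  show "A' $ j $ j = 0" if "A $ j $ j = 0" for j
    using psd_diag_nonneg[OF p, of j] that pos by (simp add: A'_def divide_le_0_iff mult_le_0_iff) linarith
qed

lemma psd_zero_diag:
  assumes A: "psd A" and "A $ i $ i = 0"
  shows "A $ i $ j = 0"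
proof (rule ccontr)
  assume n: "A $ i $ j \<noteq> 0"
  have sym: "A $ j $ i = A $ i $ j"
    using psdD(1)[OF A] by (metis transpose_def vec_lambda_beta)
  define t where "t = - (A $ j $ j + 1) / (2 * A $ i $ j)"
  have "0 \<le> (t *\<^sub>R axis i 1 + axis j 1) \<bullet> (A *v (t *\<^sub>R axis i 1 + axis j 1))"
    by (rule psdD(2)[OF A])
  also have "\<dots> = 2 * t * A $ i $ j + A $ j $ j"
    using assms sym by (simp add: matrix_vector_right_distrib matrix_vector_mult_scaleR inner_add_left
          inner_add_right inner_axis_matrix)
  also have "\<dots> = -1" using n by (simp add: t_def field_simps)
  finally show False by simp
qed

lemma psd_factor:
  fixes A :: "real^'n^'n"
  assumes "psd A"
  obtains L :: "real^'n^'n" where "A = L ** transpose L"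
proof -
  have "\<exists>L :: real^'n^'n. A = L ** transpose L \<and> (\<forall>i. i \<notin> S \<longrightarrow> (\<forall>j. L $ j $ i = 0))"
    if "finite S" "psd A" "\<forall>i. i \<notin> S \<longrightarrow> A $ i $ i = 0" for S A
    using that
  proof (induction S arbitrary: A)
    case empty
    then have "A $ i $ j = 0" for i j using psd_zero_diag[of A i j] by blast
    then have "A = 0" by (simp add: vec_eq_iff)
    then show ?case by (intro exI[of _ 0]) (simp add: transpose_algebra_simps matrix_algebra_simps)
  next
    case (insert i S)
    show ?case
    proof (cases "A $ i $ i = 0")
      case True
      then have "\<forall>j. j \<notin> S \<longrightarrow> A $ j $ j = 0" using insert.prems(2) by (metis insert_iff)
      then obtain L :: "real^'n^'n" where "A = L ** transpose L" "\<forall>i. i \<notin> S \<longrightarrow> (\<forall>j. L $ j $ i = 0)"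
        using insert.IH[OF insert.prems(1)] by blast
      then show ?thesis by (intro exI[of _ L]) auto
    next
      case False
      then have pos: "0 < A $ i $ i" using psd_diag_nonneg[OF insert.prems(1), of i] by simp
      define A' where "A' = (\<chi> j k. A $ j $ k - A $ j $ i * A $ k $ i / A $ i $ i)"
      have A': "psd A'" "A' $ i $ i = 0" "\<And>j. A $ j $ j = 0 \<Longrightarrow> A' $ j $ j = 0"
        using psd_eliminate[OF insert.prems(1) pos] unfolding A'_def by auto
      have "\<forall>j. j \<notin> S \<longrightarrow> A' $ j $ j = 0"
        using A' insert.prems by (metis insert_iff)
      then obtain L :: "real^'n^'n" where L: "A' = L ** transpose L" "\<And>k j. k \<notin> S \<Longrightarrow> L $ j $ k = 0"
        using insert.IH[OF A'(1)] by blast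
      define L' where "L' = (\<chi> j k. if k = i then A $ j $ i / sqrt (A $ i $ i) else L $ j $ k)"
      have "(L' ** transpose L') $ j $ k = A $ j $ k" for j k
      proof -
        have "(L' ** transpose L') $ j $ k = (\<Sum>l\<in>UNIV. L' $ j $ l * L' $ k $ l)"
          by (simp add: matrix_matrix_mult_def transpose_def)
        also have "\<dots> = (\<Sum>l\<in>UNIV. (if l = i then A $ j $ i * A $ k $ i / A $ i $ i else 0) + L $ j $ l * L $ k $ l)"
          using pos L(2)[OF insert.hyps(2)] by (intro sum.cong refl) (simp add: L'_def)
        also have "\<dots> = A $ j $ i * A $ k $ i / A $ i $ i + (L ** transpose L) $ j $ k"
          by (simp add: sum.distrib matrix_matrix_mult_def transpose_def)
        also have "(L ** transpose L) $ j $ k = A $ j $ k - A $ j $ i * A $ k $ i / A $ i $ i"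
          unfolding L(1)[symmetric] by (simp add: A'_def)
        finally show ?thesis by simp
      qed
      then have "A = L' ** transpose L'" by (simp add: vec_eq_iff)
      moreover have "\<forall>k. k \<notin> insert i S \<longrightarrow> (\<forall>j. L' $ j $ k = 0)"
        using L(2) by (simp add: L'_def)
      ultimately show ?thesis by blast
    qed
  qed
  from this[OF finite[of UNIV] assms] that show ?thesis by auto
qed

lemma trace_psd_mult_nonneg:
  fixes A C :: "real^'n^'n"
  assumes "psd A" "psd C"
  shows "0 \<le> trace (A ** C)"
proof -
  obtain L :: "real^'n^'n" where L: "A = L ** transpose L" by (rule psd_factor[OF assms(1)])
  have "trace (A ** C) = trace (transpose L ** C ** transpose (transpose L))"
    unfolding L by (subst matrix_mul_assoc[symmetric], subst trace_mul_sym) simp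
  then show ?thesis using psd_trace_nonneg[OF psd_congruence[OF assms(2)]] by metis
qed

lemma trace_sandwich_nonneg:
  assumes "psd A" "psd C" "transpose D = D"
  shows "0 \<le> trace (A ** D ** C ** D)"
  using trace_psd_mult_nonneg[OF assms(1) psd_congruence[OF assms(2), of D]] assms(3)
  by (simp add: matrix_mul_assoc)

lemma pos_def_ker:
  assumes "pos_def_matrix A" "A *v x = 0"
  shows "x = 0"
  using assms by (metis inner_zero_right less_irrefl pos_def_matrix_def)

lemma pos_def_invertible: "pos_def_matrix A \<Longrightarrow> invertible A"
  unfolding invertible_left_inverse matrix_left_invertible_ker using pos_def_ker by blast

lemma pos_def_det_pos:
  assumes "pos_def_matrix (A :: real^'n^'n)"
  shows "0 < det A"
proof -
  obtain L :: "real^'n^'n" where "A = L ** transpose L" by (rule psd_factor[OF pos_def_imp_psd[OF assms]])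
  then have "det A = (det L)\<^sup>2" by (simp add: det_mul power2_eq_square)
  moreover have "det A \<noteq> 0" using pos_def_invertible[OF assms] invertible_det_nz by blast
  ultimately show ?thesis by simp
qed

lemma matrix_inv:
  fixes A :: "real^'n^'n"
  assumes "invertible A"
  shows matrix_inv_right: "A ** matrix_inv A = mat 1" and matrix_inv_left: "matrix_inv A ** A = mat 1"
  using someI_ex[OF assms[unfolded invertible_def]] unfolding matrix_inv_def by auto

lemma matrix_inv_unique:
  fixes A B :: "real^'n^'n"
  assumes "A ** B = mat 1"
  shows "matrix_inv A = B"
proof -
  have "invertible A" using assms invertible_right_inverse by blast
  then have "matrix_inv A ** (A ** B) = B" by (simp add: matrix_mul_assoc matrix_inv)
  then show ?thesis by (simp add: assms)
qed

lemma transpose_matrix_inv: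
  assumes "invertible (A :: real^'n^'n)"
  shows "transpose (matrix_inv A) = matrix_inv (transpose A)"
proof -
  have "transpose A ** transpose (matrix_inv A) = transpose (matrix_inv A ** A)"
    by (simp add: matrix_transpose_mul)
  then show ?thesis using matrix_inv_left[OF assms] by (metis matrix_inv_unique transpose_mat)
qed

lemma pos_def_matrix_inv:
  assumes A: "pos_def_matrix (A :: real^'n^'n)"
  shows "pos_def_matrix (matrix_inv A)"
proof -
  have inv: "invertible A" by (rule pos_def_invertible[OF A])
  have "0 < x \<bullet> (matrix_inv A *v x)" if "x \<noteq> 0" for x
  proof -
    define y where "y = matrix_inv A *v x"
    have x: "x = A *v y" by (simp add: y_def matrix_vector_mul_assoc matrix_inv[OF inv])
    then have "y \<noteq> 0" using that by auto
    then have "0 < y \<bullet> (A *v y)" using A by (simp add: pos_def_matrix_def)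
    then show ?thesis unfolding y_def[symmetric] using x by (simp add: inner_commute)
  qed
  then show ?thesis
    using A transpose_matrix_inv[OF inv] by (simp add: pos_def_matrix_def)
qed

lemma continuous_on_det [continuous_intros]:
  fixes f :: "'a::topological_space \<Rightarrow> real^'n^'n"
  assumes "continuous_on S f"
  shows "continuous_on S (\<lambda>x. det (f x))"
  unfolding det_def by (intro continuous_intros assms)

lemma continuous_on_trace [continuous_intros]:
  fixes f :: "'a::topological_space \<Rightarrow> real^'n^'n"
  assumes "continuous_on S f"
  shows "continuous_on S (\<lambda>x. trace (f x))"
  unfolding trace_def by (intro continuous_intros assms)

lemma continuous_on_transpose [continuous_intros]:
  fixes f :: "'a::topological_space \<Rightarrow> real^'n^'m"
  assumes "continuous_on S f"
  shows "continuous_on S (\<lambda>x. transpose (f x))"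
  unfolding transpose_def by (intro continuous_intros assms)

lemma continuous_on_matrix_mult [continuous_intros]:
  fixes f :: "'a::topological_space \<Rightarrow> real^'n^'m" and g :: "'a \<Rightarrow> real^'p^'n"
  assumes "continuous_on S f" "continuous_on S g"
  shows "continuous_on S (\<lambda>x. f x ** g x)"
  unfolding matrix_matrix_mult_def by (intro continuous_intros assms)

lemma matrix_inv_cramer:
  fixes A :: "real^'n^'n"
  assumes "det A \<noteq> 0"
  shows "matrix_inv A = (\<chi> k j. det (\<chi> i l. if l = k then axis j 1 $ i else A $ i $ l) / det A)"
proof -
  have inv: "invertible A" using assms invertible_det_nz by blast
  have "matrix_inv A $ k $ j = det (\<chi> i l. if l = k then axis j 1 $ i else A $ i $ l) / det A" for k j
  proof -
    have "A *v (matrix_inv A *v axis j 1) = axis j 1"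
      by (simp add: matrix_vector_mul_assoc matrix_inv[OF inv])
    then have "matrix_inv A *v axis j 1 = (\<chi> k. det (\<chi> i l. if l = k then axis j 1 $ i else A $ i $ l) / det A)"
      by (subst (asm) cramer[OF assms])
    then have "(matrix_inv A *v axis j 1) $ k = det (\<chi> i l. if l = k then axis j 1 $ i else A $ i $ l) / det A"
      by simp
    then show ?thesis by (simp add: matrix_vector_mult_basis column_def)
  qed
  then show ?thesis by (simp add: vec_eq_iff)
qed

lemma continuous_on_matrix_inv [continuous_intros]:
  fixes f :: "'a::topological_space \<Rightarrow> real^'n^'n"
  assumes f: "continuous_on S f" and inv: "\<And>x. x \<in> S \<Longrightarrow> invertible (f x)"
  shows "continuous_on S (\<lambda>x. matrix_inv (f x))"
proof -
  have nz: "det (f x) \<noteq> 0" if "x \<in> S" for x using inv[OF that] invertible_det_nz by blast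
  have "continuous_on S (\<lambda>x. \<chi> k j. det (\<chi> i l. if l = k then axis j 1 $ i else f x $ i $ l) / det (f x))"
  proof (intro continuous_intros f)
    fix k i l :: 'n and j
    show "continuous_on S (\<lambda>x. if l = k then axis j 1 $ i else f x $ i $ l)"
      by (cases "l = k") (auto intro!: continuous_intros f)
  qed (use nz in auto)
  then show ?thesis
    by (rule continuous_on_eq) (simp add: matrix_inv_cramer nz)
qed

lemma borel_measurable_matrix_ops [measurable]:
  shows "(det :: real^'n^'n \<Rightarrow> real) \<in> borel_measurable borel"
    and "(trace :: real^'n^'n \<Rightarrow> real) \<in> borel_measurable borel"
    and "(matrix_inv :: real^'n^'n \<Rightarrow> real^'n^'n) \<in> borel_measurable borel"
    and "(transpose :: real^'n^'m \<Rightarrow> real^'m^'n) \<in> borel_measurable borel"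
proof -
  show [measurable]: "(det :: real^'n^'n \<Rightarrow> real) \<in> borel_measurable borel"
    by (intro borel_measurable_continuous_onI continuous_intros)
  show "(trace :: real^'n^'n \<Rightarrow> real) \<in> borel_measurable borel"
    by (intro borel_measurable_continuous_onI continuous_intros)
  show "(transpose :: real^'n^'m \<Rightarrow> real^'m^'n) \<in> borel_measurable borel"
    by (intro borel_measurable_continuous_onI continuous_intros)
  \<comment> \<open>\<open>matrix_inv\<close> takes the same junk value at every singular matrix.\<close>
  let ?junk = "SOME A' :: real^'n^'n. False"
  have "matrix_inv A = (if det A \<noteq> 0 then matrix_inv A else ?junk)" for A :: "real^'n^'n"
  proof (cases "det A = 0")
    case True
    then have "(\<lambda>A'. A ** A' = mat 1 \<and> A' ** A = mat 1) = (\<lambda>_. False)"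
      using invertible_det_nz[of A] by (auto simp: invertible_def fun_eq_iff)
    then show ?thesis using True by (simp add: matrix_inv_def)
  qed simp
  moreover have "(\<lambda>A. if A \<in> {A :: real^'n^'n. det A \<noteq> 0} then matrix_inv A else ?junk) \<in> borel_measurable borel"
  proof (rule borel_measurable_continuous_on_if)
    show "{A :: real^'n^'n. det A \<noteq> 0} \<in> sets borel" by measurable
    show "continuous_on {A :: real^'n^'n. det A \<noteq> 0} matrix_inv"
      by (intro continuous_intros) (auto simp: invertible_det_nz)
  qed (auto intro: continuous_intros)
  ultimately show "(matrix_inv :: real^'n^'n \<Rightarrow> real^'n^'n) \<in> borel_measurable borel"
    unfolding mem_Collect_eq by presburger
qed

lemma borel_measurable_matrix_mult [measurable (raw)]:
  fixes f :: "'a \<Rightarrow> real^'n^'m" and g :: "'a \<Rightarrow> real^'p^'n"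
  assumes "f \<in> borel_measurable M" "g \<in> borel_measurable M"
  shows "(\<lambda>x. f x ** g x) \<in> borel_measurable M"
proof -
  have "(\<lambda>(A :: real^'n^'m, B :: real^'p^'n). A ** B) \<in> borel_measurable borel"
    unfolding case_prod_beta by (intro borel_measurable_continuous_onI continuous_intros)
  then have "(\<lambda>(A :: real^'n^'m, B :: real^'p^'n). A ** B) \<in> borel_measurable (borel \<Otimes>\<^sub>M borel)"
    by (simp add: borel_prod)
  from measurable_compose[OF measurable_Pair[OF assms] this] show ?thesis by simp
qed

lemma det_line_at_identity:
  fixes X :: "real^'n^'n"
  shows "((\<lambda>t. det (mat 1 + t *\<^sub>R X)) has_field_derivative trace X) (at 0)"
proof -
  have fin: "finite {p. p permutes (UNIV :: 'n set)}" by (rule finite_permutations) simp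
  define D where "D p = (\<Sum>i\<in>UNIV. X $ i $ p i * (\<Prod>j\<in>UNIV - {i}. (mat 1 :: real^'n^'n) $ j $ p j))" for p
  have comp: "((\<lambda>t. of_int (sign p) * (\<Prod>i\<in>UNIV. (mat 1 + t *\<^sub>R X) $ i $ p i)) has_field_derivative of_int (sign p) * D p) (at 0)" for p
  proof -
    have "((\<lambda>t. \<Prod>i\<in>UNIV. (mat 1 :: real^'n^'n) $ i $ p i + t * X $ i $ p i) has_field_derivative
        (\<Sum>i\<in>UNIV. X $ i $ p i * (\<Prod>j\<in>UNIV - {i}. (mat 1 :: real^'n^'n) $ j $ p j + 0 * X $ j $ p j))) (at 0)"
      by (rule has_field_derivative_prod) (auto intro!: derivative_eq_intros)
    then show ?thesis by (intro DERIV_cmult) (simp add: D_def)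
  qed
  have "((\<lambda>t. det (mat 1 + t *\<^sub>R X)) has_field_derivative (\<Sum>p | p permutes UNIV. of_int (sign p) * D p)) (at 0)"
    unfolding det_def by (rule DERIV_sum) (rule comp)
  also have "(\<Sum>p | p permutes UNIV. of_int (sign p) * D p) = (\<Sum>p | p permutes (UNIV :: 'n set). if p = id then trace X else 0)"
  proof (rule sum.cong[OF refl])
    fix p assume "p \<in> {p. p permutes (UNIV :: 'n set)}"
    then have p: "p permutes UNIV" by simp
    show "of_int (sign p) * D p = (if p = id then trace X else 0)"
    proof (cases "p = id")
      case True
      then show ?thesis by (simp add: D_def sign_id trace_def mat_def)
    next
      case False
      \<comment> \<open>A permutation other than the identity moves at least two points.\<close>
      have "(\<Prod>j\<in>UNIV - {i}. (mat 1 :: real^'n^'n) $ j $ p j) = 0" for i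
      proof -
        obtain k where k: "p k \<noteq> k" using False by (auto simp: fun_eq_iff)
        have "p (p k) \<noteq> p k" using k permutes_inj[OF p] by (auto dest: injD)
        then obtain j where "j \<noteq> i" "p j \<noteq> j" using k by metis
        then show ?thesis by (intro prod_zero) (auto simp: mat_def intro!: bexI[of _ j])
      qed
      then have "D p = 0" unfolding D_def by (intro sum.neutral) (metis mult_zero_right)
      then show ?thesis using False by simp
    qed
  qed
  also have "\<dots> = trace X" using fin permutes_id by (subst sum.delta) auto
  finally show ?thesis .
qed

lemma det_line_deriv:
  fixes A H :: "real^'n^'n"
  assumes inv: "invertible (A + t *\<^sub>R H)"
  shows "((\<lambda>t. det (A + t *\<^sub>R H)) has_field_derivative
    det (A + t *\<^sub>R H) * trace (matrix_inv (A + t *\<^sub>R H) ** H)) (at t)"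
proof -
  define M where "M = A + t *\<^sub>R H"
  have inv': "invertible M" using inv by (simp add: M_def)
  have e: "A + (s + t) *\<^sub>R H = M ** (mat 1 + s *\<^sub>R (matrix_inv M ** H))" for s
  proof -
    have "M ** (mat 1 + s *\<^sub>R (matrix_inv M ** H)) = M + s *\<^sub>R H"
      by (simp add: matrix_algebra_simps matrix_mul_assoc matrix_inv_right[OF inv'])
    then show ?thesis by (simp add: M_def algebra_simps)
  qed
  have "((\<lambda>s. det M * det (mat 1 + s *\<^sub>R (matrix_inv M ** H))) has_field_derivative
     det M * trace (matrix_inv M ** H)) (at 0)"
    by (intro DERIV_cmult det_line_at_identity)
  then have "((\<lambda>s. det (A + (s + t) *\<^sub>R H)) has_field_derivative det M * trace (matrix_inv M ** H)) (at 0)"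
    unfolding e det_mul .
  then have "((\<lambda>s. det (A + s *\<^sub>R H)) has_field_derivative det M * trace (matrix_inv M ** H)) (at (0 + t))"
    unfolding DERIV_shift .
  then show ?thesis by (simp add: M_def)
qed

lemma matrix_inv_line_deriv:
  fixes A H :: "real^'n^'n"
  assumes inv: "invertible (A + t *\<^sub>R H)"
  shows "((\<lambda>t. matrix_inv (A + t *\<^sub>R H)) has_vector_derivative
    - (matrix_inv (A + t *\<^sub>R H) ** H ** matrix_inv (A + t *\<^sub>R H))) (at t)"
proof -
  define S where "S = {s. det (A + s *\<^sub>R H) \<noteq> 0}"
  have S: "open S" unfolding S_def by (intro open_Collect_neq continuous_intros)
  have tS: "t \<in> S" using inv by (simp add: S_def invertible_det_nz)
  have invS: "invertible (A + s *\<^sub>R H)" if "s \<in> S" for s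
    using that by (simp add: S_def invertible_det_nz)
  let ?I = "\<lambda>s. matrix_inv (A + s *\<^sub>R H)"
  have diff: "?I s - ?I t = (s - t) *\<^sub>R (- (?I s ** H ** ?I t))" if "s \<in> S" for s
  proof -
    have "?I s ** ((A + t *\<^sub>R H) - (A + s *\<^sub>R H)) ** ?I t = ?I s - ?I t"
      unfolding matrix_mult_diff_left matrix_mult_diff_right matrix_mul_assoc[symmetric]
      by (simp add: matrix_inv[OF inv] matrix_mul_assoc matrix_inv[OF invS[OF that]])
    moreover have "(A + t *\<^sub>R H) - (A + s *\<^sub>R H) = (t - s) *\<^sub>R H" by (simp add: algebra_simps)
    ultimately have "?I s - ?I t = (t - s) *\<^sub>R (?I s ** H ** ?I t)"
      by (simp only: matrix_mult_scaleR_left matrix_mult_scaleR_right)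
    then show ?thesis by (simp add: scaleR_diff_left)
  qed
  have "continuous_on S (\<lambda>s. - (?I s ** H ** ?I t))"
    by (intro continuous_intros invS)
  then have "((\<lambda>s. - (?I s ** H ** ?I t)) \<longlongrightarrow> - (?I t ** H ** ?I t)) (at t)"
    using S tS by (simp add: continuous_on_eq_continuous_at isCont_def)
  then have lim: "((\<lambda>s. norm (- (?I s ** H ** ?I t) - - (?I t ** H ** ?I t))) \<longlongrightarrow> 0) (at t)"
    by (intro tendsto_norm_zero LIM_zero)
  have "\<forall>\<^sub>F s in at t. norm (- (?I s ** H ** ?I t) - - (?I t ** H ** ?I t))
      = norm ((?I s - ?I t) - (s - t) *\<^sub>R - (?I t ** H ** ?I t)) / norm (s - t)"
    using eventually_at_in_open[OF S tS]
  proof eventually_elim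
    case (elim s)
    then have "(?I s - ?I t) - (s - t) *\<^sub>R - (?I t ** H ** ?I t)
        = (s - t) *\<^sub>R (- (?I s ** H ** ?I t) - - (?I t ** H ** ?I t))"
      by (subst diff) (auto simp only: scaleR_diff_right)
    then show ?case using elim by simp
  qed
  from Lim_transform_eventually[OF lim this]
  show ?thesis
    unfolding has_vector_derivative_def has_derivative_iff_norm
    by (intro conjI bounded_linear_scaleR_left)
qed

section \<open>Lebesgue measure on symmetric matrices\<close>

lemma norm_matrix_vector_le:
  fixes A :: "real^'n^'m"
  shows "norm (A *v x) \<le> norm A * norm x"
proof (rule power2_le_imp_le)
  have "(norm (A *v x))\<^sup>2 = (\<Sum>i\<in>UNIV. (A $ i \<bullet> x)\<^sup>2)"
    unfolding power2_norm_eq_inner inner_vec_def[of "A *v x"] by (simp add: matrix_vector_mul_component power2_eq_square)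
  also have "\<dots> \<le> (\<Sum>i\<in>UNIV. (A $ i \<bullet> A $ i) * (x \<bullet> x))"
    by (intro sum_mono Cauchy_Schwarz_ineq)
  also have "\<dots> = (norm A * norm x)\<^sup>2"
    by (simp add: power_mult_distrib power2_norm_eq_inner inner_vec_def[of A] sum_distrib_right)
  finally show "(norm (A *v x))\<^sup>2 \<le> (norm A * norm x)\<^sup>2" .
qed simp

lemma quadratic_form_le:
  fixes A :: "real^'n^'n"
  shows "\<bar>x \<bullet> (A *v x)\<bar> \<le> norm A * (norm x)\<^sup>2"
proof -
  have "\<bar>x \<bullet> (A *v x)\<bar> \<le> norm x * norm (A *v x)" by (rule Cauchy_Schwarz_ineq2)
  also have "\<dots> \<le> norm x * (norm A * norm x)" by (intro mult_left_mono norm_matrix_vector_le) auto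
  finally show ?thesis by (simp add: power2_eq_square mult_ac)
qed

lemma norm_matrix_le_sum: "norm (A :: real^'n^'m) \<le> (\<Sum>i\<in>UNIV. \<Sum>j\<in>UNIV. \<bar>A $ i $ j\<bar>)"
proof -
  have "norm A \<le> (\<Sum>i\<in>UNIV. norm (A $ i))" unfolding norm_vec_def by (rule L2_set_le_sum) simp
  also have "\<dots> \<le> (\<Sum>i\<in>UNIV. \<Sum>j\<in>UNIV. \<bar>A $ i $ j\<bar>)" by (intro sum_mono norm_le_l1_cart)
  finally show ?thesis .
qed

lemma open_positive_form: "open {A :: real^'n^'n. \<forall>x. x \<noteq> 0 \<longrightarrow> 0 < x \<bullet> (A *v x)}" (is "open ?U")
  unfolding open_dist
proof
  fix A assume A: "A \<in> ?U"
  have ne: "sphere (0 :: real^'n) 1 \<noteq> {}" by (auto intro!: exI[of _ "axis undefined 1"])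
  have cont: "continuous_on (sphere 0 1) (\<lambda>x. x \<bullet> (A *v x))"
    by (intro continuous_intros linear_continuous_on matrix_vector_mul_bounded_linear)
  obtain u where u: "u \<in> sphere 0 1" "\<And>x. x \<in> sphere 0 1 \<Longrightarrow> u \<bullet> (A *v u) \<le> x \<bullet> (A *v x)"
    using continuous_attains_inf[OF compact_sphere ne cont] by blast
  define m where "m = u \<bullet> (A *v u)"
  have "u \<noteq> 0" using u(1) by auto
  then have m: "0 < m" using A by (auto simp: m_def)
  have "0 < x \<bullet> (A' *v x)" if d: "dist A' A < m" and x: "x \<noteq> 0" for A' x
  proof -
    define y where "y = x /\<^sub>R norm x"
    have y: "norm y = 1" "x = norm x *\<^sub>R y" using x by (auto simp: y_def)
    have "m \<le> y \<bullet> (A *v y)" using u(2)[of y] y by (simp add: m_def)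
    moreover have "\<bar>y \<bullet> ((A' - A) *v y)\<bar> < m"
      using quadratic_form_le[of y "A' - A"] d y(1) by (simp add: dist_norm)
    ultimately have "0 < y \<bullet> (A' *v y)"
      by (simp add: matrix_vector_mult_diff_rdistrib inner_diff_right)
    moreover have "x \<bullet> (A' *v x) = (norm x)\<^sup>2 * (y \<bullet> (A' *v y))"
      by (subst (1 2) y(2)) (simp add: matrix_vector_mult_scaleR power2_eq_square)
    ultimately show ?thesis using x by simp
  qed
  then show "\<exists>e>0. \<forall>y. dist y A < e \<longrightarrow> y \<in> ?U" using m by blast
qed

lemma R_set_eq:
  "R_set = {A. transpose A = A} \<inter> ({A. \<forall>x. x \<noteq> 0 \<longrightarrow> 0 < x \<bullet> (A *v x)}
     \<inter> (\<lambda>A. mat 1 - A) -` {A. \<forall>x. x \<noteq> 0 \<longrightarrow> 0 < x \<bullet> (A *v x)})"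
  by (auto simp: R_set_def pos_def_matrix_def transpose_algebra_simps)

lemma R_set_open_part: "open ({A. \<forall>x. x \<noteq> 0 \<longrightarrow> 0 < x \<bullet> (A *v x)}
     \<inter> (\<lambda>A. mat 1 - A) -` {A :: real^'n^'n. \<forall>x. x \<noteq> 0 \<longrightarrow> 0 < x \<bullet> (A *v x)})"
  by (intro open_Int open_positive_form open_vimage continuous_intros)

lemma R_set_measurable [measurable]: "(R_set :: (real^'n^'n) set) \<in> sets borel"
proof -
  have "closed {A :: real^'n^'n. transpose A = A}"
    by (intro closed_Collect_eq continuous_intros)
  then show ?thesis unfolding R_set_eq by (rule sets.Int[OF borel_closed borel_open[OF R_set_open_part]])
qed

lemma R_setD:
  assumes "\<Omega> \<in> R_set"
  shows "pos_def_matrix \<Omega>" "pos_def_matrix (mat 1 - \<Omega>)" "transpose \<Omega> = \<Omega>"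
  using assms by (auto simp: R_set_def pos_def_matrix_def)

lemma R_set_entry_le:
  assumes "\<Omega> \<in> R_set"
  shows "\<bar>\<Omega> $ i $ j\<bar> \<le> 1"
proof -
  have sym: "\<Omega> $ j $ i = \<Omega> $ i $ j"
    using R_setD(3)[OF assms] by (metis transpose_def vec_lambda_beta)
  have p: "0 \<le> x \<bullet> (\<Omega> *v x)" "x \<bullet> (\<Omega> *v x) \<le> x \<bullet> x" for x
    using psdD(2)[OF pos_def_imp_psd[OF R_setD(1)[OF assms]], of x]
      psdD(2)[OF pos_def_imp_psd[OF R_setD(2)[OF assms]], of x]
    by (auto simp: matrix_vector_mult_diff_rdistrib inner_diff_right)
  have d: "0 \<le> \<Omega> $ k $ k" "\<Omega> $ k $ k \<le> 1" for k
    using p[of "axis k 1"] by (auto simp: inner_axis_matrix inner_axis_axis)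
  show ?thesis
  proof (cases "i = j")
    case True
    then show ?thesis using d[of i] by simp
  next
    case False
    have "(axis i 1 + axis j 1) \<bullet> (\<Omega> *v (axis i 1 + axis j 1)) = \<Omega> $ i $ i + \<Omega> $ j $ j + 2 * \<Omega> $ i $ j"
      using sym by (simp add: matrix_vector_right_distrib inner_add_left inner_add_right inner_axis_matrix)
    moreover have "(axis i 1 + axis j 1) \<bullet> (axis i 1 + axis j (1::real)) = 2"
      using False by (simp add: inner_add_left inner_add_right inner_axis_axis)
    ultimately show ?thesis
      using p[of "axis i 1 + axis j 1"] d[of i] d[of j] by (auto simp: abs_le_iff)
  qed
qed

definition pair_index :: "'n::finite set set" where
  "pair_index = {{i, j} | i j. True}"

lemma pair_in_pair_index [simp]: "{i, j} \<in> pair_index" "{i} \<in> pair_index"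
  by (auto simp: pair_index_def)

lemma sym_lborel_eq:
  "sym_lborel = distr (Pi\<^sub>M pair_index (\<lambda>_. lborel)) borel (\<lambda>f. \<chi> i j. f {i, j})"
  by (simp add: sym_lborel_def pair_index_def)

interpretation lborel_product: product_sigma_finite "\<lambda>_::'k. lborel :: real measure" ..

lemma measurable_sym_matrix [measurable]:
  "(\<lambda>f. \<chi> i j :: 'n::finite. f {i, j}) \<in> borel_measurable (Pi\<^sub>M pair_index (\<lambda>_. lborel :: real measure))"
proof (rule borel_measurable_euclidean_space[THEN iffD2], rule ballI)
  fix b :: "real^'n^'n" assume "b \<in> Basis"
  then obtain i j where b: "b = axis i (axis j 1)" by (auto simp: Basis_vec_def)
  have "(\<lambda>f. f {i, j}) \<in> borel_measurable (Pi\<^sub>M pair_index (\<lambda>_. lborel :: real measure))"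
    by (rule measurable_component_singleton[THEN measurable_compose]) auto
  then show "(\<lambda>f. (\<chi> i j. f {i, j}) \<bullet> b) \<in> borel_measurable (Pi\<^sub>M pair_index (\<lambda>_. lborel :: real measure))"
    by (simp add: b inner_axis)
qed

lemma sets_sym_lborel [simp, measurable_cong]: "sets sym_lborel = sets borel"
  by (simp add: sym_lborel_def)

lemma space_sym_lborel [simp]: "space sym_lborel = UNIV"
  by (simp add: sym_lborel_def)

lemma sym_lborel_translate:
  fixes H :: "real^'n::finite^'n"
  assumes H: "transpose H = H"
  shows "distr sym_lborel borel (\<lambda>A. A + H) = sym_lborel"
proof -
  let ?I = "pair_index :: 'n set set" and ?P = "Pi\<^sub>M (pair_index :: 'n set set) (\<lambda>_. lborel :: real measure)"
  have sym: "H $ i $ j = H $ j $ i" for i j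
    using H by (metis transpose_def vec_lambda_beta)
  define c where "c k = (THE x. \<exists>i j. k = {i, j} \<and> x = H $ i $ j)" for k
  have c: "c {i, j} = H $ i $ j" for i j
    unfolding c_def by (rule the_equality) (auto simp: doubleton_eq_iff sym)
  define s where "s = (\<lambda>f. \<lambda>k\<in>?I. f k + c k)"
  have [measurable]: "s \<in> measurable ?P ?P"
    unfolding s_def by measurable
  have "distr ?P ?P s = ?P"
  proof (rule lborel_product.PiM_eqI)
    fix A assume A: "\<And>k. k \<in> ?I \<Longrightarrow> A k \<in> sets (lborel :: real measure)"
    have [measurable]: "A k \<in> sets borel" if "k \<in> ?I" for k using A[OF that] by simp
    have m: "(\<lambda>x. x + c k) -` A k \<in> sets borel" if "k \<in> ?I" for k
      using measurable_sets[of "\<lambda>x. x + c k" borel borel "A k"] that by simp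
    have "emeasure (distr ?P ?P s) (Pi\<^sub>E ?I A) = emeasure ?P (s -` Pi\<^sub>E ?I A \<inter> space ?P)"
      by (rule emeasure_distr) (auto intro!: sets_PiM_I_finite)
    also have "s -` Pi\<^sub>E ?I A \<inter> space ?P = Pi\<^sub>E ?I (\<lambda>k. (\<lambda>x. x + c k) -` A k)"
      by (auto simp: s_def space_PiM PiE_iff extensional_def)
    also have "emeasure ?P \<dots> = (\<Prod>k\<in>?I. emeasure lborel ((\<lambda>x. x + c k) -` A k))"
      using m by (intro lborel_product.emeasure_PiM) auto
    also have "\<dots> = (\<Prod>k\<in>?I. emeasure lborel (A k))"
    proof (rule prod.cong[OF refl])
      fix k assume k: "k \<in> ?I"
      have "emeasure lborel (A k) = emeasure (distr lborel borel ((+) (c k))) (A k)"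
        by (simp only: lborel_distr_plus)
      also have "\<dots> = emeasure lborel ((+) (c k) -` A k)"
        using k by (subst emeasure_distr) auto
      also have "(+) (c k) = (\<lambda>x. x + c k)" by (auto simp: add.commute)
      finally show "emeasure lborel ((\<lambda>x. x + c k) -` A k) = emeasure lborel (A k)" by simp
    qed
    finally show "emeasure (distr ?P ?P s) (Pi\<^sub>E ?I A) = (\<Prod>k\<in>?I. emeasure lborel (A k))" .
  qed auto
  moreover have "(\<lambda>f. (\<chi> i j. f {i, j}) + H) = (\<lambda>f. \<chi> i j. f {i, j}) \<circ> s"
    by (auto simp: s_def vec_eq_iff c fun_eq_iff)
  moreover have "distr (distr ?P ?P s) borel (\<lambda>f. \<chi> i j. f {i, j}) = distr ?P borel ((\<lambda>f. \<chi> i j. f {i, j}) \<circ> s)"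
    by (rule distr_distr) measurable
  moreover have "distr sym_lborel borel (\<lambda>A. A + H) = distr ?P borel ((\<lambda>A. A + H) \<circ> (\<lambda>f. \<chi> i j. f {i, j}))"
    unfolding sym_lborel_eq by (rule distr_distr) measurable
  ultimately show ?thesis by (simp add: sym_lborel_eq o_def)
qed

lemma emeasure_sym_lborel_box_finite:
  "emeasure sym_lborel {A :: real^'n::finite^'n. \<forall>i j. \<bar>A $ i $ j\<bar> \<le> c} < \<infinity>"
proof -
  let ?I = "pair_index :: 'n set set" and ?P = "Pi\<^sub>M (pair_index :: 'n set set) (\<lambda>_. lborel :: real measure)"
  let ?B = "{A :: real^'n^'n. \<forall>i j. \<bar>A $ i $ j\<bar> \<le> c}"
  have "closed ?B"
    by (intro closed_Collect_all closed_Collect_le continuous_intros)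
  then have "emeasure sym_lborel ?B = emeasure ?P ((\<lambda>f. \<chi> i j. f {i, j}) -` ?B \<inter> space ?P)"
    unfolding sym_lborel_eq by (intro emeasure_distr) auto
  also have "\<dots> \<le> emeasure ?P (Pi\<^sub>E ?I (\<lambda>_. {-c..c}))"
  proof (rule emeasure_mono)
    show "(\<lambda>f. \<chi> i j. f {i, j}) -` ?B \<inter> space ?P \<subseteq> Pi\<^sub>E ?I (\<lambda>_. {-c..c})"
    proof
      fix f assume f: "f \<in> (\<lambda>f. \<chi> i j. f {i, j}) -` ?B \<inter> space ?P"
      then have "f {i, j} \<in> {-c..c}" for i j by (auto simp: abs_le_iff minus_le_iff)
      then show "f \<in> Pi\<^sub>E ?I (\<lambda>_. {-c..c})" using f by (auto simp: space_PiM PiE_iff pair_index_def)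
    qed
  qed (auto intro!: sets_PiM_I_finite)
  also have "\<dots> = (\<Prod>k\<in>?I. emeasure lborel {-c..c})"
    by (rule lborel_product.emeasure_PiM) auto
  also have "\<dots> < \<infinity>" by (auto simp: ennreal_power emeasure_lborel_Icc_eq)
  finally show ?thesis .
qed

lemma emeasure_sym_lborel_R_set_finite: "emeasure sym_lborel (R_set :: (real^'n::finite^'n) set) < \<infinity>"
proof -
  have "closed {A :: real^'n^'n. \<forall>i j. \<bar>A $ i $ j\<bar> \<le> 1}"
    by (intro closed_Collect_all closed_Collect_le continuous_intros)
  then have "emeasure sym_lborel (R_set :: (real^'n^'n) set) \<le> emeasure sym_lborel {A :: real^'n^'n. \<forall>i j. \<bar>A $ i $ j\<bar> \<le> 1}"
    by (intro emeasure_mono) (auto simp: R_set_entry_le)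
  then show ?thesis using emeasure_sym_lborel_box_finite[of 1] by (rule le_less_trans)
qed

lemma emeasure_sym_lborel_R_set_pos: "emeasure sym_lborel (R_set :: (real^'n::finite^'n) set) \<noteq> 0"
proof -
  let ?I = "pair_index :: 'n set set" and ?P = "Pi\<^sub>M (pair_index :: 'n set set) (\<lambda>_. lborel :: real measure)"
  define d where "d = 1 / (4 * real CARD('n) * real CARD('n))"
  have d: "0 < d" by (simp add: d_def)
  define c where "c k = (if card k = 1 then 1 / 2 else (0::real))" for k :: "'n set"
  have "(\<Prod>k\<in>?I. ennreal (2 * d)) = (\<Prod>k\<in>?I. emeasure lborel {c k - d .. c k + d})"
    using d by (intro prod.cong) auto
  also have "\<dots> = emeasure ?P (Pi\<^sub>E ?I (\<lambda>k. {c k - d .. c k + d}))"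
    by (rule lborel_product.emeasure_PiM[symmetric]) auto
  also have "\<dots> \<le> emeasure ?P ((\<lambda>f. \<chi> i j. f {i, j}) -` R_set \<inter> space ?P)"
  proof (rule emeasure_mono)
    show "Pi\<^sub>E ?I (\<lambda>k. {c k - d .. c k + d}) \<subseteq> (\<lambda>f. \<chi> i j. f {i, j}) -` R_set \<inter> space ?P"
    proof
      fix f assume f: "f \<in> Pi\<^sub>E ?I (\<lambda>k. {c k - d .. c k + d})"
      define A :: "real^'n^'n" where "A = (\<chi> i j. f {i, j})"
      define E where "E = A - (1 / 2) *\<^sub>R mat 1"
      have "\<bar>E $ i $ j\<bar> \<le> d" for i j
      proof -
        have "f {i, j} \<in> {c {i, j} - d .. c {i, j} + d}" using f by (rule PiE_mem) auto
        moreover have "c {i, j} = (if i = j then 1 / 2 else 0)" by (simp add: c_def card_insert_if)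
        ultimately show ?thesis by (auto simp: E_def A_def mat_def abs_le_iff)
      qed
      then have "norm E \<le> (\<Sum>i\<in>(UNIV::'n set). \<Sum>j\<in>(UNIV::'n set). d)"
        by (intro order_trans[OF norm_matrix_le_sum] sum_mono)
      also have "\<dots> = 1 / 4" by (simp add: d_def)
      finally have E: "norm E \<le> 1 / 4" .
      have q: "\<bar>x \<bullet> (A *v x) - x \<bullet> x / 2\<bar> \<le> x \<bullet> x / 4" for x
      proof -
        have "x \<bullet> (E *v x) = x \<bullet> (A *v x) - x \<bullet> x / 2"
          by (simp add: E_def matrix_vector_mult_diff_rdistrib inner_diff_right scaleR_matrix_vector_assoc[symmetric])
        moreover have "\<bar>x \<bullet> (E *v x)\<bar> \<le> 1 / 4 * (norm x)\<^sup>2"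
          by (rule order_trans[OF quadratic_form_le]) (intro mult_right_mono E, simp)
        ultimately show ?thesis by (simp add: power2_norm_eq_inner)
      qed
      have "0 < x \<bullet> (A *v x)" "x \<bullet> (A *v x) < x \<bullet> x" if "x \<noteq> 0" for x
        using q[of x] inner_gt_zero_iff[of x] that by linarith+
      moreover have "transpose A = A" by (simp add: A_def transpose_def insert_commute)
      ultimately have "A \<in> R_set"
        by (simp add: R_set_def pos_def_matrix_def transpose_algebra_simps matrix_vector_mult_diff_rdistrib inner_diff_right)
      then show "f \<in> (\<lambda>f. \<chi> i j. f {i, j}) -` R_set \<inter> space ?P"
        using f by (auto simp: A_def space_PiM PiE_iff)
    qed
  qed measurable
  also have "\<dots> = emeasure sym_lborel (R_set :: (real^'n^'n) set)"
    unfolding sym_lborel_eq by (rule emeasure_distr[symmetric]) auto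
  finally have "(\<Prod>k\<in>?I. ennreal (2 * d)) \<le> emeasure sym_lborel (R_set :: (real^'n^'n) set)" .
  moreover have "(\<Prod>k\<in>?I. ennreal (2 * d)) \<noteq> 0" using d by simp
  ultimately show ?thesis by auto
qed

section \<open>A vector field on \<open>R_set\<close> and its divergence\<close>

lemma trace_cyclic:
  fixes A B C :: "real^'n^'n"
  shows "trace (A ** B ** C) = trace (C ** A ** B)"
  by (subst trace_mul_sym) (simp add: matrix_mul_assoc)

lemmas mring = matrix_algebra_simps matrix_mul_assoc scaleR_add_right scaleR_diff_right

definition resolvent :: "real \<Rightarrow> real^'n^'n \<Rightarrow> real^'n^'n" where
  "resolvent \<kappa> \<Omega> = matrix_inv (mat 1 - \<kappa> *\<^sub>R \<Omega>)"

definition precision :: "real \<Rightarrow> real \<Rightarrow> real^'n^'n \<Rightarrow> real^'n^'n" where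
  "precision v\<^sub>0 \<kappa> \<Omega> = (1 / v\<^sub>0) *\<^sub>R (\<Omega> ** resolvent \<kappa> \<Omega>)"

lemma psd_square_diff:
  assumes "\<Omega> \<in> R_set"
  shows "psd (\<Omega> - \<Omega> ** \<Omega>)"
proof -
  note s = R_setD(3)[OF assms]
  have "\<Omega> - \<Omega> ** \<Omega> = \<Omega> ** (mat 1 - \<Omega>) ** transpose \<Omega> + (mat 1 - \<Omega>) ** \<Omega> ** transpose (mat 1 - \<Omega>)"
    by (simp add: s transpose_algebra_simps mring)
  then show ?thesis
    using pos_def_imp_psd[OF R_setD(1)[OF assms]] pos_def_imp_psd[OF R_setD(2)[OF assms]]
    by (metis psd_add psd_congruence)
qed

lemma inverse_relations:
  fixes X Y A :: "real^'n^'n"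
  assumes "X ** Y = Z"
  shows "A ** X ** Y = A ** Z"
  using assms by (metis matrix_mul_assoc)

locale omega_point =
  fixes \<Omega> :: "real^'n^'n" and v\<^sub>0 \<kappa> :: real
  assumes \<Omega>: "\<Omega> \<in> R_set" and v0: "0 < v\<^sub>0" and \<kappa>: "0 \<le> \<kappa>" "\<kappa> < 1"
begin

abbreviation "J \<equiv> matrix_inv \<Omega>"
abbreviation "P \<equiv> matrix_inv (mat 1 - \<Omega>)"
abbreviation "R \<equiv> resolvent \<kappa> \<Omega>"
abbreviation "B \<equiv> precision v\<^sub>0 \<kappa> \<Omega>"
abbreviation "v \<equiv> (1 - \<kappa>) * v\<^sub>0"
abbreviation "P' \<equiv> (1 - \<kappa>) *\<^sub>R P + \<kappa> *\<^sub>R mat 1"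

lemma sym_\<Omega>: "transpose \<Omega> = \<Omega>" by (rule R_setD(3)[OF \<Omega>])

lemma psd_\<Omega>: "psd \<Omega>" and psd_1_\<Omega>: "psd (mat 1 - \<Omega>)"
  by (intro pos_def_imp_psd R_setD \<Omega>)+

lemma pos_def_1_\<kappa>\<Omega>: "pos_def_matrix (mat 1 - \<kappa> *\<^sub>R \<Omega>)"
proof -
  have "0 < x \<bullet> ((mat 1 - \<kappa> *\<^sub>R \<Omega>) *v x)" if "x \<noteq> 0" for x
  proof -
    have "0 \<le> \<kappa> * (x \<bullet> ((mat 1 - \<Omega>) *v x))" using \<kappa> psdD(2)[OF psd_1_\<Omega>] by simp
    moreover have "0 < (1 - \<kappa>) * (x \<bullet> x)" using \<kappa> that by simp
    ultimately show ?thesis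
      by (simp add: matrix_vector_mult_diff_rdistrib scaleR_matrix_vector_assoc[symmetric] inner_diff_right algebra_simps)
  qed
  then show ?thesis by (simp add: pos_def_matrix_def transpose_algebra_simps sym_\<Omega>)
qed

lemma J_rel [simp]: "J ** \<Omega> = mat 1" "\<Omega> ** J = mat 1"
  using matrix_inv[OF pos_def_invertible[OF R_setD(1)[OF \<Omega>]]] by auto

lemma P_rel [simp]: "P ** \<Omega> = P - mat 1" "\<Omega> ** P = P - mat 1"
proof -
  note i = matrix_inv[OF pos_def_invertible[OF R_setD(2)[OF \<Omega>]]]
  have "P - P ** \<Omega> = mat 1" using i(2) by (simp add: mring)
  then show "P ** \<Omega> = P - mat 1" by (metis diff_diff_eq2 diff_eq_eq add_diff_cancel_left')
  have "P - \<Omega> ** P = mat 1" using i(1) by (simp add: mring)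
  then show "\<Omega> ** P = P - mat 1" by (metis diff_diff_eq2 diff_eq_eq add_diff_cancel_left')
qed

lemma R_rel0: "R - \<kappa> *\<^sub>R (R ** \<Omega>) = mat 1" "R - \<kappa> *\<^sub>R (\<Omega> ** R) = mat 1"
  using matrix_inv[OF pos_def_invertible[OF pos_def_1_\<kappa>\<Omega>]] by (auto simp: resolvent_def mring)

lemma R_comm: "R ** \<Omega> = \<Omega> ** R"
proof -
  have "R ** \<Omega> = R ** \<Omega> ** (R - \<kappa> *\<^sub>R (\<Omega> ** R))" by (simp add: R_rel0)
  also have "\<dots> = (R - \<kappa> *\<^sub>R (R ** \<Omega>)) ** \<Omega> ** R" by (simp add: mring)
  finally show ?thesis by (simp add: R_rel0)
qed

lemma \<Omega>R_rel [simp]: "\<Omega> ** R = v\<^sub>0 *\<^sub>R B" "R ** \<Omega> = v\<^sub>0 *\<^sub>R B"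
  using v0 by (simp_all add: precision_def R_comm)

lemma R_eq: "R = mat 1 + (\<kappa> * v\<^sub>0) *\<^sub>R B"
  using R_rel0(2) by (simp add: algebra_simps)

lemma B\<Omega>: "B ** \<Omega> = \<Omega> ** B"
proof -
  have "\<Omega> ** R ** \<Omega> = \<Omega> ** (\<Omega> ** R)" by (simp only: matrix_mul_assoc[symmetric] R_comm)
  then show ?thesis unfolding precision_def by (simp only: matrix_mult_scaleR_left matrix_mult_scaleR_right)
qed

lemma B_rel: "v\<^sub>0 *\<^sub>R B - (\<kappa> * v\<^sub>0) *\<^sub>R (\<Omega> ** B) = \<Omega>"
proof -
  have "\<Omega> ** R = \<Omega> + (\<kappa> * v\<^sub>0) *\<^sub>R (\<Omega> ** B)" by (subst R_eq) (simp add: mring)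
  then show ?thesis by simp
qed

lemma sym_ops: "transpose J = J" "transpose P = P" "transpose R = R" "transpose B = B"
proof -
  show "transpose J = J" "transpose P = P"
    using pos_def_matrix_inv R_setD[OF \<Omega>] by (auto simp: pos_def_matrix_def)
  show R: "transpose R = R"
    using pos_def_matrix_inv[OF pos_def_1_\<kappa>\<Omega>] by (auto simp: pos_def_matrix_def resolvent_def)
  show "transpose B = B"
    unfolding precision_def by (simp add: transpose_algebra_simps matrix_transpose_mul R sym_\<Omega> del: \<Omega>R_rel) (metis R_comm)
qed

lemma psd_J: "psd J" and psd_P: "psd P" and psd_R: "psd R"
  unfolding resolvent_def using pos_def_imp_psd[OF pos_def_matrix_inv] R_setD[OF \<Omega>] pos_def_1_\<kappa>\<Omega> by auto

lemma psd_B: "psd B"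
proof -
  have "psd ((1 - \<kappa>) *\<^sub>R \<Omega> + \<kappa> *\<^sub>R (\<Omega> - \<Omega> ** \<Omega>))"
    using \<kappa> by (intro psd_add psd_scaleR psd_\<Omega> psd_square_diff \<Omega>) auto
  from psd_scaleR[OF psd_congruence[OF this, of R], of "1 / v\<^sub>0"]
  have "psd ((1 / v\<^sub>0) *\<^sub>R (R ** ((1 - \<kappa>) *\<^sub>R \<Omega> + \<kappa> *\<^sub>R (\<Omega> - \<Omega> ** \<Omega>)) ** R))"
    using v0 by (simp add: sym_ops)
  also have "R ** ((1 - \<kappa>) *\<^sub>R \<Omega> + \<kappa> *\<^sub>R (\<Omega> - \<Omega> ** \<Omega>)) ** R = R ** \<Omega> ** (R - \<kappa> *\<^sub>R (\<Omega> ** R))"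
    by (simp add: mring scaleR_diff_left del: \<Omega>R_rel)
  also have "\<dots> = v\<^sub>0 *\<^sub>R B" by (simp only: R_rel0 matrix_mul_rid) (rule \<Omega>R_rel)
  finally show ?thesis using v0 by simp
qed

lemma psd_P_minus_1: "psd (P - mat 1)"
proof -
  have "P - mat 1 = P ** (\<Omega> - \<Omega> ** \<Omega>) ** transpose P"
    by (simp add: sym_ops mring inverse_relations[OF P_rel(1)] inverse_relations[OF P_rel(2)])
  then show ?thesis using psd_congruence[OF psd_square_diff[OF \<Omega>]] by metis
qed

lemma psd_P': "psd P'" using \<kappa> by (intro psd_add psd_scaleR psd_P psd_mat_1) auto

lemma P'_rel: "P' ** (mat 1 - v *\<^sub>R B) = mat 1" "(mat 1 - v *\<^sub>R B) ** P' = mat 1" "P' - mat 1 = (1 - \<kappa>) *\<^sub>R (P - mat 1)"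
proof -
  have "(mat 1 - \<Omega>) ** R = R - v\<^sub>0 *\<^sub>R B" by (simp add: mring)
  also have "\<dots> = mat 1 - v *\<^sub>R B" by (subst R_eq) (simp add: algebra_simps)
  finally have e: "mat 1 - v *\<^sub>R B = (mat 1 - \<Omega>) ** R" ..
  have P'e: "P' = (mat 1 - \<kappa> *\<^sub>R \<Omega>) ** P" by (simp add: mring algebra_simps)
  have RY: "R ** (mat 1 - \<kappa> *\<^sub>R \<Omega>) = mat 1" using R_rel0(1) by (simp add: mring)
  have "(mat 1 - v *\<^sub>R B) ** P' = (mat 1 - \<Omega>) ** (R ** (mat 1 - \<kappa> *\<^sub>R \<Omega>)) ** P"
    unfolding e P'e by (simp only: matrix_mul_assoc)
  also have "\<dots> = mat 1"
    unfolding RY matrix_mul_rid by (rule matrix_inv_right[OF pos_def_invertible[OF R_setD(2)[OF \<Omega>]]])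
  finally show 1: "(mat 1 - v *\<^sub>R B) ** P' = mat 1" .
  then show "P' ** (mat 1 - v *\<^sub>R B) = mat 1" by (simp add: matrix_left_right_inverse)
  show "P' - mat 1 = (1 - \<kappa>) *\<^sub>R (P - mat 1)" by (simp add: algebra_simps)
qed

lemma trace_B_le: "v * trace B \<le> real CARD('n)"
proof -
  have "(mat 1 - \<Omega>) ** R = R - v\<^sub>0 *\<^sub>R B" by (simp add: mring)
  also have "\<dots> = mat 1 - v *\<^sub>R B" by (subst R_eq) (simp add: algebra_simps)
  finally have "trace (mat 1 - v *\<^sub>R B) = trace ((mat 1 - \<Omega>) ** R)" by simp
  then show ?thesis using trace_psd_mult_nonneg[OF psd_1_\<Omega> psd_R] by (simp add: trace_algebra_simps)
qed

lemma trace_R_le: "(1 - \<kappa>) * trace R \<le> real CARD('n)"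
proof -
  have "mat 1 - (1 - \<kappa>) *\<^sub>R R = \<kappa> *\<^sub>R ((mat 1 - \<Omega>) ** R)"
    by (subst R_eq) (simp add: mring, simp add: R_eq algebra_simps)
  from arg_cong[OF this, of trace] show ?thesis
    using mult_nonneg_nonneg[OF \<kappa>(1) trace_psd_mult_nonneg[OF psd_1_\<Omega> psd_R]] by (simp add: trace_algebra_simps)
qed

definition score :: "real^'n^'n \<Rightarrow> real \<Rightarrow> real \<Rightarrow> real \<Rightarrow> real \<Rightarrow> real^'n^'n" where
  "score S q \<alpha> \<beta> \<epsilon> = \<alpha> *\<^sub>R J - \<beta> *\<^sub>R P + (q * \<kappa> / 2) *\<^sub>R R - (1 / (2 * v\<^sub>0)) *\<^sub>R (R ** S ** R) + \<epsilon> *\<^sub>R (J ** J) - \<epsilon> *\<^sub>R (P ** P)"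

context
  fixes M :: "real^'n^'n"
  assumes M: "psd M" "pos_def_matrix (mat 1 - v *\<^sub>R M)"
begin

definition "Y\<^sub>M = matrix_inv (mat 1 + (\<kappa> * v\<^sub>0) *\<^sub>R M)"
definition "P\<^sub>M = matrix_inv (mat 1 - v *\<^sub>R M)"

lemma sym_M: "transpose M = M" using psdD(1)[OF M(1)] .

lemma sym_diff: "transpose (B - M) = B - M"
  by (simp add: transpose_algebra_simps sym_ops sym_M)

lemma klein_\<Omega>: "trace ((mat 1 - Y\<^sub>M) ** (B - M)) \<le> \<kappa> * trace (\<Omega> ** (B - M))"
proof -
  let ?R = "mat 1 + (\<kappa> * v\<^sub>0) *\<^sub>R M"
  have pR: "pos_def_matrix ?R"
  proof -
    have "0 < x \<bullet> (?R *v x)" if "x \<noteq> 0" for x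
    proof -
      have "0 \<le> (\<kappa> * v\<^sub>0) * (x \<bullet> (M *v x))" using \<kappa> v0 psdD(2)[OF M(1), of x] by simp
      moreover have "0 < x \<bullet> x" using that by simp
      moreover have "x \<bullet> (?R *v x) = x \<bullet> x + (\<kappa> * v\<^sub>0) * (x \<bullet> (M *v x))"
        by (simp add: matrix_vector_mult_add_rdistrib scaleR_matrix_vector_assoc[symmetric] inner_add_right)
      ultimately show ?thesis by linarith
    qed
    then show ?thesis by (simp add: pos_def_matrix_def transpose_algebra_simps sym_M)
  qed
  have YR: "Y\<^sub>M ** ?R = mat 1" unfolding Y\<^sub>M_def by (rule matrix_inv_left[OF pos_def_invertible[OF pR]])
  let ?Y = "mat 1 - \<kappa> *\<^sub>R \<Omega>"
  have RY: "R ** ?Y = mat 1" using R_rel0(1) by (simp add: mring)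
  have "Y\<^sub>M ** (R - ?R) ** Z = Y\<^sub>M ** (R ** Z) - Y\<^sub>M ** ?R ** Z" for Z :: "real^'n^'n"
    by (simp only: matrix_mult_diff_left matrix_mult_diff_right matrix_mul_assoc)
  then have "Y\<^sub>M ** (R - ?R) ** ?Y = Y\<^sub>M ** (R ** ?Y) - Y\<^sub>M ** ?R ** ?Y" .
  also have "\<dots> = Y\<^sub>M - ?Y" by (simp only: RY YR matrix_mul_lid matrix_mul_rid)
  finally have "Y\<^sub>M - ?Y = Y\<^sub>M ** (R - ?R) ** ?Y" ..
  also have "R - ?R = (\<kappa> * v\<^sub>0) *\<^sub>R (B - M)" by (subst R_eq) (simp add: algebra_simps)
  finally have "trace ((Y\<^sub>M - ?Y) ** (B - M)) = (\<kappa> * v\<^sub>0) * trace (Y\<^sub>M ** (B - M) ** ?Y ** (B - M))"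
    by (simp add: matrix_mult_scaleR_left matrix_mult_scaleR_right trace_algebra_simps)
  also have "\<dots> \<ge> 0"
    using \<kappa> v0 pos_def_imp_psd[OF pos_def_matrix_inv[OF pR]] pos_def_imp_psd[OF pos_def_1_\<kappa>\<Omega>]
    by (intro mult_nonneg_nonneg trace_sandwich_nonneg sym_diff) (auto simp: Y\<^sub>M_def)
  finally have "0 \<le> trace ((Y\<^sub>M - ?Y) ** (B - M))" .
  moreover have "Y\<^sub>M - ?Y = \<kappa> *\<^sub>R \<Omega> - (mat 1 - Y\<^sub>M)" by simp
  ultimately have "0 \<le> trace ((\<kappa> *\<^sub>R \<Omega>) ** (B - M)) - trace ((mat 1 - Y\<^sub>M) ** (B - M))"
    by (simp only: matrix_mult_diff_left trace_algebra_simps)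
  then show ?thesis by (simp only: matrix_mult_scaleR_left trace_algebra_simps)
qed

lemma P_diff: "P' - P\<^sub>M = v *\<^sub>R (P' ** (B - M) ** P\<^sub>M)"
proof -
  have XP: "(mat 1 - v *\<^sub>R M) ** P\<^sub>M = mat 1"
    unfolding P\<^sub>M_def by (rule matrix_inv_right[OF pos_def_invertible[OF M(2)]])
  have "v *\<^sub>R (B - M) = (mat 1 - v *\<^sub>R M) - (mat 1 - v *\<^sub>R B)" by (simp add: algebra_simps)
  then have "v *\<^sub>R (P' ** (B - M) ** P\<^sub>M) = P' ** ((mat 1 - v *\<^sub>R M) - (mat 1 - v *\<^sub>R B)) ** P\<^sub>M"
    by (metis matrix_mult_scaleR_left matrix_mult_scaleR_right)
  also have "\<dots> = P' ** ((mat 1 - v *\<^sub>R M) ** P\<^sub>M) - P' ** (mat 1 - v *\<^sub>R B) ** P\<^sub>M"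
    by (simp only: matrix_mult_diff_left matrix_mult_diff_right matrix_mul_assoc)
  also have "\<dots> = P' - P\<^sub>M" by (simp only: XP P'_rel matrix_mul_lid matrix_mul_rid)
  finally show ?thesis ..
qed

lemma v_pos: "0 < v" using v0 \<kappa> by simp

lemma psd_PM: "psd P\<^sub>M" unfolding P\<^sub>M_def by (intro pos_def_imp_psd pos_def_matrix_inv M)

lemma klein_P: "trace (P\<^sub>M ** (B - M)) \<le> trace (P' ** (B - M))"
proof -
  have "trace ((P' - P\<^sub>M) ** (B - M)) = v * trace (P' ** (B - M) ** P\<^sub>M ** (B - M))"
    unfolding P_diff by (simp only: matrix_mult_scaleR_left trace_algebra_simps)
  also have "\<dots> \<ge> 0" using v0 \<kappa> by (intro mult_nonneg_nonneg trace_sandwich_nonneg sym_diff psd_P' psd_PM) auto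
  finally show ?thesis by (simp only: matrix_mult_diff_left trace_algebra_simps)
qed

lemma P'_square: "P' ** P' - P' = v *\<^sub>R (P' ** B ** P')"
proof -
  have "P' - v *\<^sub>R (P' ** B) = mat 1"
    using P'_rel(1) by (simp only: matrix_mult_diff_right matrix_mult_scaleR_right matrix_mul_rid)
  then have "(P' - v *\<^sub>R (P' ** B)) ** P' = P'" by simp
  then have "P' ** P' - v *\<^sub>R (P' ** B ** P') = P'"
    by (simp only: matrix_mult_diff_left matrix_mult_scaleR_left)
  then show ?thesis by (metis add_diff_cancel_left' diff_add_cancel)
qed

lemma psd_P'_square: "psd (P' ** P' - P')"
  unfolding P'_square using psd_scaleR[OF psd_congruence[OF psd_B, of P'] less_imp_le[OF v_pos]]
  unfolding psdD(1)[OF psd_P'] .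

lemma klein_P2: "trace ((P\<^sub>M ** P\<^sub>M - P\<^sub>M) ** (B - M)) \<le> trace ((P' ** P' - P') ** (B - M))"
proof -
  let ?D = "B - M"
  have "(P' ** P' - P') - (P\<^sub>M ** P\<^sub>M - P\<^sub>M) = P' ** (P' - P\<^sub>M) + (P' - P\<^sub>M) ** P\<^sub>M - (P' - P\<^sub>M)"
    by (simp only: matrix_mult_diff_left matrix_mult_diff_right) simp
  also have "\<dots> = v *\<^sub>R ((P' ** P' - P') ** ?D ** P\<^sub>M + P' ** ?D ** (P\<^sub>M ** P\<^sub>M))"
  proof -
    have "X ** (c *\<^sub>R (X ** D ** Z)) + (c *\<^sub>R (X ** D ** Z)) ** Z - c *\<^sub>R (X ** D ** Z)
      = c *\<^sub>R ((X ** X - X) ** D ** Z + X ** D ** (Z ** Z))" for X Z D :: "real^'n^'n" and c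
      by (simp add: mring)
    then show ?thesis unfolding P_diff .
  qed
  finally have e: "(P' ** P' - P') - (P\<^sub>M ** P\<^sub>M - P\<^sub>M) = v *\<^sub>R ((P' ** P' - P') ** ?D ** P\<^sub>M + P' ** ?D ** (P\<^sub>M ** P\<^sub>M))" .
  have PM2: "psd (P\<^sub>M ** P\<^sub>M)"
    using psd_congruence[OF psd_mat_1, of P\<^sub>M] psdD(1)[OF psd_PM] by simp
  have "trace (((P' ** P' - P') - (P\<^sub>M ** P\<^sub>M - P\<^sub>M)) ** ?D)
    = v * (trace ((P' ** P' - P') ** ?D ** P\<^sub>M ** ?D) + trace (P' ** ?D ** (P\<^sub>M ** P\<^sub>M) ** ?D))"
    unfolding e by (simp only: matrix_mult_scaleR_left matrix_mult_add_left trace_algebra_simps)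
  also have "\<dots> \<ge> 0"
    using v0 \<kappa> by (intro mult_nonneg_nonneg add_nonneg_nonneg trace_sandwich_nonneg sym_diff psd_P'_square psd_P' psd_PM PM2) auto
  finally show ?thesis by (simp only: matrix_mult_diff_left[of _ _ ?D] trace_algebra_simps)
qed

text \<open>The next expression is the divergence of the density \<open>|\<Omega>|^\<alpha> |I - \<Omega>|^\<beta> |I - \<kappa>\<Omega>|^(-q/2)
  exp (- tr (B S) / 2 - \<epsilon> (tr J + tr P))\<close> times the vector field \<open>(2 / v\<^sub>0) \<Omega>\<^sup>2 - U\<close> on symmetric matrices,
  divided by that density. In the coordinate \<open>B\<close> this field is \<open>2 B\<^sup>2 - (B M + M B) / 2\<close>.\<close>

definition field2 :: "real^'n^'n" where
  "field2 = (1 / 2) *\<^sub>R (\<Omega> ** M + M ** \<Omega>) - \<kappa> *\<^sub>R (\<Omega> ** M ** \<Omega>)"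

definition field_divergence :: "real^'n^'n \<Rightarrow> real \<Rightarrow> real \<Rightarrow> real \<Rightarrow> real \<Rightarrow> real" where
  "field_divergence S q \<alpha> \<beta> \<epsilon> = (2 / v\<^sub>0) * ((real CARD('n) + 1) * trace \<Omega> + trace (score S q \<alpha> \<beta> \<epsilon> ** (\<Omega> ** \<Omega>)))
    - ((real CARD('n) + 1) * (trace M / 2 - \<kappa> * trace (\<Omega> ** M)) + trace (score S q \<alpha> \<beta> \<epsilon> ** field2))"

lemma trace_field2:
  assumes "X ** \<Omega> = \<Omega> ** X"
  shows "trace (X ** field2) = trace ((X ** \<Omega> - \<kappa> *\<^sub>R (\<Omega> ** X ** \<Omega>)) ** M)"
proof -
  have "trace (X ** M ** \<Omega>) = trace (X ** \<Omega> ** M)"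
    by (subst trace_cyclic) (simp only: assms)
  moreover have "trace (X ** \<Omega> ** M ** \<Omega>) = trace (\<Omega> ** X ** \<Omega> ** M)"
    by (subst trace_mul_sym) (simp only: matrix_mul_assoc)
  ultimately show ?thesis
    by (simp add: field2_def mring trace_algebra_simps)
qed

lemma P_comm: "P ** \<Omega> = \<Omega> ** P" "J ** \<Omega> = \<Omega> ** J" "J ** J ** \<Omega> = \<Omega> ** (J ** J)" "P ** P ** \<Omega> = \<Omega> ** (P ** P)"
proof -
  show 1: "P ** \<Omega> = \<Omega> ** P" "J ** \<Omega> = \<Omega> ** J" by simp_all
  show "J ** J ** \<Omega> = \<Omega> ** (J ** J)"
    by (simp add: matrix_mul_assoc inverse_relations[OF J_rel(1)])
  show "P ** P ** \<Omega> = \<Omega> ** (P ** P)"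
    by (simp add: mring inverse_relations[OF P_rel(1)])
qed

lemma trace_\<Omega>B: "\<kappa> * v\<^sub>0 * trace (\<Omega> ** B) = v\<^sub>0 * trace B - trace \<Omega>"
  using arg_cong[OF B_rel, of trace] by (simp add: trace_algebra_simps)

lemma P\<Omega>\<Omega>: "P ** \<Omega> ** \<Omega> = v\<^sub>0 *\<^sub>R ((\<kappa> *\<^sub>R \<Omega> + (1 - \<kappa>) *\<^sub>R (P - mat 1)) ** B)"
proof -
  have "P ** \<Omega> ** \<Omega> = (P - mat 1) ** (v\<^sub>0 *\<^sub>R B - (\<kappa> * v\<^sub>0) *\<^sub>R (\<Omega> ** B))" by (simp add: B_rel)
  also have "\<dots> = v\<^sub>0 *\<^sub>R ((\<kappa> *\<^sub>R \<Omega> + (1 - \<kappa>) *\<^sub>R (P - mat 1)) ** B)"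
    by (simp add: mring algebra_simps)
  finally show ?thesis .
qed

abbreviation "F2 \<equiv> (1 - \<kappa>) *\<^sub>R (P ** P - P) + \<kappa> *\<^sub>R (P - mat 1)"

lemma PP\<Omega>\<Omega>: "P ** P ** (\<Omega> ** \<Omega>) = v\<^sub>0 *\<^sub>R (F2 ** B)"
proof -
  have "P ** P ** (\<Omega> ** \<Omega>) = P ** (P ** \<Omega> ** \<Omega>)" by (simp only: matrix_mul_assoc)
  also have "\<dots> = v\<^sub>0 *\<^sub>R ((P ** (\<kappa> *\<^sub>R \<Omega> + (1 - \<kappa>) *\<^sub>R (P - mat 1))) ** B)"
    unfolding P\<Omega>\<Omega> by (simp only: matrix_mult_scaleR_right matrix_mul_assoc)
  also have "P ** (\<kappa> *\<^sub>R \<Omega> + (1 - \<kappa>) *\<^sub>R (P - mat 1)) = F2"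
    by (simp add: mring algebra_simps)
  finally show ?thesis .
qed

lemma trace_RSR_\<Omega>\<Omega>: "trace (R ** S ** R ** (\<Omega> ** \<Omega>)) = v\<^sub>0\<^sup>2 * trace (S ** B ** B)"
proof -
  have "trace (R ** (S ** (R ** \<Omega>) ** \<Omega>)) = trace (S ** (R ** \<Omega>) ** \<Omega> ** R)" by (rule trace_mul_sym)
  then have "trace (R ** S ** R ** (\<Omega> ** \<Omega>)) = trace (S ** (R ** \<Omega>) ** (\<Omega> ** R))"
    by (simp only: matrix_mul_assoc)
  then show ?thesis by (simp add: mring trace_algebra_simps power2_eq_square)
qed

lemma trace_RSR_field2: "trace (R ** S ** R ** field2) = v\<^sub>0 / 2 * trace (S ** (B ** M + M ** B))"
proof -
  have "R ** field2 ** R = (1 / 2) *\<^sub>R ((R ** \<Omega>) ** M ** R + R ** M ** (\<Omega> ** R)) - \<kappa> *\<^sub>R ((R ** \<Omega>) ** M ** (\<Omega> ** R))"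
    unfolding field2_def by (simp only: mring)
  also have "\<dots> = (v\<^sub>0 / 2) *\<^sub>R (B ** M + M ** B)"
    unfolding \<Omega>R_rel unfolding R_eq by (simp add: mring vec_eq_iff field_simps)
  finally have e: "R ** field2 ** R = (v\<^sub>0 / 2) *\<^sub>R (B ** M + M ** B)" .
  have "trace (R ** (S ** R ** field2)) = trace (S ** R ** field2 ** R)" by (rule trace_mul_sym)
  then have "trace (R ** S ** R ** field2) = trace (S ** (R ** field2 ** R))"
    by (simp only: matrix_mul_assoc)
  then show ?thesis unfolding e by (simp add: mring trace_algebra_simps distrib_left)
qed

lemma field_divergence_eq:
  fixes q \<alpha> \<beta> \<epsilon> :: real
  defines "n \<equiv> real CARD('n)"
  defines "c' \<equiv> n + 1 + \<alpha> - q / 2"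
  shows "field_divergence S q \<alpha> \<beta> \<epsilon> + trace (S ** B ** B) - trace (S ** (B ** M + M ** B)) / 4 - q * trace B
    = 2 * c' * trace B - (\<alpha> + (n + 1) / 2) * trace M
      - (c' + \<beta>) * \<kappa> * (2 * trace (\<Omega> ** B) - trace (\<Omega> ** M))
      - \<beta> * (2 * trace ((P' - mat 1) ** B) - trace ((P' - mat 1) ** M))
      + \<epsilon> * (2 / v\<^sub>0 * n - trace ((J - \<kappa> *\<^sub>R mat 1) ** M) - (2 * trace (F2 ** B) - trace (F2 ** M)))"
proof -
  define tB tM t\<Omega> tOB tOM where "tB = trace B" and "tM = trace M" and "t\<Omega> = trace \<Omega>" and "tOB = trace (\<Omega> ** B)" and "tOM = trace (\<Omega> ** M)"
  define f1 f1M f2 f2M jM s1 s2 where "f1 = trace ((P' - mat 1) ** B)" and "f1M = trace ((P' - mat 1) ** M)"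
    and "f2 = trace (F2 ** B)" and "f2M = trace (F2 ** M)" and "jM = trace ((J - \<kappa> *\<^sub>R mat 1) ** M)"
    and "s1 = trace (S ** B ** B)" and "s2 = trace (S ** (B ** M + M ** B))"
  have O: "\<kappa> * v\<^sub>0 * tOB = v\<^sub>0 * tB - t\<Omega>" unfolding tOB_def tB_def t\<Omega>_def by (rule trace_\<Omega>B)
  have a: "trace (J ** (\<Omega> ** \<Omega>)) = t\<Omega>" "trace (J ** J ** (\<Omega> ** \<Omega>)) = n"
    by (simp_all add: matrix_mul_assoc inverse_relations[OF J_rel(1)] t\<Omega>_def n_def trace_algebra_simps)
  have b: "trace (P ** (\<Omega> ** \<Omega>)) = v\<^sub>0 * (\<kappa> * tOB + f1)"
    unfolding matrix_mul_assoc P\<Omega>\<Omega> P'_rel(3) f1_def tOB_def by (simp add: mring trace_algebra_simps algebra_simps)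
  have b2: "trace (P ** P ** (\<Omega> ** \<Omega>)) = v\<^sub>0 * f2"
    unfolding PP\<Omega>\<Omega> f2_def by (simp add: trace_algebra_simps)
  have "trace (R ** (\<Omega> ** \<Omega>)) = v\<^sub>0 * tOB"
    by (simp add: matrix_mul_assoc matrix_mult_scaleR_left B\<Omega> trace_algebra_simps tOB_def)
  note d = this
  note e = trace_RSR_\<Omega>\<Omega>[of S, folded s1_def]
  have T1: "trace (score S q \<alpha> \<beta> \<epsilon> ** (\<Omega> ** \<Omega>)) = \<alpha> * t\<Omega> - \<beta> * (v\<^sub>0 * (\<kappa> * tOB + f1)) + (q * \<kappa> / 2) * (v\<^sub>0 * tOB)
     - (1 / (2 * v\<^sub>0)) * (v\<^sub>0\<^sup>2 * s1) + \<epsilon> * n - \<epsilon> * (v\<^sub>0 * f2)"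
    unfolding score_def
    by (simp only: matrix_mult_add_left matrix_mult_diff_left matrix_mult_scaleR_left trace_algebra_simps a b b2 d e)
  have "J ** \<Omega> - \<kappa> *\<^sub>R (\<Omega> ** J ** \<Omega>) = mat 1 - \<kappa> *\<^sub>R \<Omega>" by simp
  then have a': "trace (J ** field2) = tM - \<kappa> * tOM"
    unfolding trace_field2[OF P_comm(2)] by (simp add: mring trace_algebra_simps tM_def tOM_def)
  have "P ** \<Omega> - \<kappa> *\<^sub>R (\<Omega> ** P ** \<Omega>) = \<kappa> *\<^sub>R \<Omega> + (P' - mat 1)" by (simp add: mring algebra_simps)
  then have b': "trace (P ** field2) = \<kappa> * tOM + f1M"
    unfolding trace_field2[OF P_comm(1)] by (simp only: matrix_mult_add_left matrix_mult_scaleR_left trace_algebra_simps f1M_def tOM_def)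
  have "R ** \<Omega> - \<kappa> *\<^sub>R (\<Omega> ** R ** \<Omega>) = \<Omega>"
    using B_rel B\<Omega> by (simp add: matrix_mult_scaleR_left)
  then have d': "trace (R ** field2) = tOM"
    unfolding trace_field2[OF R_comm] by (simp add: tOM_def)
  have "J ** J ** \<Omega> - \<kappa> *\<^sub>R (\<Omega> ** (J ** J) ** \<Omega>) = J - \<kappa> *\<^sub>R mat 1"
    by (simp add: matrix_mul_assoc inverse_relations[OF J_rel(1)])
  then have a2': "trace (J ** J ** field2) = jM"
    unfolding trace_field2[OF P_comm(3)] by (simp add: jM_def)
  have "P ** P ** \<Omega> - \<kappa> *\<^sub>R (\<Omega> ** (P ** P) ** \<Omega>) = F2"
    by (simp add: mring inverse_relations[OF P_rel(1)] algebra_simps)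
  then have b2': "trace (P ** P ** field2) = f2M"
    unfolding trace_field2[OF P_comm(4)] by (simp add: f2M_def)
  have T2: "trace (score S q \<alpha> \<beta> \<epsilon> ** field2) = \<alpha> * (tM - \<kappa> * tOM) - \<beta> * (\<kappa> * tOM + f1M) + (q * \<kappa> / 2) * tOM
     - (1 / (2 * v\<^sub>0)) * (v\<^sub>0 / 2 * s2) + \<epsilon> * jM - \<epsilon> * f2M"
    unfolding score_def
    by (simp only: matrix_mult_add_left matrix_mult_diff_left matrix_mult_scaleR_left trace_algebra_simps a' b' a2' b2' d'
        trace_RSR_field2 s2_def)
  have t\<Omega>: "t\<Omega> = v\<^sub>0 * (tB - \<kappa> * tOB)" using O by (simp add: algebra_simps)
  show ?thesis
    unfolding field_divergence_def T1 T2 n_def[symmetric] tB_def[symmetric] tM_def[symmetric] tOB_def[symmetric] tOM_def[symmetric]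
      t\<Omega>_def[symmetric] f1_def[symmetric] f1M_def[symmetric] f2_def[symmetric] f2M_def[symmetric] jM_def[symmetric] s1_def[symmetric] s2_def[symmetric]
    unfolding t\<Omega> c'_def using v0 by (simp add: field_simps power2_eq_square)
qed

lemma field_divergence_le:
  fixes q \<alpha> \<beta> \<epsilon> :: real
  defines "n \<equiv> real CARD('n)"
  defines "c' \<equiv> n + 1 + \<alpha> - q / 2"
  defines "N \<equiv> max 0 (c' + \<beta>) *\<^sub>R (mat 1 - Y\<^sub>M) + \<beta> *\<^sub>R (P\<^sub>M - mat 1) + (\<epsilon> / (1 - \<kappa>)) *\<^sub>R (P\<^sub>M ** P\<^sub>M - P\<^sub>M)"
  assumes \<beta>: "0 \<le> \<beta>" and \<epsilon>: "0 \<le> \<epsilon>"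
  shows "field_divergence S q \<alpha> \<beta> \<epsilon> + trace (S ** B ** B) - trace (S ** (B ** M + M ** B)) / 4 - q * trace B
    \<le> (2 * c' + 2 * max 0 (- (c' + \<beta>))) * trace B - (\<alpha> + (n + 1) / 2) * trace M + 2 / v\<^sub>0 * n * \<epsilon> - trace (N ** (B - M))"
proof -
  let ?D = "B - M" and ?c = "c' + \<beta>"
  have dup: "2 * trace (X ** B) - trace (X ** M) = trace (X ** B) + trace (X ** ?D)" for X
    by (simp add: matrix_mult_diff_right trace_algebra_simps)
  have OB: "0 \<le> trace (\<Omega> ** B)" and OM: "0 \<le> trace (\<Omega> ** M)"
    by (intro trace_psd_mult_nonneg psd_\<Omega> psd_B M)+
  have 1: "- ?c * \<kappa> * (2 * trace (\<Omega> ** B) - trace (\<Omega> ** M)) \<le> 2 * max 0 (- ?c) * trace B - max 0 ?c * trace ((mat 1 - Y\<^sub>M) ** ?D)"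
  proof (cases "0 \<le> ?c")
    case True
    have "?c * trace ((mat 1 - Y\<^sub>M) ** ?D) \<le> ?c * (\<kappa> * trace (\<Omega> ** ?D))"
      using klein_\<Omega> True by (rule mult_left_mono)
    moreover have "0 \<le> ?c * (\<kappa> * trace (\<Omega> ** B))" using True \<kappa> OB by simp
    ultimately show ?thesis using True unfolding dup by (simp add: algebra_simps)
  next
    case False
    have "v\<^sub>0 * (\<kappa> * trace (\<Omega> ** B)) \<le> v\<^sub>0 * trace B"
      using trace_\<Omega>B psd_trace_nonneg[OF psd_\<Omega>] by (simp add: mult_ac)
    then have "\<kappa> * trace (\<Omega> ** B) \<le> trace B" using v0 by simp
    then have "- ?c * (\<kappa> * trace (\<Omega> ** B)) \<le> - ?c * trace B" using False by (intro mult_left_mono) auto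
    moreover have "0 \<le> - ?c * (\<kappa> * trace (\<Omega> ** M))" using False \<kappa> OM by (intro mult_nonneg_nonneg) auto
    ultimately show ?thesis using False by (simp add: algebra_simps)
  qed
  have pF: "psd (P' - mat 1)"
    unfolding P'_rel(3) using \<kappa> by (intro psd_scaleR psd_P_minus_1) auto
  have "trace ((P\<^sub>M - mat 1) ** ?D) \<le> trace ((P' - mat 1) ** ?D)"
    using klein_P by (simp only: matrix_mult_diff_left[of _ "mat 1"] trace_algebra_simps)
  then have "trace ((P\<^sub>M - mat 1) ** ?D) \<le> 2 * trace ((P' - mat 1) ** B) - trace ((P' - mat 1) ** M)"
    unfolding dup using trace_psd_mult_nonneg[OF pF psd_B] by linarith
  then have 2: "\<beta> * trace ((P\<^sub>M - mat 1) ** ?D) \<le> \<beta> * (2 * trace ((P' - mat 1) ** B) - trace ((P' - mat 1) ** M))"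
    using \<beta> by (rule mult_left_mono)
  have F2: "F2 = (1 / (1 - \<kappa>)) *\<^sub>R (P' ** P' - P')"
  proof -
    have "P' ** P' - P' = (1 - \<kappa>) *\<^sub>R F2"
      by (simp add: mring algebra_simps)
    then show ?thesis using \<kappa> by simp
  qed
  have pF2: "psd F2" unfolding F2 using \<kappa> by (intro psd_scaleR psd_P'_square) auto
  have "trace ((P\<^sub>M ** P\<^sub>M - P\<^sub>M) ** ?D) / (1 - \<kappa>) \<le> trace (F2 ** ?D)"
    unfolding F2 using klein_P2 \<kappa> by (simp only: matrix_mult_scaleR_left trace_algebra_simps) (simp add: divide_right_mono)
  then have "trace ((P\<^sub>M ** P\<^sub>M - P\<^sub>M) ** ?D) / (1 - \<kappa>) \<le> 2 * trace (F2 ** B) - trace (F2 ** M)"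
    unfolding dup using trace_psd_mult_nonneg[OF pF2 psd_B] by linarith
  then have 3: "\<epsilon> * (trace ((P\<^sub>M ** P\<^sub>M - P\<^sub>M) ** ?D) / (1 - \<kappa>)) \<le> \<epsilon> * (2 * trace (F2 ** B) - trace (F2 ** M))"
    using \<epsilon> by (rule mult_left_mono)
  have "J - \<kappa> *\<^sub>R mat 1 = (1 - \<kappa>) *\<^sub>R mat 1 + J ** (\<Omega> - \<Omega> ** \<Omega>) ** transpose J"
    by (simp add: sym_ops mring inverse_relations[OF J_rel(2)] algebra_simps)
  then have "psd (J - \<kappa> *\<^sub>R mat 1)"
    using \<kappa> psd_add[OF psd_scaleR[OF psd_mat_1] psd_congruence[OF psd_square_diff[OF \<Omega>]], of "1 - \<kappa>" J] by simp
  from trace_psd_mult_nonneg[OF this M(1)]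
  have 4: "0 \<le> \<epsilon> * trace ((J - \<kappa> *\<^sub>R mat 1) ** M)" using \<epsilon> by simp
  have N: "trace (N ** ?D) = max 0 ?c * trace ((mat 1 - Y\<^sub>M) ** ?D) + \<beta> * trace ((P\<^sub>M - mat 1) ** ?D)
    + \<epsilon> * (trace ((P\<^sub>M ** P\<^sub>M - P\<^sub>M) ** ?D) / (1 - \<kappa>))"
    unfolding N_def by (simp only: matrix_mult_add_left matrix_mult_scaleR_left trace_algebra_simps) simp
  show ?thesis
    using 1 2 3 4 field_divergence_eq[of S q \<alpha> \<beta> \<epsilon>] unfolding N n_def[symmetric] c'_def[symmetric]
    by (simp only: distrib_right right_diff_distrib mult_minus_left) (simp add: mult.commute)
qed

end

end

section \<open>Integration by parts on \<open>R_set\<close>\<close>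

lemma norm_transpose: "norm (transpose A) = norm (A :: real^'n^'m)"
proof -
  have "(norm (transpose A))\<^sup>2 = (norm A)\<^sup>2"
    unfolding norm_matrix_eq_trace transpose_transpose by (rule trace_mul_sym)
  then show ?thesis by (simp add: power2_eq_iff_nonneg)
qed

lemma norm_matrix_mult_le:
  fixes A :: "real^'n^'m" and C :: "real^'p^'n"
  shows "norm (A ** C) \<le> norm A * norm C"
proof (rule power2_le_imp_le)
  have e: "(A ** C) $ i $ j = A $ i \<bullet> transpose C $ j" for i j
    by (simp add: matrix_matrix_mult_def transpose_def inner_vec_def)
  have "(norm (A ** C))\<^sup>2 = (\<Sum>i\<in>UNIV. \<Sum>j\<in>UNIV. (A ** C) $ i $ j * (A ** C) $ i $ j)"
    by (simp add: power2_norm_eq_inner inner_vec_def)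
  also have "\<dots> = (\<Sum>i\<in>UNIV. \<Sum>j\<in>UNIV. (A $ i \<bullet> transpose C $ j)\<^sup>2)"
    by (simp only: e power2_eq_square)
  also have "\<dots> \<le> (\<Sum>i\<in>UNIV. \<Sum>j\<in>UNIV. (A $ i \<bullet> A $ i) * (transpose C $ j \<bullet> transpose C $ j))"
    by (intro sum_mono Cauchy_Schwarz_ineq)
  also have "\<dots> = (norm A)\<^sup>2 * (norm (transpose C))\<^sup>2"
    unfolding power2_norm_eq_inner inner_vec_def[of A] inner_vec_def[of "transpose C"] by (rule sum_product[symmetric])
  finally show "(norm (A ** C))\<^sup>2 \<le> (norm A * norm C)\<^sup>2"
    by (simp add: norm_transpose power_mult_distrib)
qed simp

lemma psd_norm_le_trace:
  fixes A :: "real^'n^'n"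
  assumes "psd A"
  shows "norm A \<le> trace A"
proof -
  obtain L :: "real^'n^'n" where L: "A = L ** transpose L" by (rule psd_factor[OF assms])
  then have "norm A \<le> norm L * norm (transpose L)" by (simp add: norm_matrix_mult_le)
  also have "\<dots> = trace A" unfolding L norm_transpose norm_matrix_eq_trace[symmetric] by (simp add: power2_eq_square)
  finally show ?thesis .
qed

lemma abs_entry_le_norm: "\<bar>(A :: real^'n^'m) $ i $ j\<bar> \<le> norm A"
  using component_le_norm_cart[of "A $ i" j] Finite_Cartesian_Product.norm_nth_le[of A i] by linarith

lemma trace_inverse_ge:
  fixes A :: "real^'n^'n"
  assumes A: "pos_def_matrix A" and y: "norm y = 1"
  shows "1 \<le> (y \<bullet> (A *v y)) * trace (matrix_inv A)"
proof -
  note inv = pos_def_invertible[OF A]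
  obtain L :: "real^'n^'n" where L: "A = L ** transpose L" by (rule psd_factor[OF pos_def_imp_psd[OF A]])
  have form: "x \<bullet> (A *v z) = (transpose L *v x) \<bullet> (transpose L *v z)" for x z
    unfolding L matrix_vector_mul_assoc[symmetric] by (rule inner_matrix_vector_transpose)
  define z where "z = matrix_inv A *v y"
  have Az: "A *v z = y" by (simp add: z_def matrix_vector_mul_assoc matrix_inv[OF inv])
  have "1 = (y \<bullet> (A *v z))\<^sup>2" using y by (simp add: Az power2_norm_eq_inner[symmetric])
  also have "\<dots> \<le> (y \<bullet> (A *v y)) * (z \<bullet> (A *v z))"
    unfolding form by (rule Cauchy_Schwarz_ineq)
  also have "z \<bullet> (A *v z) = y \<bullet> (matrix_inv A *v y)"
    unfolding Az by (simp add: z_def inner_commute)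
  also have "(y \<bullet> (A *v y)) * (y \<bullet> (matrix_inv A *v y)) \<le> (y \<bullet> (A *v y)) * trace (matrix_inv A)"
  proof (rule mult_left_mono)
    have "y \<bullet> (matrix_inv A *v y) \<le> norm (matrix_inv A)"
      using quadratic_form_le[of y "matrix_inv A"] y by simp
    also have "\<dots> \<le> trace (matrix_inv A)"
      by (intro psd_norm_le_trace pos_def_imp_psd pos_def_matrix_inv A)
    finally show "y \<bullet> (matrix_inv A *v y) \<le> trace (matrix_inv A)" .
    show "0 \<le> y \<bullet> (A *v y)" by (rule psdD(2)[OF pos_def_imp_psd[OF A]])
  qed
  finally show ?thesis .
qed

lemma abs_det_le:
  fixes A :: "real^'n^'n"
  assumes K: "\<And>i j. \<bar>A $ i $ j\<bar> \<le> K"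
  shows "\<bar>det A\<bar> \<le> fact CARD('n) * K ^ CARD('n)"
proof -
  have "\<bar>det A\<bar> \<le> (\<Sum>p | p permutes (UNIV :: 'n set). \<bar>of_int (sign p) * (\<Prod>i\<in>UNIV. A $ i $ p i)\<bar>)"
    unfolding det_def by (rule sum_abs)
  also have "\<dots> \<le> (\<Sum>p | p permutes (UNIV :: 'n set). K ^ CARD('n))"
  proof (rule sum_mono)
    fix p :: "'n \<Rightarrow> 'n"
    have "\<bar>of_int (sign p) * (\<Prod>i\<in>UNIV. A $ i $ p i)\<bar> = (\<Prod>i\<in>UNIV. \<bar>A $ i $ p i\<bar>)"
      by (simp add: abs_mult sign_def abs_prod)
    also have "\<dots> \<le> (\<Prod>i\<in>(UNIV :: 'n set). K)" by (rule prod_mono) (use K in auto)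
    finally show "\<bar>of_int (sign p) * (\<Prod>i\<in>UNIV. A $ i $ p i)\<bar> \<le> K ^ CARD('n)" by simp
  qed
  also have "\<dots> = fact CARD('n) * K ^ CARD('n)"
    by (simp add: card_permutations[of UNIV "CARD('n)"])
  finally show ?thesis .
qed

lemma psd_det_le:
  assumes "psd (A :: real^'n^'n)" "trace A \<le> t"
  shows "det A \<le> fact CARD('n) * t ^ CARD('n)"
  using abs_det_le[of A t] order_trans[OF abs_entry_le_norm psd_norm_le_trace[OF assms(1)]] assms(2)
  by (metis abs_ge_self order_trans)

lemma DERIV_zero_of_quadratic_bound:
  fixes f :: "real \<Rightarrow> real"
  assumes f: "\<And>t. \<bar>f t\<bar> \<le> K * t\<^sup>2"
  shows "(f has_field_derivative 0) (at 0)"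
proof -
  have f0: "f 0 = 0" using f[of 0] by simp
  have "((\<lambda>t. \<bar>K\<bar> * \<bar>t\<bar>) \<longlongrightarrow> \<bar>K\<bar> * \<bar>0\<bar>) (at (0::real))" by (intro tendsto_intros)
  then have l: "((\<lambda>t. \<bar>K\<bar> * \<bar>t\<bar>) \<longlongrightarrow> 0) (at (0::real))" by simp
  have "((\<lambda>t. (f t - f 0) / (t - 0)) \<longlongrightarrow> 0) (at 0)"
  proof (rule Lim_null_comparison[OF _ l])
    have "norm ((f t - f 0) / (t - 0)) \<le> \<bar>K\<bar> * \<bar>t\<bar>" if "t \<noteq> 0" for t
    proof -
      have "\<bar>f t\<bar> \<le> \<bar>K\<bar> * (\<bar>t\<bar> * \<bar>t\<bar>)"
        by (rule order_trans[OF f]) (simp add: power2_eq_square mult_right_mono flip: abs_mult)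
      then show ?thesis using that by (simp add: f0 pos_divide_le_eq mult.assoc)
    qed
    then show "\<forall>\<^sub>F t in at 0. norm ((f t - f 0) / (t - 0)) \<le> \<bar>K\<bar> * \<bar>t\<bar>"
      by (simp add: eventually_at_filter)
  qed
  then show ?thesis by (simp add: has_field_derivative_iff)
qed

lemma R_set_bounded_image:
  fixes f :: "real^'n^'n \<Rightarrow> real"
  assumes "continuous_on UNIV f"
  obtains K where "0 < K" "\<And>x. x \<in> R_set \<Longrightarrow> \<bar>f x\<bar> \<le> K"
proof -
  have "bounded (R_set :: (real^'n^'n) set)"
    unfolding bounded_iff
    by (intro exI[of _ "\<Sum>i\<in>(UNIV :: 'n set). \<Sum>j\<in>(UNIV :: 'n set). 1"] ballI
        order_trans[OF norm_matrix_le_sum] sum_mono R_set_entry_le)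
  then have "compact (f ` closure R_set)"
    using assms by (intro compact_continuous_image) (auto intro: continuous_on_subset)
  then obtain K where "\<And>y. y \<in> f ` closure R_set \<Longrightarrow> norm y \<le> K"
    using compact_imp_bounded bounded_iff by metis
  then have "\<bar>f x\<bar> \<le> \<bar>K\<bar> + 1" if "x \<in> R_set" for x
    using that closure_subset by fastforce
  then show ?thesis by (intro that[of "\<bar>K\<bar> + 1"]) auto
qed

locale regularised_density =
  fixes v\<^sub>0 \<kappa> q \<alpha> \<beta> \<epsilon> :: real and S :: "real^'n^'n"
  assumes v0: "0 < v\<^sub>0" and \<kappa>: "0 \<le> \<kappa>" "\<kappa> < 1" and q: "0 \<le> q" and \<alpha>: "0 \<le> \<alpha>" and \<beta>: "0 \<le> \<beta>"
    and \<epsilon>: "0 < \<epsilon>" and S: "psd S"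
begin

definition log_density :: "real^'n^'n \<Rightarrow> real" where
  "log_density \<Omega> = \<alpha> * ln (det \<Omega>) + \<beta> * ln (det (mat 1 - \<Omega>)) - q / 2 * ln (det (mat 1 - \<kappa> *\<^sub>R \<Omega>))
     - trace (precision v\<^sub>0 \<kappa> \<Omega> ** S) / 2"

definition barrier :: "real^'n^'n \<Rightarrow> real" where
  "barrier \<Omega> = trace (matrix_inv \<Omega>) + trace (matrix_inv (mat 1 - \<Omega>))"

definition density :: "real^'n^'n \<Rightarrow> real" where
  "density \<Omega> = exp (log_density \<Omega>)"

definition reg_density :: "real^'n^'n \<Rightarrow> real" where
  "reg_density \<Omega> = density \<Omega> * exp (- \<epsilon> * barrier \<Omega>)"

lemma point: "\<Omega> \<in> R_set \<Longrightarrow> omega_point \<Omega> v\<^sub>0 \<kappa>"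
  using v0 \<kappa> by unfold_locales

abbreviation "score\<^sub>\<Omega> \<Omega> \<equiv> omega_point.score \<Omega> v\<^sub>0 \<kappa> S q \<alpha> \<beta> \<epsilon>"

lemma measurable_ops [measurable]:
  "resolvent \<kappa> \<in> borel_measurable borel" "precision v\<^sub>0 \<kappa> \<in> borel_measurable borel"
  "log_density \<in> borel_measurable borel" "barrier \<in> borel_measurable borel"
  "density \<in> borel_measurable borel" "reg_density \<in> borel_measurable borel"
proof -
  show 1 [measurable]: "resolvent \<kappa> \<in> borel_measurable borel" unfolding resolvent_def by measurable
  show [measurable]: "precision v\<^sub>0 \<kappa> \<in> borel_measurable borel" unfolding precision_def by measurable
  show [measurable]: "log_density \<in> borel_measurable borel" unfolding log_density_def by measurable
  show [measurable]: "barrier \<in> borel_measurable borel" unfolding barrier_def by measurable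
  show [measurable]: "density \<in> borel_measurable borel" unfolding density_def by measurable
  show "reg_density \<in> borel_measurable borel" unfolding reg_density_def by measurable
qed

lemma barrier_nonneg: "\<Omega> \<in> R_set \<Longrightarrow> 0 \<le> barrier \<Omega>"
  unfolding barrier_def by (intro add_nonneg_nonneg psd_trace_nonneg omega_point.psd_J[OF point] omega_point.psd_P[OF point])

lemma density_pos: "0 < density \<Omega>" and reg_density_pos: "0 < reg_density \<Omega>"
  by (simp_all add: density_def reg_density_def)

lemma trace_R_set:
  fixes \<Omega> :: "real^'n^'n"
  shows "\<Omega> \<in> R_set \<Longrightarrow> trace \<Omega> \<le> real CARD('n)" "\<Omega> \<in> R_set \<Longrightarrow> trace (mat 1 - \<Omega>) \<le> real CARD('n)"
  using psd_trace_nonneg[OF omega_point.psd_\<Omega>[OF point[of \<Omega>]]] psd_trace_nonneg[OF omega_point.psd_1_\<Omega>[OF point[of \<Omega>]]]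
  by (auto simp: trace_algebra_simps)

definition "dens_bound = (\<alpha> + \<beta>) * ln (fact CARD('n) * real CARD('n) ^ CARD('n))
    + q / 2 * ln (fact CARD('n) * (real CARD('n) / (1 - \<kappa>)) ^ CARD('n))"

lemma density_le:
  assumes \<Omega>: "\<Omega> \<in> R_set"
  shows "density \<Omega> \<le> exp dens_bound"
proof -
  interpret omega_point \<Omega> v\<^sub>0 \<kappa> by (rule point[OF \<Omega>])
  have 1: "ln (det \<Omega>) \<le> ln (fact CARD('n) * real CARD('n) ^ CARD('n))"
    using psd_det_le[OF psd_\<Omega> trace_R_set(1)[OF \<Omega>]] pos_def_det_pos[OF R_setD(1)[OF \<Omega>]] by (simp add: ln_le_cancel_iff)
  have 2: "ln (det (mat 1 - \<Omega>)) \<le> ln (fact CARD('n) * real CARD('n) ^ CARD('n))"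
    using psd_det_le[OF psd_1_\<Omega> trace_R_set(2)[OF \<Omega>]] pos_def_det_pos[OF R_setD(2)[OF \<Omega>]] by (simp add: ln_le_cancel_iff)
  have RY: "R ** (mat 1 - \<kappa> *\<^sub>R \<Omega>) = mat 1"
    unfolding resolvent_def by (rule matrix_inv_left[OF pos_def_invertible[OF pos_def_1_\<kappa>\<Omega>]])
  have dR: "det R * det (mat 1 - \<kappa> *\<^sub>R \<Omega>) = 1" using arg_cong[OF RY, of det] by (simp add: det_mul)
  have dY: "0 < det (mat 1 - \<kappa> *\<^sub>R \<Omega>)" by (rule pos_def_det_pos[OF pos_def_1_\<kappa>\<Omega>])
  then have dR0: "0 < det R" using dR by (metis mult_less_0_iff not_less_iff_gr_or_eq mult_zero_left zero_less_one)
  have "ln (det R) + ln (det (mat 1 - \<kappa> *\<^sub>R \<Omega>)) = 0"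
    using dR dR0 dY ln_mult_pos[of "det R" "det (mat 1 - \<kappa> *\<^sub>R \<Omega>)"] by simp
  moreover have "trace R \<le> real CARD('n) / (1 - \<kappa>)"
    using trace_R_le \<kappa> by (simp add: field_simps)
  then have "ln (det R) \<le> ln (fact CARD('n) * (real CARD('n) / (1 - \<kappa>)) ^ CARD('n))"
    using psd_det_le[OF psd_R] dR0 by (subst ln_le_cancel_iff) (auto intro: order.strict_trans2)
  ultimately have 3: "- (q / 2 * ln (det (mat 1 - \<kappa> *\<^sub>R \<Omega>))) \<le> q / 2 * ln (fact CARD('n) * (real CARD('n) / (1 - \<kappa>)) ^ CARD('n))"
    using q mult_left_mono[of "- ln (det (mat 1 - \<kappa> *\<^sub>R \<Omega>))" _ "q / 2"] by simp
  have 4: "0 \<le> trace (B ** S)" by (rule trace_psd_mult_nonneg[OF psd_B S])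
  show ?thesis
    unfolding density_def log_density_def dens_bound_def
    using mult_left_mono[OF 1 \<alpha>] mult_left_mono[OF 2 \<beta>] 3 4 by (simp add: distrib_right)
qed

lemma reg_density_le: "\<Omega> \<in> R_set \<Longrightarrow> reg_density \<Omega> \<le> exp dens_bound * exp (- \<epsilon> * barrier \<Omega>)"
  unfolding reg_density_def by (intro mult_right_mono density_le) auto

lemma log_density_line_deriv:
  assumes \<Omega>: "\<Omega> \<in> R_set" and H: "transpose H = H"
  shows "((\<lambda>t. log_density (\<Omega> + t *\<^sub>R H) - \<epsilon> * barrier (\<Omega> + t *\<^sub>R H)) has_field_derivative trace (score\<^sub>\<Omega> \<Omega> ** H)) (at 0)"
proof -
  interpret omega_point \<Omega> v\<^sub>0 \<kappa> by (rule point[OF \<Omega>])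
  note pd = R_setD(1)[OF \<Omega>] R_setD(2)[OF \<Omega>] pos_def_1_\<kappa>\<Omega>
  note inv = pd[THEN pos_def_invertible] and dp = pd[THEN pos_def_det_pos]
  have e1: "mat 1 - (\<Omega> + t *\<^sub>R H) = (mat 1 - \<Omega>) + t *\<^sub>R (- H)" for t by (simp add: algebra_simps)
  have e2: "mat 1 - \<kappa> *\<^sub>R (\<Omega> + t *\<^sub>R H) = (mat 1 - \<kappa> *\<^sub>R \<Omega>) + t *\<^sub>R (- \<kappa> *\<^sub>R H)" for t by (simp add: algebra_simps)
  have D: "((\<lambda>t. ln (det (A + t *\<^sub>R K))) has_field_derivative trace (matrix_inv A ** K)) (at 0)"
    if "invertible A" "0 < det A" for A K :: "real^'n^'n"
    using DERIV_chain2[OF DERIV_ln_divide det_line_deriv[of A 0 K]] that by simp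
  have I: "((\<lambda>t. f (matrix_inv (A + t *\<^sub>R K))) has_field_derivative f (- (matrix_inv A ** K ** matrix_inv A))) (at 0)"
    if "invertible A" "linear f" for A K :: "real^'n^'n" and f :: "real^'n^'n \<Rightarrow> real"
    using bounded_linear.has_vector_derivative[OF linear_conv_bounded_linear[THEN iffD1, OF that(2)] matrix_inv_line_deriv[of A 0 K]] that
    by (simp add: has_real_derivative_iff_has_vector_derivative)
  have lt: "linear (trace :: real^'n^'n \<Rightarrow> real)"
    by (rule linearI) (simp_all add: trace_algebra_simps)
  have lB: "linear (\<lambda>X. trace (C ** X ** S))" for C :: "real^'n^'n"
    by (rule linearI) (simp_all add: trace_algebra_simps matrix_algebra_simps)
  have dB: "((\<lambda>t. trace (precision v\<^sub>0 \<kappa> (\<Omega> + t *\<^sub>R H) ** S)) has_field_derivative trace (R ** S ** R ** H) / v\<^sub>0) (at 0)"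
  proof -
    let ?R = "\<lambda>t. matrix_inv ((mat 1 - \<kappa> *\<^sub>R \<Omega>) + t *\<^sub>R (- \<kappa> *\<^sub>R H))"
    have R0: "matrix_inv (mat 1 - \<kappa> *\<^sub>R \<Omega>) = R" by (simp add: resolvent_def)
    have R1: "- (R ** (- \<kappa> *\<^sub>R H) ** R) = \<kappa> *\<^sub>R (R ** H ** R)" by (simp add: matrix_algebra_simps)
    have "((\<lambda>t. trace (\<Omega> ** ?R t ** S)) has_field_derivative trace (\<Omega> ** (\<kappa> *\<^sub>R (R ** H ** R)) ** S)) (at 0)"
      using I[OF inv(3) lB[of \<Omega>], of "- \<kappa> *\<^sub>R H"] unfolding R0 R1 .
    moreover have "((\<lambda>t. trace (H ** ?R t ** S)) has_field_derivative trace (H ** (\<kappa> *\<^sub>R (R ** H ** R)) ** S)) (at 0)"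
      using I[OF inv(3) lB[of H], of "- \<kappa> *\<^sub>R H"] unfolding R0 R1 .
    ultimately have "((\<lambda>t. (1 / v\<^sub>0) * (trace (\<Omega> ** ?R t ** S) + t * trace (H ** ?R t ** S))) has_field_derivative
      (1 / v\<^sub>0) * (trace (\<Omega> ** (\<kappa> *\<^sub>R (R ** H ** R)) ** S) + trace (H ** R ** S))) (at 0)"
    proof -
      assume a: "((\<lambda>t. trace (\<Omega> ** ?R t ** S)) has_field_derivative trace (\<Omega> ** (\<kappa> *\<^sub>R (R ** H ** R)) ** S)) (at 0)"
        and b: "((\<lambda>t. trace (H ** ?R t ** S)) has_field_derivative trace (H ** (\<kappa> *\<^sub>R (R ** H ** R)) ** S)) (at 0)"
      have "?R 0 = R" by (simp add: R0)
      then show ?thesis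
        using DERIV_cmult[OF DERIV_add[OF a DERIV_mult[OF DERIV_ident b]], of "1 / v\<^sub>0"] by simp
    qed
    moreover have "(1 / v\<^sub>0) * (trace (\<Omega> ** ?R t ** S) + t * trace (H ** ?R t ** S)) = trace (precision v\<^sub>0 \<kappa> (\<Omega> + t *\<^sub>R H) ** S)" for t
      unfolding precision_def resolvent_def e2 by (simp add: matrix_algebra_simps trace_algebra_simps distrib_left)
    moreover have "trace (\<Omega> ** (\<kappa> *\<^sub>R (R ** H ** R)) ** S) + trace (H ** R ** S) = trace (R ** S ** R ** H)"
    proof -
      have "\<Omega> ** (\<kappa> *\<^sub>R (R ** H ** R)) + H ** R = (mat 1 + \<kappa> *\<^sub>R (\<Omega> ** R)) ** H ** R"
        by (simp add: mring del: \<Omega>R_rel)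
      also have "mat 1 + \<kappa> *\<^sub>R (\<Omega> ** R) = R" using R_rel0(2) by (simp only: diff_eq_eq)
      finally have "trace ((\<Omega> ** (\<kappa> *\<^sub>R (R ** H ** R)) + H ** R) ** S) = trace ((R ** H) ** (R ** S))"
        by (simp only: matrix_mul_assoc)
      also have "\<dots> = trace ((R ** S) ** (R ** H))" by (rule trace_mul_sym)
      finally show ?thesis by (simp only: matrix_mult_add_left trace_algebra_simps matrix_mul_assoc)
    qed
    ultimately show ?thesis by simp
  qed
  have 1: "((\<lambda>t. ln (det (\<Omega> + t *\<^sub>R H))) has_field_derivative trace (J ** H)) (at 0)"
    by (rule D[OF inv(1) dp(1)])
  have 2: "((\<lambda>t. ln (det (mat 1 - (\<Omega> + t *\<^sub>R H)))) has_field_derivative - trace (P ** H)) (at 0)"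
    unfolding e1 using D[OF inv(2) dp(2), of "- H"] by (simp add: matrix_algebra_simps trace_algebra_simps)
  have 3: "((\<lambda>t. ln (det (mat 1 - \<kappa> *\<^sub>R (\<Omega> + t *\<^sub>R H)))) has_field_derivative - \<kappa> * trace (R ** H)) (at 0)"
    unfolding e2 using D[OF inv(3) dp(3), of "- \<kappa> *\<^sub>R H"] by (simp add: matrix_algebra_simps trace_algebra_simps resolvent_def)
  have c: "trace (X ** H ** X) = trace (X ** X ** H)" for X by (rule trace_cyclic)
  have 4: "((\<lambda>t. trace (matrix_inv (\<Omega> + t *\<^sub>R H))) has_field_derivative - trace (J ** J ** H)) (at 0)"
    using I[OF inv(1) lt, of H] by (simp add: trace_algebra_simps c)
  have 5: "((\<lambda>t. trace (matrix_inv (mat 1 - (\<Omega> + t *\<^sub>R H)))) has_field_derivative trace (P ** P ** H)) (at 0)"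
    unfolding e1 using I[OF inv(2) lt, of "- H"] by (simp add: trace_algebra_simps matrix_algebra_simps c)
  have "((\<lambda>t. log_density (\<Omega> + t *\<^sub>R H) - \<epsilon> * barrier (\<Omega> + t *\<^sub>R H)) has_field_derivative
     (\<alpha> * trace (J ** H) + \<beta> * - trace (P ** H) - q / 2 * (- \<kappa> * trace (R ** H)) - trace (R ** S ** R ** H) / v\<^sub>0 / 2)
      - \<epsilon> * (- trace (J ** J ** H) + trace (P ** P ** H))) (at 0)"
    unfolding log_density_def barrier_def
    by (intro DERIV_diff DERIV_add DERIV_cmult DERIV_cdivide 1 2 3 4 5 dB)
  moreover have "trace (score S q \<alpha> \<beta> \<epsilon> ** H) = (\<alpha> * trace (J ** H) + \<beta> * - trace (P ** H) - q / 2 * (- \<kappa> * trace (R ** H)) - trace (R ** S ** R ** H) / v\<^sub>0 / 2)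
      - \<epsilon> * (- trace (J ** J ** H) + trace (P ** P ** H))"
    unfolding score_def by (simp only: matrix_mult_add_left matrix_mult_diff_left matrix_mult_scaleR_left trace_algebra_simps)
      (simp add: algebra_simps)
  ultimately show ?thesis by simp
qed

lemma score_le:
  obtains K where "0 < K" "\<And>\<Omega>. \<Omega> \<in> R_set \<Longrightarrow> norm (score\<^sub>\<Omega> \<Omega>) \<le> K * (1 + barrier \<Omega>)\<^sup>2"
proof -
  define \<rho> where "\<rho> = real CARD('n) / (1 - \<kappa>)"
  define K where "K = \<alpha> + \<beta> + q * \<kappa> / 2 * \<rho> + 1 / (2 * v\<^sub>0) * (\<rho> * norm S * \<rho>) + \<epsilon>"
  have \<rho>: "0 \<le> \<rho>" using \<kappa> by (simp add: \<rho>_def)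
  have "norm (score\<^sub>\<Omega> \<Omega>) \<le> K * (1 + barrier \<Omega>)\<^sup>2" if \<Omega>: "\<Omega> \<in> R_set" for \<Omega>
  proof -
    interpret omega_point \<Omega> v\<^sub>0 \<kappa> by (rule point[OF \<Omega>])
    define s where "s = barrier \<Omega>"
    have tJ: "0 \<le> trace J" and tP: "0 \<le> trace P" by (intro psd_trace_nonneg psd_J psd_P)+
    have s: "norm J \<le> s" "norm P \<le> s" "0 \<le> s"
      using psd_norm_le_trace[OF psd_J] psd_norm_le_trace[OF psd_P] tJ tP by (auto simp: s_def barrier_def)
    have R: "norm R \<le> \<rho>"
    proof (rule order_trans[OF psd_norm_le_trace[OF psd_R]])
      show "trace R \<le> \<rho>" using trace_R_le \<kappa> by (simp add: \<rho>_def pos_le_divide_eq mult.commute)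
    qed
    have JJ: "norm J + norm P \<le> s"
      using psd_norm_le_trace[OF psd_J] psd_norm_le_trace[OF psd_P] by (auto simp: s_def barrier_def)
    have sq: "norm (J ** J) + norm (P ** P) \<le> s\<^sup>2"
    proof -
      have "norm (J ** J) + norm (P ** P) \<le> norm J * norm J + norm P * norm P"
        by (intro add_mono norm_matrix_mult_le)
      also have "\<dots> \<le> (norm J + norm P)\<^sup>2" by (simp add: power2_eq_square algebra_simps)
      also have "\<dots> \<le> s\<^sup>2" using JJ by (intro power_mono) auto
      finally show ?thesis .
    qed
    have RSR: "norm (R ** S ** R) \<le> \<rho> * norm S * \<rho>"
    proof -
      have "norm (R ** S ** R) \<le> norm (R ** S) * norm R" by (rule norm_matrix_mult_le)
      also have "\<dots> \<le> (norm R * norm S) * norm R" by (intro mult_right_mono norm_matrix_mult_le) auto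
      also have "\<dots> \<le> (\<rho> * norm S) * \<rho>" using R \<rho> by (intro mult_mono) auto
      finally show ?thesis .
    qed
    have "norm (score S q \<alpha> \<beta> \<epsilon>) \<le> \<alpha> * norm J + \<beta> * norm P + (q * \<kappa> / 2) * norm R + (1 / (2 * v\<^sub>0)) * norm (R ** S ** R)
       + \<epsilon> * norm (J ** J) + \<epsilon> * norm (P ** P)"
    proof -
      have "norm (x1 - x2 + x3 - x4 + x5 - x6) \<le> norm x1 + norm x2 + norm x3 + norm x4 + norm x5 + norm x6" for x1 x2 x3 x4 x5 x6 :: "real^'n^'n"
        by (intro order_trans[OF norm_triangle_ineq4] order_trans[OF norm_triangle_ineq] add_mono order_refl)
      note tri = this
      show ?thesis
        unfolding score_def by (rule order_trans[OF tri]) (use \<alpha> \<beta> \<epsilon> q \<kappa> v0 in \<open>simp add: abs_mult\<close>)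
    qed
    also have "\<dots> \<le> \<alpha> * (1 + s)\<^sup>2 + \<beta> * (1 + s)\<^sup>2 + (q * \<kappa> / 2 * \<rho>) * (1 + s)\<^sup>2 + (1 / (2 * v\<^sub>0) * (\<rho> * norm S * \<rho>)) * (1 + s)\<^sup>2 + \<epsilon> * (1 + s)\<^sup>2"
    proof -
      have g1: "1 \<le> (1 + s)\<^sup>2" "s \<le> (1 + s)\<^sup>2" "s\<^sup>2 \<le> (1 + s)\<^sup>2" using s(3) by (simp_all add: power2_eq_square algebra_simps)
      have "\<alpha> * norm J \<le> \<alpha> * (1 + s)\<^sup>2" "\<beta> * norm P \<le> \<beta> * (1 + s)\<^sup>2"
        using s g1 \<alpha> \<beta> by (auto intro!: mult_left_mono)
      moreover have "(q * \<kappa> / 2) * norm R \<le> (q * \<kappa> / 2 * \<rho>) * (1 + s)\<^sup>2"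
        using mult_mono[OF mult_left_mono[OF R, of "q * \<kappa> / 2"] g1(1)] q \<kappa> \<rho> by simp
      moreover have "(1 / (2 * v\<^sub>0)) * norm (R ** S ** R) \<le> (1 / (2 * v\<^sub>0) * (\<rho> * norm S * \<rho>)) * (1 + s)\<^sup>2"
        using mult_mono[OF mult_left_mono[OF RSR, of "1 / (2 * v\<^sub>0)"] g1(1)] v0 \<rho> by simp
      moreover have "\<epsilon> * (norm (J ** J) + norm (P ** P)) \<le> \<epsilon> * (1 + s)\<^sup>2"
        using sq g1 \<epsilon> by (intro mult_left_mono) auto
      ultimately show ?thesis unfolding distrib_left by linarith
    qed
    also have "\<dots> = K * (1 + s)\<^sup>2" by (simp only: K_def distrib_right)
    finally show ?thesis by (simp add: s_def)
  qed
  moreover have "0 < K" using \<alpha> \<beta> \<epsilon> q \<kappa> v0 \<rho> by (simp add: K_def add_nonneg_pos)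
  ultimately show ?thesis by (intro that)
qed

lemma barrier_exp_le:
  assumes "0 \<le> s"
  shows "(1 + s)\<^sup>2 * exp (- \<epsilon> * s) \<le> 1 + 2 / \<epsilon> + 2 / \<epsilon>\<^sup>2"
proof -
  have e: "1 + \<epsilon> * s + (\<epsilon> * s)\<^sup>2 / 2 \<le> exp (\<epsilon> * s)"
    using exp_lower_Taylor_quadratic[of "\<epsilon> * s"] assms \<epsilon> by simp
  have "(1 + s)\<^sup>2 = 1 + 2 / \<epsilon> * (\<epsilon> * s) + 2 / \<epsilon>\<^sup>2 * ((\<epsilon> * s)\<^sup>2 / 2)"
    using \<epsilon> by (simp add: field_simps power2_eq_square)
  also have "\<dots> \<le> 1 * exp (\<epsilon> * s) + 2 / \<epsilon> * exp (\<epsilon> * s) + 2 / \<epsilon>\<^sup>2 * exp (\<epsilon> * s)"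
  proof -
    have "0 \<le> \<epsilon> * s" using assms \<epsilon> by simp
    then have "1 \<le> exp (\<epsilon> * s)" "\<epsilon> * s \<le> exp (\<epsilon> * s)" "(\<epsilon> * s)\<^sup>2 / 2 \<le> exp (\<epsilon> * s)"
      using e zero_le_power2[of "\<epsilon> * s"] by linarith+
    then show ?thesis using \<epsilon> by (intro add_mono mult_left_mono) auto
  qed
  finally have "(1 + s)\<^sup>2 \<le> (1 + 2 / \<epsilon> + 2 / \<epsilon>\<^sup>2) * exp (\<epsilon> * s)" by (simp only: distrib_right)
  then have "(1 + s)\<^sup>2 * exp (- \<epsilon> * s) \<le> (1 + 2 / \<epsilon> + 2 / \<epsilon>\<^sup>2) * exp (\<epsilon> * s) * exp (- \<epsilon> * s)"
    by (rule mult_right_mono) simp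
  then show ?thesis by (simp add: mult.assoc mult_exp_exp)
qed

text \<open>Extended by zero, the regularised density is differentiable across the boundary of \<open>R_set\<close>.\<close>

lemma reg_density_outside:
  assumes x: "x \<notin> R_set" "transpose x = x" and H: "transpose H = H"
  obtains K where "\<And>t. indicator R_set (x + t *\<^sub>R H) * reg_density (x + t *\<^sub>R H) \<le> K * t\<^sup>2"
proof -
  define h where "h = norm H + 1"
  have h: "0 < h" by (simp add: h_def add_nonneg_pos)
  obtain A where A: "A = x \<or> A = mat 1 - x" "\<not> pos_def_matrix A"
    using x(1) by (auto simp: R_set_def)
  have "transpose A = A" using A(1) x(2) by (auto simp: transpose_algebra_simps)
  then obtain y0 where y0: "y0 \<noteq> 0" "y0 \<bullet> (A *v y0) \<le> 0" using A(2) by (auto simp: pos_def_matrix_def not_less)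
  define y where "y = y0 /\<^sub>R norm y0"
  have y: "norm y = 1" "y \<bullet> (A *v y) \<le> 0"
    using y0 by (auto simp: y_def matrix_vector_mult_scaleR mult_nonneg_nonpos)
  have Hy: "\<bar>y \<bullet> (H *v y)\<bar> \<le> h" using quadratic_form_le[of y H] y(1) by (simp add: h_def)
  define K where "K = exp dens_bound * (2 * h\<^sup>2 / \<epsilon>\<^sup>2)"
  have "indicator R_set (x + t *\<^sub>R H) * reg_density (x + t *\<^sub>R H) \<le> K * t\<^sup>2" for t
  proof (cases "x + t *\<^sub>R H \<in> R_set")
    case False
    then show ?thesis by (simp add: K_def)
  next
    case True
    then have t: "t \<noteq> 0" using x(1) by auto
    define \<Omega> where "\<Omega> = x + t *\<^sub>R H"
    have \<Omega>: "\<Omega> \<in> R_set" using True by (simp add: \<Omega>_def)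
    define C where "C = (if A = x then \<Omega> else mat 1 - \<Omega>)"
    have pC: "pos_def_matrix C" using R_setD[OF \<Omega>] by (simp add: C_def)
    have "C = A + (if A = x then t else - t) *\<^sub>R H"
    proof (cases "A = x")
      case False
      then have "A = mat 1 - x" using A(1) by simp
      then show ?thesis using False by (simp only: C_def \<Omega>_def if_False) (simp add: algebra_simps)
    qed (simp add: C_def \<Omega>_def)
    then have "y \<bullet> (C *v y) = y \<bullet> (A *v y) + (if A = x then t else - t) * (y \<bullet> (H *v y))"
      by (simp only: matrix_vector_mult_add_rdistrib scaleR_matrix_vector_assoc[symmetric] inner_add_right inner_scaleR_right)
    also have "\<dots> \<le> \<bar>t\<bar> * h"
      using y(2) mult_left_mono[OF Hy, of "\<bar>t\<bar>"] abs_ge_self[of "(if A = x then t else - t) * (y \<bullet> (H *v y))"]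
      by (simp add: abs_mult split: if_splits)
    finally have c: "y \<bullet> (C *v y) \<le> \<bar>t\<bar> * h" .
    have tC: "0 \<le> trace (matrix_inv C)" by (intro psd_trace_nonneg pos_def_imp_psd pos_def_matrix_inv pC)
    have "1 \<le> (y \<bullet> (C *v y)) * trace (matrix_inv C)" by (rule trace_inverse_ge[OF pC y(1)])
    also have "\<dots> \<le> (\<bar>t\<bar> * h) * trace (matrix_inv C)" by (rule mult_right_mono[OF c tC])
    also have "\<dots> \<le> (\<bar>t\<bar> * h) * barrier \<Omega>"
    proof (rule mult_left_mono)
      have "0 \<le> trace (matrix_inv \<Omega>)" "0 \<le> trace (matrix_inv (mat 1 - \<Omega>))"
        by (intro psd_trace_nonneg pos_def_imp_psd pos_def_matrix_inv R_setD \<Omega>)+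
      then show "trace (matrix_inv C) \<le> barrier \<Omega>" by (simp add: C_def barrier_def)
    qed (use h in auto)
    finally have b: "1 \<le> (\<bar>t\<bar> * h) * barrier \<Omega>" .
    define s where "s = \<epsilon> * barrier \<Omega>"
    have sp: "0 < s" using b \<epsilon> h t by (simp add: s_def) (smt (verit, ccfv_SIG) mult_nonneg_nonpos mult_pos_pos zero_less_abs_iff)
    have "s\<^sup>2 / 2 \<le> exp s" using exp_lower_Taylor_quadratic[of s] sp by simp
    then have "exp (- s) \<le> 2 / s\<^sup>2" using sp by (simp add: exp_minus field_simps)
    also have "\<dots> \<le> 2 * (h\<^sup>2 / \<epsilon>\<^sup>2 * t\<^sup>2)"
    proof -
      have "\<epsilon> \<le> (\<bar>t\<bar> * h) * s" using mult_left_mono[OF b, of \<epsilon>] \<epsilon> by (simp add: s_def mult_ac)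
      then have "\<epsilon>\<^sup>2 \<le> ((\<bar>t\<bar> * h) * s)\<^sup>2" using \<epsilon> by (intro power_mono) auto
      then have "\<epsilon>\<^sup>2 \<le> t\<^sup>2 * h\<^sup>2 * s\<^sup>2" by (simp add: power_mult_distrib)
      then show ?thesis using sp \<epsilon> by (simp add: field_simps)
    qed
    finally have "exp dens_bound * exp (- s) \<le> exp dens_bound * (2 * (h\<^sup>2 / \<epsilon>\<^sup>2 * t\<^sup>2))" by (intro mult_left_mono) auto
    then show ?thesis
      using reg_density_le[OF \<Omega>] True unfolding \<Omega>_def[symmetric] by (simp add: s_def K_def mult_ac)
  qed
  then show ?thesis by (rule that)
qed

lemma integrable_R_set_bounded:
  fixes f :: "real^'n^'n \<Rightarrow> real"
  assumes [measurable]: "f \<in> borel_measurable borel" and K: "\<And>x. x \<in> R_set \<Longrightarrow> \<bar>f x\<bar> \<le> K"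
  shows "integrable sym_lborel (\<lambda>x. indicator R_set x * f x)"
proof (rule Bochner_Integration.integrable_bound)
  show "integrable sym_lborel (\<lambda>x :: real^'n^'n. indicator R_set x * \<bar>K\<bar>)"
    using emeasure_sym_lborel_R_set_finite by (intro integrable_mult_left integrable_real_indicator) auto
  show "AE x in sym_lborel. norm (indicator R_set x * f x) \<le> norm (indicator R_set x * \<bar>K\<bar>)"
    using order_trans[OF K abs_ge_self] by (intro AE_I2) (auto simp: indicator_def)
qed measurable

lemma reg_density_integration_by_parts:
  assumes H: "transpose H = H" "\<And>i j. \<bar>H $ i $ j\<bar> \<le> 1"
    and u[measurable]: "u \<in> borel_measurable borel"
    and uK: "\<And>x. x \<in> R_set \<Longrightarrow> \<bar>u x\<bar> \<le> K" "\<And>x. x \<in> R_set \<Longrightarrow> \<bar>u' x\<bar> \<le> K"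
    and du: "\<And>x. x \<in> R_set \<Longrightarrow> ((\<lambda>t. u (x + t *\<^sub>R H)) has_field_derivative u' x) (at 0)"
  shows "(\<integral>x. indicator R_set x * (reg_density x * (u' x + u x * trace (score\<^sub>\<Omega> x ** H))) \<partial>sym_lborel) = 0"
    and "integrable sym_lborel (\<lambda>x. indicator R_set x * (reg_density x * (u' x + u x * trace (score\<^sub>\<Omega> x ** H))))"
proof -
  define g where "g x = indicator R_set x * (reg_density x * u x)" for x
  define g' where "g' x = indicator R_set x * (reg_density x * (u' x + u x * trace (score\<^sub>\<Omega> x ** H)))" for x
  have K0: "0 \<le> K" using emeasure_sym_lborel_R_set_pos[where 'n='n] uK(1) by (metis abs_ge_zero emeasure_empty equals0I order_trans)
  obtain Ks where Ks: "0 < Ks" "\<And>\<Omega>. \<Omega> \<in> R_set \<Longrightarrow> norm (score\<^sub>\<Omega> \<Omega>) \<le> Ks * (1 + barrier \<Omega>)\<^sup>2"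
    using score_le by blast
  define L where "L = exp dens_bound * (K * (1 + real CARD('n) * norm H * Ks) * (1 + 2 / \<epsilon> + 2 / \<epsilon>\<^sup>2))"
  have tr_le: "\<bar>trace (A ** H)\<bar> \<le> real CARD('n) * norm H * norm A" for A
  proof -
    have "\<bar>trace (A ** H)\<bar> \<le> (\<Sum>i\<in>(UNIV :: 'n set). \<bar>(A ** H) $ i $ i\<bar>)" unfolding trace_def by (rule sum_abs)
    also have "\<dots> \<le> (\<Sum>i\<in>(UNIV :: 'n set). norm (A ** H))" by (intro sum_mono abs_entry_le_norm)
    also have "\<dots> \<le> real CARD('n) * (norm A * norm H)" by (simp add: mult_left_mono norm_matrix_mult_le)
    finally show ?thesis by (simp add: mult_ac)
  qed
  have g'L: "\<bar>g' x\<bar> \<le> indicator R_set x * L" for x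
  proof (cases "x \<in> R_set")
    case True
    let ?s = "barrier x"
    have s0: "0 \<le> ?s" by (rule barrier_nonneg[OF True])
    have one: "1 \<le> (1 + ?s)\<^sup>2" using s0 by (simp add: one_le_power)
    have "\<bar>u' x + u x * trace (score\<^sub>\<Omega> x ** H)\<bar> \<le> K + K * (real CARD('n) * norm H * (Ks * (1 + ?s)\<^sup>2))"
    proof -
      have "\<bar>trace (score\<^sub>\<Omega> x ** H)\<bar> \<le> real CARD('n) * norm H * (Ks * (1 + ?s)\<^sup>2)"
        by (rule order_trans[OF tr_le]) (intro mult_left_mono Ks True, simp)
      then have "\<bar>u x * trace (score\<^sub>\<Omega> x ** H)\<bar> \<le> K * (real CARD('n) * norm H * (Ks * (1 + ?s)\<^sup>2))"
        unfolding abs_mult using uK(1)[OF True] K0 by (intro mult_mono) auto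
      then show ?thesis using uK(2)[OF True] by linarith
    qed
    also have "\<dots> \<le> K * (1 + real CARD('n) * norm H * Ks) * (1 + ?s)\<^sup>2"
      using mult_left_mono[OF one K0] by (simp add: algebra_simps)
    finally have a: "\<bar>u' x + u x * trace (score\<^sub>\<Omega> x ** H)\<bar> \<le> K * (1 + real CARD('n) * norm H * Ks) * (1 + ?s)\<^sup>2" .
    have "\<bar>g' x\<bar> = reg_density x * \<bar>u' x + u x * trace (score\<^sub>\<Omega> x ** H)\<bar>"
      using True reg_density_pos[of x] by (simp add: g'_def abs_mult)
    also have "\<dots> \<le> (exp dens_bound * exp (- \<epsilon> * ?s)) * (K * (1 + real CARD('n) * norm H * Ks) * (1 + ?s)\<^sup>2)"
      using a reg_density_le[OF True] by (intro mult_mono) auto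
    also have "\<dots> = (exp dens_bound * (K * (1 + real CARD('n) * norm H * Ks))) * ((1 + ?s)\<^sup>2 * exp (- \<epsilon> * ?s))"
      by (simp add: mult_ac)
    also have "\<dots> \<le> (exp dens_bound * (K * (1 + real CARD('n) * norm H * Ks))) * (1 + 2 / \<epsilon> + 2 / \<epsilon>\<^sup>2)"
      using K0 Ks(1) by (intro mult_left_mono barrier_exp_le s0) (auto intro!: mult_nonneg_nonneg add_nonneg_nonneg)
    also have "\<dots> = L" by (simp add: L_def mult_ac)
    finally show ?thesis using True by simp
  qed (simp add: g'_def)
  have L0: "0 \<le> L" using K0 Ks(1) \<epsilon> by (auto simp: L_def intro!: mult_nonneg_nonneg add_nonneg_nonneg)
  have gi: "integrable sym_lborel g"
    unfolding g_def
  proof (rule integrable_R_set_bounded)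
    fix x :: "real^'n^'n" assume x: "x \<in> R_set"
    have "reg_density x \<le> exp dens_bound"
      using order_trans[OF reg_density_le[OF x] mult_left_le[of "exp (- \<epsilon> * barrier x)"]] barrier_nonneg[OF x] \<epsilon> by simp
    then show "\<bar>reg_density x * u x\<bar> \<le> exp dens_bound * K"
      unfolding abs_mult using uK(1)[OF x] reg_density_pos[of x] by (intro mult_mono) auto
  qed measurable
  have gd: "((\<lambda>t. g (x + t *\<^sub>R H)) has_field_derivative g' x) (at 0)" for x
  proof (cases "transpose x = x")
    case False
    have "x + t *\<^sub>R H \<notin> R_set" for t
      using R_setD(3)[of "x + t *\<^sub>R H"] False H(1) by (auto simp: transpose_algebra_simps)
    then have "g (x + t *\<^sub>R H) = 0" for t by (simp add: g_def)
    moreover have "g' x = 0" using R_setD(3)[of x] False by (auto simp: g'_def indicator_def)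
    ultimately show ?thesis by simp
  next
    case sym: True
    show ?thesis
    proof (cases "x \<in> R_set")
      case False
      then obtain C where C: "\<And>t. indicator R_set (x + t *\<^sub>R H) * reg_density (x + t *\<^sub>R H) \<le> C * t\<^sup>2"
        using reg_density_outside[OF False sym H(1)] by blast
      have "\<bar>g (x + t *\<^sub>R H)\<bar> \<le> (C * K) * t\<^sup>2" for t
      proof -
        have "\<bar>g (x + t *\<^sub>R H)\<bar> \<le> indicator R_set (x + t *\<^sub>R H) * reg_density (x + t *\<^sub>R H) * K"
          using uK(1)[of "x + t *\<^sub>R H"] reg_density_pos[of "x + t *\<^sub>R H"]
          by (auto simp: g_def indicator_def abs_mult intro!: mult_left_mono)
        also have "\<dots> \<le> (C * t\<^sup>2) * K" by (rule mult_right_mono[OF C K0])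
        finally show ?thesis by (simp add: mult_ac)
      qed
      then have "((\<lambda>t. g (x + t *\<^sub>R H)) has_field_derivative 0) (at 0)" by (rule DERIV_zero_of_quadratic_bound)
      then show ?thesis using False by (simp add: g'_def)
    next
      case True
      define Q where "Q = {A. \<forall>x. x \<noteq> 0 \<longrightarrow> 0 < x \<bullet> (A *v x)} \<inter> (\<lambda>A. mat 1 - A) -` {A :: real^'n^'n. \<forall>x. x \<noteq> 0 \<longrightarrow> 0 < x \<bullet> (A *v x)}"
      define T where "T = (\<lambda>t. x + t *\<^sub>R H) -` Q"
      have "open T" unfolding T_def Q_def by (intro open_vimage R_set_open_part continuous_intros)
      moreover have "0 \<in> T" using True unfolding T_def Q_def R_set_eq by simp
      moreover have TR: "x + t *\<^sub>R H \<in> R_set" if "t \<in> T" for t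
        using that sym H(1) unfolding R_set_eq T_def Q_def by (simp add: transpose_algebra_simps)
      have "((\<lambda>t. exp (log_density (x + t *\<^sub>R H) - \<epsilon> * barrier (x + t *\<^sub>R H)) * u (x + t *\<^sub>R H)) has_field_derivative
         exp (log_density (x + 0 *\<^sub>R H) - \<epsilon> * barrier (x + 0 *\<^sub>R H)) * trace (score\<^sub>\<Omega> x ** H) * u (x + 0 *\<^sub>R H)
          + u' x * exp (log_density (x + 0 *\<^sub>R H) - \<epsilon> * barrier (x + 0 *\<^sub>R H))) (at 0)"
        by (intro DERIV_mult DERIV_chain2[OF DERIV_exp] log_density_line_deriv[OF True H(1)] du True)
      moreover have re: "exp (log_density y - \<epsilon> * barrier y) = reg_density y" for y
        by (simp add: reg_density_def density_def mult_exp_exp)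
      ultimately have "((\<lambda>t. reg_density (x + t *\<^sub>R H) * u (x + t *\<^sub>R H)) has_field_derivative g' x) (at 0)"
        using True unfolding re by (simp add: g'_def algebra_simps)
      then show ?thesis
        by (rule has_field_derivative_transform_within_open[OF _ \<open>open T\<close> \<open>0 \<in> T\<close>]) (simp add: g_def TR)
    qed
  qed
  let ?D = "\<lambda>x :: real^'n^'n. L * indicator {A. \<forall>i j. \<bar>A $ i $ j\<bar> \<le> 2} x"
  have cl: "closed {A :: real^'n^'n. \<forall>i j. \<bar>A $ i $ j\<bar> \<le> 2}"
    by (intro closed_Collect_all closed_Collect_le continuous_intros)
  have Di: "integrable sym_lborel ?D"
    using emeasure_sym_lborel_box_finite[of 2, where 'n='n] cl
    by (intro integrable_mult_right integrable_real_indicator) auto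
  have bnd: "\<bar>g' (x + t *\<^sub>R H)\<bar> \<le> ?D x" if "\<bar>t\<bar> \<le> 1" for x t
  proof (cases "x + t *\<^sub>R H \<in> R_set")
    case True
    have "\<bar>x $ i $ j\<bar> \<le> 2" for i j
    proof -
      have "\<bar>t * H $ i $ j\<bar> \<le> 1" unfolding abs_mult using that H(2)[of i j] by (intro mult_le_one) auto
      then show ?thesis using R_set_entry_le[OF True, of i j] by simp
    qed
    then show ?thesis using g'L[of "x + t *\<^sub>R H"] True by simp
  next
    case False
    then show ?thesis using L0 by (simp add: g'_def)
  qed
  have inv: "distr sym_lborel borel (\<lambda>x. x + t *\<^sub>R H) = sym_lborel" for t
    by (rule sym_lborel_translate) (simp add: transpose_algebra_simps H(1))
  show "(\<integral>x. indicator R_set x * (reg_density x * (u' x + u x * trace (score\<^sub>\<Omega> x ** H))) \<partial>sym_lborel) = 0"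
    and "integrable sym_lborel (\<lambda>x. indicator R_set x * (reg_density x * (u' x + u x * trace (score\<^sub>\<Omega> x ** H))))"
    using integral_derivative_translation_invariant[OF sets_sym_lborel inv gi gd bnd Di] unfolding g'_def by auto
qed

end

section \<open>The differential inequality for the marginal\<close>

lemma symmetric_entry: "transpose A = A \<Longrightarrow> A $ i $ j = A $ j $ i"
  by (drule arg_cong[of _ _ "\<lambda>X. X $ j $ i"]) (simp add: transpose_def)

definition unit_matrix :: "'n \<Rightarrow> 'n \<Rightarrow> real^'n^'n" where
  "unit_matrix i j = (\<chi> a b. if a = i \<and> b = j then 1 else 0)"

definition sym_unit :: "'n \<Rightarrow> 'n \<Rightarrow> real^'n^'n" where
  "sym_unit i j = (1 / 2) *\<^sub>R (unit_matrix i j + unit_matrix j i)"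

lemma matrix_sum_units: "(X :: real^'n^'n) = (\<Sum>i\<in>UNIV. \<Sum>j\<in>UNIV. X $ i $ j *\<^sub>R unit_matrix i j)"
proof -
  have "(\<Sum>i\<in>UNIV. \<Sum>j\<in>UNIV. X $ i $ j *\<^sub>R unit_matrix i j) $ a $ b = X $ a $ b" for a b
  proof -
    have "(\<Sum>i\<in>UNIV. \<Sum>j\<in>UNIV. X $ i $ j *\<^sub>R unit_matrix i j) $ a $ b
      = (\<Sum>i\<in>UNIV. \<Sum>j\<in>UNIV. X $ i $ j * (if a = i \<and> b = j then 1 else 0))"
      by (simp add: sum_component unit_matrix_def)
    also have "\<dots> = (\<Sum>j\<in>UNIV. \<Sum>i\<in>UNIV. if a = i then (if b = j then X $ i $ j else 0) else 0)"
      by (subst sum.swap) (rule sum.cong[OF refl], rule sum.cong[OF refl], simp)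
    finally show ?thesis by simp
  qed
  then show ?thesis by (simp add: vec_eq_iff)
qed

lemma linear_matrix_entries:
  fixes L :: "real^'n^'n \<Rightarrow> real"
  assumes "linear L"
  shows "L X = (\<Sum>i\<in>UNIV. \<Sum>j\<in>UNIV. X $ i $ j * L (unit_matrix i j))"
  by (subst matrix_sum_units) (simp add: linear_sum[OF assms] linear_cmul[OF assms])

lemma mult_unit_matrix:
  "((X :: real^'n^'n) ** unit_matrix k l) $ i $ j = (if l = j then X $ i $ k else 0)"
  "(unit_matrix k l ** (X :: real^'n^'n)) $ i $ j = (if k = i then X $ l $ j else 0)"
proof -
  have "(X ** unit_matrix k l) $ i $ j = (\<Sum>a\<in>UNIV. X $ i $ a * (if a = k \<and> j = l then 1 else 0))"
    by (simp add: matrix_matrix_mult_def unit_matrix_def)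
  also have "\<dots> = (\<Sum>a\<in>UNIV. if a = k then (if l = j then X $ i $ a else 0) else 0)"
    by (intro sum.cong refl) auto
  finally show "(X ** unit_matrix k l) $ i $ j = (if l = j then X $ i $ k else 0)" by simp
  have "(unit_matrix k l ** X) $ i $ j = (\<Sum>a\<in>UNIV. (if i = k \<and> a = l then 1 else 0) * X $ a $ j)"
    by (simp add: matrix_matrix_mult_def unit_matrix_def)
  also have "\<dots> = (\<Sum>a\<in>UNIV. if a = l then (if k = i then X $ a $ j else 0) else 0)"
    by (intro sum.cong refl) auto
  finally show "(unit_matrix k l ** X) $ i $ j = (if k = i then X $ l $ j else 0)" by simp
qed

lemma sum_sym_unit:
  fixes X :: "real^'n^'n"
  shows "(\<Sum>i\<in>UNIV. \<Sum>j\<in>UNIV. (X ** sym_unit i j) $ i $ j) = (real CARD('n) + 1) / 2 * trace X"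
    and "(\<Sum>i\<in>UNIV. \<Sum>j\<in>UNIV. (sym_unit i j ** X) $ i $ j) = (real CARD('n) + 1) / 2 * trace X"
proof -
  have "(X ** sym_unit i j) $ i $ j = X $ i $ i / 2 + (if i = j then X $ i $ j / 2 else 0)" for i j
    unfolding sym_unit_def by (simp add: matrix_algebra_simps mult_unit_matrix)
  then have "(\<Sum>i\<in>UNIV. \<Sum>j\<in>UNIV. (X ** sym_unit i j) $ i $ j) = (\<Sum>i\<in>UNIV. real CARD('n) * (X $ i $ i / 2) + X $ i $ i / 2)"
    by (simp add: sum.distrib)
  then show "(\<Sum>i\<in>UNIV. \<Sum>j\<in>UNIV. (X ** sym_unit i j) $ i $ j) = (real CARD('n) + 1) / 2 * trace X"
    by (simp add: trace_def sum.distrib sum_distrib_left algebra_simps sum_divide_distrib)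
  have "(sym_unit i j ** X) $ i $ j = X $ j $ j / 2 + (if i = j then X $ i $ j / 2 else 0)" for i j
    unfolding sym_unit_def by (simp add: matrix_algebra_simps mult_unit_matrix)
  then have "(\<Sum>i\<in>UNIV. \<Sum>j\<in>UNIV. (sym_unit i j ** X) $ i $ j) = real CARD('n) * (\<Sum>j\<in>UNIV. X $ j $ j / 2) + (\<Sum>i\<in>UNIV. X $ i $ i / 2)"
    by (simp add: sum.distrib)
  then show "(\<Sum>i\<in>UNIV. \<Sum>j\<in>UNIV. (sym_unit i j ** X) $ i $ j) = (real CARD('n) + 1) / 2 * trace X"
    by (simp add: trace_def sum_divide_distrib[symmetric] algebra_simps add_divide_distrib)
qed

lemma trace_mult_sym_unit:
  fixes A :: "real^'n^'n"
  assumes "transpose A = A"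
  shows "trace (A ** sym_unit i j) = A $ j $ i"
proof -
  have u: "trace (A ** unit_matrix k l) = A $ l $ k" for k l
    by (simp add: trace_def mult_unit_matrix)
  have "A $ i $ j = A $ j $ i" by (rule symmetric_entry[OF assms])
  then show ?thesis by (simp add: sym_unit_def matrix_algebra_simps trace_algebra_simps u)
qed

lemma sym_unit_properties:
  fixes i j a b :: "'a :: finite"
  shows "transpose (sym_unit i j) = sym_unit i j" "\<bar>sym_unit i j $ a $ b\<bar> \<le> 1"
proof -
  have swap: "unit_matrix k l $ b $ a = unit_matrix l k $ a $ b" for k l a b :: 'a
    unfolding unit_matrix_def vec_lambda_beta by (rule if_cong) auto
  show "transpose (sym_unit i j) = sym_unit i j"
  proof -
    have "sym_unit i j $ b $ a = sym_unit i j $ a $ b" for a b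
      unfolding sym_unit_def vector_scaleR_component vector_add_component swap[of i j b a] swap[of j i b a]
      by (rule arg_cong[OF add.commute])
    then have "(\<chi> a b. sym_unit i j $ b $ a) = (\<chi> a b. sym_unit i j $ a $ b)" by (simp only:)
    then show ?thesis unfolding transpose_def vec_nth_inverse .
  qed
  have u: "0 \<le> unit_matrix k l $ a $ b" "unit_matrix k l $ a $ b \<le> 1" for k l
    by (cases "a = k \<and> b = l") (simp_all only: unit_matrix_def vec_lambda_beta if_True if_False, simp_all)
  from u[of i j] u[of j i] show "\<bar>sym_unit i j $ a $ b\<bar> \<le> 1"
    unfolding sym_unit_def vector_scaleR_component vector_add_component real_scaleR_def abs_le_iff by (intro conjI) simp_all
qed

context regularised_density
begin

lemma transpose_score: "\<Omega> \<in> R_set \<Longrightarrow> transpose (score\<^sub>\<Omega> \<Omega>) = score\<^sub>\<Omega> \<Omega>"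
proof -
  assume "\<Omega> \<in> R_set"
  then interpret omega_point \<Omega> v\<^sub>0 \<kappa> by (rule point)
  show ?thesis
    by (simp add: score_def transpose_algebra_simps matrix_transpose_mul matrix_mul_assoc sym_ops psdD(1)[OF S])
qed

lemma field_divergence_integral:
  assumes M: "psd M" "pos_def_matrix (mat 1 - ((1 - \<kappa>) * v\<^sub>0) *\<^sub>R M)"
  defines "D \<equiv> \<lambda>x. omega_point.field_divergence x v\<^sub>0 \<kappa> M S q \<alpha> \<beta> \<epsilon>"
  shows "(\<integral>x. indicator R_set x * (reg_density x * D x) \<partial>sym_lborel) = 0"
    and "integrable sym_lborel (\<lambda>x. indicator R_set x * (reg_density x * D x))"
proof -
  define U where "U x = (2 / v\<^sub>0) *\<^sub>R (x ** x) - ((1 / 2) *\<^sub>R (x ** M + M ** x) - \<kappa> *\<^sub>R (x ** M ** x))" for x :: "real^'n^'n"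
  define U' where "U' H x = (2 / v\<^sub>0) *\<^sub>R (H ** x + x ** H) - ((1 / 2) *\<^sub>R (H ** M + M ** H) - \<kappa> *\<^sub>R (H ** (M ** x) + x ** M ** H))" for H x :: "real^'n^'n"
  have Uline: "U (x + t *\<^sub>R H) = U x + t *\<^sub>R U' H x + t\<^sup>2 *\<^sub>R ((2 / v\<^sub>0) *\<^sub>R (H ** H) + \<kappa> *\<^sub>R (H ** M ** H))" for x t H
    unfolding U_def U'_def by (simp add: mring vec_eq_iff algebra_simps power2_eq_square)
  let ?g = "\<lambda>i j x. indicator R_set x * (reg_density x * (U' (sym_unit i j) x $ i $ j + U x $ i $ j * trace (score\<^sub>\<Omega> x ** sym_unit i j)))"
  have ibp: "(\<integral>x. ?g i j x \<partial>sym_lborel) = 0" "integrable sym_lborel (?g i j)" for i j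
  proof -
    have c1: "continuous_on UNIV (\<lambda>x. U x $ i $ j)" unfolding U_def by (intro continuous_intros)
    have c2: "continuous_on UNIV (\<lambda>x. U' (sym_unit i j) x $ i $ j)" unfolding U'_def by (intro continuous_intros)
    obtain K1 where K1: "0 < K1" "\<And>x. x \<in> R_set \<Longrightarrow> \<bar>U x $ i $ j\<bar> \<le> K1"
      by (rule R_set_bounded_image[OF c1]) (rule that)
    obtain K2 where K2: "0 < K2" "\<And>x. x \<in> R_set \<Longrightarrow> \<bar>U' (sym_unit i j) x $ i $ j\<bar> \<le> K2"
      by (rule R_set_bounded_image[OF c2]) (rule that)
    have K': "\<bar>U x $ i $ j\<bar> \<le> K1 + K2" "\<bar>U' (sym_unit i j) x $ i $ j\<bar> \<le> K1 + K2" if "x \<in> R_set" for x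
      using K1(1) K2(1) K1(2)[OF that] K2(2)[OF that] by auto
    have d: "((\<lambda>t. U (x + t *\<^sub>R sym_unit i j) $ i $ j) has_field_derivative U' (sym_unit i j) x $ i $ j) (at 0)" for x
      unfolding Uline by (auto intro!: derivative_eq_intros)
    have m: "(\<lambda>x. U x $ i $ j) \<in> borel_measurable borel"
      by (rule borel_measurable_continuous_onI[OF c1])
    show "(\<integral>x. ?g i j x \<partial>sym_lborel) = 0" "integrable sym_lborel (?g i j)"
      using reg_density_integration_by_parts[OF sym_unit_properties m K' d] by auto
  qed
  have e: "indicator R_set x * (reg_density x * D x) = (\<Sum>i\<in>UNIV. \<Sum>j\<in>UNIV. ?g i j x)" for x
  proof (cases "x \<in> R_set")
    case True
    interpret omega_point x v\<^sub>0 \<kappa> by (rule point[OF True])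
    have s1: "(\<Sum>i\<in>UNIV. \<Sum>j\<in>UNIV. U' (sym_unit i j) x $ i $ j)
      = (2 / v\<^sub>0) * ((real CARD('n) + 1) * trace x) - (real CARD('n) + 1) * (trace M / 2 - \<kappa> * trace (x ** M))"
    proof -
      have "(\<Sum>i\<in>UNIV. \<Sum>j\<in>UNIV. U' (sym_unit i j) x $ i $ j)
        = (2 / v\<^sub>0) * ((\<Sum>i\<in>UNIV. \<Sum>j\<in>UNIV. (sym_unit i j ** x) $ i $ j) + (\<Sum>i\<in>UNIV. \<Sum>j\<in>UNIV. (x ** sym_unit i j) $ i $ j))
         - ((1 / 2) * ((\<Sum>i\<in>UNIV. \<Sum>j\<in>UNIV. (sym_unit i j ** M) $ i $ j) + (\<Sum>i\<in>UNIV. \<Sum>j\<in>UNIV. (M ** sym_unit i j) $ i $ j))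
           - \<kappa> * ((\<Sum>i\<in>UNIV. \<Sum>j\<in>UNIV. (sym_unit i j ** (M ** x)) $ i $ j) + (\<Sum>i\<in>UNIV. \<Sum>j\<in>UNIV. (x ** M ** sym_unit i j) $ i $ j)))"
        by (simp only: U'_def vector_minus_component vector_add_component vector_scaleR_component real_scaleR_def sum.distrib sum_subtractf sum_distrib_left[symmetric])
      also have "\<dots> = (2 / v\<^sub>0) * ((real CARD('n) + 1) * trace x) - (real CARD('n) + 1) * (trace M / 2 - \<kappa> * trace (x ** M))"
      proof -
        have arith: "d * (k / 2 * t + k / 2 * t) - (1 / 2 * (k / 2 * u + k / 2 * u) - e * (k / 2 * w + k / 2 * w))
          = d * (k * t) - k * (u / 2 - e * w)" for d e k t u w :: real by (simp add: right_diff_distrib)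
        show ?thesis unfolding sum_sym_unit trace_mul_sym[of M x] by (rule arith)
      qed
      finally show ?thesis .
    qed
    have "(\<Sum>i\<in>UNIV. \<Sum>j\<in>UNIV. U x $ i $ j * trace (score\<^sub>\<Omega> x ** sym_unit i j)) = trace (U x ** score\<^sub>\<Omega> x)"
      by (simp only: trace_mult_sym_unit[OF transpose_score[OF True]]) (simp add: trace_def matrix_matrix_mult_def)
    also have "\<dots> = trace (score\<^sub>\<Omega> x ** U x)" by (rule trace_mul_sym)
    also have "\<dots> = (2 / v\<^sub>0) * trace (score\<^sub>\<Omega> x ** (x ** x)) - trace (score\<^sub>\<Omega> x ** field2 M)"
      by (simp only: U_def field2_def[OF M] matrix_mult_diff_right matrix_mult_scaleR_right trace_algebra_simps)
    finally have s2: "(\<Sum>i\<in>UNIV. \<Sum>j\<in>UNIV. U x $ i $ j * trace (score\<^sub>\<Omega> x ** sym_unit i j))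
       = (2 / v\<^sub>0) * trace (score\<^sub>\<Omega> x ** (x ** x)) - trace (score\<^sub>\<Omega> x ** field2 M)" .
    have "D x = (\<Sum>i\<in>UNIV. \<Sum>j\<in>UNIV. U' (sym_unit i j) x $ i $ j) + (\<Sum>i\<in>UNIV. \<Sum>j\<in>UNIV. U x $ i $ j * trace (score\<^sub>\<Omega> x ** sym_unit i j))"
      unfolding D_def field_divergence_def[OF M] s1 s2 by (simp add: algebra_simps)
    also have "\<dots> = (\<Sum>i\<in>UNIV. \<Sum>j\<in>UNIV. U' (sym_unit i j) x $ i $ j + U x $ i $ j * trace (score\<^sub>\<Omega> x ** sym_unit i j))"
      by (simp add: sum.distrib)
    finally show ?thesis by (simp only: sum_distrib_left)
  qed simp
  show "integrable sym_lborel (\<lambda>x. indicator R_set x * (reg_density x * D x))"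
    unfolding e by (intro Bochner_Integration.integrable_sum ibp(2))
  have "(\<integral>x. (\<Sum>i\<in>UNIV. \<Sum>j\<in>UNIV. ?g i j x) \<partial>sym_lborel) = (\<Sum>i\<in>UNIV. \<integral>x. (\<Sum>j\<in>UNIV. ?g i j x) \<partial>sym_lborel)"
    by (intro Bochner_Integration.integral_sum Bochner_Integration.integrable_sum ibp(2))
  also have "\<dots> = (\<Sum>i\<in>UNIV. \<Sum>j\<in>UNIV. \<integral>x. ?g i j x \<partial>sym_lborel)"
    by (intro sum.cong refl Bochner_Integration.integral_sum ibp(2))
  also have "\<dots> = 0" by (simp only: ibp(1)) simp
  finally show "(\<integral>x. indicator R_set x * (reg_density x * D x) \<partial>sym_lborel) = 0"
    unfolding e .
qed

lemma norm_precision_le: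
  fixes \<Omega> :: "real^'n^'n"
  assumes "\<Omega> \<in> R_set"
  shows "norm (precision v\<^sub>0 \<kappa> \<Omega>) \<le> real CARD('n) / ((1 - \<kappa>) * v\<^sub>0)"
proof -
  interpret omega_point \<Omega> v\<^sub>0 \<kappa> by (rule point[OF assms])
  have "trace B \<le> real CARD('n) / ((1 - \<kappa>) * v\<^sub>0)"
    using trace_B_le v0 \<kappa> by (simp add: pos_le_divide_eq mult.commute)
  then show ?thesis by (rule order_trans[OF psd_norm_le_trace[OF psd_B]])
qed

lemma reg_density_le': "\<Omega> \<in> R_set \<Longrightarrow> reg_density \<Omega> \<le> exp dens_bound"
  using order_trans[OF reg_density_le mult_left_le[of "exp (- \<epsilon> * barrier \<Omega>)"]] barrier_nonneg \<epsilon> by simp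

lemma integrable_reg_density_mult:
  fixes f :: "real^'n^'n \<Rightarrow> real"
  assumes [measurable]: "f \<in> borel_measurable borel" and K: "\<And>x. x \<in> R_set \<Longrightarrow> \<bar>f x\<bar> \<le> K"
  shows "integrable sym_lborel (\<lambda>x. indicator R_set x * (reg_density x * f x))"
proof (rule integrable_R_set_bounded)
  show "\<bar>reg_density x * f x\<bar> \<le> exp dens_bound * K" if "x \<in> R_set" for x
    unfolding abs_mult using reg_density_le'[OF that] reg_density_pos[of x] K[OF that] by (intro mult_mono) auto
qed measurable

lemma abs_trace_le: "\<bar>trace (A :: real^'n^'n)\<bar> \<le> real CARD('n) * norm A"
proof -
  have "\<bar>trace A\<bar> \<le> (\<Sum>i\<in>(UNIV :: 'n set). \<bar>A $ i $ i\<bar>)" unfolding trace_def by (rule sum_abs)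
  also have "\<dots> \<le> (\<Sum>i\<in>(UNIV :: 'n set). norm A)" by (intro sum_mono abs_entry_le_norm)
  finally show ?thesis by simp
qed

lemma regularised_inequality:
  defines "m \<equiv> \<integral>x. indicator R_set x * reg_density x \<partial>sym_lborel"
    and "N \<equiv> \<chi> i j. \<integral>x. indicator R_set x * (reg_density x * precision v\<^sub>0 \<kappa> x $ i $ j) \<partial>sym_lborel"
  assumes cond: "2 * (real CARD('n) + 1 + \<alpha> - q / 2 + \<beta>) \<le> q - real CARD('n) - 1"
  shows "2 * m * (\<integral>x. indicator R_set x * (reg_density x * (trace (S ** precision v\<^sub>0 \<kappa> x ** precision v\<^sub>0 \<kappa> x) - q * trace (precision v\<^sub>0 \<kappa> x))) \<partial>sym_lborel)
    \<le> trace (S ** N ** N) + 4 / v\<^sub>0 * real CARD('n) * \<epsilon> * m\<^sup>2"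
proof -
  let ?B = "precision v\<^sub>0 \<kappa>" and ?v = "(1 - \<kappa>) * v\<^sub>0" and ?n = "real CARD('n)"
  let ?I = "\<lambda>f. \<integral>x. indicator R_set x * (reg_density x * f x) \<partial>(sym_lborel :: (real^'n^'n) measure)"
  have v: "0 < ?v" using v0 \<kappa> by simp
  have intL: "integrable sym_lborel (\<lambda>x. indicator R_set x * (reg_density x * L (?B x)))" if L: "linear L" for L :: "real^'n^'n \<Rightarrow> real"
  proof -
    obtain K where K: "\<And>x. norm (L x) \<le> norm x * K"
      using bounded_linear.bounded[OF linear_conv_bounded_linear[THEN iffD1, OF L]] by blast
    have [measurable]: "L \<in> borel_measurable borel"
      by (intro borel_measurable_continuous_onI linear_continuous_on linear_conv_bounded_linear[THEN iffD1, OF L])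
    have "\<bar>L (?B x)\<bar> \<le> ?n / ?v * \<bar>K\<bar>" if "x \<in> R_set" for x
    proof -
      have "\<bar>L (?B x)\<bar> \<le> norm (?B x) * \<bar>K\<bar>"
        using order_trans[OF K[of "?B x"] mult_left_mono[OF abs_ge_self norm_ge_zero]] by simp
      then show ?thesis using mult_right_mono[OF norm_precision_le[OF that], of "\<bar>K\<bar>"] by simp
    qed
    then show ?thesis by (intro integrable_reg_density_mult) auto
  qed
  have lin_entry: "linear (\<lambda>X :: real^'n^'n. X $ i $ j)" for i j by (rule linearI) auto
  have IL: "?I (\<lambda>x. L (?B x)) = L N" if L: "linear L" for L :: "real^'n^'n \<Rightarrow> real"
  proof -
    have "indicator R_set x * (reg_density x * L (?B x)) = (\<Sum>i\<in>UNIV. \<Sum>j\<in>UNIV. indicator R_set x * (reg_density x * ?B x $ i $ j) * L (unit_matrix i j))" for x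
      by (subst linear_matrix_entries[OF L]) (simp add: sum_distrib_left mult_ac)
    then have "?I (\<lambda>x. L (?B x)) = (\<Sum>i\<in>UNIV. \<Sum>j\<in>UNIV. N $ i $ j * L (unit_matrix i j))"
      using intL[OF lin_entry] by (simp add: Bochner_Integration.integral_sum N_def)
    also have "\<dots> = L N" by (rule linear_matrix_entries[OF L, symmetric])
    finally show ?thesis .
  qed
  have int1: "integrable sym_lborel (\<lambda>x :: real^'n^'n. indicator R_set x * (reg_density x * c))" for c
    by (rule integrable_reg_density_mult[of _ "\<bar>c\<bar>"]) auto
  have I1: "?I (\<lambda>x. c) = c * m" for c
    by (simp add: m_def mult.assoc[symmetric])
  have pos: "0 < ?I f" if "\<And>x. x \<in> R_set \<Longrightarrow> 0 < f x" "integrable sym_lborel (\<lambda>x. indicator R_set x * (reg_density x * f x))" for f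
  proof -
    have nn: "0 \<le> indicator R_set x * (reg_density x * f x)" for x
      using that(1)[of x] reg_density_pos[of x] by (auto simp: indicator_def less_imp_le)
    have "?I f \<noteq> 0"
    proof
      assume "?I f = 0"
      then have "AE x in sym_lborel. indicator R_set x * (reg_density x * f x) = 0"
        using integral_nonneg_eq_0_iff_AE[OF that(2)] nn by auto
      then have "AE x in (sym_lborel :: (real^'n^'n) measure). x \<notin> R_set"
      proof (rule AE_mp, intro AE_I2 impI notI)
        fix x :: "real^'n^'n" assume "indicator R_set x * (reg_density x * f x) = 0" "x \<in> R_set"
        then show False using that(1)[of x] reg_density_pos[of x] by simp
      qed
      then show False
        using emeasure_sym_lborel_R_set_pos[where 'n='n] AE_iff_measurable[of R_set sym_lborel "\<lambda>x. x \<notin> R_set"] by auto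
    qed
    moreover have "0 \<le> ?I f" using nn by (intro integral_nonneg_AE AE_I2)
    ultimately show ?thesis by simp
  qed
  have m: "0 < m" using pos[of "\<lambda>_. 1"] int1[of 1] I1[of 1] by simp
  define M where "M = (1 / m) *\<^sub>R N"
  have N: "N = m *\<^sub>R M" using m by (simp add: M_def)
  have lin_quad: "linear (\<lambda>X :: real^'n^'n. x \<bullet> (X *v x))" for x
    by (rule linearI) (simp_all add: matrix_vector_mult_add_rdistrib inner_add_right scaleR_matrix_vector_assoc[symmetric])
  have symN: "transpose N = N"
  proof -
    have e: "indicator R_set x * (reg_density x * ?B x $ i $ j) = indicator R_set x * (reg_density x * ?B x $ j $ i)" for x i j
    proof (cases "x \<in> R_set")
      case True
      then have "transpose (?B x) = ?B x" by (intro omega_point.sym_ops point)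
      then have "?B x $ i $ j = ?B x $ j $ i" by (rule symmetric_entry)
      then show ?thesis by simp
    qed simp
    have "N $ i $ j = N $ j $ i" for i j
      unfolding N_def vec_lambda_beta by (rule Bochner_Integration.integral_cong[OF refl e])
    then show ?thesis by (simp add: transpose_def vec_eq_iff)
  qed
  have psdN: "psd N"
  proof -
    have "0 \<le> x \<bullet> (N *v x)" for x
    proof -
      have "0 \<le> ?I (\<lambda>y. x \<bullet> (?B y *v x))"
      proof (intro integral_nonneg_AE AE_I2)
        fix y :: "real^'n^'n"
        show "0 \<le> indicator R_set y * (reg_density y * (x \<bullet> (?B y *v x)))"
          using psdD(2)[OF omega_point.psd_B[OF point], of y x] less_imp_le[OF reg_density_pos[of y]]
          by (cases "y \<in> R_set") (simp_all add: mult_nonneg_nonneg)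
      qed
      then show ?thesis using IL[OF lin_quad] by simp
    qed
    then show ?thesis using symN by (simp add: psd_def)
  qed
  have psdM: "psd M" unfolding M_def using m by (intro psd_scaleR psdN) auto
  have pdM: "pos_def_matrix (mat 1 - ?v *\<^sub>R M)"
  proof -
    have "0 < x \<bullet> ((mat 1 - ?v *\<^sub>R M) *v x)" if x: "x \<noteq> 0" for x
    proof -
      define f where "f y = x \<bullet> x - ?v * (x \<bullet> (?B y *v x))" for y
      have fe: "indicator R_set y * (reg_density y * f y) = indicator R_set y * (reg_density y * (x \<bullet> x))
          - ?v * (indicator R_set y * (reg_density y * (x \<bullet> (?B y *v x))))" for y
        by (simp only: f_def right_diff_distrib mult_ac)
      note ints = int1[of "x \<bullet> x"] integrable_mult_right[OF intL[OF lin_quad[of x]], of ?v]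
      have fi: "integrable sym_lborel (\<lambda>y. indicator R_set y * (reg_density y * f y))"
        unfolding fe by (rule Bochner_Integration.integrable_diff[OF ints])
      have "0 < f y" if y: "y \<in> R_set" for y
      proof -
        interpret omega_point y v\<^sub>0 \<kappa> by (rule point[OF y])
        have pP': "pos_def_matrix P'"
        proof -
          have "0 < z \<bullet> (P' *v z)" if "z \<noteq> 0" for z
          proof -
            have "0 < (1 - \<kappa>) * (z \<bullet> (P *v z))"
              using pos_def_matrix_inv[OF R_setD(2)[OF y]] that \<kappa> by (simp add: pos_def_matrix_def)
            moreover have "0 \<le> \<kappa> * (z \<bullet> z)" using \<kappa> by simp
            ultimately show ?thesis
              by (simp add: matrix_vector_mult_add_rdistrib scaleR_matrix_vector_assoc[symmetric] inner_add_right)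
          qed
          then show ?thesis using psdD(1)[OF psd_P'] by (simp add: pos_def_matrix_def)
        qed
        have "matrix_inv P' = mat 1 - ?v *\<^sub>R ?B y" by (rule matrix_inv_unique[OF P'_rel(1)])
        then have "pos_def_matrix (mat 1 - ?v *\<^sub>R ?B y)" using pos_def_matrix_inv[OF pP'] by simp
        then have "0 < x \<bullet> ((mat 1 - ?v *\<^sub>R ?B y) *v x)" using x by (simp add: pos_def_matrix_def)
        then show ?thesis
          by (simp add: f_def matrix_vector_mult_diff_rdistrib scaleR_matrix_vector_assoc[symmetric] inner_diff_right)
      qed
      from pos[OF this fi] have "0 < ?I f" .
      also have "?I f = ?I (\<lambda>_. x \<bullet> x) - ?v * ?I (\<lambda>y. x \<bullet> (?B y *v x))"
        unfolding fe by (subst Bochner_Integration.integral_diff[OF ints]) (simp only: integral_mult_right_zero)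
      also have "\<dots> = m * (x \<bullet> x) - ?v * (x \<bullet> (N *v x))"
        unfolding I1 IL[OF lin_quad] by (simp only: mult.commute)
      also have "\<dots> = m * (x \<bullet> ((mat 1 - ?v *\<^sub>R M) *v x))"
        unfolding N by (simp only: matrix_vector_mult_diff_rdistrib scaleR_matrix_vector_assoc[symmetric] inner_diff_right
            inner_scaleR_right matrix_vector_mul_lid right_diff_distrib mult_ac)
      finally show ?thesis using m by (simp add: zero_less_mult_iff)
    qed
    then show ?thesis using psdD(1)[OF psdM] by (simp add: pos_def_matrix_def transpose_algebra_simps)
  qed
  define D where "D x = omega_point.field_divergence x v\<^sub>0 \<kappa> M S q \<alpha> \<beta> \<epsilon>" for x
  note D0 = field_divergence_integral[OF psdM pdM, folded D_def]
  define c' where "c' = ?n + 1 + \<alpha> - q / 2"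
  define A where "A = 2 * c' + 2 * max 0 (- (c' + \<beta>))"
  define a where "a = \<alpha> + (?n + 1) / 2"
  define W where "W = max 0 (c' + \<beta>) *\<^sub>R (mat 1 - omega_point.Y\<^sub>M v\<^sub>0 \<kappa> M) + \<beta> *\<^sub>R (omega_point.P\<^sub>M v\<^sub>0 \<kappa> M - mat 1)
    + (\<epsilon> / (1 - \<kappa>)) *\<^sub>R (omega_point.P\<^sub>M v\<^sub>0 \<kappa> M ** omega_point.P\<^sub>M v\<^sub>0 \<kappa> M - omega_point.P\<^sub>M v\<^sub>0 \<kappa> M)"
  define L1 where "L1 X = trace (S ** (X ** M + M ** X)) / 4 + q * trace X + A * trace X - trace (W ** X)" for X :: "real^'n^'n"
  have linL1: "linear L1"
    by (rule linearI) (simp_all add: L1_def matrix_algebra_simps trace_algebra_simps algebra_simps add_divide_distrib)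
  have lin_tr: "linear (trace :: real^'n^'n \<Rightarrow> real)"
    by (rule linearI) (simp_all add: trace_algebra_simps)
  define h where "h = - a * trace M + 2 / v\<^sub>0 * ?n * \<epsilon> + trace (W ** M)"
  have pt: "D x + trace (S ** ?B x ** ?B x) \<le> L1 (?B x) + h" if x: "x \<in> R_set" for x
    using omega_point.field_divergence_le[OF point[OF x] psdM pdM \<beta> less_imp_le[OF \<epsilon>], of S q \<alpha>]
    unfolding D_def[symmetric] c'_def[symmetric] A_def[symmetric] a_def[symmetric] W_def[symmetric]
    by (simp add: L1_def h_def matrix_mult_diff_right trace_algebra_simps)
  have intQ: "integrable sym_lborel (\<lambda>x. indicator R_set x * (reg_density x * trace (S ** ?B x ** ?B x)))"
  proof (rule integrable_reg_density_mult)
    fix x :: "real^'n^'n" assume x: "x \<in> R_set"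
    have "norm (S ** ?B x ** ?B x) \<le> (norm S * norm (?B x)) * norm (?B x)"
      by (rule order_trans[OF norm_matrix_mult_le]) (intro mult_right_mono norm_matrix_mult_le, simp)
    also have "\<dots> \<le> (norm S * (?n / ?v)) * (?n / ?v)"
      using norm_precision_le[OF x] v by (intro mult_mono mult_left_mono) auto
    finally show "\<bar>trace (S ** ?B x ** ?B x)\<bar> \<le> ?n * ((norm S * (?n / ?v)) * (?n / ?v))"
      by (intro order_trans[OF abs_trace_le] mult_left_mono) auto
  qed measurable
  have "?I (\<lambda>x. trace (S ** ?B x ** ?B x)) = ?I D + ?I (\<lambda>x. trace (S ** ?B x ** ?B x))"
    using D0(1) by simp
  also have "\<dots> = (\<integral>x. indicator R_set x * (reg_density x * D x) + indicator R_set x * (reg_density x * trace (S ** ?B x ** ?B x)) \<partial>sym_lborel)"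
    using D0(2) intQ by simp
  also have "\<dots> \<le> (\<integral>x. indicator R_set x * (reg_density x * L1 (?B x)) + indicator R_set x * (reg_density x * h) \<partial>sym_lborel)"
  proof (rule integral_mono)
    fix x :: "real^'n^'n"
    show "indicator R_set x * (reg_density x * D x) + indicator R_set x * (reg_density x * trace (S ** ?B x ** ?B x))
      \<le> indicator R_set x * (reg_density x * L1 (?B x)) + indicator R_set x * (reg_density x * h)"
      using mult_left_mono[OF pt[of x], of "reg_density x"] reg_density_pos[of x]
      by (cases "x \<in> R_set") (auto simp: distrib_left)
  qed (use D0(2) intQ intL[OF linL1] int1 in auto)
  also have "\<dots> = L1 N + h * m"
    using intL[OF linL1] int1[of h] IL[OF linL1] I1[of h] by simp
  also have "L1 N + h * m = m * (trace (S ** M ** M) / 2 + q * trace M + (A - a) * trace M + 2 / v\<^sub>0 * ?n * \<epsilon>)"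
  proof -
    have "L1 N = m * (trace (S ** M ** M) / 2 + (q + A) * trace M - trace (W ** M))"
      unfolding N L1_def
      by (simp only: matrix_mult_scaleR_left matrix_mult_scaleR_right matrix_mult_add_right matrix_mul_assoc trace_algebra_simps)
        (simp add: distrib_left right_diff_distrib distrib_right mult_ac)
    then show ?thesis by (simp add: h_def distrib_left right_diff_distrib left_diff_distrib distrib_right mult_ac)
  qed
  also have "\<dots> \<le> m * (trace (S ** M ** M) / 2 + q * trace M + 2 / v\<^sub>0 * ?n * \<epsilon>)"
  proof -
    have "A - a \<le> 0"
    proof (cases "0 \<le> c' + \<beta>")
      case True
      then have "max 0 (- (c' + \<beta>)) = 0" by simp
      then show ?thesis using cond \<beta> unfolding A_def a_def c'_def by (simp only:) (simp add: field_simps)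
    next
      case False
      then have "max 0 (- (c' + \<beta>)) = - (c' + \<beta>)" by simp
      then have "A - a = - 2 * \<beta> - \<alpha> - (?n + 1) / 2" by (simp add: A_def a_def)
      moreover have "0 \<le> (?n + 1) / 2" by simp
      ultimately show ?thesis using \<alpha> \<beta> by linarith
    qed
    then have "(A - a) * trace M \<le> 0" using psd_trace_nonneg[OF psdM] by (rule mult_nonpos_nonneg)
    then show ?thesis using m by (intro mult_left_mono) auto
  qed
  finally have "?I (\<lambda>x. trace (S ** ?B x ** ?B x)) - q * trace N \<le> m * (trace (S ** M ** M) / 2 + 2 / v\<^sub>0 * ?n * \<epsilon>)"
    unfolding N by (simp add: trace_algebra_simps algebra_simps)
  moreover have "?I (\<lambda>x. trace (S ** ?B x ** ?B x) - q * trace (?B x)) = ?I (\<lambda>x. trace (S ** ?B x ** ?B x)) - q * trace N"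
    using Bochner_Integration.integral_diff[OF intQ integrable_mult_right[OF intL[OF lin_tr], of q]] IL[OF lin_tr]
    by (simp add: algebra_simps)
  ultimately have "(2 * m) * ?I (\<lambda>x. trace (S ** ?B x ** ?B x) - q * trace (?B x)) \<le> (2 * m) * (m * (trace (S ** M ** M) / 2 + 2 / v\<^sub>0 * ?n * \<epsilon>))"
    using m by (intro mult_left_mono) auto
  also have "\<dots> = trace (S ** N ** N) + 4 / v\<^sub>0 * ?n * \<epsilon> * m\<^sup>2"
    unfolding N by (simp add: matrix_algebra_simps trace_algebra_simps power2_eq_square algebra_simps)
  finally show ?thesis .
qed

end

lemma density_inequality:
  fixes v\<^sub>0 \<kappa> q \<alpha> \<beta> :: real and S :: "real^'n^'n"
  defines "g \<equiv> regularised_density.density v\<^sub>0 \<kappa> q \<alpha> \<beta> S"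
  defines "I \<equiv> \<lambda>h. \<integral>x. indicator R_set x * (g x * h (precision v\<^sub>0 \<kappa> x)) \<partial>(sym_lborel :: (real^'n^'n) measure)"
  assumes par: "0 < v\<^sub>0" "0 \<le> \<kappa>" "\<kappa> < 1" "0 \<le> q" "0 \<le> \<alpha>" "0 \<le> \<beta>" "psd S"
    and cond: "2 * (real CARD('n) + 1 + \<alpha> - q / 2 + \<beta>) \<le> q - real CARD('n) - 1"
  shows "2 * I (\<lambda>_. 1) * I (\<lambda>B. trace (S ** B ** B) - q * trace B)
    \<le> trace (S ** (\<chi> i j. I (\<lambda>B. B $ i $ j)) ** (\<chi> i j. I (\<lambda>B. B $ i $ j)))"
proof -
  define e where "e k = 1 / real (Suc k)" for k
  have rd: "regularised_density v\<^sub>0 \<kappa> q \<alpha> \<beta> (e k) S" for k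
    using par by unfold_locales (auto simp: e_def)
  interpret D: regularised_density v\<^sub>0 \<kappa> q \<alpha> \<beta> "e 0" S by (rule rd)
  define rg where "rg k = regularised_density.reg_density v\<^sub>0 \<kappa> q \<alpha> \<beta> (e k) S" for k
  define J where "J k h = (\<integral>x. indicator R_set x * (rg k x * h (precision v\<^sub>0 \<kappa> x)) \<partial>(sym_lborel :: (real^'n^'n) measure))" for k h
  have rg_eq: "rg k x = g x * exp (- e k * D.barrier x)" for k x
    unfolding rg_def g_def by (rule regularised_density.reg_density_def[OF rd])
  have [measurable]: "rg k \<in> borel_measurable borel" for k
    unfolding rg_def by (rule regularised_density.measurable_ops[OF rd])
  have [measurable]: "g \<in> borel_measurable borel" unfolding g_def by (rule D.measurable_ops)
  have e_lim: "e \<longlonglongrightarrow> 0" unfolding e_def by (rule LIMSEQ_Suc[OF lim_1_over_n])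
  have lim: "(\<lambda>k. J k h) \<longlonglongrightarrow> I h" if h: "continuous_on UNIV h" for h :: "real^'n^'n \<Rightarrow> real"
  proof -
    have [measurable]: "h \<in> borel_measurable borel" by (rule borel_measurable_continuous_onI[OF h])
    have "bounded (h ` cball 0 (real CARD('n) / ((1 - \<kappa>) * v\<^sub>0)))"
      by (intro compact_imp_bounded compact_continuous_image continuous_on_subset[OF h]) auto
    then obtain K where K: "\<And>X. X \<in> cball 0 (real CARD('n) / ((1 - \<kappa>) * v\<^sub>0)) \<Longrightarrow> norm (h X) \<le> K"
      unfolding bounded_iff by blast
    have hK: "\<bar>h (precision v\<^sub>0 \<kappa> x)\<bar> \<le> K" if "x \<in> R_set" for x
      using K[of "precision v\<^sub>0 \<kappa> x"] D.norm_precision_le[OF that] by simp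
    show ?thesis unfolding I_def J_def
    proof (rule integral_dominated_convergence)
      show "integrable sym_lborel (\<lambda>x :: real^'n^'n. indicator R_set x * (exp D.dens_bound * \<bar>K\<bar>))"
        by (rule D.integrable_R_set_bounded[of _ "exp D.dens_bound * \<bar>K\<bar>"]) auto
      show "AE x in sym_lborel. (\<lambda>k. indicator R_set x * (rg k x * h (precision v\<^sub>0 \<kappa> x)))
        \<longlonglongrightarrow> indicator R_set x * (g x * h (precision v\<^sub>0 \<kappa> x))"
      proof (rule AE_I2)
        fix x :: "real^'n^'n"
        have "(\<lambda>k. indicator R_set x * (g x * exp (- e k * D.barrier x) * h (precision v\<^sub>0 \<kappa> x)))
          \<longlonglongrightarrow> indicator R_set x * (g x * exp (- 0 * D.barrier x) * h (precision v\<^sub>0 \<kappa> x))"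
          by (intro tendsto_intros e_lim)
        then show "(\<lambda>k. indicator R_set x * (rg k x * h (precision v\<^sub>0 \<kappa> x)))
          \<longlonglongrightarrow> indicator R_set x * (g x * h (precision v\<^sub>0 \<kappa> x))"
          by (simp add: rg_eq)
      qed
      show "AE x in sym_lborel. norm (indicator R_set x * (rg k x * h (precision v\<^sub>0 \<kappa> x)))
        \<le> indicator R_set x * (exp D.dens_bound * \<bar>K\<bar>)" for k
      proof (rule AE_I2)
        fix x :: "real^'n^'n"
        show "norm (indicator R_set x * (rg k x * h (precision v\<^sub>0 \<kappa> x))) \<le> indicator R_set x * (exp D.dens_bound * \<bar>K\<bar>)"
        proof (cases "x \<in> R_set")
          case True
          have "\<bar>rg k x\<bar> \<le> exp D.dens_bound"
            using regularised_density.reg_density_le'[OF rd True, of k] regularised_density.reg_density_pos[OF rd, of k x]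
            by (simp add: rg_def)
          then have "\<bar>rg k x\<bar> * \<bar>h (precision v\<^sub>0 \<kappa> x)\<bar> \<le> exp D.dens_bound * \<bar>K\<bar>"
            using order_trans[OF hK[OF True] abs_ge_self] by (intro mult_mono) auto
          then show ?thesis using True by (simp add: abs_mult)
        qed simp
      qed
    qed measurable
  qed
  define NJ where "NJ k = (\<chi> i j. J k (\<lambda>B. B $ i $ j))" for k
  let ?N = "\<chi> i j. I (\<lambda>B. B $ i $ j)"
  have "NJ \<longlonglongrightarrow> ?N"
    unfolding NJ_def by (intro vec_tendstoI) (simp, intro lim continuous_intros)
  moreover have "continuous_on UNIV (\<lambda>X. trace (S ** X ** X))" by (intro continuous_intros)
  ultimately have t: "(\<lambda>k. trace (S ** NJ k ** NJ k)) \<longlonglongrightarrow> trace (S ** ?N ** ?N)"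
    using continuous_on_tendsto_compose[of UNIV "\<lambda>X. trace (S ** X ** X)" NJ ?N] by simp
  let ?h = "\<lambda>B. trace (S ** B ** B) - q * trace B"
  have l1: "(\<lambda>k. J k (\<lambda>_. 1)) \<longlonglongrightarrow> I (\<lambda>_. 1)" and l2: "(\<lambda>k. J k ?h) \<longlonglongrightarrow> I ?h"
    by (intro lim continuous_intros)+
  have "(\<lambda>k. trace (S ** NJ k ** NJ k) + 4 / v\<^sub>0 * real CARD('n) * e k * (J k (\<lambda>_. 1))\<^sup>2)
    \<longlonglongrightarrow> trace (S ** ?N ** ?N) + 4 / v\<^sub>0 * real CARD('n) * 0 * (I (\<lambda>_. 1))\<^sup>2"
    by (intro tendsto_intros t l1 e_lim)
  moreover have "(\<lambda>k. 2 * J k (\<lambda>_. 1) * J k ?h) \<longlonglongrightarrow> 2 * I (\<lambda>_. 1) * I ?h"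
    by (intro tendsto_intros l1 l2)
  moreover have "2 * J k (\<lambda>_. 1) * J k ?h \<le> trace (S ** NJ k ** NJ k) + 4 / v\<^sub>0 * real CARD('n) * e k * (J k (\<lambda>_. 1))\<^sup>2" for k
    using regularised_density.regularised_inequality[OF rd cond, of k] by (simp add: J_def NJ_def rg_def)
  ultimately have "2 * I (\<lambda>_. 1) * I ?h \<le> trace (S ** ?N ** ?N) + 4 / v\<^sub>0 * real CARD('n) * 0 * (I (\<lambda>_. 1))\<^sup>2"
    by (intro LIMSEQ_le) auto
  then show ?thesis by simp
qed

section \<open>The hierarchical prior\<close>

lemma Basis_matrix: "(Basis :: (real^'q^'r) set) = (\<lambda>(i, j). axis i (axis j 1)) ` UNIV"
  by (auto simp: Basis_vec_def)

lemma inj_matrix_axis: "inj (\<lambda>(i, j). axis i (axis j 1) :: real^'q^'r)"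
  by (auto simp: inj_def axis_eq_axis)

lemma sum_Basis_matrix:
  "(\<Sum>b\<in>(Basis :: (real^'q^'r) set). f b) = (\<Sum>i\<in>UNIV. \<Sum>j\<in>UNIV. f (axis i (axis j 1)))"
  unfolding Basis_matrix sum.reindex[OF inj_matrix_axis] comp_def
  by (simp add: sum.cartesian_product UNIV_Times_UNIV[symmetric] split_def del: UNIV_Times_UNIV)

lemma inner_matrix_axis: "axis i (axis j 1) \<bullet> (X :: real^'q^'r) = X $ i $ j"
  by (simp add: inner_axis')

lemma matrix_mult_axis:
  fixes X :: "real^'r^'r"
  shows "(X ** (axis k (axis l 1) :: real^'q^'r)) $ i $ j = (if j = l then X $ i $ k else 0)"
proof -
  have "(X ** (axis k (axis l 1) :: real^'q^'r)) $ i $ j = (\<Sum>a\<in>UNIV. if a = k then (if j = l then X $ i $ a else 0) else 0)"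
    unfolding matrix_matrix_mult_def vec_lambda_beta by (intro sum.cong refl) (simp add: axis_def)
  then show ?thesis by simp
qed

lemma sum_Basis_matrix_mult:
  fixes X :: "real^'r^'r"
  shows "(\<Sum>b\<in>(Basis :: (real^'q^'r) set). b \<bullet> (X ** b)) = real CARD('q) * trace X"
  by (simp add: sum_Basis_matrix inner_matrix_axis matrix_mult_axis trace_def sum_distrib_left)

lemma inner_matrix_mult_self:
  fixes X :: "real^'r^'r" and z :: "real^'q^'r"
  shows "z \<bullet> (X ** z) = trace (X ** (z ** transpose z))"
  unfolding inner_matrix_eq_trace trace_mul_sym[of "transpose z"] by (simp add: matrix_mul_assoc)

lemma norm_matrix_mult_self:
  fixes X :: "real^'r^'r" and z :: "real^'q^'r"
  shows "(norm (X ** z))\<^sup>2 = trace (z ** transpose z ** transpose X ** X)"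
  unfolding norm_matrix_eq_trace matrix_transpose_mul matrix_mul_assoc[symmetric]
  by (subst trace_mul_sym) (simp add: matrix_mul_assoc)

lemma psd_gram: "psd (z ** transpose z)" for z :: "real^'q^'r"
  using psd_congruence[OF psd_mat_1, of z] by simp

text \<open>The term with the matrix \<open>S\<close> is switched off in the weight; it comes back as the
  kernel \<open>exp (- tr (B S) / 2)\<close> with \<open>S = z z\<^sup>T\<close>.\<close>

definition gb_weight :: "real \<Rightarrow> real \<Rightarrow> real \<Rightarrow> real \<Rightarrow> real \<Rightarrow> real \<Rightarrow> real^'r^'r \<Rightarrow> real" where
  "gb_weight v\<^sub>0 q \<alpha> \<beta> c v \<Omega> = c * regularised_density.density v\<^sub>0 (1 - v / v\<^sub>0) q \<alpha> \<beta> 0 \<Omega>"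

definition gb_form :: "real \<Rightarrow> real \<Rightarrow> real^'r^'r \<Rightarrow> real^'q^'r \<Rightarrow> real^'q^'r" where
  "gb_form v\<^sub>0 v \<Omega> z = precision v\<^sub>0 (1 - v / v\<^sub>0) \<Omega> ** z"

locale gb_mixture =
  fixes v\<^sub>0 \<alpha> \<beta> c lo hi :: real
  assumes lo: "0 < lo" and lohi: "lo < hi" and hi: "hi \<le> v\<^sub>0"
    and \<alpha>: "0 \<le> \<alpha>" and \<beta>: "0 \<le> \<beta>" and c: "0 < c"
begin

lemma v0: "0 < v\<^sub>0" using lo lohi hi by simp

lemma \<kappa>:
  assumes "v \<in> {lo..hi}"
  shows "0 \<le> 1 - v / v\<^sub>0" "1 - v / v\<^sub>0 < 1" "(1 - (1 - v / v\<^sub>0)) * v\<^sub>0 = v"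
  using assms lo hi v0 by (auto simp: field_simps)

lemma reg: "v \<in> {lo..hi} \<Longrightarrow> 0 \<le> q \<Longrightarrow> psd S \<Longrightarrow> regularised_density v\<^sub>0 (1 - v / v\<^sub>0) q \<alpha> \<beta> 1 S"
  using \<kappa> v0 \<alpha> \<beta> by unfold_locales auto

lemma point: "v \<in> {lo..hi} \<Longrightarrow> \<Omega> \<in> R_set \<Longrightarrow> omega_point \<Omega> v\<^sub>0 (1 - v / v\<^sub>0)"
  using \<kappa> v0 by unfold_locales auto

lemma line: "mat 1 - (1 - v / v\<^sub>0) *\<^sub>R \<Omega> = (mat 1 - \<Omega>) + v *\<^sub>R ((1 / v\<^sub>0) *\<^sub>R \<Omega>)" for \<Omega> :: "real^'r^'r"
  by (simp add: algebra_simps)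

lemma precision_line: "precision v\<^sub>0 (1 - v / v\<^sub>0) \<Omega> = ((1 / v\<^sub>0) *\<^sub>R \<Omega>) ** matrix_inv ((mat 1 - \<Omega>) + v *\<^sub>R ((1 / v\<^sub>0) *\<^sub>R \<Omega>))" for \<Omega> :: "real^'r^'r"
  unfolding precision_def resolvent_def line by (simp only: matrix_mult_scaleR_left)

lemma gb_weight_eq:
  fixes \<Omega> :: "real^'r^'r"
  assumes "v \<in> {lo..hi}" "0 \<le> q"
  shows "gb_weight v\<^sub>0 q \<alpha> \<beta> c v \<Omega>
    = c * exp (\<alpha> * ln (det \<Omega>) + \<beta> * ln (det (mat 1 - \<Omega>)) - q / 2 * ln (det ((mat 1 - \<Omega>) + v *\<^sub>R ((1 / v\<^sub>0) *\<^sub>R \<Omega>))))"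
  unfolding gb_weight_def regularised_density.density_def[OF reg[OF assms psd_0]]
    regularised_density.log_density_def[OF reg[OF assms psd_0]] line
  by (simp add: matrix_mult_zero_right trace_algebra_simps)

definition "bound q n = c * exp ((\<alpha> + \<beta>) * ln (fact n * real n ^ n) + q / 2 * ln (fact n * (real n * v\<^sub>0 / lo) ^ n)) + real n / lo"

lemma gb_weight_le:
  fixes \<Omega> :: "real^'r^'r"
  assumes v: "v \<in> {lo..hi}" and q: "0 \<le> q" and \<Omega>: "\<Omega> \<in> R_set"
  shows "gb_weight v\<^sub>0 q \<alpha> \<beta> c v \<Omega> \<le> bound q CARD('r)"
proof -
  interpret D: regularised_density v\<^sub>0 "1 - v / v\<^sub>0" q \<alpha> \<beta> 1 "0 :: real^'r^'r" by (rule reg[OF v q psd_0])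
  have n: "0 < real CARD('r)" by simp
  have "real CARD('r) / (1 - (1 - v / v\<^sub>0)) = real CARD('r) * v\<^sub>0 / v" using v0 by simp
  also have "\<dots> \<le> real CARD('r) * v\<^sub>0 / lo"
    using v lo v0 by (intro divide_left_mono mult_nonneg_nonneg mult_pos_pos) auto
  finally have "(real CARD('r) / (1 - (1 - v / v\<^sub>0))) ^ CARD('r) \<le> (real CARD('r) * v\<^sub>0 / lo) ^ CARD('r)"
    using v lo v0 by (intro power_mono) auto
  moreover have "0 < (real CARD('r) / (1 - (1 - v / v\<^sub>0))) ^ CARD('r)"
    using v lo v0 by (intro zero_less_power) auto
  ultimately have "ln (fact CARD('r) * (real CARD('r) / (1 - (1 - v / v\<^sub>0))) ^ CARD('r))
    \<le> ln (fact CARD('r) * (real CARD('r) * v\<^sub>0 / lo) ^ CARD('r))"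
    by (intro ln_mono mult_pos_pos mult_left_mono) auto
  then have "D.dens_bound \<le> (\<alpha> + \<beta>) * ln (fact CARD('r) * real CARD('r) ^ CARD('r)) + q / 2 * ln (fact CARD('r) * (real CARD('r) * v\<^sub>0 / lo) ^ CARD('r))"
    unfolding D.dens_bound_def using q by (intro add_left_mono mult_left_mono) auto
  then have "D.density \<Omega> \<le> exp ((\<alpha> + \<beta>) * ln (fact CARD('r) * real CARD('r) ^ CARD('r)) + q / 2 * ln (fact CARD('r) * (real CARD('r) * v\<^sub>0 / lo) ^ CARD('r)))"
    by (intro order_trans[OF D.density_le[OF \<Omega>]]) simp
  then have "c * D.density \<Omega> \<le> bound q CARD('r) - real CARD('r) / lo"
    unfolding bound_def using c by (simp add: mult_left_mono)
  moreover have "0 \<le> real CARD('r) / lo" using lo by simp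
  ultimately show ?thesis by (simp add: gb_weight_def)
qed

lemma norm_gb_form_le:
  fixes \<Omega> :: "real^'r^'r"
  assumes v: "v \<in> {lo..hi}" and q: "0 \<le> q" and \<Omega>: "\<Omega> \<in> R_set"
  shows "norm (gb_form v\<^sub>0 v \<Omega> z) \<le> bound q CARD('r) * norm z"
proof -
  interpret D: regularised_density v\<^sub>0 "1 - v / v\<^sub>0" q \<alpha> \<beta> 1 "0 :: real^'r^'r" by (rule reg[OF v q psd_0])
  have "norm (precision v\<^sub>0 (1 - v / v\<^sub>0) \<Omega>) \<le> real CARD('r) / v"
    using D.norm_precision_le[OF \<Omega>] unfolding \<kappa>(3)[OF v] .
  also have "\<dots> \<le> real CARD('r) / lo" using v lo by (intro divide_left_mono) auto
  also have "\<dots> \<le> bound q CARD('r)" unfolding bound_def using c by simp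
  finally show ?thesis
    unfolding gb_form_def by (intro order_trans[OF norm_matrix_mult_le] mult_right_mono) auto
qed

lemma gauss_mixture:
  "gauss_mixture (restrict_space sym_lborel R_set) (gb_weight v\<^sub>0 (real CARD('q)) \<alpha> \<beta> c)
    (gb_form v\<^sub>0 :: real \<Rightarrow> real^'r^'r \<Rightarrow> real^'q^'r \<Rightarrow> _) lo hi (bound (real CARD('q)) CARD('r))"
proof (rule gauss_mixture.intro[OF finite_measureI gauss_mixture_axioms.intro])
  let ?\<mu> = "restrict_space (sym_lborel :: (real^'r^'r) measure) R_set" and ?q = "real CARD('q)"
  have em: "emeasure ?\<mu> (space ?\<mu>) = emeasure sym_lborel (R_set :: (real^'r^'r) set)"
    by (simp add: emeasure_restrict_space space_restrict_space)
  show "emeasure ?\<mu> (space ?\<mu>) \<noteq> \<infinity>" "emeasure ?\<mu> (space ?\<mu>) \<noteq> 0"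
    unfolding em using emeasure_sym_lborel_R_set_finite[where 'n='r] emeasure_sym_lborel_R_set_pos[where 'n='r] by auto
  show "0 < lo" "lo < hi" by (rule lo, rule lohi)
  show "linear (gb_form v\<^sub>0 v \<Omega> :: real^'q^'r \<Rightarrow> real^'q^'r)" for v and \<Omega> :: "real^'r^'r"
    by (rule linearI) (simp_all add: gb_form_def matrix_mult_add_right matrix_mult_scaleR_right)
  fix v assume v: "v \<in> {lo..hi}"
  interpret D: regularised_density v\<^sub>0 "1 - v / v\<^sub>0" ?q \<alpha> \<beta> 1 "0 :: real^'r^'r" by (rule reg[OF v _ psd_0]) simp
  show "gb_weight v\<^sub>0 ?q \<alpha> \<beta> c v \<in> borel_measurable ?\<mu>"
    unfolding gb_weight_def by (rule measurable_restrict_space1) measurable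
  show "(\<lambda>\<Omega>. gb_form v\<^sub>0 v \<Omega> (x :: real^'q^'r)) \<in> borel_measurable ?\<mu>" for x
    unfolding gb_form_def by (rule measurable_restrict_space1) measurable
  fix \<Omega> :: "real^'r^'r" assume "\<Omega> \<in> space ?\<mu>"
  then have \<Omega>: "\<Omega> \<in> R_set" by (simp add: space_restrict_space)
  interpret omega_point \<Omega> v\<^sub>0 "1 - v / v\<^sub>0" by (rule point[OF v \<Omega>])
  show "0 < gb_weight v\<^sub>0 ?q \<alpha> \<beta> c v \<Omega>" using c D.density_pos by (simp add: gb_weight_def)
  show "gb_weight v\<^sub>0 ?q \<alpha> \<beta> c v \<Omega> \<le> bound ?q CARD('r)" by (rule gb_weight_le[OF v _ \<Omega>]) simp
  show "x \<bullet> gb_form v\<^sub>0 v \<Omega> y = gb_form v\<^sub>0 v \<Omega> x \<bullet> y" for x y :: "real^'q^'r"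
    unfolding gb_form_def by (simp add: inner_matrix_mult_left sym_ops)
  show "0 \<le> x \<bullet> gb_form v\<^sub>0 v \<Omega> x" for x :: "real^'q^'r"
    unfolding gb_form_def inner_matrix_mult_self by (intro trace_psd_mult_nonneg psd_B psd_gram)
  show "norm (gb_form v\<^sub>0 v \<Omega> x) \<le> bound ?q CARD('r) * norm x" for x :: "real^'q^'r"
    by (rule norm_gb_form_le[OF v _ \<Omega>]) simp
  let ?H = "(1 / v\<^sub>0) *\<^sub>R \<Omega>" and ?A = "mat 1 - \<Omega>"
  have inv: "invertible (?A + v *\<^sub>R ?H)" and dp: "0 < det (?A + v *\<^sub>R ?H)"
    using pos_def_invertible[OF pos_def_1_\<kappa>\<Omega>] pos_def_det_pos[OF pos_def_1_\<kappa>\<Omega>] unfolding line .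
  have tB: "trace (matrix_inv (?A + v *\<^sub>R ?H) ** ?H) = trace B"
    unfolding precision_line by (rule trace_mul_sym)
  let ?g = "\<lambda>v. c * exp (\<alpha> * ln (det \<Omega>) + \<beta> * ln (det ?A) - ?q / 2 * ln (det (?A + v *\<^sub>R ?H)))"
  have "((\<lambda>v. ln (det (?A + v *\<^sub>R ?H))) has_field_derivative trace B) (at v)"
    using DERIV_chain2[OF DERIV_ln_divide[OF dp] det_line_deriv[OF inv]] dp unfolding tB by simp
  moreover have "((\<lambda>v. c * exp (s - k / 2 * L v)) has_field_derivative - (k * l) / 2 * (c * exp (s - k / 2 * L v))) (at v)"
    if "(L has_field_derivative l) (at v)" for L :: "real \<Rightarrow> real" and s k l v
    using that by (auto intro!: derivative_eq_intros)
  ultimately have "(?g has_field_derivative - (?q * trace B) / 2 * ?g v) (at v)" by blast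
  then have "(?g has_field_derivative - (\<Sum>b\<in>Basis. b \<bullet> (gb_form v\<^sub>0 v \<Omega> b :: real^'q^'r)) / 2 * ?g v) (at v within {lo..hi})"
    unfolding gb_form_def sum_Basis_matrix_mult by (rule has_field_derivative_at_within)
  then show "((\<lambda>v. gb_weight v\<^sub>0 ?q \<alpha> \<beta> c v \<Omega>) has_field_derivative
      - (\<Sum>b\<in>Basis. b \<bullet> (gb_form v\<^sub>0 v \<Omega> b :: real^'q^'r)) / 2 * gb_weight v\<^sub>0 ?q \<alpha> \<beta> c v \<Omega>) (at v within {lo..hi})"
    unfolding gb_weight_eq[OF v of_nat_0_le_iff]
    by (rule has_field_derivative_transform_within[OF _ zero_less_one v]) (simp_all add: gb_weight_eq)
  fix x :: "real^'q^'r"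
  have bl: "bounded_linear (\<lambda>X. ?H ** X ** x)"
    unfolding linear_conv_bounded_linear[symmetric]
    by (rule linearI) (simp_all only: matrix_algebra_simps)
  have "((\<lambda>v. ?H ** matrix_inv (?A + v *\<^sub>R ?H) ** x) has_vector_derivative
     ?H ** (- (matrix_inv (?A + v *\<^sub>R ?H) ** ?H ** matrix_inv (?A + v *\<^sub>R ?H))) ** x) (at v)"
    by (rule bounded_linear.has_vector_derivative[OF bl matrix_inv_line_deriv[OF inv]])
  also have "?H ** (- (matrix_inv (?A + v *\<^sub>R ?H) ** ?H ** matrix_inv (?A + v *\<^sub>R ?H))) ** x
    = - (gb_form v\<^sub>0 v \<Omega> (gb_form v\<^sub>0 v \<Omega> x))"
    unfolding gb_form_def precision_line by (simp only: matrix_mult_minus_right matrix_mult_minus_left matrix_mul_assoc)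
  finally show "((\<lambda>v. gb_form v\<^sub>0 v \<Omega> x) has_vector_derivative - gb_form v\<^sub>0 v \<Omega> (gb_form v\<^sub>0 v \<Omega> x)) (at v within {lo..hi})"
    unfolding gb_form_def precision_line by (rule has_vector_derivative_at_within)
qed

end

lemma (in gb_mixture) mixture_inequality:
  fixes z :: "real^'q^'r"
  assumes v: "v \<in> {lo..hi}" and cond: "2 * (real CARD('r) + 1 + \<alpha> - real CARD('q) / 2 + \<beta>) \<le> real CARD('q) - real CARD('r) - 1"
  defines "mix \<equiv> gauss_mixture.mix (restrict_space sym_lborel R_set) (gb_weight v\<^sub>0 (real CARD('q)) \<alpha> \<beta> c) (gb_form v\<^sub>0)"
    and "grad \<equiv> gauss_mixture.grad (restrict_space sym_lborel R_set) (gb_weight v\<^sub>0 (real CARD('q)) \<alpha> \<beta> c) (gb_form v\<^sub>0)"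
    and "hess \<equiv> gauss_mixture.hess (restrict_space sym_lborel R_set) (gb_weight v\<^sub>0 (real CARD('q)) \<alpha> \<beta> c) (gb_form v\<^sub>0)"
  shows "2 * mix v z * (\<Sum>b\<in>Basis. hess b v z) \<le> (\<Sum>b\<in>Basis. (grad b v z)\<^sup>2)"
proof -
  let ?\<mu> = "restrict_space (sym_lborel :: (real^'r^'r) measure) R_set" and ?q = "real CARD('q)"
  let ?S = "z ** transpose z" and ?B = "precision v\<^sub>0 (1 - v / v\<^sub>0) :: real^'r^'r \<Rightarrow> real^'r^'r"
  interpret G: gauss_mixture ?\<mu> "gb_weight v\<^sub>0 ?q \<alpha> \<beta> c" "gb_form v\<^sub>0 :: real \<Rightarrow> real^'r^'r \<Rightarrow> real^'q^'r \<Rightarrow> _" lo hi "bound ?q CARD('r)"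
    by (rule gauss_mixture)
  interpret D: regularised_density v\<^sub>0 "1 - v / v\<^sub>0" ?q \<alpha> \<beta> 1 ?S by (rule reg[OF v _ psd_gram]) simp
  interpret D0: regularised_density v\<^sub>0 "1 - v / v\<^sub>0" ?q \<alpha> \<beta> 1 "0 :: real^'r^'r" by (rule reg[OF v _ psd_0]) simp
  have kern: "G.kern v z \<Omega> = c * D.density \<Omega>" for \<Omega>
  proof -
    have "D0.log_density \<Omega> - trace (?B \<Omega> ** ?S) / 2 = D.log_density \<Omega>"
      by (simp only: D0.log_density_def D.log_density_def) (simp add: matrix_mult_zero_right trace_algebra_simps)
    then have "D.density \<Omega> = D0.density \<Omega> * exp (- trace (?B \<Omega> ** ?S) / 2)"
      by (simp add: D.density_def D0.density_def exp_add[symmetric])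
    moreover have "z \<bullet> gb_form v\<^sub>0 v \<Omega> z = trace (?B \<Omega> ** ?S)"
      unfolding gb_form_def by (rule inner_matrix_mult_self)
    ultimately show ?thesis by (simp add: G.kern_def gb_weight_def)
  qed
  define I where "I h = (\<integral>x. indicator R_set x * (D.density x * h (?B x)) \<partial>(sym_lborel :: (real^'r^'r) measure))" for h :: "real^'r^'r \<Rightarrow> real"
  have I: "(\<integral>\<Omega>. h (?B \<Omega>) * G.kern v z \<Omega> \<partial>?\<mu>) = c * I h" for h
    by (subst integral_restrict_space) (simp_all add: kern I_def mult_ac)
  have meas: "(\<lambda>\<Omega>. h (?B \<Omega>)) \<in> borel_measurable ?\<mu>" if "h \<in> borel_measurable borel" for h :: "real^'r^'r \<Rightarrow> real"
    by (rule measurable_restrict_space1) (use that in measurable)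
  have mix: "G.mix v z = c * I (\<lambda>_. 1)"
    using I[of "\<lambda>_. 1"] by (simp add: G.mix_def)
  have "(\<Sum>b\<in>Basis. G.hess b v z) = (\<integral>\<Omega>. (\<Sum>b\<in>Basis. ((b \<bullet> gb_form v\<^sub>0 v \<Omega> z)\<^sup>2 - b \<bullet> gb_form v\<^sub>0 v \<Omega> b) * G.kern v z \<Omega>) \<partial>?\<mu>)"
    unfolding G.hess_def
    by (intro Bochner_Integration.integral_sum[symmetric] G.integrable_mult_kern[OF v])
      (use G.coeff_le(2)[OF v] G.B_meas[OF v] in \<open>auto intro!: borel_measurable_diff borel_measurable_power borel_measurable_inner\<close>)
  also have "\<dots> = (\<integral>\<Omega>. (trace (?S ** ?B \<Omega> ** ?B \<Omega>) - ?q * trace (?B \<Omega>)) * G.kern v z \<Omega> \<partial>?\<mu>)"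
  proof (rule Bochner_Integration.integral_cong[OF refl])
    fix \<Omega> :: "real^'r^'r" assume "\<Omega> \<in> space ?\<mu>"
    then have "transpose (?B \<Omega>) = ?B \<Omega>"
      by (intro omega_point.sym_ops point[OF v]) (simp add: space_restrict_space)
    then have "(\<Sum>b\<in>Basis. (b \<bullet> gb_form v\<^sub>0 v \<Omega> z)\<^sup>2) = trace (?S ** ?B \<Omega> ** ?B \<Omega>)"
      using norm2_eq_sum_Basis[of "gb_form v\<^sub>0 v \<Omega> z"] norm_matrix_mult_self[of "?B \<Omega>" z]
      by (simp add: gb_form_def inner_commute)
    then show "(\<Sum>b\<in>Basis. ((b \<bullet> gb_form v\<^sub>0 v \<Omega> z)\<^sup>2 - b \<bullet> gb_form v\<^sub>0 v \<Omega> b) * G.kern v z \<Omega>)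
      = (trace (?S ** ?B \<Omega> ** ?B \<Omega>) - ?q * trace (?B \<Omega>)) * G.kern v z \<Omega>"
      unfolding sum_distrib_right[symmetric] sum_subtractf by (simp add: gb_form_def sum_Basis_matrix_mult)
  qed
  also have "\<dots> = c * I (\<lambda>B. trace (?S ** B ** B) - ?q * trace B)" by (rule I)
  finally have hess: "(\<Sum>b\<in>Basis. G.hess b v z) = c * I (\<lambda>B. trace (?S ** B ** B) - ?q * trace B)" .
  define N where "N = (\<chi> i j. I (\<lambda>B. B $ i $ j))"
  have symN: "transpose N = N"
  proof -
    have "I (\<lambda>B. B $ i $ j) = I (\<lambda>B. B $ j $ i)" for i j
      unfolding I_def
    proof (rule Bochner_Integration.integral_cong[OF refl])
      fix x :: "real^'r^'r"
      show "indicator R_set x * (D.density x * ?B x $ i $ j) = indicator R_set x * (D.density x * ?B x $ j $ i)"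
      proof (cases "x \<in> R_set")
        case True
        then have "transpose (?B x) = ?B x" by (intro omega_point.sym_ops point[OF v])
        then show ?thesis by (subst symmetric_entry) simp_all
      qed simp
    qed
    then show ?thesis by (simp add: N_def transpose_def vec_eq_iff)
  qed
  have grad: "G.grad b v z = - c * (b \<bullet> (N ** z))" if b: "b \<in> Basis" for b
  proof -
    from b obtain i j where bij: "b = axis i (axis j 1)" by (auto simp: Basis_matrix)
    have "norm (?B \<Omega>) \<le> real CARD('r) / v" if "\<Omega> \<in> space ?\<mu>" for \<Omega>
      using D.norm_precision_le[of \<Omega>] that unfolding \<kappa>(3)[OF v] by (simp add: space_restrict_space)
    then have ent: "\<bar>?B \<Omega> $ i $ k\<bar> \<le> real CARD('r) / v" if "\<Omega> \<in> space ?\<mu>" for k \<Omega>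
      using order_trans[OF abs_entry_le_norm] that by blast
    have int: "integrable ?\<mu> (\<lambda>\<Omega>. ?B \<Omega> $ i $ k * G.kern v z \<Omega>)" for k
      proof (rule G.integrable_mult_kern[OF v _ ent])
      show "(\<lambda>\<Omega>. ?B \<Omega> $ i $ k) \<in> borel_measurable ?\<mu>"
        by (intro meas borel_measurable_continuous_onI continuous_intros)
    qed
    have "G.grad b v z = (\<integral>\<Omega>. - (\<Sum>k\<in>UNIV. z $ k $ j * (?B \<Omega> $ i $ k * G.kern v z \<Omega>)) \<partial>?\<mu>)"
      unfolding G.grad_def bij inner_matrix_axis gb_form_def
      by (simp add: matrix_matrix_mult_def sum_distrib_right mult_ac)
    also have "\<dots> = - (\<Sum>k\<in>UNIV. z $ k $ j * (\<integral>\<Omega>. ?B \<Omega> $ i $ k * G.kern v z \<Omega> \<partial>?\<mu>))"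
      using int by (simp add: Bochner_Integration.integral_sum)
    also have "\<dots> = - c * (b \<bullet> (N ** z))"
      unfolding bij inner_matrix_axis I[of "\<lambda>B. B $ i $ k" for k]
      by (simp add: matrix_matrix_mult_def N_def sum_distrib_left sum_negf mult_ac)
    finally show ?thesis .
  qed
  have "(\<Sum>b\<in>Basis. (G.grad b v z)\<^sup>2) = c\<^sup>2 * (\<Sum>b\<in>Basis. ((N ** z) \<bullet> b)\<^sup>2)"
    by (simp add: grad sum_distrib_left power_mult_distrib inner_commute)
  also have "\<dots> = c\<^sup>2 * trace (?S ** N ** N)"
    using norm2_eq_sum_Basis[of "N ** z"] norm_matrix_mult_self[of N z] symN by simp
  finally have grad2: "(\<Sum>b\<in>Basis. (G.grad b v z)\<^sup>2) = c\<^sup>2 * trace (?S ** N ** N)" .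
  have "2 * I (\<lambda>_. 1) * I (\<lambda>B. trace (?S ** B ** B) - ?q * trace B) \<le> trace (?S ** N ** N)"
    unfolding I_def N_def
    by (rule density_inequality[OF v0 \<kappa>(1)[OF v] \<kappa>(2)[OF v] _ \<alpha> \<beta> psd_gram cond]) simp
  then have "c\<^sup>2 * (2 * I (\<lambda>_. 1) * I (\<lambda>B. trace (?S ** B ** B) - ?q * trace B)) \<le> c\<^sup>2 * trace (?S ** N ** N)"
    by (intro mult_left_mono) auto
  then show ?thesis
    unfolding mix_def grad_def hess_def grad2 hess mix by (simp only: power2_eq_square mult_ac)
qed

lemma pos_def_one_plus:
  fixes A :: "real^'n^'n"
  assumes A: "psd A"
  shows "pos_def_matrix (mat 1 + A)"
proof -
  have "0 < x \<bullet> ((mat 1 + A) *v x)" if "x \<noteq> 0" for x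
    using add_pos_nonneg[of "x \<bullet> x" "x \<bullet> (A *v x)"] psdD(2)[OF A, of x] that
    by (simp add: matrix_vector_mult_add_rdistrib inner_add_right)
  then show ?thesis by (simp add: pos_def_matrix_def transpose_algebra_simps psdD(1)[OF A])
qed

lemma symmetric_matrix_form:
  fixes A :: "real^'n^'n" and x y :: "real^'q^'n"
  assumes A: "transpose A = A"
  shows "x \<bullet> (A ** y) = y \<bullet> (A ** x)" "x \<bullet> (A ** y) = (A ** x) \<bullet> y"
proof -
  show e: "x \<bullet> (A ** y) = (A ** x) \<bullet> y" by (subst inner_matrix_mult_left) (simp only: A)
  show "x \<bullet> (A ** y) = y \<bullet> (A ** x)" unfolding e by (rule inner_commute)
qed

lemma gaussian_det_integral:
  fixes Q :: "real^'r^'r"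
  assumes Q: "psd Q"
  shows "(\<integral>\<xi>. gauss 1 \<xi> * exp (- (\<xi> \<bullet> (Q ** \<xi>)) / 2) \<partial>(lborel :: (real^'q^'r) measure)) = det (mat 1 + Q) powr (- real CARD('q) / 2)"
proof -
  let ?q = "real CARD('q)"
  define e where "e t \<xi> = exp (- t * (\<xi> \<bullet> (Q ** \<xi>)) / 2)" for t and \<xi> :: "real^'q^'r"
  define G where "G t = (\<integral>\<xi>. gauss 1 \<xi> * e t \<xi> \<partial>(lborel :: (real^'q^'r) measure))" for t
  have form: "0 \<le> \<xi> \<bullet> (Q ** \<xi>)" "\<xi> \<bullet> (Q ** \<xi>) \<le> norm Q * (norm \<xi>)\<^sup>2" for \<xi> :: "real^'q^'r"
  proof -
    show "0 \<le> \<xi> \<bullet> (Q ** \<xi>)" unfolding inner_matrix_mult_self by (intro trace_psd_mult_nonneg Q psd_gram)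
    have "\<xi> \<bullet> (Q ** \<xi>) \<le> norm \<xi> * norm (Q ** \<xi>)" by (rule norm_cauchy_schwarz)
    also have "\<dots> \<le> norm \<xi> * (norm Q * norm \<xi>)" by (intro mult_left_mono norm_matrix_mult_le) auto
    finally show "\<xi> \<bullet> (Q ** \<xi>) \<le> norm Q * (norm \<xi>)\<^sup>2" by (simp add: power2_eq_square mult_ac)
  qed
  have e_le: "e t \<xi> \<le> 1" "0 < e t \<xi>" if "0 \<le> t" for t \<xi>
    using form(1)[of \<xi>] that by (simp_all add: e_def)
  have [measurable]: "e t \<in> borel_measurable borel" for t unfolding e_def by measurable
  have pd: "pos_def_matrix (mat 1 + t *\<^sub>R Q)" if "0 \<le> t" for t
    using that by (intro pos_def_one_plus psd_scaleR Q)
  have int: "integrable lborel (\<lambda>\<xi>. gauss 1 \<xi> * e t \<xi>)" if "0 \<le> t" for t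
  proof (rule Bochner_Integration.integrable_bound[OF integrable_gauss])
    show "AE \<xi> in lborel. norm (gauss 1 \<xi> * e t \<xi>) \<le> norm (gauss 1 \<xi>)"
      using less_imp_le[OF e_le(2)[OF that]] e_le(1)[OF that] by (intro AE_I2) (simp add: abs_mult mult_left_le)
  qed auto
  have dG: "(G has_field_derivative (\<integral>\<xi>. gauss 1 \<xi> * (- (\<xi> \<bullet> (Q ** \<xi>)) / 2 * e t \<xi>) \<partial>lborel)) (at t within {0..1})"
    if t: "t \<in> {0..1}" for t
    unfolding G_def
  proof (rule has_field_derivative_integral(1)[of "{0..1}" t lborel "\<lambda>t \<xi>. gauss 1 \<xi> * e t \<xi>"
        "\<lambda>t \<xi>. gauss 1 \<xi> * (- (\<xi> \<bullet> (Q ** \<xi>)) / 2 * e t \<xi>)", where g="\<lambda>\<xi>. norm Q * (gauss 1 \<xi> * (norm \<xi>)\<^sup>2)"])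
    show "t \<in> {0..1}" by (rule t)
    show "at t within {0..1} \<noteq> bot" using t by (auto simp: trivial_limit_within islimpt_Icc)
    show "integrable lborel (\<lambda>\<xi>. gauss 1 \<xi> * e s \<xi>)" if "s \<in> {0..1}" for s
      using that by (intro int) auto
    show "((\<lambda>s. gauss 1 \<xi> * e s \<xi>) has_field_derivative gauss 1 \<xi> * (- (\<xi> \<bullet> (Q ** \<xi>)) / 2 * e s \<xi>)) (at s within {0..1})" for s \<xi>
      unfolding e_def by (auto intro!: derivative_eq_intros)
    show "\<bar>gauss 1 \<xi> * (- (\<xi> \<bullet> (Q ** \<xi>)) / 2 * e s \<xi>)\<bar> \<le> norm Q * (gauss 1 \<xi> * (norm \<xi>)\<^sup>2)" if "s \<in> {0..1}" for s \<xi>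
    proof -
      have "\<bar>gauss 1 \<xi> * (- (\<xi> \<bullet> (Q ** \<xi>)) / 2 * e s \<xi>)\<bar> = gauss 1 \<xi> * ((\<xi> \<bullet> (Q ** \<xi>)) / 2 * e s \<xi>)"
        using form(1)[of \<xi>] e_le(2)[of s \<xi>] that by (simp add: abs_mult)
      also have "\<dots> \<le> gauss 1 \<xi> * (norm Q * (norm \<xi>)\<^sup>2 * 1)"
        using form[of \<xi>] e_le[of s \<xi>] that by (intro mult_left_mono mult_mono) auto
      finally show ?thesis by (simp add: mult_ac)
    qed
    show "integrable lborel (\<lambda>\<xi>::real^'q^'r. norm Q * (gauss 1 \<xi> * (norm \<xi>)\<^sup>2))"
      by (intro integrable_mult_right integrable_gauss_norm2) simp
  qed auto
  have ibp: "(\<integral>\<xi>. gauss 1 \<xi> * ((\<xi> \<bullet> (Q ** \<xi>)) * e t \<xi>) \<partial>lborel) = ?q * trace (matrix_inv (mat 1 + t *\<^sub>R Q) ** Q) * G t"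
    and ibp_int: "integrable lborel (\<lambda>\<xi>. gauss 1 \<xi> * ((\<xi> \<bullet> (Q ** \<xi>)) * e t \<xi>))"
    if t: "t \<in> {0..1}" for t
  proof -
    define X where "X = matrix_inv (mat 1 + t *\<^sub>R Q) ** Q"
    have t0: "0 \<le> t" using t by simp
    have X: "X + t *\<^sub>R (Q ** X) = Q"
    proof -
      have "(mat 1 + t *\<^sub>R Q) ** X = Q"
        unfolding X_def matrix_mul_assoc by (simp add: matrix_inv_right[OF pos_def_invertible[OF pd[OF t0]]])
      then show ?thesis by (simp add: matrix_algebra_simps)
    qed
    let ?C = "norm X + norm X * norm Q"
    have Xn: "norm (X ** \<xi>) \<le> norm X * norm \<xi>" "norm (Q ** \<xi>) \<le> norm Q * norm \<xi>" for \<xi> :: "real^'q^'r"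
      by (rule norm_matrix_mult_le)+
    have stein: "(\<integral>\<xi>. gauss 1 \<xi> * ((\<xi> \<bullet> b) * ((b \<bullet> (X ** \<xi>)) * e t \<xi>)) \<partial>lborel)
        = (\<integral>\<xi>. gauss 1 \<xi> * ((b \<bullet> (X ** b) - t * ((b \<bullet> (X ** \<xi>)) * (b \<bullet> (Q ** \<xi>)))) * e t \<xi>) \<partial>lborel)"
      "integrable lborel (\<lambda>\<xi>. gauss 1 \<xi> * ((b \<bullet> (X ** b) - t * ((b \<bullet> (X ** \<xi>)) * (b \<bullet> (Q ** \<xi>)))) * e t \<xi>))"
      "integrable lborel (\<lambda>\<xi>. gauss 1 \<xi> * ((\<xi> \<bullet> b) * ((b \<bullet> (X ** \<xi>)) * e t \<xi>)))"
      if b: "b \<in> Basis" for b :: "real^'q^'r"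
    proof -
      have nb: "norm b = 1" using b by simp
      have bX: "\<bar>b \<bullet> (X ** \<xi>)\<bar> \<le> norm X * norm \<xi>" "\<bar>b \<bullet> (Q ** \<xi>)\<bar> \<le> norm Q * norm \<xi>" for \<xi>
        using order_trans[OF Cauchy_Schwarz_ineq2[of b "X ** \<xi>"]] order_trans[OF Cauchy_Schwarz_ineq2[of b "Q ** \<xi>"]] Xn[of \<xi>] nb by auto
      have der: "((\<lambda>s. (b \<bullet> (X ** (\<xi> + s *\<^sub>R b))) * e t (\<xi> + s *\<^sub>R b)) has_field_derivative
          (b \<bullet> (X ** b) - t * ((b \<bullet> (X ** \<xi>)) * (b \<bullet> (Q ** \<xi>)))) * e t \<xi>) (at 0)" for \<xi>
      proof -
        have s: "b \<bullet> (Q ** \<xi>) = \<xi> \<bullet> (Q ** b)" by (rule symmetric_matrix_form[OF psdD(1)[OF Q]])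
        show ?thesis
          unfolding e_def matrix_mult_add_right matrix_mult_scaleR_right inner_add_left inner_add_right inner_scaleR_left inner_scaleR_right
          by (auto intro!: derivative_eq_intros simp: s algebra_simps)
      qed
      have f: "\<bar>(b \<bullet> (X ** \<xi>)) * e t \<xi>\<bar> \<le> ?C * (1 + norm \<xi>)\<^sup>2" for \<xi>
      proof -
        have "\<bar>(b \<bullet> (X ** \<xi>)) * e t \<xi>\<bar> \<le> (norm X * norm \<xi>) * 1"
          unfolding abs_mult using bX(1)[of \<xi>] e_le[OF t0, of \<xi>] by (intro mult_mono) auto
        also have "\<dots> \<le> norm X * (1 + norm \<xi>)\<^sup>2"
          by (simp add: power2_eq_square algebra_simps mult_left_mono)
        also have "\<dots> \<le> ?C * (1 + norm \<xi>)\<^sup>2" by (intro mult_right_mono) auto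
        finally show ?thesis .
      qed
      have f': "\<bar>(b \<bullet> (X ** b) - t * ((b \<bullet> (X ** \<xi>)) * (b \<bullet> (Q ** \<xi>)))) * e t \<xi>\<bar> \<le> ?C * (1 + norm \<xi>)\<^sup>2" for \<xi>
      proof -
        have "\<bar>t * ((b \<bullet> (X ** \<xi>)) * (b \<bullet> (Q ** \<xi>)))\<bar> \<le> 1 * ((norm X * norm \<xi>) * (norm Q * norm \<xi>))"
          unfolding abs_mult using t bX[of \<xi>] by (intro mult_mono) auto
        also have "\<dots> \<le> norm X * norm Q * (1 + norm \<xi>)\<^sup>2"
        proof -
          have "norm \<xi> * norm \<xi> \<le> (1 + norm \<xi>)\<^sup>2" by (simp add: power2_eq_square algebra_simps)
          then have "(norm X * norm Q) * (norm \<xi> * norm \<xi>) \<le> (norm X * norm Q) * (1 + norm \<xi>)\<^sup>2"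
            by (rule mult_left_mono) auto
          then show ?thesis by (simp only: mult_ac mult_1_left)
        qed
        moreover have "\<bar>b \<bullet> (X ** b)\<bar> \<le> norm X * (1 + norm \<xi>)\<^sup>2"
        proof -
          have "norm X * 1 \<le> norm X * (1 + norm \<xi>)\<^sup>2" by (intro mult_left_mono one_le_power) auto
          then show ?thesis using bX(1)[of b] nb by simp
        qed
        ultimately have "\<bar>b \<bullet> (X ** b) - t * ((b \<bullet> (X ** \<xi>)) * (b \<bullet> (Q ** \<xi>)))\<bar> \<le> ?C * (1 + norm \<xi>)\<^sup>2"
          by (simp only: distrib_right)
        then have "\<bar>b \<bullet> (X ** b) - t * ((b \<bullet> (X ** \<xi>)) * (b \<bullet> (Q ** \<xi>)))\<bar> * \<bar>e t \<xi>\<bar> \<le> (?C * (1 + norm \<xi>)\<^sup>2) * 1"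
          using e_le[OF t0, of \<xi>] by (intro mult_mono) auto
        then show ?thesis by (simp add: abs_mult)
      qed
      have m: "(\<lambda>\<xi>. (b \<bullet> (X ** \<xi>)) * e t \<xi>) \<in> borel_measurable borel" by measurable
      show "(\<integral>\<xi>. gauss 1 \<xi> * ((\<xi> \<bullet> b) * ((b \<bullet> (X ** \<xi>)) * e t \<xi>)) \<partial>lborel)
          = (\<integral>\<xi>. gauss 1 \<xi> * ((b \<bullet> (X ** b) - t * ((b \<bullet> (X ** \<xi>)) * (b \<bullet> (Q ** \<xi>)))) * e t \<xi>) \<partial>lborel)"
        "integrable lborel (\<lambda>\<xi>. gauss 1 \<xi> * ((b \<bullet> (X ** b) - t * ((b \<bullet> (X ** \<xi>)) * (b \<bullet> (Q ** \<xi>)))) * e t \<xi>))"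
        "integrable lborel (\<lambda>\<xi>. gauss 1 \<xi> * ((\<xi> \<bullet> b) * ((b \<bullet> (X ** \<xi>)) * e t \<xi>)))"
        by (rule gauss_integration_by_parts[OF eq_refl[OF nb] m der f f'])+
    qed
    have l: "(\<Sum>b\<in>Basis. gauss 1 \<xi> * ((\<xi> \<bullet> b) * ((b \<bullet> (X ** \<xi>)) * e t \<xi>))) = gauss 1 \<xi> * ((\<xi> \<bullet> (X ** \<xi>)) * e t \<xi>)" for \<xi> :: "real^'q^'r"
      unfolding euclidean_inner[of \<xi> "X ** \<xi>"] sum_distrib_left sum_distrib_right
      by (intro sum.cong refl) (simp only: inner_commute[of "X ** \<xi>"] mult_ac)
    have r: "(\<Sum>b\<in>Basis. gauss 1 \<xi> * ((b \<bullet> (X ** b) - t * ((b \<bullet> (X ** \<xi>)) * (b \<bullet> (Q ** \<xi>)))) * e t \<xi>))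
      = ?q * trace X * (gauss 1 \<xi> * e t \<xi>) - t * (gauss 1 \<xi> * ((\<xi> \<bullet> (Q ** X ** \<xi>)) * e t \<xi>))" for \<xi> :: "real^'q^'r"
    proof -
      have "\<xi> \<bullet> (Q ** X ** \<xi>) = (X ** \<xi>) \<bullet> (Q ** \<xi>)"
        unfolding matrix_mul_assoc[symmetric] by (rule symmetric_matrix_form(1)[OF psdD(1)[OF Q]])
      also have "\<dots> = (\<Sum>b\<in>Basis. (b \<bullet> (X ** \<xi>)) * (b \<bullet> (Q ** \<xi>)))"
        unfolding euclidean_inner[of "X ** \<xi>" "Q ** \<xi>"] by (simp only: inner_commute[of "X ** \<xi>"] inner_commute[of "Q ** \<xi>"])
      finally have "(\<Sum>b\<in>Basis. b \<bullet> (X ** b) - t * ((b \<bullet> (X ** \<xi>)) * (b \<bullet> (Q ** \<xi>)))) = ?q * trace X - t * (\<xi> \<bullet> (Q ** X ** \<xi>))"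
        by (simp add: sum_subtractf sum_Basis_matrix_mult sum_distrib_left)
      then show ?thesis
        unfolding sum_distrib_left[symmetric] sum_distrib_right[symmetric] by (simp only:) (simp add: algebra_simps)
    qed
    have i1: "integrable lborel (\<lambda>\<xi>. gauss 1 \<xi> * ((\<xi> \<bullet> (X ** \<xi>)) * e t \<xi>))"
      unfolding l[symmetric] by (intro Bochner_Integration.integrable_sum stein(3))
    have rhs_int: "integrable lborel (\<lambda>\<xi>::real^'q^'r. ?q * trace X * (gauss 1 \<xi> * e t \<xi>) - t * (gauss 1 \<xi> * ((\<xi> \<bullet> (Q ** X ** \<xi>)) * e t \<xi>)))"
      unfolding r[symmetric] by (intro Bochner_Integration.integrable_sum stein(2))
    have i3: "integrable lborel (\<lambda>\<xi>::real^'q^'r. ?q * trace X * (gauss 1 \<xi> * e t \<xi>))"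
      by (intro integrable_mult_right int t0)
    have i2: "integrable lborel (\<lambda>\<xi>::real^'q^'r. t * (gauss 1 \<xi> * ((\<xi> \<bullet> (Q ** X ** \<xi>)) * e t \<xi>)))"
      using Bochner_Integration.integrable_diff[OF i3 rhs_int] by simp
    have "(\<integral>\<xi>. gauss 1 \<xi> * ((\<xi> \<bullet> (X ** \<xi>)) * e t \<xi>) \<partial>(lborel :: (real^'q^'r) measure))
      = (\<integral>\<xi>. ?q * trace X * (gauss 1 \<xi> * e t \<xi>) - t * (gauss 1 \<xi> * ((\<xi> \<bullet> (Q ** X ** \<xi>)) * e t \<xi>)) \<partial>lborel)"
      unfolding l[symmetric] r[symmetric] using stein by (simp add: Bochner_Integration.integral_sum)
    also have "\<dots> = ?q * trace X * G t - (\<integral>\<xi>. t * (gauss 1 \<xi> * ((\<xi> \<bullet> (Q ** X ** \<xi>)) * e t \<xi>)) \<partial>lborel)"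
      unfolding G_def by (subst Bochner_Integration.integral_diff[OF i3 i2]) simp
    finally have eq: "(\<integral>\<xi>. gauss 1 \<xi> * ((\<xi> \<bullet> (X ** \<xi>)) * e t \<xi>) \<partial>(lborel :: (real^'q^'r) measure))
      + (\<integral>\<xi>. t * (gauss 1 \<xi> * ((\<xi> \<bullet> (Q ** X ** \<xi>)) * e t \<xi>)) \<partial>lborel) = ?q * trace X * G t" by simp
    have split: "gauss 1 \<xi> * ((\<xi> \<bullet> (Q ** \<xi>)) * e t \<xi>)
      = gauss 1 \<xi> * ((\<xi> \<bullet> (X ** \<xi>)) * e t \<xi>) + t * (gauss 1 \<xi> * ((\<xi> \<bullet> (Q ** X ** \<xi>)) * e t \<xi>))" for \<xi> :: "real^'q^'r"
    proof -
      have "\<xi> \<bullet> (Q ** \<xi>) = \<xi> \<bullet> (X ** \<xi>) + t * (\<xi> \<bullet> (Q ** X ** \<xi>))"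
        by (subst X[symmetric]) (simp add: matrix_mult_add_left matrix_mult_scaleR_left inner_add_right)
      then show ?thesis by (simp only:) (simp add: algebra_simps)
    qed
    show "integrable lborel (\<lambda>\<xi>. gauss 1 \<xi> * ((\<xi> \<bullet> (Q ** \<xi>)) * e t \<xi>))"
      unfolding split by (rule Bochner_Integration.integrable_add[OF i1 i2])
    show "(\<integral>\<xi>. gauss 1 \<xi> * ((\<xi> \<bullet> (Q ** \<xi>)) * e t \<xi>) \<partial>lborel) = ?q * trace (matrix_inv (mat 1 + t *\<^sub>R Q) ** Q) * G t"
      unfolding split Bochner_Integration.integral_add[OF i1 i2] eq by (simp add: X_def)
  qed
  define F where "F t = G t * exp (?q / 2 * ln (det (mat 1 + t *\<^sub>R Q)))" for t
  have dF: "(F has_field_derivative 0) (at t within {0..1})" if t: "t \<in> {0..1}" for t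
  proof -
    let ?\<tau> = "trace (matrix_inv (mat 1 + t *\<^sub>R Q) ** Q)"
    have t0: "0 \<le> t" using t by simp
    have "(\<integral>\<xi>. gauss 1 \<xi> * (- (\<xi> \<bullet> (Q ** \<xi>)) / 2 * e t \<xi>) \<partial>lborel) = (\<integral>\<xi>. - 1 / 2 * (gauss 1 \<xi> * ((\<xi> \<bullet> (Q ** \<xi>)) * e t \<xi>)) \<partial>lborel)"
      by (intro Bochner_Integration.integral_cong) auto
    also have "\<dots> = - (?q / 2 * ?\<tau>) * G t" by (simp add: ibp[OF t])
    finally have d1: "(G has_field_derivative - (?q / 2 * ?\<tau>) * G t) (at t within {0..1})" using dG[OF t] by simp
    have "((\<lambda>t. ln (det (mat 1 + t *\<^sub>R Q))) has_field_derivative ?\<tau>) (at t)"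
      using DERIV_chain2[OF DERIV_ln_divide det_line_deriv] pos_def_det_pos[OF pd[OF t0]] pos_def_invertible[OF pd[OF t0]]
      by fastforce
    then have d2: "((\<lambda>t. ln (det (mat 1 + t *\<^sub>R Q))) has_field_derivative ?\<tau>) (at t within {0..1})"
      by (rule has_field_derivative_at_within)
    have "((\<lambda>t. f t * exp (k * L t)) has_field_derivative 0) (at t within {0..1})"
      if "(f has_field_derivative - (k * l) * f t) (at t within {0..1})" "(L has_field_derivative l) (at t within {0..1})" for f L :: "real \<Rightarrow> real" and k l
      using that by (auto intro!: derivative_eq_intros)
    from this[OF d1 d2] show ?thesis unfolding F_def .
  qed
  obtain k where k: "\<And>t. t \<in> {0..1} \<Longrightarrow> F t = k"
    using has_field_derivative_zero_constant[of "{0..1}" F] dF by auto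
  have "F 0 = 1" by (simp add: F_def G_def e_def integral_gauss)
  then have "F 1 = 1" using k[of 0] k[of 1] by simp
  moreover have "0 < det (mat 1 + Q)" using pos_def_det_pos[OF pd[of 1]] by simp
  ultimately have "G 1 = det (mat 1 + Q) powr (- ?q / 2)"
    by (simp add: F_def powr_def exp_minus field_simps)
  then show ?thesis by (simp add: G_def e_def)
qed

lemma gaussian_convolution:
  fixes P :: "real^'r^'r" and z :: "real^'q^'r"
  assumes P: "psd P" and v: "0 < v"
  shows "(\<integral>\<^sup>+\<theta>. ennreal (gauss v (z - \<theta>) * exp (- (\<theta> \<bullet> (P ** \<theta>)) / 2)) \<partial>lborel)
    = ennreal (det (mat 1 + v *\<^sub>R P) powr (- real CARD('q) / 2) * exp (- (z \<bullet> (matrix_inv (mat 1 + v *\<^sub>R P) ** P ** z)) / 2))"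
proof -
  let ?M = "mat 1 + v *\<^sub>R P" and ?s = "sqrt v"
  have psdv: "psd (v *\<^sub>R P)" using v by (intro psd_scaleR P) simp
  have "pos_def_matrix ?M" by (rule pos_def_one_plus[OF psdv])
  note inv = pos_def_invertible[OF this]
  define Y where "Y = matrix_inv ?M ** P"
  have Y: "P = Y + v *\<^sub>R (P ** Y)"
  proof -
    have "?M ** Y = P" unfolding Y_def matrix_mul_assoc by (simp add: matrix_inv_right[OF inv])
    then show ?thesis by (simp add: matrix_algebra_simps)
  qed
  define h where "h = ?s *\<^sub>R (Y ** z)"
  let ?f = "\<lambda>\<theta>. exp (- (\<theta> \<bullet> (P ** \<theta>)) / 2)"
  have ss: "?s * ?s = v" using v by simp
  have h: "?s *\<^sub>R (P ** z) = h + v *\<^sub>R (P ** h)"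
    unfolding h_def by (subst Y) (simp add: matrix_algebra_simps matrix_mul_assoc algebra_simps)
  note s2 = symmetric_matrix_form(1)[OF psdD(1)[OF P]]
  have key: "(norm (\<eta> - h))\<^sup>2 + (z + ?s *\<^sub>R (\<eta> - h)) \<bullet> (P ** (z + ?s *\<^sub>R (\<eta> - h)))
      = (norm \<eta>)\<^sup>2 + \<eta> \<bullet> ((v *\<^sub>R P) ** \<eta>) + z \<bullet> (Y ** z)" for \<eta>
  proof -
    have c1: "?s * (\<eta> \<bullet> (P ** z)) = \<eta> \<bullet> h + v * (\<eta> \<bullet> (P ** h))"
      using arg_cong[OF h, of "\<lambda>x. \<eta> \<bullet> x"] by (simp add: inner_add_right)
    have c2: "?s * (h \<bullet> (P ** z)) = h \<bullet> h + v * (h \<bullet> (P ** h))"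
      using arg_cong[OF h, of "\<lambda>x. h \<bullet> x"] by (simp add: inner_add_right)
    have "z \<bullet> (P ** z) = z \<bullet> (Y ** z) + v * (z \<bullet> (P ** (Y ** z)))"
      by (subst Y) (simp add: matrix_algebra_simps inner_add_right matrix_mul_assoc)
    also have "v * (z \<bullet> (P ** (Y ** z))) = ?s * (z \<bullet> (P ** h))"
      by (simp only: h_def matrix_mult_scaleR_right inner_scaleR_right mult.assoc[symmetric] ss)
    also have "z \<bullet> (P ** h) = h \<bullet> (P ** z)" by (rule s2)
    finally have c3: "z \<bullet> (P ** z) = z \<bullet> (Y ** z) + ?s * (h \<bullet> (P ** z))" .
    have e1: "(norm (\<eta> - h))\<^sup>2 = (norm \<eta>)\<^sup>2 - 2 * (\<eta> \<bullet> h) + h \<bullet> h"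
      by (simp add: power2_norm_eq_inner inner_diff_left inner_diff_right inner_commute)
    have e2: "(z + ?s *\<^sub>R (\<eta> - h)) \<bullet> (P ** (z + ?s *\<^sub>R (\<eta> - h))) = z \<bullet> (P ** z) + 2 * (?s * (\<eta> \<bullet> (P ** z))) - 2 * (?s * (h \<bullet> (P ** z)))
        + v * (\<eta> \<bullet> (P ** \<eta>)) - 2 * (v * (\<eta> \<bullet> (P ** h))) + v * (h \<bullet> (P ** h))"
    proof -
      have arith: "a + s * (b - c) + s * (d + s * (e - f) - (g + s * (i - j)))
          = a + s * b + s * d - s * c - s * g + (s * s) * e - (s * s) * i - (s * s) * f + (s * s) * j" for a b c d e f g i j s :: real
        by (simp add: algebra_simps)
      have "(z + ?s *\<^sub>R (\<eta> - h)) \<bullet> (P ** (z + ?s *\<^sub>R (\<eta> - h))) = z \<bullet> (P ** z) + ?s * (\<eta> \<bullet> (P ** z)) + ?s * (z \<bullet> (P ** \<eta>))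
         - ?s * (h \<bullet> (P ** z)) - ?s * (z \<bullet> (P ** h)) + (?s * ?s) * (\<eta> \<bullet> (P ** \<eta>)) - (?s * ?s) * (\<eta> \<bullet> (P ** h)) - (?s * ?s) * (h \<bullet> (P ** \<eta>)) + (?s * ?s) * (h \<bullet> (P ** h))"
        by (simp only: matrix_algebra_simps inner_add_left inner_add_right inner_diff_left inner_diff_right inner_scaleR_left inner_scaleR_right)
          (rule arith)
      also have "z \<bullet> (P ** \<eta>) = \<eta> \<bullet> (P ** z)" by (rule s2)
      also have "z \<bullet> (P ** h) = h \<bullet> (P ** z)" by (rule s2)
      also have "h \<bullet> (P ** \<eta>) = \<eta> \<bullet> (P ** h)" by (rule s2)
      finally show ?thesis unfolding ss by simp
    qed
    show ?thesis unfolding e1 e2 c1 c2 c3 by (simp add: matrix_mult_scaleR_left)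
  qed
  have fm: "?f \<in> borel_measurable borel" by measurable
  have f01: "?f \<theta> \<le> 1" for \<theta> :: "real^'q^'r"
  proof -
    have "0 \<le> \<theta> \<bullet> (P ** \<theta>)" unfolding inner_matrix_mult_self by (intro trace_psd_mult_nonneg P psd_gram)
    then show ?thesis by simp
  qed
  have int: "integrable lborel (\<lambda>\<theta>. gauss v (z - \<theta>) * ?f \<theta>)"
  proof (rule Bochner_Integration.integrable_bound)
    show "integrable lborel (\<lambda>\<theta>. gauss v (\<theta> - z))"
    proof -
      have "integrable (distr lborel borel (\<lambda>\<theta>. \<theta> + - z)) (gauss v)"
        unfolding distr_lborel_plus_right by (rule integrable_gauss[OF v])
      then show ?thesis by (subst (asm) integrable_distr_eq) auto
    qed
    show "AE \<theta> in lborel. norm (gauss v (z - \<theta>) * ?f \<theta>) \<le> norm (gauss v (\<theta> - z))"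
      using f01 by (intro AE_I2) (simp add: gauss_commute[of v z] abs_mult mult_left_le)
  qed measurable
  have "(\<integral>\<theta>. gauss v (z - \<theta>) * ?f \<theta> \<partial>lborel) = (\<integral>\<xi>. gauss 1 \<xi> * ?f (z + ?s *\<^sub>R \<xi>) \<partial>lborel)"
    unfolding gauss_commute[of v z] by (rule integral_gauss_scale[OF v fm])
  also have "\<dots> = (\<integral>\<eta>. gauss 1 (\<eta> + - h) * ?f (z + ?s *\<^sub>R (\<eta> + - h)) \<partial>lborel)"
    by (rule integral_lborel_translate[symmetric, of "\<lambda>\<xi>. gauss 1 \<xi> * ?f (z + ?s *\<^sub>R \<xi>)"]) measurable
  also have "\<dots> = (\<integral>\<eta>. exp (- (z \<bullet> (Y ** z)) / 2) * (gauss 1 \<eta> * exp (- (\<eta> \<bullet> ((v *\<^sub>R P) ** \<eta>)) / 2)) \<partial>(lborel :: (real^'q^'r) measure))"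
  proof (rule Bochner_Integration.integral_cong[OF refl])
    fix \<eta> :: "real^'q^'r"
    have "exp (- (norm (\<eta> - h))\<^sup>2 / 2) * ?f (z + ?s *\<^sub>R (\<eta> - h)) = exp (- ((norm (\<eta> - h))\<^sup>2 + (z + ?s *\<^sub>R (\<eta> - h)) \<bullet> (P ** (z + ?s *\<^sub>R (\<eta> - h)))) / 2)"
      by (simp only: exp_add[symmetric]) simp
    also have "\<dots> = exp (- (norm \<eta>)\<^sup>2 / 2) * exp (- (\<eta> \<bullet> ((v *\<^sub>R P) ** \<eta>)) / 2) * exp (- (z \<bullet> (Y ** z)) / 2)"
      unfolding key by (simp only: exp_add[symmetric]) simp
    finally show "gauss 1 (\<eta> + - h) * ?f (z + ?s *\<^sub>R (\<eta> + - h)) = exp (- (z \<bullet> (Y ** z)) / 2) * (gauss 1 \<eta> * exp (- (\<eta> \<bullet> ((v *\<^sub>R P) ** \<eta>)) / 2))"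
      by (simp add: gauss_def mult_ac)
  qed
  also have "\<dots> = det ?M powr (- real CARD('q) / 2) * exp (- (z \<bullet> (Y ** z)) / 2)"
    by (simp only: integral_mult_right_zero gaussian_det_integral[OF psdv]) (simp only: mult.commute)
  finally show ?thesis
    by (subst nn_integral_eq_integral[OF int]) (auto simp: Y_def)
qed

lemma (in omega_point) precision_convolution:
  defines "T \<equiv> (1 / v\<^sub>0) *\<^sub>R (\<Omega> ** P)"
  shows "psd T" and "matrix_inv (mat 1 + v *\<^sub>R T) ** T = B"
    and "det (mat 1 + v *\<^sub>R T) = det (mat 1 - \<kappa> *\<^sub>R \<Omega>) * det P"
proof -
  have vv: "v *\<^sub>R T = (1 - \<kappa>) *\<^sub>R (P - mat 1)"
  proof -
    have "v * (1 / v\<^sub>0) = 1 - \<kappa>" using v0 by simp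
    then have "v *\<^sub>R T = (1 - \<kappa>) *\<^sub>R (\<Omega> ** P)" unfolding T_def scaleR_scaleR by (simp only:)
    then show ?thesis by (simp only: P_rel)
  qed
  have M: "mat 1 + v *\<^sub>R T = (mat 1 - \<kappa> *\<^sub>R \<Omega>) ** P"
    unfolding vv by (simp add: mring algebra_simps)
  show "psd T"
    unfolding T_def using psd_P_minus_1 v0 by (intro psd_scaleR) simp_all
  have PO: "P ** (mat 1 - \<Omega>) = mat 1" by (simp add: mring)
  have RY: "R ** (mat 1 - \<kappa> *\<^sub>R \<Omega>) = mat 1" using R_rel0(1) by (simp add: mring)
  have YR: "(mat 1 - \<kappa> *\<^sub>R \<Omega>) ** R = mat 1" using R_rel0(2) by (simp add: mring)
  have inv: "matrix_inv (mat 1 + v *\<^sub>R T) = (mat 1 - \<Omega>) ** R"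
  proof (rule matrix_inv_unique)
    have "(mat 1 - \<kappa> *\<^sub>R \<Omega>) ** P ** ((mat 1 - \<Omega>) ** R) = (mat 1 - \<kappa> *\<^sub>R \<Omega>) ** (P ** (mat 1 - \<Omega>)) ** R"
      by (simp only: matrix_mul_assoc)
    then show "(mat 1 + v *\<^sub>R T) ** ((mat 1 - \<Omega>) ** R) = mat 1" unfolding M PO by (simp add: YR)
  qed
  have "(mat 1 - \<Omega>) ** R ** (\<Omega> ** P) = R ** ((mat 1 - \<Omega>) ** P) ** \<Omega>"
  proof -
    have e: "\<Omega> ** P = P ** \<Omega>" by simp
    have c: "(mat 1 - \<Omega>) ** R = R ** (mat 1 - \<Omega>)"
      by (simp only: matrix_mult_diff_left matrix_mult_diff_right matrix_mul_lid matrix_mul_rid R_comm)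
    show ?thesis unfolding e c by (simp only: matrix_mul_assoc)
  qed
  also have "(mat 1 - \<Omega>) ** P = mat 1" by (simp add: mring)
  finally show "matrix_inv (mat 1 + v *\<^sub>R T) ** T = B"
    unfolding inv unfolding T_def precision_def by (simp only: matrix_mult_scaleR_right matrix_mul_rid R_comm)
  show "det (mat 1 + v *\<^sub>R T) = det (mat 1 - \<kappa> *\<^sub>R \<Omega>) * det P"
    unfolding M by (rule det_mul)
qed

lemma powr_of_exp_ln: "0 < (x :: real) \<Longrightarrow> x powr a = exp (a * ln x)"
  by (auto simp: powr_def)

context gb_mixture
begin

lemma kern_eq_convolution:
  fixes \<Omega> :: "real^'r^'r" and z :: "real^'q^'r"
  assumes v: "v \<in> {lo..hi}" and \<Omega>: "\<Omega> \<in> R_set"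
    and K: "0 < K" and c_eq: "c = (2 * pi * v\<^sub>0) powr (- (real CARD('q) * real CARD('r)) / 2) * K"
    and ab: "\<alpha> = (real CARD('q) + a) / 2 - 1" "\<beta> = b / 2 - 1"
  shows "(\<integral>\<^sup>+\<theta>. ennreal (gauss v (z - \<theta>)) * ennreal (pi_1 v\<^sub>0 \<Omega> \<theta> * pi_GB K a b \<Omega>) \<partial>lborel)
    = ennreal (gb_weight v\<^sub>0 (real CARD('q)) \<alpha> \<beta> c v \<Omega> * exp (- (z \<bullet> gb_form v\<^sub>0 v \<Omega> z) / 2))"
proof -
  interpret O: omega_point \<Omega> v\<^sub>0 "1 - v / v\<^sub>0" by (rule point[OF v \<Omega>])
  let ?q = "real CARD('q)" and ?P = "matrix_inv (mat 1 - \<Omega>)"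
  define T where "T = (1 / v\<^sub>0) *\<^sub>R (\<Omega> ** ?P)"
  have vpos: "0 < v" using v lo by simp
  note T = O.precision_convolution[folded T_def, unfolded \<kappa>(3)[OF v]]
  note dpos = pos_def_det_pos[OF R_setD(1)[OF \<Omega>]] pos_def_det_pos[OF R_setD(2)[OF \<Omega>]] pos_def_det_pos[OF O.pos_def_1_\<kappa>\<Omega>]
  define k where "k = (2 * pi * v\<^sub>0) powr (- (?q * real CARD('r)) / 2) * det (\<Omega> ** ?P) powr (?q / 2) * pi_GB K a b \<Omega>"
  have k0: "0 \<le> k" using K by (simp add: k_def pi_GB_def)
  have pi: "pi_1 v\<^sub>0 \<Omega> \<theta> * pi_GB K a b \<Omega> = k * exp (- (\<theta> \<bullet> (T ** \<theta>)) / 2)" for \<theta> :: "real^'q^'r"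
    unfolding inner_matrix_mult_self T_def by (simp add: pi_1_def k_def matrix_mult_scaleR_left trace_algebra_simps)
  have "(\<integral>\<^sup>+\<theta>. ennreal (gauss v (z - \<theta>)) * ennreal (pi_1 v\<^sub>0 \<Omega> \<theta> * pi_GB K a b \<Omega>) \<partial>lborel)
    = (\<integral>\<^sup>+\<theta>. ennreal k * ennreal (gauss v (z - \<theta>) * exp (- (\<theta> \<bullet> (T ** \<theta>)) / 2)) \<partial>lborel)"
    unfolding pi using k0 by (intro nn_integral_cong) (simp add: ennreal_mult[symmetric] mult_ac)
  also have "\<dots> = ennreal k * ennreal (det (mat 1 + v *\<^sub>R T) powr (- ?q / 2) * exp (- (z \<bullet> (precision v\<^sub>0 (1 - v / v\<^sub>0) \<Omega> ** z)) / 2))"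
    by (subst nn_integral_cmult) (measurable, simp only: gaussian_convolution[OF T(1) vpos] T(2))
  also have "\<dots> = ennreal (k * det (mat 1 + v *\<^sub>R T) powr (- ?q / 2) * exp (- (z \<bullet> gb_form v\<^sub>0 v \<Omega> z) / 2))"
    using k0 by (simp add: ennreal_mult[symmetric] gb_form_def mult.assoc)
  also have "k * det (mat 1 + v *\<^sub>R T) powr (- ?q / 2) = gb_weight v\<^sub>0 ?q \<alpha> \<beta> c v \<Omega>"
  proof -
    have dP: "det ?P = 1 / det (mat 1 - \<Omega>)"
    proof -
      have "?P ** (mat 1 - \<Omega>) = mat 1" by (simp add: mring)
      then have "det ?P * det (mat 1 - \<Omega>) = 1" using arg_cong[of _ _ det] by (metis det_I det_mul)
      then show ?thesis using dpos(2) by (simp add: field_simps)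
    qed
    have e1: "det (\<Omega> ** ?P) powr (?q / 2) = exp (?q / 2 * (ln (det \<Omega>) - ln (det (mat 1 - \<Omega>))))"
      unfolding det_mul dP using dpos by (subst powr_of_exp_ln) (simp_all add: ln_div)
    have e2: "det (mat 1 + v *\<^sub>R T) powr (- ?q / 2) = exp (- ?q / 2 * (ln (det (mat 1 - (1 - v / v\<^sub>0) *\<^sub>R \<Omega>)) - ln (det (mat 1 - \<Omega>))))"
      unfolding T(3) dP using dpos by (subst powr_of_exp_ln) (simp_all add: ln_div)
    have e3: "pi_GB K a b \<Omega> = K * exp ((a / 2 - 1) * ln (det \<Omega>)) * exp ((b / 2 - 1) * ln (det (mat 1 - \<Omega>)))"
      unfolding pi_GB_def using dpos by (simp add: powr_of_exp_ln)
    let ?l0 = "ln (det \<Omega>)" and ?l1 = "ln (det (mat 1 - \<Omega>))" and ?l2 = "ln (det (mat 1 - (1 - v / v\<^sub>0) *\<^sub>R \<Omega>))"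
    have w: "gb_weight v\<^sub>0 ?q \<alpha> \<beta> c v \<Omega> = c * exp (\<alpha> * ?l0 + \<beta> * ?l1 - ?q / 2 * ?l2)"
      using gb_weight_eq[OF v of_nat_0_le_iff, of "CARD('q)" \<Omega>] unfolding line[symmetric] .
    have "(x + a) / 2 * l0 - l0 + (b / 2 * l1 - l1) - x / 2 * l2
      = x / 2 * (l0 - l1) + ((a / 2 * l0 - l0) + (b / 2 * l1 - l1)) + - x / 2 * (l2 - l1)" for x l0 l1 l2 :: real
      by (simp add: field_simps)
    then have expo: "\<alpha> * ?l0 + \<beta> * ?l1 - ?q / 2 * ?l2
      = ?q / 2 * (?l0 - ?l1) + ((a / 2 - 1) * ?l0 + (b / 2 - 1) * ?l1) + - ?q / 2 * (?l2 - ?l1)"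
      unfolding ab by (simp only: left_diff_distrib mult_1_left)
    show ?thesis
      unfolding k_def e1 e2 e3 w expo unfolding c_eq by (simp only: exp_add mult_ac)
  qed
  finally show ?thesis .
qed

lemma prior_marginal_GB_prior:
  fixes z :: "real^'q^'r"
  assumes v: "v \<in> {lo..hi}"
    and K: "0 < K" and c_eq: "c = (2 * pi * v\<^sub>0) powr (- (real CARD('q) * real CARD('r)) / 2) * K"
    and ab: "\<alpha> = (real CARD('q) + a) / 2 - 1" "\<beta> = b / 2 - 1"
  defines "mix \<equiv> gauss_mixture.mix (restrict_space sym_lborel R_set) (gb_weight v\<^sub>0 (real CARD('q)) \<alpha> \<beta> c) (gb_form v\<^sub>0)"
  shows "prior_marginal (GB_prior v\<^sub>0 K a b) v z = ennreal (mix v z)"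
    and "(GB_prior v\<^sub>0 K a b :: real^'q^'r \<Rightarrow> ennreal) \<in> borel_measurable borel"
proof -
  let ?\<mu> = "restrict_space (sym_lborel :: (real^'r^'r) measure) R_set" and ?q = "real CARD('q)"
  interpret G: gauss_mixture ?\<mu> "gb_weight v\<^sub>0 ?q \<alpha> \<beta> c" "gb_form v\<^sub>0 :: real \<Rightarrow> real^'r^'r \<Rightarrow> real^'q^'r \<Rightarrow> _" lo hi "bound ?q CARD('r)"
    by (rule gauss_mixture)
  interpret pair_sigma_finite "lborel :: (real^'q^'r) measure" ?\<mu>
    by (intro pair_sigma_finite.intro sigma_finite_lborel) unfold_locales
  let ?f = "\<lambda>\<theta> \<Omega>. pi_1 v\<^sub>0 \<Omega> \<theta> * pi_GB K a b \<Omega> :: real"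
  have Rs: "R_set \<inter> space sym_lborel \<in> sets (sym_lborel :: (real^'r^'r) measure)" by simp
  have GB: "GB_prior v\<^sub>0 K a b \<theta> = (\<integral>\<^sup>+\<Omega>. ennreal (?f \<theta> \<Omega>) \<partial>?\<mu>)" for \<theta> :: "real^'q^'r"
    unfolding GB_prior_def by (rule nn_integral_restrict_space[OF Rs, symmetric])
  have [measurable]: "(\<lambda>\<Omega>. \<Omega>) \<in> measurable ?\<mu> borel"
    by (rule measurable_restrict_space1) simp
  have fm [measurable]: "(\<lambda>(\<theta> :: real^'q^'r, \<Omega>). ?f \<theta> \<Omega>) \<in> borel_measurable (borel \<Otimes>\<^sub>M ?\<mu>)"
    unfolding pi_1_def pi_GB_def by measurable
  show "(GB_prior v\<^sub>0 K a b :: real^'q^'r \<Rightarrow> ennreal) \<in> borel_measurable borel"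
    unfolding GB by measurable
  have "prior_marginal (GB_prior v\<^sub>0 K a b) v z = (\<integral>\<^sup>+\<theta>. \<integral>\<^sup>+\<Omega>. ennreal (gauss v (z - \<theta>)) * ennreal (?f \<theta> \<Omega>) \<partial>?\<mu> \<partial>lborel)"
    unfolding prior_marginal_def GB by (intro nn_integral_cong, subst nn_integral_cmult) measurable
  also have "\<dots> = (\<integral>\<^sup>+\<Omega>. \<integral>\<^sup>+\<theta>. ennreal (gauss v (z - \<theta>)) * ennreal (?f \<theta> \<Omega>) \<partial>lborel \<partial>?\<mu>)"
    by (rule Fubini'[symmetric]) measurable
  also have "\<dots> = (\<integral>\<^sup>+\<Omega>. ennreal (G.kern v z \<Omega>) \<partial>?\<mu>)"
  proof (rule nn_integral_cong)
    fix \<Omega> :: "real^'r^'r" assume "\<Omega> \<in> space ?\<mu>"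
    then have "\<Omega> \<in> R_set" by (simp add: space_restrict_space)
    from kern_eq_convolution[OF v this K c_eq ab]
    show "(\<integral>\<^sup>+\<theta>. ennreal (gauss v (z - \<theta>)) * ennreal (?f \<theta> \<Omega>) \<partial>lborel) = ennreal (G.kern v z \<Omega>)"
      unfolding G.kern_def .
  qed
  also have "\<dots> = ennreal (mix v z)"
    unfolding mix_def G.mix_def using G.kern_pos[OF v]
    by (intro nn_integral_eq_integral G.kern_integrable[OF v] AE_I2) (auto simp: less_imp_le)
  finally show "prior_marginal (GB_prior v\<^sub>0 K a b) v z = ennreal (mix v z)" .
qed

end

lemma kl_minimax_GB:
  fixes v\<^sub>x v\<^sub>y v\<^sub>0 v\<^sub>w K a b q r :: real
  defines "q \<equiv> real CARD('q)" and "r \<equiv> real CARD('r)" and "v\<^sub>w \<equiv> v\<^sub>x * v\<^sub>y / (v\<^sub>x + v\<^sub>y)"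
  assumes vx: "0 < v\<^sub>x" and vy: "0 < v\<^sub>y" and v0: "v\<^sub>x \<le> v\<^sub>0" and K: "0 < K"
    and ab: "- q + 2 \<le> a" "2 \<le> b" and cond: "a + b \<le> q - 3 * r + 1"
  shows "kl_minimax v\<^sub>x v\<^sub>y (p_GB v\<^sub>x v\<^sub>y v\<^sub>0 K a b :: real^'q^'r \<Rightarrow> real^'q^'r \<Rightarrow> real)"
proof -
  define \<alpha> where "\<alpha> = (q + a) / 2 - 1"
  define \<beta> where "\<beta> = b / 2 - 1"
  define k where "k = (2 * pi * v\<^sub>0) powr (- (real CARD('q) * real CARD('r)) / 2) * K"
  define c where "c = v\<^sub>x / (v\<^sub>x + v\<^sub>y)"
  have vw: "0 < v\<^sub>w" "v\<^sub>w < v\<^sub>x" using vx vy by (simp_all add: v\<^sub>w_def field_simps)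
  interpret gb_mixture v\<^sub>0 \<alpha> \<beta> k v\<^sub>w v\<^sub>x
    using vw vx v0 K ab by unfold_locales (auto simp: \<alpha>_def \<beta>_def k_def field_simps)
  let ?\<mu> = "restrict_space (sym_lborel :: (real^'r^'r) measure) R_set"
  interpret G: gauss_mixture ?\<mu> "gb_weight v\<^sub>0 (real CARD('q)) \<alpha> \<beta> k" "gb_form v\<^sub>0 :: real \<Rightarrow> real^'r^'r \<Rightarrow> real^'q^'r \<Rightarrow> _" v\<^sub>w v\<^sub>x "bound (real CARD('q)) CARD('r)"
    by (rule gauss_mixture)
  have vin: "v\<^sub>w \<in> {v\<^sub>w..v\<^sub>x}" "v\<^sub>x \<in> {v\<^sub>w..v\<^sub>x}" using vw by auto
  let ?\<pi> = "GB_prior v\<^sub>0 K a b :: real^'q^'r \<Rightarrow> ennreal"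
  note prior = prior_marginal_GB_prior[OF _ K k_def \<alpha>_def[unfolded q_def] \<beta>_def]
  have pm: "prior_marginal ?\<pi> v\<^sub>w z = ennreal (G.mix v\<^sub>w z)" "prior_marginal ?\<pi> v\<^sub>x z = ennreal (G.mix v\<^sub>x z)" for z
    by (rule prior(1)[OF vin(1)], rule prior(1)[OF vin(2)])
  note vw_eq = v\<^sub>w_def[THEN meta_eq_to_obj_eq]
  note bayes = bayes_predictive_mixture[OF vx vy vw_eq c_def prior(2)[OF vin(1)] G.mix_meas[OF vin(1)] G.mix_meas[OF vin(2)]
      pm(1) G.mix_pos[OF vin(1)] pm(2) G.mix_pos[OF vin(2)]]
  let ?p = "bayes_predictive v\<^sub>x v\<^sub>y ?\<pi>"
  obtain K1 where K1: "\<And>z. \<bar>ln (G.mix v\<^sub>w z)\<bar> \<le> K1 * (1 + (norm z)\<^sup>2)" using G.ln_mix_bound[OF vin(1)] by blast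
  obtain K2 where K2: "\<And>z. \<bar>ln (G.mix v\<^sub>x z)\<bar> \<le> K2 * (1 + (norm z)\<^sup>2)" using G.ln_mix_bound[OF vin(2)] by blast
  have b1: "\<bar>ln (G.mix v\<^sub>w z)\<bar> \<le> max K1 K2 * (1 + (norm z)\<^sup>2)" and b2: "\<bar>ln (G.mix v\<^sub>x z)\<bar> \<le> max K1 K2 * (1 + (norm z)\<^sup>2)" for z
    by (rule order_trans[OF K1] order_trans[OF K2], intro mult_right_mono, simp_all)+
  have p1: "(\<integral>\<^sup>+y. ennreal (?p x y) \<partial>lborel) = 1" for x
    using bayes(2) by (simp add: predictive_density_def)
  have cond': "2 * (real CARD('r) + 1 + \<alpha> - real CARD('q) / 2 + \<beta>) \<le> real CARD('q) - real CARD('r) - 1"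
    using cond by (simp add: \<alpha>_def \<beta>_def q_def r_def field_simps)
  have le: "nn_risk v\<^sub>x v\<^sub>y \<theta> ?p \<le> ennreal (real DIM(real^'q^'r) / 2 * ln ((v\<^sub>x + v\<^sub>y) / v\<^sub>y))" for \<theta>
  proof -
    note risk = nn_risk_formula(1)[OF vx vy vw_eq c_def bayes(1) p1 G.mix_meas[OF vin(1)] G.mix_meas[OF vin(2)]
        G.mix_pos[OF vin(1)] G.mix_pos[OF vin(2)] b1 b2, of \<theta>]
    have "(\<integral>z. gauss v\<^sub>x (z - \<theta>) * ln (G.mix v\<^sub>x z) \<partial>lborel) \<le> (\<integral>z. gauss v\<^sub>w (z - \<theta>) * ln (G.mix v\<^sub>w z) \<partial>lborel)"
      by (rule G.expectation_ln_mix_le) (rule mixture_inequality[OF _ cond'])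
    then show ?thesis unfolding risk by (intro ennreal_leI) simp
  qed
  show ?thesis unfolding p_GB_def by (rule kl_minimaxI[OF vx vy vw_eq c_def bayes(2) le])
qed

theorem proposition3p1:
  fixes v\<^sub>x v\<^sub>y v\<^sub>0 v\<^sub>w q r :: real
  defines "q \<equiv> real CARD('q::finite)" and "r \<equiv> real CARD('r::finite)"
    and "v\<^sub>w \<equiv> inverse (1 / v\<^sub>x + 1 / v\<^sub>y)"
  assumes "CARD('r) \<le> CARD('q)"
    and "0 < v\<^sub>x" and "0 < v\<^sub>y" and "v\<^sub>x \<le> v\<^sub>0"
    and "0 < q - r - 1"
  shows "(\<forall>a b K :: real.
            0 < K
            \<and> ((\<integral>\<^sup>+\<Omega>\<in>R_set. ennreal (pi_GB K a b \<Omega>) \<partial>(sym_lborel :: (real^'r^'r) measure)) < \<infinity>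
               \<longrightarrow> (\<integral>\<^sup>+\<Omega>\<in>R_set. ennreal (pi_GB K a b \<Omega>) \<partial>(sym_lborel :: (real^'r^'r) measure)) = 1)
            \<and> - q + 2 < a \<and> 2 < b
            \<and> a + b \<le> (q - r - 1) / (2 - v\<^sub>w / v\<^sub>0) - 2 * r + 2
            \<longrightarrow> kl_minimax v\<^sub>x v\<^sub>y (p_GB v\<^sub>x v\<^sub>y v\<^sub>0 K a b :: real^'q^'r \<Rightarrow> real^'q^'r \<Rightarrow> real))
       \<and> (0 < q - r - 1 + (2 - v\<^sub>w / v\<^sub>0) * (q - 2 * r - 2)
          \<longrightarrow> (\<exists>a b :: real. - q + 2 < a \<and> 2 < b
                 \<and> a + b \<le> (q - r - 1) / (2 - v\<^sub>w / v\<^sub>0) - 2 * r + 2))"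
proof -
  note vx = assms(5) and vy = assms(6) and v0 = assms(7) and qr = assms(8)
  let ?L = "(q - r - 1) / (2 - v\<^sub>w / v\<^sub>0)"
  have vw: "v\<^sub>w = v\<^sub>x * v\<^sub>y / (v\<^sub>x + v\<^sub>y)" using vx vy by (simp add: v\<^sub>w_def field_simps)
  have "v\<^sub>w \<le> v\<^sub>x" unfolding vw using vx vy by (simp add: field_simps)
  then have "v\<^sub>w / v\<^sub>0 \<le> 1" using vx v0 by simp
  then have d: "1 \<le> 2 - v\<^sub>w / v\<^sub>0" by simp
  then have L: "?L \<le> q - r - 1"
    using divide_left_mono[of 1 "2 - v\<^sub>w / v\<^sub>0" "q - r - 1"] qr by simp
  have "kl_minimax v\<^sub>x v\<^sub>y (p_GB v\<^sub>x v\<^sub>y v\<^sub>0 K a b :: real^'q^'r \<Rightarrow> real^'q^'r \<Rightarrow> real)"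
    if "0 < K" "- q + 2 < a" "2 < b" "a + b \<le> ?L - 2 * r + 2" for a b K
    using that L by (intro kl_minimax_GB vx vy v0) (auto simp: q_def r_def)
  moreover have "\<exists>a b :: real. - q + 2 < a \<and> 2 < b \<and> a + b \<le> ?L - 2 * r + 2"
    if pos: "0 < q - r - 1 + (2 - v\<^sub>w / v\<^sub>0) * (q - 2 * r - 2)"
  proof -
    have "?L + (q - 2 * r - 2) = (q - r - 1 + (2 - v\<^sub>w / v\<^sub>0) * (q - 2 * r - 2)) / (2 - v\<^sub>w / v\<^sub>0)"
      using d by (simp add: add_divide_distrib)
    also have "0 < \<dots>" using pos d by (intro divide_pos_pos) auto
    finally have "0 < ?L + (q - 2 * r - 2)" .
    then show ?thesis
      by (intro exI[of _ "- q + 2 + (?L + (q - 2 * r - 2)) / 2"] exI[of _ "2 + (?L + (q - 2 * r - 2)) / 2"]) simp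
  qed
  ultimately show ?thesis by blast
qed

end
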